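(* (1) For $m \in \mathbb{Z}_{\geq 0}$ let $a_m = |X_{p^m}|$, and let $a_{-1} = 0$. Then for all $m \in \mathbb{Z}_{\ge 0}$, $$a_m = a_{m-1}^p + p^{2p^m-1}(p-1).$$ (2) Let $k \in \mathbb{Z}^+$ with $p \nmid k$, and let $(\kappa_1,\dots,\kappa_l)$ be the $p$-adic $p$-composition of $k$. Then $|X_{k-1}| = \prod_{i=1}^{l-1} a_{\kappa_i}$. In particular, with $P=P_k$ the Sylow $p$-subgroup of $\mathfrak{S}_{kp}$ described in the context, $$\dim_F \big((\mathrm{Res}^{\mathfrak{S}_{kp}}_P \mathrm{Lie}(kp))_{pf}\big) = (p-1)\,(k-1)!\,\prod_{i=1}^{l-1} a_{\kappa_i}.$$
   Context: $p$ is a prime and $F$ is a field of characteristic $p$. $\mathfrak{S}_n$ is the symmetric group on $[1,n]=\{1,\dots,n\}$, acting on the right (so $i\sigma$ is the image of $i$, and products are composed left to right); for $m<n$, $\mathfrak{S}_m$ is identified with the subgroup of $\mathfrak{S}_n$ fixing $m+1,\dots,n$. $\mathbb{Z}_p^*$ is the set of nonzero residues mod $p$. Lie module: $\mathrm{Lie}(n)=\omega_nF\mathfrak{S}_n$ is the right ideal of $F\mathfrak{S}_n$ generated by $\omega_n=(1-c_2)(1-c_3)\cdots(1-c_n)$, $c_j=(1,2,\dots,j)$. For a finite-dimensional module $W$ over $FG$, $G$ a finite group, $W=W_{pr}\oplus W_{pf}$ (unique up to isomorphism) with $W_{pr}$ projective and $W_{pf}$ without nonzero projective summands. For $\sigma\in\mathfrak{S}_a$,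 $\sigma^{[b]}\in\mathfrak{S}_{ab}$ is given by $((i-1)b+j)\sigma^{[b]}=(i\sigma-1)b+j$ ($i\in[1,a]$, $j\in[1,b]$). For $\tau\in\mathfrak{S}_b$ and $r\ge1$, $\tau[r]$ is the permutation with $((r-1)b+j)\tau[r]=(r-1)b+j\tau$ for $j\in[1,b]$, fixing everything else. For $K\subseteq \mathfrak{S}_b$, $K[r]=\{\kappa[r]:\kappa\in K\}$. $\pi=(1,2,\dots,p)$. For $i\ge0$, $R_i=\langle \pi^{[p^j]}: 0\le j\le i\rangle\le\mathfrak{S}_{p^{i+1}}$; $R_{-1}=1$. For $s\ge 1$, $H_s=\prod_{a=1}^s\langle\pi[a]\rangle$. For $m\ge0$, $R_m^0=\prod_{i=1}^{p-1}R_{m-1}[i]$ (blocks of size $p^m$). For $t\in\mathbb{Z}_p^*$ and $m\ge0$, $z_{m,t}\in\mathfrak{S}_{p^{m+1}}$ is given by $((i-1)p+j)z_{m,t}=i+\overline{t(j-1)}\,p^m$ for $1\le i\le p^m$, $1\le j\le p$, where $\overline{x}\in\{0,\dots,p-1\}$ is the residue of $x$ mod $p$. A $p$-composition of $d$ is a finite sequence $\lambda=(\lambda_1,\dots,\lambda_s)$ of non-negative integers with $\sum_{i=1}^s p^{\lambda_i}=d$ such that for each $j$ the partial sum $\Sigma^\lambda_j=\sum_{i=1}^jp^{\lambda_i}$ is divisible by $p^{\lambda_j}$. If $r=\sum_{i=0}^tb_ip^i$ is the $p$-adic expansion with $b_t\ne0$, the $p$-adic $p$-composition of $r$ is $(t^{b_t},(t-1)^{b_{t-1}},\dots,0^{b_0})$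 (exponents are multiplicities of parts). $Y_m=\{hz_{m,t}b : h\in H_{p^m},\ t\in\mathbb{Z}_p^*,\ b\in R_m^0\}\subseteq\mathfrak{S}_{p^{m+1}}$. For a $p$-composition $\lambda=(\lambda_1,\dots,\lambda_s)$ of $d$, $X_\lambda=\prod_{r=1}^sY_{\lambda_r}[\Sigma^\lambda_r/p^{\lambda_r}]\subseteq\mathfrak{S}_{pd}$ (the $r$-th factor supported on $(p\Sigma^\lambda_{r-1},p\Sigma^\lambda_r]$), and $X_d=\bigcup_\lambda X_\lambda$ over all $p$-compositions $\lambda$ of $d$; $X_0=\{1\}$ (empty product). $P_k=\prod_{i=1}^lR_{\kappa_i}[\Sigma^\kappa_i/p^{\kappa_i}]$ where $\kappa=(\kappa_1,\dots,\kappa_l)$ is the $p$-adic $p$-composition of $k$; it is a Sylow $p$-subgroup of $\mathfrak{S}_{pk}$. *)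

theory Defs
  imports
    Complex_Main
    "HOL-Algebra.AbelCoset"
    "HOL-Algebra.Generated_Groups"
    "HOL-Algebra.Module"
    "HOL-Computational_Algebra.Primes"
    "HOL-Algebra.Sym_Groups"
    "HOL-Library.Function_Algebras"
begin

section \<open>Symmetric groups with right action\<close>

text \<open>
  Permutations act on the right: \<open>\<sigma> i\<close> renders the image \<open>i\<sigma>\<close>, and the product
  \<open>\<sigma>\<tau>\<close> (first \<open>\<sigma>\<close>, then \<open>\<tau>\<close>) is the function \<open>\<tau> \<circ> \<sigma>\<close>. Hence this is the
  opposite of the library's \<^const>\<open>sym_group\<close>. As permutations of \<open>{1..m}\<close> are functions that fix
  everything else, \<open>\<SS>\<^sub>m \<subseteq> \<SS>\<^sub>n\<close> for \<open>m < n\<close> holds literally.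
\<close>

definition Sym :: "nat \<Rightarrow> (nat \<Rightarrow> nat) monoid" where
  "Sym n = \<lparr>carrier = {\<sigma>. \<sigma> permutes {1..n}}, monoid.mult = (\<lambda>\<sigma> \<tau>. \<tau> \<circ> \<sigma>), one = id\<rparr>"

text \<open>The cycle \<open>(1, 2, \<dots>, j)\<close>, sending \<open>1 \<mapsto> 2 \<mapsto> \<dots> \<mapsto> j \<mapsto> 1\<close>.\<close>

definition cyc :: "nat \<Rightarrow> nat \<Rightarrow> nat" where
  "cyc j = cycle_of_list [1..<Suc j]"

text \<open>\<open>blow_up b \<sigma>\<close> is \<open>\<sigma>\<^bsup>[b]\<^esup>\<close> and \<open>shift b r \<tau>\<close> is \<open>\<tau>[r]\<close> for \<open>\<tau> \<in> \<SS>\<^sub>b\<close>.\<close>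

definition blow_up :: "nat \<Rightarrow> (nat \<Rightarrow> nat) \<Rightarrow> nat \<Rightarrow> nat" where
  "blow_up b \<sigma> x = (if x = 0 then 0 else (\<sigma> ((x - 1) div b + 1) - 1) * b + ((x - 1) mod b + 1))"

definition shift :: "nat \<Rightarrow> nat \<Rightarrow> (nat \<Rightarrow> nat) \<Rightarrow> nat \<Rightarrow> nat" where
  "shift b r \<tau> x = (if (r - 1) * b < x \<and> x \<le> r * b then (r - 1) * b + \<tau> (x - (r - 1) * b) else x)"

definition set_prod :: "('a, 'x) monoid_scheme \<Rightarrow> 'a set list \<Rightarrow> 'a set" where
  "set_prod G Ks = foldr (set_mult G) Ks {\<one>\<^bsub>G\<^esub>}"


section \<open>The sets \<open>X\<^sub>d\<close> and the groups \<open>P\<^sub>k\<close>\<close>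

text \<open>The index is an integer so that \<open>R_grp p (- 1)\<close> is the trivial group \<open>R\<^bsub>-1\<^esub>\<close>.\<close>

definition R_grp :: "nat \<Rightarrow> int \<Rightarrow> (nat \<Rightarrow> nat) set" where
  "R_grp p i = generate (Sym (p ^ nat (i + 1))) {blow_up (p ^ j) (cyc p) | j. int j \<le> i}"

definition H_grp :: "nat \<Rightarrow> nat \<Rightarrow> (nat \<Rightarrow> nat) set" where
  "H_grp p s = set_prod (Sym (p * s))
     (map (\<lambda>a. generate (Sym (p * s)) {shift p a (cyc p)}) [1..<Suc s])"

definition R0_grp :: "nat \<Rightarrow> nat \<Rightarrow> (nat \<Rightarrow> nat) set" where
  "R0_grp p m = set_prod (Sym (p ^ (m + 1)))
     (map (\<lambda>i. shift (p ^ m) i ` R_grp p (int m - 1)) [1..<p])"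

text \<open>In \<open>z_perm p m t\<close> an element \<open>t\<close> of \<open>\<int>\<^sub>p\<^sup>*\<close> is given by its representative in \<open>{1..<p}\<close>.\<close>

definition z_perm :: "nat \<Rightarrow> nat \<Rightarrow> nat \<Rightarrow> nat \<Rightarrow> nat" where
  "z_perm p m t x = (if x \<in> {1..p ^ (m + 1)}
     then (x - 1) div p + 1 + (t * ((x - 1) mod p)) mod p * p ^ m else x)"

definition Y_set :: "nat \<Rightarrow> nat \<Rightarrow> (nat \<Rightarrow> nat) set" where
  "Y_set p m = {h \<otimes>\<^bsub>Sym (p ^ (m + 1))\<^esub> z_perm p m t \<otimes>\<^bsub>Sym (p ^ (m + 1))\<^esub> b | h t b.
     h \<in> H_grp p (p ^ m) \<and> t \<in> {1..<p} \<and> b \<in> R0_grp p m}"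

text \<open>
  A sequence \<open>(\<lambda>\<^sub>1, \<dots>, \<lambda>\<^sub>s)\<close> is a list, so \<open>\<lambda>\<^sub>j\<close> is \<open>\<lambda> ! (j - 1)\<close>;
  \<open>psum p \<lambda> j\<close> is \<open>\<Sigma>\<^sup>\<lambda>\<^sub>j\<close>.
\<close>

definition psum :: "nat \<Rightarrow> nat list \<Rightarrow> nat \<Rightarrow> nat" where
  "psum p l j = (\<Sum>i=1..j. p ^ (l ! (i - 1)))"

definition p_composition :: "nat \<Rightarrow> nat \<Rightarrow> nat list \<Rightarrow> bool" where
  "p_composition p d l \<longleftrightarrow>
     psum p l (length l) = d \<and> (\<forall>j\<in>{1..length l}. p ^ (l ! (j - 1)) dvd psum p l j)"

text \<open>
  The \<open>i\<close>-th \<open>p\<close>-adic digit of \<open>r\<close> is \<open>r div p ^ i mod p\<close>; it vanishes for \<open>i \<ge> r\<close>, and zero digits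
  contribute no parts.
\<close>

definition padic_composition :: "nat \<Rightarrow> nat \<Rightarrow> nat list" where
  "padic_composition p r = concat (map (\<lambda>i. replicate (r div p ^ i mod p) i) (rev [0..<r]))"

text \<open>
  \<open>\<Prod>\<^sub>r K\<^bsub>\<lambda>\<^sub>r\<^esub>[\<Sigma>\<^sup>\<lambda>\<^sub>r / p\<^bsup>\<lambda>\<^sub>r\<^esup>]\<close> for a family of sets
  \<open>K m \<subseteq> \<SS>\<^bsub>p^(m+1)\<^esub>\<close>.
\<close>

definition block_prod :: "nat \<Rightarrow> nat list \<Rightarrow> (nat \<Rightarrow> (nat \<Rightarrow> nat) set) \<Rightarrow> (nat \<Rightarrow> nat) set" where
  "block_prod p l K = set_prod (Sym (p * psum p l (length l)))
     (map (\<lambda>r. shift (p ^ (l ! (r - 1) + 1)) (psum p l r div p ^ (l ! (r - 1))) ` K (l ! (r - 1)))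
       [1..<Suc (length l)])"

definition X_set :: "nat \<Rightarrow> nat \<Rightarrow> (nat \<Rightarrow> nat) set" where
  "X_set p d = (\<Union>l\<in>{l. p_composition p d l}. block_prod p l (Y_set p))"

definition P_grp :: "nat \<Rightarrow> nat \<Rightarrow> (nat \<Rightarrow> nat) set" where
  "P_grp p k = block_prod p (padic_composition p k) (\<lambda>m. R_grp p (int m))"

definition a_num :: "nat \<Rightarrow> int \<Rightarrow> nat" where
  "a_num p m = (if m = -1 then 0 else card (X_set p (p ^ nat m)))"


section \<open>Group algebras and right modules\<close>

text \<open>Meant for finite groups \<open>G\<close> only.\<close>

definition group_algebra :: "('g, 'x) monoid_scheme \<Rightarrow> ('g \<Rightarrow> 'f::field) ring" where
  "group_algebra G =
    \<lparr>carrier = {a. \<forall>g. g \<notin> carrier G \<longrightarrow> a g = 0},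
     monoid.mult = (\<lambda>a b g. \<Sum>(h, k)\<in>{(h, k). h \<in> carrier G \<and> k \<in> carrier G \<and> h \<otimes>\<^bsub>G\<^esub> k = g}. a h * b k),
     one = (\<lambda>g. if g = \<one>\<^bsub>G\<^esub> then 1 else 0),
     zero = (\<lambda>g. 0),
     add = (\<lambda>a b g. a g + b g)\<rparr>"

definition basis_elt :: "'g \<Rightarrow> 'g \<Rightarrow> 'f::field" where
  "basis_elt h = (\<lambda>g. if g = h then 1 else 0)"

text \<open>
  The library's \<^locale>\<open>module\<close> is restricted to commutative rings. For a right module the record
  field \<^const>\<open>smult\<close> is read as \<open>a \<odot> x = x \<cdot> a\<close>. The library's \<^locale>\<open>submodule\<close> does not need
  commutativity and is used as it stands.
\<close>

locale right_module = R?: ring R + M?: abelian_group M for R (structure) and M (structure) +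
  assumes r_smult_closed:
      "\<lbrakk>a \<in> carrier R; x \<in> carrier M\<rbrakk> \<Longrightarrow> a \<odot>\<^bsub>M\<^esub> x \<in> carrier M"
    and r_smult_l_distr:
      "\<lbrakk>a \<in> carrier R; b \<in> carrier R; x \<in> carrier M\<rbrakk> \<Longrightarrow>
        (a \<oplus>\<^bsub>R\<^esub> b) \<odot>\<^bsub>M\<^esub> x = a \<odot>\<^bsub>M\<^esub> x \<oplus>\<^bsub>M\<^esub> b \<odot>\<^bsub>M\<^esub> x"
    and r_smult_r_distr:
      "\<lbrakk>a \<in> carrier R; x \<in> carrier M; y \<in> carrier M\<rbrakk> \<Longrightarrow>
        a \<odot>\<^bsub>M\<^esub> (x \<oplus>\<^bsub>M\<^esub> y) = a \<odot>\<^bsub>M\<^esub> x \<oplus>\<^bsub>M\<^esub> a \<odot>\<^bsub>M\<^esub> y"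
    and r_smult_assoc:
      "\<lbrakk>a \<in> carrier R; b \<in> carrier R; x \<in> carrier M\<rbrakk> \<Longrightarrow>
        (a \<otimes>\<^bsub>R\<^esub> b) \<odot>\<^bsub>M\<^esub> x = b \<odot>\<^bsub>M\<^esub> (a \<odot>\<^bsub>M\<^esub> x)"
    and r_smult_one:
      "x \<in> carrier M \<Longrightarrow> \<one>\<^bsub>R\<^esub> \<odot>\<^bsub>M\<^esub> x = x"

text \<open>
  In the two module records below multiplication and unit carry no meaning; the module record
  merely inherits these fields.
\<close>

definition right_regular :: "('r, 'x) ring_scheme \<Rightarrow> ('r, 'r) module" where
  "right_regular R = \<lparr>carrier = carrier R, monoid.mult = monoid.mult R, one = \<one>\<^bsub>R\<^esub>,
     zero = \<zero>\<^bsub>R\<^esub>, add = add R, smult = (\<lambda>a x. x \<otimes>\<^bsub>R\<^esub> a)\<rparr>"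

definition free_module :: "('r, 'x) ring_scheme \<Rightarrow> nat \<Rightarrow> ('r, nat \<Rightarrow> 'r) module" where
  "free_module R n = \<lparr>carrier = {..<n} \<rightarrow>\<^sub>E carrier R,
     monoid.mult = (\<lambda>x y. \<lambda>i\<in>{..<n}. x i \<otimes>\<^bsub>R\<^esub> y i), one = (\<lambda>i\<in>{..<n}. \<one>\<^bsub>R\<^esub>),
     zero = (\<lambda>i\<in>{..<n}. \<zero>\<^bsub>R\<^esub>), add = (\<lambda>x y. \<lambda>i\<in>{..<n}. x i \<oplus>\<^bsub>R\<^esub> y i),
     smult = (\<lambda>a x. \<lambda>i\<in>{..<n}. x i \<otimes>\<^bsub>R\<^esub> a)\<rparr>"

definition module_isomorphic ::
    "('r, 'x) ring_scheme \<Rightarrow> ('r, 'm, 'y) module_scheme \<Rightarrow> ('r, 'n, 'z) module_scheme \<Rightarrow> bool" where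
  "module_isomorphic R M N \<longleftrightarrow> (\<exists>f\<in>iso (add_monoid M) (add_monoid N).
     \<forall>a\<in>carrier R. \<forall>x\<in>carrier M. f (a \<odot>\<^bsub>M\<^esub> x) = a \<odot>\<^bsub>N\<^esub> f x)"

text \<open>\<open>M = A \<oplus> B\<close> as an internal direct sum of submodules.\<close>

definition internal_direct_sum ::
    "('r, 'x) ring_scheme \<Rightarrow> ('r, 'm, 'y) module_scheme \<Rightarrow> 'm set \<Rightarrow> 'm set \<Rightarrow> bool" where
  "internal_direct_sum R M A B \<longleftrightarrow> submodule A R M \<and> submodule B R M \<and>
     A <+>\<^bsub>M\<^esub> B = carrier M \<and> A \<inter> B = {\<zero>\<^bsub>M\<^esub>}"

text \<open>
  Projective: isomorphic to a direct summand of a free module. Free modules of finite rank suffice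
  because the notion is only used for finitely generated modules.
\<close>

definition projective_module :: "('r, 'x) ring_scheme \<Rightarrow> ('r, 'm, 'y) module_scheme \<Rightarrow> bool" where
  "projective_module R M \<longleftrightarrow> right_module R M \<and>
     (\<exists>n U V. internal_direct_sum R (free_module R n) U V \<and>
        module_isomorphic R M ((free_module R n)\<lparr>carrier := U\<rparr>))"

definition projective_free_module :: "('r, 'x) ring_scheme \<Rightarrow> ('r, 'm, 'y) module_scheme \<Rightarrow> bool" where
  "projective_free_module R M \<longleftrightarrow> right_module R M \<and>
     (\<forall>A B. internal_direct_sum R M A B \<and> projective_module R (M\<lparr>carrier := A\<rparr>) \<longrightarrow> A = {\<zero>\<^bsub>M\<^esub>})"

text \<open>\<open>M = A \<oplus> B\<close> with \<open>A\<close> in the role of \<open>M\<^sub>p\<^sub>r\<close> and \<open>B\<close> in the role of \<open>M\<^sub>p\<^sub>f\<close>.\<close>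

definition pr_pf_decomposition ::
    "('r, 'x) ring_scheme \<Rightarrow> ('r, 'm, 'y) module_scheme \<Rightarrow> 'm set \<Rightarrow> 'm set \<Rightarrow> bool" where
  "pr_pf_decomposition R M A B \<longleftrightarrow> internal_direct_sum R M A B \<and>
     projective_module R (M\<lparr>carrier := A\<rparr>) \<and> projective_free_module R (M\<lparr>carrier := B\<rparr>)"


section \<open>The Lie module\<close>

definition omega :: "nat \<Rightarrow> (nat \<Rightarrow> nat) \<Rightarrow> 'f::field" where
  "omega n = (let A = group_algebra (Sym n) in
     foldr (monoid.mult A) (map (\<lambda>j. \<one>\<^bsub>A\<^esub> \<ominus>\<^bsub>A\<^esub> basis_elt (cyc j)) [2..<Suc n]) \<one>\<^bsub>A\<^esub>)"

definition Lie :: "nat \<Rightarrow> ((nat \<Rightarrow> nat) \<Rightarrow> 'f::field, (nat \<Rightarrow> nat) \<Rightarrow> 'f) module" where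
  "Lie n = (let A = group_algebra (Sym n) in
     (right_regular A)\<lparr>carrier := {omega n \<otimes>\<^bsub>A\<^esub> a | a. a \<in> carrier A}\<rparr>)"

text \<open>
  For \<open>P \<le> \<SS>\<^sub>n\<close> the elements of \<open>FP\<close> are those elements of \<open>F\<SS>\<^sub>n\<close> that are supported on \<open>P\<close>.
  So the restriction of an \<open>F\<SS>\<^sub>n\<close>-module to \<open>P\<close> is the same record, regarded as a
  module over the following ring.
\<close>

abbreviation subgroup_algebra :: "nat \<Rightarrow> (nat \<Rightarrow> nat) set \<Rightarrow> ((nat \<Rightarrow> nat) \<Rightarrow> 'f::field) ring" where
  "subgroup_algebra n P \<equiv> group_algebra (Sym n\<lparr>carrier := P\<rparr>)"

definition fun_scale :: "'f::field \<Rightarrow> ('g \<Rightarrow> 'f) \<Rightarrow> 'g \<Rightarrow> 'f" where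
  "fun_scale c a = (\<lambda>g. c * a g)"

definition dim_F :: "('g \<Rightarrow> 'f::field) set \<Rightarrow> nat" where
  "dim_F = vector_space.dim fun_scale"


section \<open>Conformity of the encodings\<close>

lemma cyc_apply:
  assumes "1 \<le> i" "i \<le> j"
  shows "cyc j i = (if i = j then 1 else i + 1)"
proof -
  have "map (cyc j) [1..<Suc j] = rotate 1 [1..<Suc j]"
    unfolding cyc_def using cyclic_rotation[of "[1..<Suc j]" 1] by (simp del: upt_Suc)
  then have "map (cyc j) [1..<Suc j] ! (i - 1) = rotate 1 [1..<Suc j] ! (i - 1)"
    by (rule arg_cong)
  moreover have "map (cyc j) [1..<Suc j] ! (i - 1) = cyc j i"
    using assms by (simp del: upt_Suc)
  moreover have "rotate 1 [1..<Suc j] ! (i - 1) = [1..<Suc j] ! ((1 + (i - 1)) mod j)"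
    using assms nth_rotate[of "i - 1" "[1..<Suc j]" 1] by (simp del: upt_Suc rotate_Suc)
  moreover have "[1..<Suc j] ! ((1 + (i - 1)) mod j) = (1 + (i - 1)) mod j + 1"
    using assms by (subst nth_upt) auto
  ultimately show ?thesis
    using assms by (auto simp: mod_if)
qed

lemma blow_up_apply:
  assumes "1 \<le> i" "j \<in> {1..b}"
  shows "blow_up b \<sigma> ((i - 1) * b + j) = (\<sigma> i - 1) * b + j"
proof -
  obtain i' j' where "i = Suc i'" "j = Suc j'" "j' < b"
    using assms by (cases i; cases j) auto
  then show ?thesis
    by (simp add: blow_up_def)
qed

lemma shift_apply:
  assumes "1 \<le> r" "j \<in> {1..b}"
  shows "shift b r \<tau> ((r - 1) * b + j) = (r - 1) * b + \<tau> j"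
proof -
  obtain r' where "r = Suc r'"
    using assms by (cases r) auto
  then show ?thesis
    using assms by (simp add: shift_def)
qed

lemma z_perm_apply:
  assumes "i \<in> {1..p ^ m}" "j \<in> {1..p}"
  shows "z_perm p m t ((i - 1) * p + j) = i + (t * (j - 1)) mod p * p ^ m"
proof -
  obtain i' j' where ij: "i = Suc i'" "j = Suc j'" "j' < p" "i' < p ^ m"
    using assms by (cases i; cases j) auto
  have "i' * p + Suc j' \<le> Suc i' * p"
    using ij by simp
  also have "\<dots> \<le> p ^ m * p"
    using ij by (intro mult_right_mono) auto
  finally show ?thesis
    using ij by (simp add: z_perm_def mult.commute)
qed

lemma group_Sym: "group (Sym n)"
proof (rule groupI)
  fix \<sigma> assume "\<sigma> \<in> carrier (Sym n)"
  then show "\<exists>\<tau>\<in>carrier (Sym n). \<tau> \<otimes>\<^bsub>Sym n\<^esub> \<sigma> = \<one>\<^bsub>Sym n\<^esub>"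
    by (intro bexI[of _ "inv_into UNIV \<sigma>"]) (auto simp: Sym_def permutes_inv permutes_inv_o)
qed (auto simp: Sym_def permutes_compose permutes_id comp_assoc)

lemma finite_carrier_Sym: "finite (carrier (Sym n))"
  by (simp add: Sym_def finite_permutations)

lemma group_algebra_mult_eq:
  fixes G (structure)
  assumes "group G" "g \<in> carrier G"
  shows "(a \<otimes>\<^bsub>group_algebra G\<^esub> b) g = (\<Sum>h\<in>carrier G. a h * b (inv h \<otimes> g))"
proof -
  interpret group G by fact
  have "{(h, k). h \<in> carrier G \<and> k \<in> carrier G \<and> h \<otimes> k = g} = (\<lambda>h. (h, inv h \<otimes> g)) ` carrier G"
    using assms(2) by (auto simp: image_iff m_assoc[symmetric])
  then show ?thesis
    by (simp add: group_algebra_def sum.reindex inj_on_def)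
qed

lemma ring_group_algebra:
  fixes G :: "('g, 'x) monoid_scheme" (structure)
  assumes "group G" "finite (carrier G)"
  shows "ring (group_algebra G :: ('g \<Rightarrow> 'f::field) ring)" (is "ring ?A")
proof -
  interpret group G by fact
  note mult_eq = group_algebra_mult_eq[OF assms(1)]
  have mult_out: "(a \<otimes>\<^bsub>?A\<^esub> b) g = 0" if "g \<notin> carrier G" for a b g
    using that by (auto simp: group_algebra_def intro!: sum.neutral)
  have cancel: "u \<otimes> (inv u \<otimes> h) = h" "inv u \<otimes> (u \<otimes> h) = h"
    if "u \<in> carrier G" "h \<in> carrier G" for u h
    using that by (simp_all flip: m_assoc)
  have eqI: "a = b" if "\<And>g. g \<in> carrier G \<Longrightarrow> a g = b g" "a \<in> carrier ?A" "b \<in> carrier ?A" for a b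
  proof
    fix g show "a g = b g"
      using that by (cases "g \<in> carrier G") (auto simp: group_algebra_def)
  qed
  have mult_closed: "a \<otimes>\<^bsub>?A\<^esub> b \<in> carrier ?A" for a b
    using mult_out[of _ a b] by (simp add: group_algebra_def)
  have ev: "(a \<oplus>\<^bsub>?A\<^esub> b) g = a g + b g" for a b g
    by (simp add: group_algebra_def)
  have one_ev: "\<one>\<^bsub>?A\<^esub> g = (if g = \<one> then 1 else 0)" for g
    by (simp add: group_algebra_def)
  show ?thesis
  proof (rule ringI)
    show "abelian_group ?A"
    proof (rule abelian_groupI)
      fix x assume "x \<in> carrier ?A"
      then show "\<exists>y\<in>carrier ?A. y \<oplus>\<^bsub>?A\<^esub> x = \<zero>\<^bsub>?A\<^esub>"
        by (intro bexI[of _ "\<lambda>g. - x g"]) (auto simp: group_algebra_def)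
    qed (auto simp: group_algebra_def algebra_simps)
  next
    show "monoid ?A"
    proof (rule monoidI)
      fix a b c :: "'g \<Rightarrow> 'f"
      assume abc: "a \<in> carrier ?A" "b \<in> carrier ?A" "c \<in> carrier ?A"
      show "a \<otimes>\<^bsub>?A\<^esub> b \<otimes>\<^bsub>?A\<^esub> c = a \<otimes>\<^bsub>?A\<^esub> (b \<otimes>\<^bsub>?A\<^esub> c)"
      proof (rule eqI)
        fix g assume g: "g \<in> carrier G"
        have "(a \<otimes>\<^bsub>?A\<^esub> b \<otimes>\<^bsub>?A\<^esub> c) g
            = (\<Sum>h\<in>carrier G. (\<Sum>u\<in>carrier G. a u * b (inv u \<otimes> h)) * c (inv h \<otimes> g))"
          using g by (simp add: mult_eq cong: sum.cong)
        also have "\<dots> = (\<Sum>u\<in>carrier G. \<Sum>h\<in>carrier G. a u * (b (inv u \<otimes> h) * c (inv h \<otimes> g)))"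
          by (subst sum.swap) (simp add: sum_distrib_right mult.assoc)
        also have "\<dots> = (\<Sum>u\<in>carrier G. \<Sum>h\<in>carrier G. a u * (b h * c (inv h \<otimes> (inv u \<otimes> g))))"
        proof (rule sum.cong[OF refl])
          fix u assume u: "u \<in> carrier G"
          show "(\<Sum>h\<in>carrier G. a u * (b (inv u \<otimes> h) * c (inv h \<otimes> g)))
            = (\<Sum>h\<in>carrier G. a u * (b h * c (inv h \<otimes> (inv u \<otimes> g))))"
            by (rule sum.reindex_bij_witness[of _ "\<lambda>h. u \<otimes> h" "\<lambda>h. inv u \<otimes> h"])
              (use u g in \<open>simp_all add: cancel m_assoc inv_mult_group\<close>)
        qed
        also have "\<dots> = (a \<otimes>\<^bsub>?A\<^esub> (b \<otimes>\<^bsub>?A\<^esub> c)) g"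
          using g by (simp add: mult_eq sum_distrib_left cong: sum.cong)
        finally show "(a \<otimes>\<^bsub>?A\<^esub> b \<otimes>\<^bsub>?A\<^esub> c) g = (a \<otimes>\<^bsub>?A\<^esub> (b \<otimes>\<^bsub>?A\<^esub> c)) g" .
      qed (rule mult_closed)+
    next
      fix a :: "'g \<Rightarrow> 'f" assume a: "a \<in> carrier ?A"
      show "\<one>\<^bsub>?A\<^esub> \<otimes>\<^bsub>?A\<^esub> a = a"
      proof (rule eqI)
        fix g assume g: "g \<in> carrier G"
        have "(\<one>\<^bsub>?A\<^esub> \<otimes>\<^bsub>?A\<^esub> a) g = (\<Sum>h\<in>carrier G. if h = \<one> then a (inv h \<otimes> g) else 0)"
          using g by (auto simp: mult_eq one_ev intro!: sum.cong)
        then show "(\<one>\<^bsub>?A\<^esub> \<otimes>\<^bsub>?A\<^esub> a) g = a g"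
          using g assms(2) by simp
      qed (rule mult_closed, rule a)
      show "a \<otimes>\<^bsub>?A\<^esub> \<one>\<^bsub>?A\<^esub> = a"
      proof (rule eqI)
        fix g assume g: "g \<in> carrier G"
        have "inv h \<otimes> g = \<one> \<longleftrightarrow> h = g" if "h \<in> carrier G" for h
          using that g cancel(1)[of h g] by auto
        then have "(a \<otimes>\<^bsub>?A\<^esub> \<one>\<^bsub>?A\<^esub>) g = (\<Sum>h\<in>carrier G. if h = g then a h else 0)"
          using g by (auto simp: mult_eq one_ev intro!: sum.cong)
        then show "(a \<otimes>\<^bsub>?A\<^esub> \<one>\<^bsub>?A\<^esub>) g = a g"
          using g assms(2) by simp
      qed (rule mult_closed, rule a)
    qed (rule mult_closed, simp add: group_algebra_def)
  next
    fix a b c :: "'g \<Rightarrow> 'f"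
    assume abc: "a \<in> carrier ?A" "b \<in> carrier ?A" "c \<in> carrier ?A"
    have add_closed: "x \<oplus>\<^bsub>?A\<^esub> y \<in> carrier ?A" if "x \<in> carrier ?A" "y \<in> carrier ?A" for x y
      using that by (auto simp: group_algebra_def)
    show "(a \<oplus>\<^bsub>?A\<^esub> b) \<otimes>\<^bsub>?A\<^esub> c = a \<otimes>\<^bsub>?A\<^esub> c \<oplus>\<^bsub>?A\<^esub> b \<otimes>\<^bsub>?A\<^esub> c"
      by (rule eqI) (auto simp: mult_eq ev sum.distrib distrib_right intro: mult_closed add_closed)
    show "c \<otimes>\<^bsub>?A\<^esub> (a \<oplus>\<^bsub>?A\<^esub> b) = c \<otimes>\<^bsub>?A\<^esub> a \<oplus>\<^bsub>?A\<^esub> c \<otimes>\<^bsub>?A\<^esub> b"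
      by (rule eqI) (auto simp: mult_eq ev sum.distrib distrib_left intro: mult_closed add_closed)
  qed
qed

lemma vector_space_fun_scale: "vector_space (fun_scale :: 'f::field \<Rightarrow> ('g \<Rightarrow> 'f) \<Rightarrow> 'g \<Rightarrow> 'f)"
  by unfold_locales (auto simp: fun_scale_def fun_eq_iff algebra_simps)

end

theory Submission
  imports Defs "HOL-Algebra.Group_Action"
begin

text \<open>Let \<open>P\<close> be a finite \<open>p\<close>-group and \<open>U\<close> a finite-dimensional \<open>FP\<close>-module in characteristic \<open>p\<close>, and let
  \<open>N\<close> be the sum of the elements of \<open>P\<close>. Preimages of a basis of \<open>U N\<close> generate a free submodule of rank
  \<open>dim (U N)\<close> (\<open>translates_independent\<close>), and it has a complement that is killed by \<open>N\<close>; such a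
  complement has no projective summand, because the fixed vectors of a projective module are norms
  (\<open>projective_fixed\<close>). So the projective-free part of \<open>U\<close> has dimension \<open>dim U - \<bar>P\<bar> dim (U N)\<close>, and the
  task is to find the rank of \<open>N\<close> on \<open>Lie(pk)\<close>, whose dimension is \<open>(pk - 1)!\<close>.

  Let \<open>n = pk\<close> and let \<open>A\<close> consist of the last \<open>p\<close> points. As \<open>p\<close> does not divide \<open>k\<close>, the last part of the
  \<open>p\<close>-adic composition of \<open>k\<close> is \<open>0\<close>, so \<open>P = Q \<times> \<langle>\<zeta>\<rangle>\<close>, where \<open>\<zeta>\<close> rotates \<open>A\<close> and \<open>Q\<close> fixes \<open>A\<close>
  pointwise. Let \<open>V\<close> (\<open>X_space\<close>) be spanned by the words \<open>\<sigma>\<close> with \<open>1\<sigma> \<in> A\<close>. Then \<open>Lie(n) = \<omega>\<^sub>n V\<close>, and \<open>V\<close>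
  is a free \<open>FP\<close>-module, so \<open>V N\<close> is the space \<open>V\<^sup>P\<close> of invariants and \<open>Lie(n) N = \<omega>\<^sub>n V\<^sup>P\<close>. The kernel of \<open>\<omega>\<^sub>n\<close> on \<open>V\<close>
  has a basis that \<open>P\<close> permutes: to a partition of \<open>{1..n}\<close> into chains (ordered sets whose first element
  is a prescribed element of \<open>A\<close>) belongs the sum of all words that contain every chain as a subword,
  that is, a shuffle product. All these sums together form a basis of \<open>V\<close> (\<open>X_span_E\<close>,
  \<open>E_independent\<close>), and those with at least two chains span the kernel (\<open>kernel_dynkin\<close>), since \<open>\<omega>\<^sub>n\<close>
  annihilates proper shuffles, by Ree's orthogonality of Lie elements and shuffles. The first elements
  can be prescribed in a \<open>P\<close>-equivariant way for nonempty proper subsets of \<open>A\<close>, because \<open>p\<close> is prime and hence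
  \<open>\<langle>\<zeta>\<rangle>\<close> acts freely on these subsets. Counting the orbits on the words in \<open>V\<close> and on these partitions by Burnside's lemma shows that the
  projective-free part of \<open>Lie(n)\<close> has dimension \<open>\<Sum>\<close> over \<open>g \<noteq> 1\<close> in \<open>P\<close> of the number of partitions into
  at least two chains that \<open>g\<close> fixes (\<open>dim_nrm_Lie\<close>).

  An element \<open>h\<zeta>\<^sup>i\<close> with \<open>h \<in> Q\<close> fixes such a partition only if \<open>i \<noteq> 0\<close> and \<open>h\<close> is a fixed point free element
  with \<open>h\<^sup>p = 1\<close>; the partition then consists of the \<open>p\<close> translates of one chain that starts at the first
  point of \<open>A\<close> and continues with a transversal of the orbits of \<open>h\<close>. There are \<open>(k - 1)! p\<^bsup>k-1\<^esup>\<close> of these. So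
  the dimension is \<open>(p - 1) (k - 1)! p\<^bsup>k-1\<^esup> f(Q)\<close>, where \<open>f\<close> counts the fixed point free \<open>h\<close> with \<open>h\<^sup>p = 1\<close>.

  Finally \<open>f\<close> is multiplicative along the factors of \<open>Q\<close>, and the wreath product structure of the factors
  gives the recursion \<open>fpf_count_Suc\<close>. On the other side, cutting a \<open>p\<close>-composition where its partial sum
  becomes divisible by a larger power of \<open>p\<close> shows that \<open>X\<^sub>d\<close> is multiplicative along the \<open>p\<close>-adic
  composition of \<open>d\<close> (\<open>card_comps\<close>), and that \<open>X\<^sub>d\<close> for \<open>d = p\<^bsup>m+1\<^esup>\<close> is the disjoint union of \<open>Y\<^bsub>m+1\<^esub>\<close> and a set
  that has as many elements as the \<open>p\<close>-th cartesian power of \<open>X\<^sub>d\<close> for \<open>d = p\<^sup>m\<close>. Both recursions agree up to the factor \<open>p\<^bsup>p^m\<^esup>\<close>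
  (\<open>card_X_power_eq_fpf\<close>), which absorbs \<open>p\<^bsup>k-1\<^esup>\<close>.\<close>

interpretation fs: vector_space "fun_scale :: 'f::field \<Rightarrow> ('x \<Rightarrow> 'f) \<Rightarrow> 'x \<Rightarrow> 'f"
  by (rule vector_space_fun_scale)

section \<open>Linear actions of p-groups\<close>

lemma group_actionI:
  fixes G (structure)
  assumes "group G"
    and closed: "\<And>g x. \<lbrakk>g \<in> carrier G; x \<in> E\<rbrakk> \<Longrightarrow> a g x \<in> E"
    and one: "\<And>x. x \<in> E \<Longrightarrow> a \<one> x = x"
    and mult: "\<And>g h x. \<lbrakk>g \<in> carrier G; h \<in> carrier G; x \<in> E\<rbrakk> \<Longrightarrow> a (g \<otimes> h) x = a g (a h x)"
  shows "group_action G E (\<lambda>g. restrict (a g) E)"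
proof -
  interpret group G by fact
  have bij: "restrict (a g) E \<in> Bij E" if g: "g \<in> carrier G" for g
  proof -
    have "bij_betw (a g) E E"
      by (rule bij_betw_byWitness[where f' = "a (inv g)"])
        (use g closed one mult[of "inv g" g] mult[of g "inv g"] in auto)
    then show ?thesis
      by (simp add: Bij_def cong: bij_betw_cong)
  qed
  have "restrict (a (g \<otimes> h)) E = compose E (restrict (a g) E) (restrict (a h) E)"
    if "g \<in> carrier G" "h \<in> carrier G" for g h
    using that closed mult by (auto simp: compose_def restrict_def fun_eq_iff)
  then have "group_hom G (BijGroup E) (\<lambda>g. restrict (a g) E)"
    using bij by (auto simp: group_hom_def group_hom_axioms_def hom_def BijGroup_def
        group_BijGroup[unfolded BijGroup_def] assms(1))
  then show ?thesis
    by (simp add: group_action_def)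
qed

text \<open>Orbits of moved points have more than one element, so their lengths are divisible by \<open>p\<close>.\<close>

lemma dvd_card_moved_points:
  fixes G (structure)
  assumes "group_action G E \<phi>" "order G = p ^ e" "prime (p::nat)" "finite E"
  shows "p dvd card {x \<in> E. \<exists>g\<in>carrier G. \<phi> g x \<noteq> x}"
proof -
  interpret group_action G E \<phi> by fact
  let ?M = "{x \<in> E. \<exists>g\<in>carrier G. \<phi> g x \<noteq> x}"
  have sub: "orbit G \<phi> x \<subseteq> ?M" if x: "x \<in> ?M" for x
  proof
    fix y assume y: "y \<in> orbit G \<phi> x"
    have xE: "x \<in> E" using x by simp
    obtain h where h: "h \<in> carrier G" "y = \<phi> h x" using y by (auto simp: orbit_def)
    have yE: "y \<in> E" using h element_image[OF h(1) xE] by simp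
    have "\<exists>g\<in>carrier G. \<phi> g y \<noteq> y"
    proof (rule ccontr)
      assume "\<not> ?thesis"
      then have fx: "orbit G \<phi> y = {y}"
        using orbit_refl[OF yE] by (auto simp: orbit_def)
      have "x \<in> orbit G \<phi> y" using orbit_sym[OF xE yE y] .
      then have "x = y" using fx by auto
      then show False using x fx by (auto simp: orbit_def)
    qed
    then show "y \<in> ?M" using yE by simp
  qed
  have U: "\<Union> (orbit G \<phi> ` ?M) = ?M"
    using sub orbit_refl by fastforce
  have "p dvd card (\<Union> (orbit G \<phi> ` ?M))"
  proof (rule dvd_partition)
    show "finite (\<Union> (orbit G \<phi> ` ?M))" using assms(4) U by simp
    show "\<forall>c\<in>orbit G \<phi> ` ?M. p dvd card c"
    proof
      fix c assume "c \<in> orbit G \<phi> ` ?M"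
      then obtain x where x: "x \<in> ?M" "c = orbit G \<phi> x" by blast
      have xE: "x \<in> E" using x by simp
      have "card c dvd p ^ e"
        using orbit_stabilizer_theorem[OF xE] assms(2) x(2) by (metis dvd_triv_left)
      then obtain i where i: "card c = p ^ i"
        using assms(3) by (metis divides_primepow_nat)
      have "card c \<noteq> 1"
      proof
        assume "card c = 1"
        then have "c = {x}" using x(2) orbit_refl[OF xE] by (metis card_1_singletonE singletonD)
        then show False using x by (auto simp: orbit_def)
      qed
      then have "i \<noteq> 0" using i by (metis power_0)
      then show "p dvd card c" using i by (simp add: dvd_power)
    qed
    show "\<forall>c1\<in>orbit G \<phi> ` ?M. \<forall>c2\<in>orbit G \<phi> ` ?M. c1 \<noteq> c2 \<longrightarrow> c1 \<inter> c2 = {}"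
    proof (intro ballI impI)
      fix c1 c2 assume c: "c1 \<in> orbit G \<phi> ` ?M" "c2 \<in> orbit G \<phi> ` ?M" "c1 \<noteq> c2"
      then have "c1 \<in> orbits G E \<phi>" "c2 \<in> orbits G E \<phi>" by (auto simp: orbits_def)
      then show "c1 \<inter> c2 = {}" using disjoint_union c(3) by blast
    qed
  qed
  then show ?thesis using U by simp
qed

text \<open>A linear action on functions, written on the right: the product \<open>g \<otimes> h\<close> acts by \<open>T g\<close> first.\<close>

locale group_rep = group G for G :: "('g, 'b) monoid_scheme" (structure) +
  fixes T :: "'g \<Rightarrow> ('x \<Rightarrow> 'f::field) \<Rightarrow> 'x \<Rightarrow> 'f"
  assumes fin_carrier: "finite (carrier G)"
    and T_add: "g \<in> carrier G \<Longrightarrow> T g (x + y) = T g x + T g y"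
    and T_scale: "g \<in> carrier G \<Longrightarrow> T g (fun_scale c x) = fun_scale c (T g x)"
    and T_one: "T \<one> x = x"
    and T_mult: "\<lbrakk>g \<in> carrier G; h \<in> carrier G\<rbrakk> \<Longrightarrow> T (g \<otimes> h) x = T h (T g x)"
begin

definition act :: "('g \<Rightarrow> 'f) \<Rightarrow> ('x \<Rightarrow> 'f) \<Rightarrow> 'x \<Rightarrow> 'f" where
  "act a x = (\<Sum>g\<in>carrier G. fun_scale (a g) (T g x))"

text \<open>The action of the sum of all group elements.\<close>

definition nrm :: "('x \<Rightarrow> 'f) \<Rightarrow> 'x \<Rightarrow> 'f" where
  "nrm x = (\<Sum>g\<in>carrier G. T g x)"

definition fixed :: "('x \<Rightarrow> 'f) \<Rightarrow> bool" where
  "fixed x \<longleftrightarrow> (\<forall>g\<in>carrier G. T g x = x)"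

lemma T_zero: "g \<in> carrier G \<Longrightarrow> T g 0 = 0"
  using T_add[of g 0 0] by simp

lemma T_sum: "g \<in> carrier G \<Longrightarrow> T g (\<Sum>i\<in>I. f i) = (\<Sum>i\<in>I. T g (f i))"
  by (induction I rule: infinite_finite_induct) (simp_all add: T_add T_zero)

lemma sum_translate:
  assumes "h \<in> carrier G"
  shows "(\<Sum>g\<in>carrier G. f (g \<otimes> h)) = (\<Sum>g\<in>carrier G. f g)"
  by (rule sum.reindex_bij_witness[of _ "\<lambda>g. g \<otimes> inv h" "\<lambda>g. g \<otimes> h"])
    (use assms in \<open>auto simp: m_assoc\<close>)

lemma fixed_nrm: "fixed (nrm x)"
  unfolding fixed_def nrm_def
  by (auto simp: T_sum T_mult[symmetric] sum_translate[of _ "\<lambda>g. T g x"])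

text \<open>The field may be infinite, so the fixed point theorem for \<open>p\<close>-groups is applied to the additive group
  generated by the orbit of \<open>v\<close>. It is finite and its order is divisible by \<open>p\<close>, because \<open>p\<close> annihilates
  it; as the zero vector is fixed, there must be another fixed vector.\<close>

lemma exists_fixed_vector:
  assumes char: "CHAR('f) = p" "prime p" and ord: "order G = p ^ e"
    and S: "\<And>x y. \<lbrakk>x \<in> S; y \<in> S\<rbrakk> \<Longrightarrow> x + y \<in> S" "\<And>g x. \<lbrakk>g \<in> carrier G; x \<in> S\<rbrakk> \<Longrightarrow> T g x \<in> S"
    and v: "v \<in> S" "v \<noteq> 0"
  shows "\<exists>w\<in>S. w \<noteq> 0 \<and> fixed w"
proof -
  define lc where "lc m = (\<Sum>g\<in>carrier G. fun_scale (of_nat (m g)) (T g v))" for m :: "'g \<Rightarrow> nat"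
  \<comment> \<open>the additive group generated by the orbit; the field has positive characteristic, so natural multiples suffice\<close>
  define Z where "Z = range lc"
  have p_pos: "p > 0" using char(2) prime_gt_0_nat by blast
  have lc_add: "lc m + lc m' = lc (\<lambda>g. m g + m' g)" for m m'
    by (simp add: lc_def fs.scale_left_distrib flip: sum.distrib)
  have lc_mult: "fun_scale (of_nat i) (lc m) = lc (\<lambda>g. i * m g)" for i m
    by (simp add: lc_def fs.scale_sum_right)
  have Z_add: "x + y \<in> Z" if "x \<in> Z" "y \<in> Z" for x y
    using that lc_add by (auto simp: Z_def)
  have Z_mult: "fun_scale (of_nat i) x \<in> Z" if "x \<in> Z" for i x
    using that lc_mult by (auto simp: Z_def)
  have p0: "fun_scale (of_nat p) x = 0" for x :: "'x \<Rightarrow> 'f"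
    using char(1) of_nat_CHAR[where 'a = 'f] by simp
  have scale_Suc: "fun_scale (of_nat (Suc i)) x = x + fun_scale (of_nat i) x" for i and x :: "'x \<Rightarrow> 'f"
    by (simp only: of_nat_Suc fs.scale_left_distrib fs.scale_one)
  have S0: "0 \<in> S"
  proof -
    have "fun_scale (of_nat (Suc i)) v \<in> S" for i
    proof (induction i)
      case 0
      then show ?case using v by simp
    next
      case (Suc i)
      then show ?case using S(1)[OF v(1)] by (metis scale_Suc)
    qed
    from this[of "p - 1"] show ?thesis using p0[of v] p_pos by simp
  qed
  have S_mult: "fun_scale (of_nat i) x \<in> S" if x: "x \<in> S" for i x
  proof (induction i)
    case 0
    then show ?case using S0 by (metis fs.scale_zero_left of_nat_0)
  next
    case (Suc i)
    then show ?case using S(1)[OF x] by (metis scale_Suc)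
  qed
  have ZS: "Z \<subseteq> S"
  proof -
    have "(\<Sum>g\<in>I. fun_scale (of_nat (m g)) (T g v)) \<in> S" if "I \<subseteq> carrier G" for I and m :: "'g \<Rightarrow> nat"
      using that
      by (induction I rule: infinite_finite_induct) (auto intro!: S(1) S_mult S(2) S0 v(1))
    then show ?thesis by (auto simp: Z_def lc_def)
  qed
  have vZ: "v \<in> Z"
  proof -
    have "lc (\<lambda>g. if g = \<one> then 1 else 0) = (\<Sum>g\<in>carrier G. if g = \<one> then v else 0)"
      unfolding lc_def by (rule sum.cong) (auto simp: T_one)
    then have "lc (\<lambda>g. if g = \<one> then 1 else 0) = v" using fin_carrier by simp
    then show ?thesis unfolding Z_def by (metis rangeI)
  qed
  have Z0: "0 \<in> Z" using Z_mult[OF vZ, of 0] by simp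
  have ZT: "T h x \<in> Z" if h: "h \<in> carrier G" and xZ: "x \<in> Z" for h x
  proof -
    obtain m where m: "x = lc m" using xZ by (auto simp: Z_def)
    have "T h x = (\<Sum>g\<in>carrier G. fun_scale (of_nat (m g)) (T (g \<otimes> h) v))"
      using h by (simp add: m lc_def T_sum T_scale T_mult)
    also have "\<dots> = (\<Sum>g\<in>carrier G. fun_scale (of_nat (m ((g \<otimes> h) \<otimes> inv h))) (T (g \<otimes> h) v))"
      using h by (intro sum.cong refl) (simp add: m_assoc)
    also have "\<dots> = lc (\<lambda>g. m (g \<otimes> inv h))"
      unfolding lc_def by (rule sum_translate[OF h, of "\<lambda>g. fun_scale (of_nat (m (g \<otimes> inv h))) (T g v)"])
    finally show ?thesis by (auto simp: Z_def)
  qed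
  have p_0: "(of_nat p :: 'f) = 0" unfolding char(1)[symmetric] by (rule of_nat_CHAR)
  have mod: "(of_nat (i mod p) :: 'f) = of_nat i" for i
  proof -
    have "(of_nat i :: 'f) = of_nat (p * (i div p) + i mod p)"
      by (simp only: mult_div_mod_eq)
    also have "\<dots> = of_nat p * of_nat (i div p) + of_nat (i mod p)"
      by (simp only: of_nat_add of_nat_mult)
    also have "\<dots> = of_nat (i mod p)" by (simp only: p_0 mult_zero_left add_0)
    finally show ?thesis by (rule sym)
  qed
  have of_nat_inj: "i = j" if ij: "i < p" "j < p" and eq: "(of_nat i :: 'f) = of_nat j" for i j
  proof -
    have dv: "p dvd n" if "(of_nat n :: 'f) = 0" for n
      using that of_nat_eq_0_iff_char_dvd[where 'a = 'f, of n] unfolding char(1) by blast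
    have "(of_nat (i - j) :: 'f) = 0" "(of_nat (j - i) :: 'f) = 0"
      using eq by (cases "i \<le> j"; simp add: of_nat_diff)+
    then have "p dvd i - j" "p dvd j - i" using dv by blast+
    moreover have "i - j < p" "j - i < p" using ij by auto
    ultimately have "i - j = 0" "j - i = 0" by (metis gr0I nat_dvd_not_less)+
    then show ?thesis by simp
  qed
  have finZ: "finite Z"
  proof (rule finite_subset)
    show "Z \<subseteq> lc ` (carrier G \<rightarrow>\<^sub>E {..<p})"
    proof
      fix x assume "x \<in> Z"
      then obtain m where m: "x = lc m" by (auto simp: Z_def)
      have "x = lc (\<lambda>g\<in>carrier G. m g mod p)"
        unfolding m lc_def by (rule sum.cong) (auto simp: mod)
      then show "x \<in> lc ` (carrier G \<rightarrow>\<^sub>E {..<p})" using p_pos by auto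
    qed
    show "finite (lc ` (carrier G \<rightarrow>\<^sub>E {..<p}))"
      using fin_carrier by (intro finite_imageI finite_PiE) auto
  qed
  have dvdZ: "p dvd card Z"
  proof -
    define K where "K x = range (\<lambda>i. x + fun_scale (of_nat i) v)" for x
    have KZ: "K x \<subseteq> Z" if "x \<in> Z" for x
      using that Z_add Z_mult[OF vZ] by (auto simp: K_def)
    have xK: "x \<in> K x" for x
      unfolding K_def by (rule range_eqI[of _ _ 0]) simp
    have K_sub: "K y \<subseteq> K x" if y: "y \<in> K x" for x y
    proof
      fix z assume "z \<in> K y"
      then obtain i j where "z = x + fun_scale (of_nat i) v + fun_scale (of_nat j) v"
        using y by (auto simp: K_def)
      then have "z = x + fun_scale (of_nat (i + j)) v" by (simp add: fs.scale_left_distrib)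
      then show "z \<in> K x" unfolding K_def by blast
    qed
    have K_sym: "x \<in> K y" if y: "y \<in> K x" for x y
    proof -
      obtain i where i: "y = x + fun_scale (of_nat i) v" using y by (auto simp: K_def)
      have "fun_scale (of_nat i) v + fun_scale (of_nat (i * (p - 1))) v = fun_scale (of_nat (i + i * (p - 1))) v"
        by (simp only: of_nat_add fs.scale_left_distrib)
      also have "i + i * (p - 1) = i * p" using p_pos by (cases p) auto
      also have "fun_scale (of_nat (i * p)) v = 0"
        using fs.scale_scale[of "of_nat i" "of_nat p" v] p0[of v] by (simp only: of_nat_mult fs.scale_zero_right)
      finally have "x = y + fun_scale (of_nat (i * (p - 1))) v" by (simp only: i add.assoc add_0_right)
      then show ?thesis unfolding K_def by blast
    qed
    have K_card: "card (K x) = p" for x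
    proof -
      have "x + fun_scale (of_nat i) v \<in> (\<lambda>i. x + fun_scale (of_nat i) v) ` {..<p}" for i
        by (rule image_eqI[of _ _ "i mod p"]) (use p_pos in \<open>simp_all add: mod\<close>)
      then have "K x = (\<lambda>i. x + fun_scale (of_nat i) v) ` {..<p}"
        unfolding K_def by blast
      moreover have "inj_on (\<lambda>i. x + fun_scale (of_nat i) v) {..<p}"
      proof (rule inj_onI)
        fix i j assume ij: "i \<in> {..<p}" "j \<in> {..<p}" "x + fun_scale (of_nat i) v = x + fun_scale (of_nat j) v"
        then have "(of_nat i :: 'f) = of_nat j" using v(2) by simp
        then show "i = j" using ij by (auto intro: of_nat_inj)
      qed
      ultimately show ?thesis by (simp add: card_image)
    qed
    have U: "\<Union> (K ` Z) = Z" using KZ xK by blast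
    have "p dvd card (\<Union> (K ` Z))"
    proof (rule dvd_partition)
      show "\<forall>c1\<in>K ` Z. \<forall>c2\<in>K ` Z. c1 \<noteq> c2 \<longrightarrow> c1 \<inter> c2 = {}"
      proof (intro ballI impI equals0I)
        fix c1 c2 z assume "c1 \<in> K ` Z" "c2 \<in> K ` Z" "c1 \<noteq> c2" "z \<in> c1 \<inter> c2"
        then obtain x y where "c1 = K x" "c2 = K y" "z \<in> K x" "z \<in> K y" by blast
        then show False using \<open>c1 \<noteq> c2\<close> K_sub[of z x] K_sub[of x z] K_sub[of z y] K_sub[of y z] K_sym by auto
      qed
    qed (use U finZ K_card in auto)
    then show ?thesis using U by simp
  qed
  have "group_action G Z (\<lambda>g. restrict (T (inv g)) Z)"
    by (rule group_actionI) (auto simp: ZT T_one T_mult inv_mult_group group_axioms)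
  from dvd_card_moved_points[OF this ord char(2) finZ]
  have d: "p dvd card {x \<in> Z. \<exists>g\<in>carrier G. T (inv g) x \<noteq> x}"
    by (simp add: conj_commute cong: conj_cong)
  have "fixed x \<longleftrightarrow> (\<forall>g\<in>carrier G. T (inv g) x = x)" for x
    unfolding fixed_def by (metis inv_closed inv_inv)
  then have eq: "{x \<in> Z. \<exists>g\<in>carrier G. T (inv g) x \<noteq> x} = Z - {x \<in> Z. fixed x}"
    by blast
  have "\<exists>w\<in>Z. w \<noteq> 0 \<and> fixed w"
  proof (rule ccontr)
    assume neg: "\<not> ?thesis"
    have "fixed 0" by (simp add: fixed_def T_zero)
    then have "{x \<in> Z. fixed x} = {0}" using neg Z0 by auto
    then have "card {x \<in> Z. \<exists>g\<in>carrier G. T (inv g) x \<noteq> x} = card Z - 1"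
      using eq Z0 finZ by simp
    moreover have "card Z > 0" using Z0 finZ card_gt_0_iff by blast
    ultimately have "p dvd 1" using d dvdZ by (metis One_nat_def Suc_leI dvd_diffD1)
    then show False using char(2) by auto
  qed
  then show ?thesis using ZS by blast
qed

end

interpretation fsp: vector_space_pair "fun_scale :: 'f::field \<Rightarrow> ('x \<Rightarrow> 'f) \<Rightarrow> 'x \<Rightarrow> 'f"
  "fun_scale :: 'f \<Rightarrow> ('y \<Rightarrow> 'f) \<Rightarrow> 'y \<Rightarrow> 'f"
  by unfold_locales

interpretation fsf: vector_space_pair "fun_scale :: 'f::field \<Rightarrow> ('x \<Rightarrow> 'f) \<Rightarrow> 'x \<Rightarrow> 'f"
  "(*) :: 'f \<Rightarrow> 'f \<Rightarrow> 'f"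
  by unfold_locales (auto simp: algebra_simps)

section \<open>Dimensions of subspaces\<close>

text \<open>The ambient function space need not be finite-dimensional; hence dimension arguments take place
  inside the span of a finite set.\<close>

definition fin_dim :: "('x \<Rightarrow> 'f::field) set \<Rightarrow> bool" where
  "fin_dim U \<longleftrightarrow> (\<exists>S. finite S \<and> U \<subseteq> fs.span S)"

lemma fin_dim_mono: "fin_dim U \<Longrightarrow> V \<subseteq> U \<Longrightarrow> fin_dim V"
  unfolding fin_dim_def by blast

lemma fin_dim_basis:
  fixes U :: "('x \<Rightarrow> 'f::field) set"
  assumes "fin_dim U" "fs.subspace U"
  obtains B where "finite B" "B \<subseteq> U" "fs.independent B" "fs.span B = U" "card B = fs.dim U"
proof -
  obtain B where B: "B \<subseteq> U" "fs.independent B" "U \<subseteq> fs.span B" "card B = fs.dim U"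
    using fs.basis_exists by blast
  obtain S where "finite S" "U \<subseteq> fs.span S" using assms(1) by (auto simp: fin_dim_def)
  then have "finite B" using B fs.independent_span_bound by blast
  moreover have "fs.span B = U" using B assms(2) by (simp add: fs.span_subspace)
  ultimately show thesis using that B by blast
qed

lemma rank_nullity:
  fixes f :: "('x \<Rightarrow> 'f::field) \<Rightarrow> 'y \<Rightarrow> 'f"
  assumes lin: "Vector_Spaces.linear fun_scale fun_scale f"
    and U: "fin_dim U" "fs.subspace U"
  shows "fs.dim (f ` U) + fs.dim {x \<in> U. f x = 0} = fs.dim U"
proof -
  let ?K = "{x \<in> U. f x = 0}"
  have K: "fs.subspace ?K"
    using fs.subspace_inter[OF U(2) fsp.linear_subspace_kernel[OF lin]] by (simp add: Int_def)
  have "fin_dim ?K" using U(1) by (rule fin_dim_mono) auto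
  from fin_dim_basis[OF this K] obtain A where
    A: "finite A" "A \<subseteq> ?K" "fs.independent A" "fs.span A = ?K" "card A = fs.dim ?K" .
  obtain B where B: "A \<subseteq> B" "B \<subseteq> U" "fs.independent B" "U \<subseteq> fs.span B"
    using fs.maximal_independent_subset_extend[of A U] A by blast
  obtain S where "finite S" "U \<subseteq> fs.span S" using U(1) by (auto simp: fin_dim_def)
  then have finB: "finite B" using B fs.independent_span_bound by blast
  have cardB: "card B = fs.dim U" using B fs.basis_card_eq_dim by blast
  define C where "C = B - A"
  have BC: "B = A \<union> C" "A \<inter> C = {}" using B(1) by (auto simp: C_def)
  have finC: "finite C" using finB by (simp add: C_def)
  have inj: "x = 0" if x: "x \<in> fs.span C" "f x = 0" for x
  proof -
    have "x \<in> U" using x(1) B(2) U(2) by (metis C_def Diff_subset fs.span_minimal subset_trans subsetD)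
    then have "x \<in> fs.span A" using A(4) x by simp
    moreover have "fs.span A \<inter> fs.span C = {0}"
    proof -
      have "fs.span A \<inter> fs.span C \<subseteq> {0}"
      proof
        fix y assume y: "y \<in> fs.span A \<inter> fs.span C"
        obtain u where u: "y = (\<Sum>v\<in>A. fun_scale (u v) v)"
          using y A(1) by (auto simp: fs.span_finite)
        obtain w where w: "y = (\<Sum>v\<in>C. fun_scale (w v) v)"
          using y finC by (auto simp: fs.span_finite)
        let ?c = "\<lambda>v. if v \<in> A then u v else - w v"
        have "(\<Sum>v\<in>B. fun_scale (?c v) v) = (\<Sum>v\<in>A. fun_scale (?c v) v) + (\<Sum>v\<in>C. fun_scale (?c v) v)"
          unfolding BC(1) by (rule sum.union_disjoint[OF A(1) finC BC(2)])
        also have "(\<Sum>v\<in>A. fun_scale (?c v) v) = y" by (simp add: u)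
        also have "(\<Sum>v\<in>C. fun_scale (?c v) v) = (\<Sum>v\<in>C. - fun_scale (w v) v)"
          using BC(2) by (intro sum.cong refl) auto
        also have "\<dots> = - y" by (simp add: w sum_negf)
        finally have "(\<Sum>v\<in>B. fun_scale (?c v) v) = 0" by (simp only: right_minus)
        then have "u v = 0" if "v \<in> A" for v
          using fs.independentD[OF B(3) finB subset_refl, of ?c v] that B(1) by auto
        then show "y \<in> {0}" by (simp add: u)
      qed
      then show ?thesis using fs.span_zero by blast
    qed
    ultimately show ?thesis using x(1) by blast
  qed
  have inj_span: "inj_on f (fs.span C)"
  proof (rule inj_onI)
    fix x y assume "x \<in> fs.span C" "y \<in> fs.span C" "f x = f y"
    then have "x - y = 0"
      by (intro inj) (auto simp: fs.span_diff fsp.linear_diff[OF lin])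
    then show "x = y" by simp
  qed
  have indC: "fs.independent C" using B(3) fs.independent_mono[of B C] by (auto simp: C_def)
  have ind: "fs.independent (f ` C)"
    by (rule fsp.linear_independent_injective_image[OF lin indC inj_span])
  have "f ` U \<subseteq> fs.span (f ` C)"
  proof -
    have "f ` U \<subseteq> fs.span (f ` B)"
      using B(4) fsp.linear_span_image[OF lin, of B] by blast
    also have "f ` B \<subseteq> insert 0 (f ` C)" using A(2) BC(1) by auto
    then have "fs.span (f ` B) \<subseteq> fs.span (f ` C)"
      using fs.span_mono[of "f ` B" "insert 0 (f ` C)"] by simp
    finally show ?thesis .
  qed
  moreover have "f ` C \<subseteq> f ` U" using B(2) by (auto simp: C_def)
  ultimately have "fs.dim (f ` U) = card (f ` C)"
    using ind fs.basis_card_eq_dim by metis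
  also have "\<dots> = card C"
    using inj_span fs.span_superset by (intro card_image) (rule inj_on_subset)
  finally show ?thesis
    using cardB A(5) card_Un_disjoint[OF A(1) finC BC(2)] BC(1) by simp
qed

lemma dim_direct_sum:
  fixes A B U :: "('x \<Rightarrow> 'f::field) set"
  assumes U: "fin_dim U" "U = {a + b |a b. a \<in> A \<and> b \<in> B}"
    and A: "fs.subspace A" and B: "fs.subspace B" and AB: "A \<inter> B = {0}"
  shows "fs.dim U = fs.dim A + fs.dim B"
proof -
  have sU: "fs.subspace U" using U(2) fs.subspace_sums[OF A B] by simp
  have AU: "A \<subseteq> U" and BU: "B \<subseteq> U"
  proof -
    show "A \<subseteq> U" unfolding U(2) using fs.subspace_0[OF B] by (metis (mono_tags, lifting) add.right_neutral mem_Collect_eq subsetI)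
    show "B \<subseteq> U" unfolding U(2) using fs.subspace_0[OF A] by (metis (mono_tags, lifting) add.left_neutral mem_Collect_eq subsetI)
  qed
  obtain C where C: "finite C" "C \<subseteq> A" "fs.independent C" "fs.span C = A" "card C = fs.dim A"
    using fin_dim_basis[OF fin_dim_mono[OF U(1) AU] A] .
  obtain D where D: "finite D" "D \<subseteq> B" "fs.independent D" "fs.span D = B" "card D = fs.dim B"
    using fin_dim_basis[OF fin_dim_mono[OF U(1) BU] B] .
  have CD: "C \<inter> D = {}"
  proof (rule equals0I)
    fix x assume x: "x \<in> C \<inter> D"
    then have "x \<in> A \<inter> B" using C(2) D(2) by auto
    then have "x = 0" using AB by simp
    then show False using x C(3) fs.dependent_zero by auto
  qed
  have ind: "fs.independent (C \<union> D)"
  proof (rule fs.independent_if_scalars_zero)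
    show fin: "finite (C \<union> D)" using C(1) D(1) by simp
    fix c v assume 0: "(\<Sum>x\<in>C \<union> D. fun_scale (c x) x) = 0" and v: "v \<in> C \<union> D"
    have sum0: "(\<Sum>x\<in>C. fun_scale (c x) x) + (\<Sum>x\<in>D. fun_scale (c x) x) = 0"
      using 0 by (simp only: sum.union_disjoint[OF C(1) D(1) CD])
    have 1: "(\<Sum>x\<in>C. fun_scale (c x) x) \<in> A" 
      using C(2) by (intro fs.subspace_sum[OF A] fs.subspace_scale[OF A]) auto
    have 2: "(\<Sum>x\<in>D. fun_scale (c x) x) \<in> B"
      using D(2) by (intro fs.subspace_sum[OF B] fs.subspace_scale[OF B]) auto
    have "(\<Sum>x\<in>C. fun_scale (c x) x) = - (\<Sum>x\<in>D. fun_scale (c x) x)"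
      using sum0 by (simp only: eq_neg_iff_add_eq_0)
    then have "(\<Sum>x\<in>C. fun_scale (c x) x) \<in> A \<inter> B"
      using fs.subspace_neg[OF B 2] 1 by simp
    then have z: "(\<Sum>x\<in>C. fun_scale (c x) x) = 0" using AB by simp
    have z': "(\<Sum>x\<in>D. fun_scale (c x) x) = 0"
      using sum0 by (simp only: z add_0_left)
    show "c v = 0"
    proof (cases "v \<in> C")
      case True
      then show ?thesis using fs.independentD[OF C(3) C(1) subset_refl z] by simp
    next
      case False
      then show ?thesis using v fs.independentD[OF D(3) D(1) subset_refl z'] by simp
    qed
  qed
  have "U \<subseteq> fs.span (C \<union> D)"
    using U(2) C(4) D(4) by (auto simp: fs.span_Un)
  moreover have "C \<union> D \<subseteq> U" using C(2) D(2) AU BU by blast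
  ultimately have "fs.dim U = card (C \<union> D)" using ind fs.basis_card_eq_dim by metis
  then show ?thesis using C D CD by (simp add: card_Un_disjoint)
qed

locale p_group_rep = group_rep G T for G :: "('g, 'b) monoid_scheme" (structure)
    and T :: "'g \<Rightarrow> ('x \<Rightarrow> 'f::field) \<Rightarrow> 'x \<Rightarrow> 'f" +
  fixes p e :: nat
  assumes char_p: "CHAR('f) = p" and prime_p: "prime p" and order_G: "order G = p ^ e"
begin

definition invariant :: "('x \<Rightarrow> 'f) set \<Rightarrow> bool" where
  "invariant U \<longleftrightarrow> fs.subspace U \<and> (\<forall>g\<in>carrier G. \<forall>x\<in>U. T g x \<in> U)"

lemma nrm_linear: "Vector_Spaces.linear fun_scale fun_scale nrm"
  by (simp add: Vector_Spaces.linear_iff vector_space_fun_scale nrm_def T_add T_scale sum.distrib fs.scale_sum_right)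

lemma nrm_in: "invariant U \<Longrightarrow> x \<in> U \<Longrightarrow> nrm x \<in> U"
  unfolding invariant_def nrm_def by (auto intro: fs.subspace_sum)

lemma invariant_nrm_image: "invariant U \<Longrightarrow> fs.subspace (nrm ` U)"
  unfolding invariant_def using fsp.linear_subspace_image[OF nrm_linear] by blast

section \<open>Free submodules from the norm\<close>

text \<open>The relations between the translates of the \<open>b i\<close> form a space of functions on pairs \<open>(i, g)\<close> on which
  \<open>G\<close> acts by translation. If it is nonzero, it contains a nonzero fixed vector, which depends on \<open>i\<close> only
  and thus is a relation between the norms of the \<open>b i\<close>.\<close>

lemma translates_independent:
  fixes b :: "nat \<Rightarrow> 'x \<Rightarrow> 'f"
  assumes indep: "\<And>c. (\<Sum>i<r. fun_scale (c i) (nrm (b i))) = 0 \<Longrightarrow> \<forall>i<r. c i = 0"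
    and a: "(\<Sum>i<r. \<Sum>g\<in>carrier G. fun_scale (a (i, g)) (T g (b i))) = 0"
    and i: "i < r" "g \<in> carrier G"
  shows "a (i, g) = 0"
proof -
  define S where "S = {a :: nat \<times> 'g \<Rightarrow> 'f. (\<forall>j h. \<not> (j < r \<and> h \<in> carrier G) \<longrightarrow> a (j, h) = 0) \<and>
    (\<Sum>i<r. \<Sum>g\<in>carrier G. fun_scale (a (i, g)) (T g (b i))) = 0}"
  define T' where "T' h a = (\<lambda>(j, g). if g \<in> carrier G then a (j, g \<otimes> inv h) else a (j, g))"
    for h and a :: "nat \<times> 'g \<Rightarrow> 'f"
  interpret T': group_rep G T'
    by unfold_locales
      (auto simp: T'_def fun_scale_def fin_carrier m_assoc inv_mult_group fun_eq_iff)
  have S_add: "x + y \<in> S" if "x \<in> S" "y \<in> S" for x y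
  proof -
    have "(\<Sum>i<r. \<Sum>g\<in>carrier G. fun_scale ((x + y) (i, g)) (T g (b i))) =
      (\<Sum>i<r. \<Sum>g\<in>carrier G. fun_scale (x (i, g)) (T g (b i))) + (\<Sum>i<r. \<Sum>g\<in>carrier G. fun_scale (y (i, g)) (T g (b i)))"
      by (simp only: plus_fun_apply fs.scale_left_distrib sum.distrib)
    then show ?thesis using that unfolding S_def by simp
  qed
  have S_T: "T' h x \<in> S" if h: "h \<in> carrier G" and x: "x \<in> S" for h x
  proof -
    have "(\<Sum>i<r. \<Sum>g\<in>carrier G. fun_scale (T' h x (i, g)) (T g (b i)))
      = (\<Sum>i<r. \<Sum>g\<in>carrier G. fun_scale (T' h x (i, g \<otimes> h)) (T (g \<otimes> h) (b i)))"
      using sum_translate[OF h, of "\<lambda>g. fun_scale (T' h x (_, g)) (T g (b _))"] by simp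
    also have "\<dots> = (\<Sum>i<r. \<Sum>g\<in>carrier G. T h (fun_scale (x (i, g)) (T g (b i))))"
      using h by (intro sum.cong refl) (simp add: T'_def m_assoc T_mult T_scale)
    also have "\<dots> = T h (\<Sum>i<r. \<Sum>g\<in>carrier G. fun_scale (x (i, g)) (T g (b i)))"
      using h by (simp add: T_sum)
    also have "\<dots> = 0" using x h by (simp add: S_def T_zero)
    finally have "(\<Sum>i<r. \<Sum>g\<in>carrier G. fun_scale (T' h x (i, g)) (T g (b i))) = 0" .
    moreover have "T' h x (j, g) = 0" if "\<not> (j < r \<and> g \<in> carrier G)" for j g
      using that x h by (auto simp: T'_def S_def)
    ultimately show ?thesis by (auto simp: S_def)
  qed
  define a' where "a' = (\<lambda>(j, h). if j < r \<and> h \<in> carrier G then a (j, h) else 0)"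
  have a': "a' \<in> S" using a by (simp add: S_def a'_def)
  have "a' = 0"
  proof (rule ccontr)
    assume "a' \<noteq> 0"
    then obtain w where w: "w \<in> S" "w \<noteq> 0" "T'.fixed w"
      using T'.exists_fixed_vector[OF char_p prime_p order_G S_add S_T a'] by blast
    have const: "w (j, g) = w (j, \<one>)" if g: "g \<in> carrier G" for j g
    proof -
      have "T' (inv g) w (j, \<one>) = w (j, \<one>)" using w(3) g by (simp add: T'.fixed_def)
      then show ?thesis using g by (simp add: T'_def)
    qed
    have "(\<Sum>i<r. fun_scale (w (i, \<one>)) (nrm (b i))) = (\<Sum>i<r. \<Sum>g\<in>carrier G. fun_scale (w (i, g)) (T g (b i)))"
      unfolding nrm_def fs.scale_sum_right by (intro sum.cong refl) (metis const)
    also have "\<dots> = 0" using w(1) by (simp add: S_def)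
    finally have "\<forall>i<r. w (i, \<one>) = 0" by (rule indep)
    then have "w (j, g) = 0" for j g
    proof (cases "j < r \<and> g \<in> carrier G")
      case True
      then show ?thesis using const[of g j] \<open>\<forall>i<r. w (i, \<one>) = 0\<close> by metis
    next
      case False
      then show ?thesis using w(1) by (simp add: S_def)
    qed
    then have "w = 0" by (auto simp: fun_eq_iff)
    then show False using w(2) by simp
  qed
  then have "a' (i, g) = 0" by simp
  then show ?thesis using i by (simp add: a'_def)
qed

text \<open>The translates of preimages of a basis of the norm image are a basis of \<open>A\<close>. A linear functional
  that picks the coefficient at the unit element, composed with the translations, yields the
  coordinates \<open>\<psi>\<close>, which extend from \<open>A\<close> to the whole space; \<open>B\<close> is the part of \<open>U\<close> where they vanish. The
  norm kills \<open>B\<close>, as norms of elements of \<open>U\<close> lie in \<open>A\<close> and \<open>A\<close> meets \<open>B\<close> in zero only.\<close>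

lemma free_splitting:
  assumes U: "invariant U" "fin_dim U"
  obtains A B \<psi> where
    "invariant A" "invariant B" "A \<subseteq> U" "B \<subseteq> U" "U = {a + b |a b. a \<in> A \<and> b \<in> B}" "A \<inter> B = {0}"
    "\<And>x. x \<in> B \<Longrightarrow> nrm x = 0" "fs.dim A = order G * fs.dim (nrm ` U)"
    "\<And>i g x y. \<psi> i (x + y) g = \<psi> i x g + \<psi> i y g"
    "\<And>i g c x. \<psi> i (fun_scale c x) g = c * \<psi> i x g"
    "\<And>i g h x. \<lbrakk>g \<in> carrier G; h \<in> carrier G\<rbrakk> \<Longrightarrow> \<psi> i (T h x) g = \<psi> i x (g \<otimes> inv h)"
    "\<And>y :: nat \<Rightarrow> 'g \<Rightarrow> 'f. \<exists>!x. x \<in> A \<and> (\<forall>i<fs.dim (nrm ` U). \<forall>g\<in>carrier G. \<psi> i x g = y i g)"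
proof -
  define r where "r = fs.dim (nrm ` U)"
  have "nrm ` U \<subseteq> U" using nrm_in[OF U(1)] by blast
  then obtain C where C: "finite C" "C \<subseteq> nrm ` U" "fs.independent C" "fs.span C = nrm ` U" "card C = r"
    using fin_dim_basis[OF fin_dim_mono[OF U(2)] invariant_nrm_image[OF U(1)]] unfolding r_def by metis
  obtain k where k: "bij_betw k {..<r} C"
    using ex_bij_betw_nat_finite[OF C(1)] C(5) by (auto simp: atLeast0LessThan)
  have "\<forall>i\<in>{..<r}. \<exists>x\<in>U. nrm x = k i"
  proof
    fix i assume "i \<in> {..<r}"
    then have "k i \<in> nrm ` U" using k C(2) by (auto simp: bij_betw_def)
    then show "\<exists>x\<in>U. nrm x = k i" by (auto simp: image_iff)
  qed
  then obtain b where b: "\<And>i. i < r \<Longrightarrow> b i \<in> U" "\<And>i. i < r \<Longrightarrow> nrm (b i) = k i"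
    by (metis lessThan_iff)
  define nb where "nb i = nrm (b i)" for i
  have nb_bij: "bij_betw nb {..<r} C"
    using bij_betw_cong[of "{..<r}" nb k C] k b(2) by (simp add: nb_def)
  have indep: "\<forall>i<r. c i = 0" if c: "(\<Sum>i<r. fun_scale (c i) (nrm (b i))) = 0" for c
  proof -
    let ?u = "\<lambda>v. c (inv_into {..<r} nb v)"
    have "(\<Sum>v\<in>C. fun_scale (?u v) v) = (\<Sum>i<r. fun_scale (?u (nb i)) (nb i))"
      by (rule sum.reindex_bij_betw[OF nb_bij, symmetric])
    also have "\<dots> = (\<Sum>i<r. fun_scale (c i) (nrm (b i)))"
      using nb_bij by (intro sum.cong refl) (auto simp: bij_betw_def simp flip: nb_def)
    finally have "(\<Sum>v\<in>C. fun_scale (?u v) v) = 0" using c by simp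
    note z = fs.independentD[OF C(3) C(1) subset_refl this]
    show ?thesis
    proof (intro allI impI)
      fix i assume i: "i < r"
      then have "nb i \<in> C" using nb_bij by (auto simp: bij_betw_def)
      then have "c (inv_into {..<r} nb (nb i)) = 0" by (rule z)
      then show "c i = 0" using i nb_bij by (auto simp: bij_betw_def inv_into_f_f)
    qed
  qed
  define I where "I = {..<r} \<times> carrier G"
  have finI: "finite I" using fin_carrier by (simp add: I_def)
  define ev where "ev = (\<lambda>(i, g). T g (b i))"
  have tindep: "a (i, g) = 0" if "(\<Sum>j\<in>I. fun_scale (a j) (ev j)) = 0" "i < r" "g \<in> carrier G" for a i g
    using translates_independent[OF indep, where a = a and i = i and g = g] that
    by (simp add: I_def ev_def sum.cartesian_product case_prod_beta)
  have ev_inj: "inj_on ev I"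
  proof (rule inj_onI)
    fix j j' assume j: "j \<in> I" "j' \<in> I" "ev j = ev j'"
    show "j = j'"
    proof (rule ccontr)
      assume ne: "j \<noteq> j'"
      let ?a = "\<lambda>l. if l = j then 1 else if l = j' then - 1 else (0::'f)"
      have "(\<Sum>l\<in>I. fun_scale (?a l) (ev l)) = (\<Sum>l\<in>I. (if l = j then ev j else 0) - (if l = j' then ev j' else 0))"
        using ne by (intro sum.cong refl) auto
      also have "\<dots> = 0" using j finI by (simp add: sum_subtractf)
      finally have "?a j = 0" using tindep[of ?a "fst j" "snd j"] j(1) by (simp add: I_def mem_Times_iff)
      then show False by simp
    qed
  qed
  have ev_indep: "fs.independent (ev ` I)"
  proof (rule fs.independent_if_scalars_zero)
    show "finite (ev ` I)" using finI by simp
    fix f x assume 0: "(\<Sum>x\<in>ev ` I. fun_scale (f x) x) = 0" and x: "x \<in> ev ` I"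
    have "(\<Sum>j\<in>I. fun_scale (f (ev j)) (ev j)) = 0"
      using 0 by (simp only: sum.reindex[OF ev_inj] o_def)
    from tindep[OF this] show "f x = 0" using x by (auto simp: I_def)
  qed
  have "\<exists>l. Vector_Spaces.linear fun_scale (*) l \<and> (\<forall>x\<in>ev ` I. l x = (if x = ev (i, \<one>) then 1 else 0))" for i
    by (rule fsf.linear_independent_extend[OF ev_indep])
  then obtain la where la: "\<And>i. Vector_Spaces.linear fun_scale (*) (la i)"
      "\<And>i x. x \<in> ev ` I \<Longrightarrow> la i x = (if x = ev (i, \<one>) then 1 else 0)"
    by metis
  have la_ev: "la i (ev j) = (if j = (i, \<one>) then 1 else 0)" if "i < r" "j \<in> I" for i j
  proof -
    have "(i, \<one>) \<in> I" using that by (simp add: I_def)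
    then have "ev j = ev (i, \<one>) \<longleftrightarrow> j = (i, \<one>)" using inj_on_eq_iff[OF ev_inj] that by blast
    then show ?thesis using la(2)[of "ev j" i] that by simp
  qed
  define \<psi> where "\<psi> i x g = la i (T (inv g) x)" for i x g
  have la_add: "la i (x + y) = la i x + la i y" and la_scale: "la i (fun_scale c x) = c * la i x" for i x y c
    using la(1)[of i] by (simp_all add: Vector_Spaces.linear_iff)
  have psi_T: "\<psi> i (T h x) g = \<psi> i x (g \<otimes> inv h)" if "g \<in> carrier G" "h \<in> carrier G" for i g h x
    using that by (simp add: \<psi>_def T_mult[symmetric] inv_mult_group)
  have psi0_add: "\<psi> i (x + y) g = \<psi> i x g + \<psi> i y g" if "g \<in> carrier G" for i g x y
    using that by (simp add: \<psi>_def la_add T_add)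
  have psi0_scale: "\<psi> i (fun_scale c x) g = c * \<psi> i x g" if "g \<in> carrier G" for i g x c
    using that by (simp add: \<psi>_def la_scale T_scale)
  have psi_0: "\<psi> i 0 g = 0" if "g \<in> carrier G" for i g
    using psi0_scale[OF that, of i 0 0] by simp
  have psi_sum: "\<psi> i (\<Sum>j\<in>J. f j) g = (\<Sum>j\<in>J. \<psi> i (f j) g)" if "g \<in> carrier G" for i g J and f :: "nat \<times> 'g \<Rightarrow> _"
    by (simp only: \<psi>_def T_sum[OF inv_closed[OF that]] fsf.linear_sum[OF la(1)])
  have psi_ev: "\<psi> i (ev (j, h)) g = (if i = j \<and> g = h then 1 else 0)"
    if "i < r" "j < r" "g \<in> carrier G" "h \<in> carrier G" for i j g h
  proof -
    have "\<psi> i (ev (j, h)) g = la i (ev (j, h \<otimes> inv g))"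
      using that by (simp add: \<psi>_def ev_def T_mult)
    moreover have "h \<otimes> inv g = \<one> \<longleftrightarrow> g = h"
      using that by (metis inv_closed inv_comm inv_equality inv_inv r_inv)
    ultimately show ?thesis using that la_ev by (auto simp: I_def)
  qed
  define A where "A = fs.span (ev ` I)"
  define B where "B = {x \<in> U. \<forall>i<r. \<forall>g\<in>carrier G. \<psi> i x g = 0}"
  define lc where "lc y = (\<Sum>j\<in>I. fun_scale (y (fst j) (snd j)) (ev j))" for y :: "nat \<Rightarrow> 'g \<Rightarrow> 'f"
  have lc_A: "lc y \<in> A" for y
    unfolding lc_def A_def by (intro fs.span_sum fs.span_scale fs.span_base imageI)
  have psi_lc: "\<psi> i (lc y) g = y i g" if i: "i < r" "g \<in> carrier G" for i g y
  proof -
    have "\<psi> i (lc y) g = (\<Sum>j\<in>I. y (fst j) (snd j) * \<psi> i (ev j) g)"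
      using i by (simp add: lc_def psi_sum psi0_scale)
    also have "\<dots> = (\<Sum>j\<in>I. if j = (i, g) then y i g else 0)"
    proof (rule sum.cong[OF refl])
      fix j assume "j \<in> I"
      then show "y (fst j) (snd j) * \<psi> i (ev j) g = (if j = (i, g) then y i g else 0)"
        using psi_ev[OF i(1) _ i(2), of "fst j" "snd j"]
        by (cases j; cases "j = (i, g)") (auto simp: I_def split: if_splits)
    qed
    finally show ?thesis using finI i by (simp add: I_def)
  qed
  have A_lc: "x = lc (\<lambda>i g. \<psi> i x g)" if x: "x \<in> A" for x
  proof -
    obtain u where u: "x = (\<Sum>v\<in>ev ` I. fun_scale (u v) v)"
      using x finI by (auto simp: A_def fs.span_finite)
    then have x': "x = lc (\<lambda>i g. u (ev (i, g)))"
      by (simp add: lc_def sum.reindex[OF ev_inj])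
    have "lc (\<lambda>i g. \<psi> i x g) = lc (\<lambda>i g. u (ev (i, g)))"
      unfolding lc_def by (intro sum.cong refl) (auto simp: x' psi_lc I_def)
    then show ?thesis using x' by simp
  qed
  have subU: "fs.subspace U" using U(1) by (simp add: invariant_def)
  have ev_U: "ev j \<in> U" if "j \<in> I" for j
    using that U(1) b(1) by (auto simp: ev_def I_def invariant_def)
  have AU: "A \<subseteq> U"
    unfolding A_def using ev_U by (intro fs.span_minimal subU) auto
  have invA: "invariant A"
  proof -
    have "T h x \<in> A" if h: "h \<in> carrier G" and x: "x \<in> A" for h x
    proof -
      have "T h (ev j) \<in> A" if "j \<in> I" for j
      proof -
        have "T h (ev j) = ev (fst j, snd j \<otimes> h)" using that h by (auto simp: ev_def I_def T_mult)
        then show ?thesis unfolding A_def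
          using that h by (auto simp: I_def intro!: fs.span_base imageI)
      qed
      then have "(\<Sum>j\<in>I. fun_scale (\<psi> (fst j) x (snd j)) (T h (ev j))) \<in> A"
        unfolding A_def by (intro fs.span_sum fs.span_scale) auto
      moreover have "T h x = (\<Sum>j\<in>I. fun_scale (\<psi> (fst j) x (snd j)) (T h (ev j)))"
        by (subst A_lc[OF x]) (simp add: lc_def T_sum[OF h] T_scale[OF h])
      ultimately show ?thesis by simp
    qed
    then show ?thesis by (auto simp: invariant_def A_def)
  qed
  have invB: "invariant B"
    unfolding invariant_def
  proof
    show "fs.subspace B"
      unfolding B_def fs.subspace_def
      using subU by (auto simp: psi0_add psi0_scale psi_0 fs.subspace_def)
    show "\<forall>g\<in>carrier G. \<forall>x\<in>B. T g x \<in> B"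
      using U(1) by (auto simp: B_def psi_T invariant_def)
  qed
  have AB: "A \<inter> B = {0}"
  proof -
    have "x = 0" if "x \<in> A" "x \<in> B" for x
    proof -
      have "x = lc (\<lambda>i g. \<psi> i x g)" by (rule A_lc[OF that(1)])
      also have "\<dots> = 0" using that(2) by (auto simp: lc_def B_def I_def intro!: sum.neutral)
      finally show ?thesis .
    qed
    moreover have "0 \<in> A" "0 \<in> B" using invA invB by (auto simp: invariant_def fs.subspace_0)
    ultimately show ?thesis by blast
  qed
  have UAB: "U = {a + b |a b. a \<in> A \<and> b \<in> B}"
  proof
    show "{a + b |a b. a \<in> A \<and> b \<in> B} \<subseteq> U"
      using AU subU by (auto simp: B_def fs.subspace_add)
    show "U \<subseteq> {a + b |a b. a \<in> A \<and> b \<in> B}"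
    proof
      fix x assume x: "x \<in> U"
      let ?a = "lc (\<lambda>i g. \<psi> i x g)"
      have "?a \<in> U" using lc_A AU by blast
      then have "x - ?a \<in> U" using x subU by (simp add: fs.subspace_diff)
      moreover have "\<psi> i (x - ?a) g = 0" if "i < r" "g \<in> carrier G" for i g
        using psi0_add[OF that(2), of i "x - ?a" ?a] psi_lc[OF that, of "\<lambda>i g. \<psi> i x g"] by simp
      ultimately have "x - ?a \<in> B" by (auto simp: B_def)
      moreover have "x = ?a + (x - ?a)" by simp
      ultimately show "x \<in> {a + b |a b. a \<in> A \<and> b \<in> B}" using lc_A by blast
    qed
  qed
  have nB: "nrm x = 0" if x: "x \<in> B" for x
  proof -
    have "nrm x \<in> nrm ` U" using x by (auto simp: B_def)
    then have "nrm x \<in> fs.span C" using C(4) by simp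
    moreover have "C \<subseteq> A"
    proof
      fix v assume "v \<in> C"
      then obtain i where i: "i < r" "v = nrm (b i)" using nb_bij by (auto simp: bij_betw_def nb_def)
      have "T g (b i) \<in> A" if "g \<in> carrier G" for g
        unfolding A_def by (rule fs.span_base) (use i that in \<open>auto simp: ev_def I_def image_iff\<close>)
      then show "v \<in> A" unfolding i nrm_def A_def by (intro fs.span_sum)
    qed
    ultimately have "nrm x \<in> A"
      using invA fs.span_minimal[of C A] by (auto simp: invariant_def)
    moreover have "nrm x \<in> B" using nrm_in[OF invB x] .
    ultimately show ?thesis using AB by blast
  qed
  have dimA: "fs.dim A = order G * fs.dim (nrm ` U)"
    unfolding A_def r_def[symmetric]
    by (simp only: fs.dim_span_eq_card_independent[OF ev_indep] card_image[OF ev_inj])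
      (simp add: I_def card_cartesian_product order_def mult.commute)
  have uniq: "\<exists>!x. x \<in> A \<and> (\<forall>i<r. \<forall>g\<in>carrier G. \<psi> i x g = y i g)" for y
  proof (rule ex1I[of _ "lc y"])
    show "lc y \<in> A \<and> (\<forall>i<r. \<forall>g\<in>carrier G. \<psi> i (lc y) g = y i g)" using lc_A psi_lc by simp
    fix x assume x: "x \<in> A \<and> (\<forall>i<r. \<forall>g\<in>carrier G. \<psi> i x g = y i g)"
    then have "x = lc (\<lambda>i g. \<psi> i x g)" using A_lc by blast
    also have "\<dots> = lc y" unfolding lc_def using x by (intro sum.cong refl) (auto simp: I_def)
    finally show "x = lc y" .
  qed
  \<comment> \<open>truncation outside the group makes additivity and homogeneity hold at every index\<close>
  define \<psi>' where "\<psi>' i x g = (if g \<in> carrier G then \<psi> i x g else 0)" for i x g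
  have 1: "\<psi>' i (x + y) g = \<psi>' i x g + \<psi>' i y g" for i g x y
    by (cases "g \<in> carrier G") (simp_all only: \<psi>'_def psi0_add if_True if_False add_0_left)
  have 2: "\<psi>' i (fun_scale c x) g = c * \<psi>' i x g" for i g c x
    by (cases "g \<in> carrier G") (simp_all only: \<psi>'_def psi0_scale if_True if_False mult_zero_right)
  have 3: "\<psi>' i (T h x) g = \<psi>' i x (g \<otimes> inv h)" if "g \<in> carrier G" "h \<in> carrier G" for i g h x
    using that by (simp only: \<psi>'_def psi_T if_True m_closed inv_closed)
  have 4: "\<exists>!x. x \<in> A \<and> (\<forall>i<fs.dim (nrm ` U). \<forall>g\<in>carrier G. \<psi>' i x g = y i g)" for y
    using uniq[of y] by (simp add: \<psi>'_def r_def)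
  have BU: "B \<subseteq> U" by (auto simp: B_def)
  show thesis
    by (rule that[of A B \<psi>', OF invA invB AU BU UAB AB nB dimA 1 2 3 4])
qed

end

lemma abelian_group_free_module:
  assumes "ring R"
  shows "abelian_group (free_module R n)"
proof -
  interpret ring R by fact
  show ?thesis
  proof (rule abelian_groupI)
    fix x assume x: "x \<in> carrier (free_module R n)"
    show "\<exists>y\<in>carrier (free_module R n). y \<oplus>\<^bsub>free_module R n\<^esub> x = \<zero>\<^bsub>free_module R n\<^esub>"
      by (rule bexI[of _ "\<lambda>i\<in>{..<n}. \<ominus>\<^bsub>R\<^esub> x i"])
        (use x in \<open>auto simp: free_module_def l_neg PiE_iff intro!: restrict_ext\<close>)
  qed (auto simp: free_module_def PiE_iff a_ac extensional_def restrict_def fun_eq_iff)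
qed

context p_group_rep
begin

abbreviation FG :: "('g \<Rightarrow> 'f) ring" where "FG \<equiv> group_algebra G"

section \<open>Projective modules over the group algebra of a p-group\<close>

text \<open>Module records carry their own operations. The relation transfers them to the pointwise operations
  of a function space on which the group acts.\<close>

definition represents :: "('g \<Rightarrow> 'f, 'x \<Rightarrow> 'f, 'm) module_scheme \<Rightarrow> ('x \<Rightarrow> 'f) set \<Rightarrow> bool" where
  "represents M U \<longleftrightarrow> carrier M = U \<and> (\<forall>x y. x \<oplus>\<^bsub>M\<^esub> y = x + y) \<and> \<zero>\<^bsub>M\<^esub> = 0 \<and>
     (\<forall>a\<in>carrier FG. \<forall>x\<in>U. a \<odot>\<^bsub>M\<^esub> x = act a x)"

lemma represents_restrict: "represents M U \<Longrightarrow> B \<subseteq> U \<Longrightarrow> represents (M\<lparr>carrier := B\<rparr>) B"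
  by (auto simp: represents_def)

lemma ring_FG: "ring FG"
  by (rule ring_group_algebra[OF group_axioms fin_carrier])

lemma act_basis: "g \<in> carrier G \<Longrightarrow> act (basis_elt g) x = T g x"
proof -
  assume g: "g \<in> carrier G"
  have "act (basis_elt g) x = (\<Sum>h\<in>carrier G. if h = g then T g x else 0)"
    unfolding act_def by (rule sum.cong) (auto simp: basis_elt_def)
  then show ?thesis using g fin_carrier by simp
qed

lemma act_one: "act (\<lambda>g. if g = \<one> then c else 0) x = fun_scale c x"
proof -
  have "act (\<lambda>g. if g = \<one> then c else 0) x = (\<Sum>h\<in>carrier G. if h = \<one> then fun_scale c x else 0)"
    unfolding act_def by (rule sum.cong) (auto simp: T_one)
  then show ?thesis using fin_carrier by simp
qed

definition norm_elt :: "'g \<Rightarrow> 'f" where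
  "norm_elt g = (if g \<in> carrier G then 1 else 0)"

lemma act_norm_elt: "act norm_elt x = nrm x"
  unfolding act_def nrm_def by (rule sum.cong) (auto simp: norm_elt_def)

lemma act_invariant: "invariant U \<Longrightarrow> x \<in> U \<Longrightarrow> act a x \<in> U"
  unfolding act_def invariant_def by (auto intro!: fs.subspace_sum fs.subspace_scale)

lemma FG_closed:
  "basis_elt g \<in> carrier FG \<longleftrightarrow> g \<in> carrier G" "norm_elt \<in> carrier FG"
  "(\<lambda>g. if g = \<one> then c else 0) \<in> carrier FG"
  by (auto simp: group_algebra_def basis_elt_def norm_elt_def)

lemma act_mult: "act (a \<otimes>\<^bsub>FG\<^esub> b) x = act b (act a x)"
proof -
  have "act (a \<otimes>\<^bsub>FG\<^esub> b) x = (\<Sum>g\<in>carrier G. \<Sum>h\<in>carrier G. fun_scale (a h * b (inv h \<otimes> g)) (T g x))"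
    by (simp add: act_def group_algebra_mult_eq[OF group_axioms] fs.scale_sum_left)
  also have "\<dots> = (\<Sum>h\<in>carrier G. \<Sum>g\<in>carrier G. fun_scale (a h * b (inv h \<otimes> g)) (T g x))"
    by (rule sum.swap)
  also have "\<dots> = (\<Sum>h\<in>carrier G. \<Sum>g\<in>carrier G. fun_scale (a h * b g) (T g (T h x)))"
  proof (rule sum.cong[OF refl])
    fix h assume h: "h \<in> carrier G"
    show "(\<Sum>g\<in>carrier G. fun_scale (a h * b (inv h \<otimes> g)) (T g x)) = (\<Sum>g\<in>carrier G. fun_scale (a h * b g) (T g (T h x)))"
      by (rule sum.reindex_bij_witness[of _ "\<lambda>g. h \<otimes> g" "\<lambda>g. inv h \<otimes> g"])
        (use h in \<open>auto simp: T_mult[symmetric] m_assoc[symmetric]\<close>)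
  qed
  also have "\<dots> = (\<Sum>g\<in>carrier G. \<Sum>h\<in>carrier G. fun_scale (a h * b g) (T g (T h x)))"
    by (rule sum.swap)
  also have "\<dots> = act b (act a x)"
    by (simp add: act_def T_sum T_scale fs.scale_sum_right mult.commute)
  finally show ?thesis .
qed

lemma represents_right_module:
  assumes M: "represents M U" and U: "invariant U"
  shows "right_module FG M"
proof -
  have sub: "fs.subspace U" using U by (simp add: invariant_def)
  have [simp]: "carrier M = U" "x \<oplus>\<^bsub>M\<^esub> y = x + y" "\<zero>\<^bsub>M\<^esub> = 0" for x y
    using M by (auto simp: represents_def)
  have sm: "a \<odot>\<^bsub>M\<^esub> x = act a x" if "a \<in> carrier FG" "x \<in> U" for a x
    using M that by (auto simp: represents_def)
  have ab: "abelian_group M"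
  proof (rule abelian_groupI)
    fix x assume x: "x \<in> carrier M"
    show "\<exists>y\<in>carrier M. y \<oplus>\<^bsub>M\<^esub> x = \<zero>\<^bsub>M\<^esub>"
      by (rule bexI[of _ "- x"]) (use x sub fs.subspace_neg in auto)
  qed (use sub in \<open>auto simp: add.assoc add.commute fs.subspace_add fs.subspace_0\<close>)
  interpret R: ring FG by (rule ring_FG)
  have add_FG: "a \<oplus>\<^bsub>FG\<^esub> b = a + b" for a b :: "'g \<Rightarrow> 'f"
    by (simp add: group_algebra_def fun_eq_iff)
  have one_FG: "\<one>\<^bsub>FG\<^esub> = (\<lambda>g. if g = \<one> then 1 else 0)"
    by (simp add: group_algebra_def)
  have act_add1: "act (a + b) x = act a x + act b x" for a b x
    by (simp only: act_def plus_fun_apply fs.scale_left_distrib sum.distrib)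
  have act_add2: "act a (x + y) = act a x + act a y" for a x y
    unfolding act_def sum.distrib[symmetric]
    by (intro sum.cong refl) (simp only: T_add fs.scale_right_distrib)
  note cl = act_invariant[OF U] fs.subspace_add[OF sub]
  show ?thesis
    unfolding right_module_def right_module_axioms_def
  proof (intro conjI allI impI)
    show "ring FG" by (rule ring_FG)
    show "abelian_group M" by (rule ab)
    fix a b :: "'g \<Rightarrow> 'f" and x y
    show "a \<odot>\<^bsub>M\<^esub> x \<in> carrier M" if "a \<in> carrier FG" "x \<in> carrier M" using that cl by (simp add: sm)
    show "(a \<oplus>\<^bsub>FG\<^esub> b) \<odot>\<^bsub>M\<^esub> x = a \<odot>\<^bsub>M\<^esub> x \<oplus>\<^bsub>M\<^esub> b \<odot>\<^bsub>M\<^esub> x"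
      if "a \<in> carrier FG" "b \<in> carrier FG" "x \<in> carrier M"
      using that R.a_closed[OF that(1,2)] by (simp only: sm add_FG act_add1 \<open>carrier M = U\<close> \<open>\<And>x y. x \<oplus>\<^bsub>M\<^esub> y = x + y\<close>)
    show "a \<odot>\<^bsub>M\<^esub> (x \<oplus>\<^bsub>M\<^esub> y) = a \<odot>\<^bsub>M\<^esub> x \<oplus>\<^bsub>M\<^esub> a \<odot>\<^bsub>M\<^esub> y"
      if "a \<in> carrier FG" "x \<in> carrier M" "y \<in> carrier M"
      using that cl(2)[of x y] by (simp only: sm act_add2 \<open>carrier M = U\<close> \<open>\<And>x y. x \<oplus>\<^bsub>M\<^esub> y = x + y\<close>)
    show "(a \<otimes>\<^bsub>FG\<^esub> b) \<odot>\<^bsub>M\<^esub> x = b \<odot>\<^bsub>M\<^esub> (a \<odot>\<^bsub>M\<^esub> x)"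
      if "a \<in> carrier FG" "b \<in> carrier FG" "x \<in> carrier M"
      using that R.m_closed[OF that(1,2)] cl(1)[of x a] by (simp only: sm act_mult \<open>carrier M = U\<close>)
    show "\<one>\<^bsub>FG\<^esub> \<odot>\<^bsub>M\<^esub> x = x" if "x \<in> carrier M"
      using that sm[OF R.one_closed, of x] act_one[of 1 x] by (simp only: one_FG fs.scale_one \<open>carrier M = U\<close>)
  qed
qed

lemma submodule_iff:
  assumes M: "represents M U" and U: "invariant U"
  shows "submodule H FG M \<longleftrightarrow> H \<subseteq> U \<and> invariant H"
proof -
  interpret right_module FG M by (rule represents_right_module[OF M U])
  have [simp]: "carrier M = U" "x \<oplus>\<^bsub>M\<^esub> y = x + y" "\<zero>\<^bsub>M\<^esub> = 0" for x y
    using M by (auto simp: represents_def)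
  have sm: "a \<odot>\<^bsub>M\<^esub> x = act a x" if "a \<in> carrier FG" "x \<in> U" for a x
    using M that by (auto simp: represents_def)
  have grp: "group (add_monoid M)" by (rule a_group)
  show ?thesis
  proof
    assume H: "submodule H FG M"
    interpret H: submodule H FG M by fact
    have HU: "H \<subseteq> U" using H.subset by simp
    have "fs.subspace H"
      unfolding fs.subspace_def
    proof (intro conjI ballI allI)
      show "0 \<in> H" using H.one_closed by simp
      show "x + y \<in> H" if "x \<in> H" "y \<in> H" for x y using H.m_closed[OF that] by simp
      show "fun_scale c x \<in> H" if "x \<in> H" for c x
        using H.smult_closed[OF FG_closed(3) that, of c] sm[OF FG_closed(3) subsetD[OF HU that], of c]
        by (simp only: act_one)
    qed
    moreover have "T g x \<in> H" if "g \<in> carrier G" "x \<in> H" for g x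
    proof -
      have g: "(basis_elt g :: 'g \<Rightarrow> 'f) \<in> carrier FG" using that FG_closed(1) by blast
      show ?thesis
        using H.smult_closed[OF g that(2)] sm[OF g subsetD[OF HU that(2)]] by (simp only: act_basis[OF that(1)])
    qed
    ultimately show "H \<subseteq> U \<and> invariant H" using HU by (simp add: invariant_def)
  next
    assume H: "H \<subseteq> U \<and> invariant H"
    then have sub: "fs.subspace H" by (simp add: invariant_def)
    show "submodule H FG M"
      unfolding submodule_def submodule_axioms_def
    proof (intro conjI allI impI)
      show "subgroup H (add_monoid M)"
      proof (rule group.subgroupI[OF grp])
        show "H \<noteq> {}" using fs.subspace_0[OF sub] by auto
        fix x assume x: "x \<in> H"
        have "inv\<^bsub>add_monoid M\<^esub> x = - x"
          by (rule group.inv_equality[OF grp]) (use x H sub in \<open>auto simp: fs.subspace_neg\<close>)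
        then show "inv\<^bsub>add_monoid M\<^esub> x \<in> H" using x sub by (simp add: fs.subspace_neg)
      qed (use H sub in \<open>auto simp: fs.subspace_add\<close>)
      show "a \<odot>\<^bsub>M\<^esub> x \<in> H" if "a \<in> carrier FG" "x \<in> H" for a x
        using that H sm[of a x] act_invariant[of H x a] by auto
    qed
  qed
qed

lemma direct_sum_iff:
  assumes M: "represents M U" and U: "invariant U"
  shows "internal_direct_sum FG M A B \<longleftrightarrow> A \<subseteq> U \<and> B \<subseteq> U \<and> invariant A \<and> invariant B \<and>
    U = {a + b |a b. a \<in> A \<and> b \<in> B} \<and> A \<inter> B = {0}"
proof -
  have "A <+>\<^bsub>M\<^esub> B = {a + b |a b. a \<in> A \<and> b \<in> B}"
    using M unfolding set_add_def' represents_def by auto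
  moreover have "carrier M = U" "\<zero>\<^bsub>M\<^esub> = 0" using M by (simp_all add: represents_def)
  ultimately show ?thesis
    unfolding internal_direct_sum_def submodule_iff[OF M U] by metis
qed

text \<open>A free module has this property, as a fixed vector there has constant coordinates; it passes to
  direct summands because the projections commute with the norm.\<close>

lemma projective_fixed:
  assumes M: "represents M A" and A: "invariant A"
    and proj: "projective_module FG M" and v: "v \<in> A" "fixed v"
  shows "v \<in> nrm ` A"
proof -
  have [simp]: "carrier M = A" "x \<oplus>\<^bsub>M\<^esub> y = x + y" "\<zero>\<^bsub>M\<^esub> = 0" for x y
    using M by (auto simp: represents_def)
  have sm: "a \<odot>\<^bsub>M\<^esub> x = act a x" if "a \<in> carrier FG" "x \<in> A" for a x
    using M that by (auto simp: represents_def)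
  obtain n U V where ds: "internal_direct_sum FG (free_module FG n) U V"
    and iso: "module_isomorphic FG M ((free_module FG n)\<lparr>carrier := U\<rparr>)"
    using proj by (auto simp: projective_module_def)
  let ?F = "free_module FG n :: ('g \<Rightarrow> 'f, nat \<Rightarrow> 'g \<Rightarrow> 'f) module"
  interpret R: ring FG by (rule ring_FG)
  interpret F: abelian_group ?F by (rule abelian_group_free_module[OF ring_FG])
  obtain f where f: "bij_betw f A U" "\<And>a x. a \<in> carrier FG \<Longrightarrow> x \<in> A \<Longrightarrow> f (a \<odot>\<^bsub>M\<^esub> x) = a \<odot>\<^bsub>?F\<^esub> f x"
    using iso by (auto simp: module_isomorphic_def iso_def free_module_def)
  interpret U: submodule U FG ?F using ds by (simp add: internal_direct_sum_def)
  interpret V: submodule V FG ?F using ds by (simp add: internal_direct_sum_def)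
  define x where "x = f v"
  have xU: "x \<in> U" using f(1) v(1) by (auto simp: x_def bij_betw_def)
  then have xF: "x \<in> carrier ?F" using U.subset by auto
  have x_cl: "x i \<in> carrier FG" if "i < n" for i using xF that by (auto simp: free_module_def)
  have const: "x i h = x i \<one>" if i: "i < n" and h: "h \<in> carrier G" for i h
  proof -
    have "act (basis_elt h) v = v" using v(2) h by (simp add: act_basis fixed_def)
    then have "basis_elt h \<odot>\<^bsub>?F\<^esub> x = x"
      using f(2)[of "basis_elt h" v] v(1) sm[of "basis_elt h" v] FG_closed(1)[of h] h by (simp add: x_def)
    then have "(basis_elt h \<odot>\<^bsub>?F\<^esub> x) i = x i" by simp
    then have "x i \<otimes>\<^bsub>FG\<^esub> basis_elt h = x i" using i by (simp add: free_module_def)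
    then have "x i h = (\<Sum>k\<in>carrier G. x i k * basis_elt h (inv k \<otimes> h))"
      using group_algebra_mult_eq[OF group_axioms h, of "x i" "basis_elt h"] by simp
    also have "\<dots> = (\<Sum>k\<in>carrier G. if k = \<one> then x i \<one> else 0)"
    proof (rule sum.cong[OF refl])
      fix k assume k: "k \<in> carrier G"
      have "k = \<one>" if "inv k \<otimes> h = h"
      proof -
        have "inv k = (inv k \<otimes> h) \<otimes> inv h" using k h by (simp add: m_assoc)
        then have "inv k = \<one>" using that h by simp
        then show ?thesis using inv_inv[OF k] by simp
      qed
      then have "inv k \<otimes> h = h \<longleftrightarrow> k = \<one>" using h by auto
      then show "x i k * basis_elt h (inv k \<otimes> h) = (if k = \<one> then x i \<one> else 0)"
        by (simp add: basis_elt_def)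
    qed
    finally show ?thesis using fin_carrier by simp
  qed
  define y where "y = (\<lambda>i\<in>{..<n}. \<lambda>h. if h = \<one> then x i \<one> else 0)"
  have yF: "y \<in> carrier ?F" by (auto simp: y_def free_module_def FG_closed(3))
  have mult_out: "(a \<otimes>\<^bsub>FG\<^esub> b) h = 0" if "h \<notin> carrier G" for a b :: "'g \<Rightarrow> 'f" and h
    using that by (auto simp: group_algebra_def intro!: sum.neutral)
  have Ny: "norm_elt \<odot>\<^bsub>?F\<^esub> y = x"
  proof
    fix i
    show "(norm_elt \<odot>\<^bsub>?F\<^esub> y) i = x i"
    proof (cases "i < n")
      case i: True
      have "(y i \<otimes>\<^bsub>FG\<^esub> norm_elt) h = x i h" for h
      proof (cases "h \<in> carrier G")
        case h: True
        have "(y i \<otimes>\<^bsub>FG\<^esub> norm_elt) h = (\<Sum>k\<in>carrier G. y i k * norm_elt (inv k \<otimes> h))"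
          by (rule group_algebra_mult_eq[OF group_axioms h])
        also have "\<dots> = (\<Sum>k\<in>carrier G. if k = \<one> then x i \<one> else 0)"
          using i h by (intro sum.cong refl) (auto simp: y_def norm_elt_def)
        finally show ?thesis using fin_carrier const[OF i h] by simp
      next
        case False
        then show ?thesis using x_cl[OF i] mult_out by (auto simp: group_algebra_def)
      qed
      then have "y i \<otimes>\<^bsub>FG\<^esub> norm_elt = x i" by (rule ext)
      then show ?thesis using i by (simp add: free_module_def)
    next
      case False
      have "x \<in> {..<n} \<rightarrow>\<^sub>E carrier FG" using xF by (simp only: free_module_def partial_object.simps)
      then have "x i = undefined" using False PiE_arb by fastforce
      then show ?thesis using False by (simp add: free_module_def)
    qed
  qed
  obtain u w where uw: "u \<in> U" "w \<in> V" "y = u \<oplus>\<^bsub>?F\<^esub> w"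
  proof -
    have "y \<in> U <+>\<^bsub>?F\<^esub> V" using yF ds by (simp add: internal_direct_sum_def)
    then show thesis using that by (auto simp: set_add_def')
  qed
  have cl: "u \<in> carrier ?F" "w \<in> carrier ?F" using uw U.subset V.subset by auto
  have "norm_elt \<odot>\<^bsub>?F\<^esub> (u \<oplus>\<^bsub>?F\<^esub> w) = norm_elt \<odot>\<^bsub>?F\<^esub> u \<oplus>\<^bsub>?F\<^esub> norm_elt \<odot>\<^bsub>?F\<^esub> w"
    using cl FG_closed(2) by (auto simp: free_module_def R.l_distr PiE_iff intro!: restrict_ext)
  then have x_eq: "x = norm_elt \<odot>\<^bsub>?F\<^esub> u \<oplus>\<^bsub>?F\<^esub> norm_elt \<odot>\<^bsub>?F\<^esub> w"
    using Ny uw(3) by simp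
  have Nu: "norm_elt \<odot>\<^bsub>?F\<^esub> u \<in> U" and Nw: "norm_elt \<odot>\<^bsub>?F\<^esub> w \<in> V"
    using uw FG_closed(2) by auto
  have NuF: "norm_elt \<odot>\<^bsub>?F\<^esub> u \<in> carrier ?F" and NwF: "norm_elt \<odot>\<^bsub>?F\<^esub> w \<in> carrier ?F"
    using Nu Nw U.subset V.subset by auto
  have "norm_elt \<odot>\<^bsub>?F\<^esub> w = \<ominus>\<^bsub>?F\<^esub> (norm_elt \<odot>\<^bsub>?F\<^esub> u) \<oplus>\<^bsub>?F\<^esub> x"
    unfolding x_eq using NuF NwF by (simp add: F.r_neg1)
  also have "\<dots> \<in> U"
    using U.m_closed[OF U.m_inv_closed[OF Nu] xU] by (simp add: a_inv_def)
  finally have "norm_elt \<odot>\<^bsub>?F\<^esub> w \<in> U \<inter> V" using Nw by simp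
  then have "norm_elt \<odot>\<^bsub>?F\<^esub> w = \<zero>\<^bsub>?F\<^esub>" using ds by (auto simp: internal_direct_sum_def)
  then have xu: "x = norm_elt \<odot>\<^bsub>?F\<^esub> u" using x_eq NuF by simp
  obtain a where a: "a \<in> A" "u = f a" using uw(1) f(1) by (auto simp: bij_betw_def)
  have "f (nrm a) = f v"
    using f(2)[OF FG_closed(2) a(1)] sm[OF FG_closed(2) a(1)] xu by (simp add: x_def a(2) act_norm_elt)
  moreover have "nrm a \<in> A" using nrm_in[OF A a(1)] .
  ultimately have "nrm a = v" using f(1) v(1) by (auto simp: bij_betw_def inj_on_def)
  then show ?thesis using a(1) by blast
qed

text \<open>The coordinates identify the module with a free one: the coordinates of a translate are the
  translated coordinates, which is exactly the action on the free module.\<close>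

lemma projective_if_coordinates:
  assumes M: "represents M A" and A: "invariant A"
    and add: "\<And>i g x y. \<psi> i (x + y) g = \<psi> i x g + \<psi> i y g"
    and scale: "\<And>i g c x. \<psi> i (fun_scale c x) g = c * \<psi> i x g"
    and T: "\<And>i g h x. \<lbrakk>g \<in> carrier G; h \<in> carrier G\<rbrakk> \<Longrightarrow> \<psi> i (T h x) g = \<psi> i x (g \<otimes> inv h)"
    and uniq: "\<And>y :: nat \<Rightarrow> 'g \<Rightarrow> 'f. \<exists>!x. x \<in> A \<and> (\<forall>i<n. \<forall>g\<in>carrier G. \<psi> i x g = y i g)"
  shows "projective_module FG M"
proof -
  let ?F = "free_module FG n :: ('g \<Rightarrow> 'f, nat \<Rightarrow> 'g \<Rightarrow> 'f) module"
  interpret R: ring FG by (rule ring_FG)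
  interpret F: abelian_group ?F by (rule abelian_group_free_module[OF ring_FG])
  have M_simps: "carrier M = A" "x \<oplus>\<^bsub>M\<^esub> y = x + y" "\<zero>\<^bsub>M\<^esub> = 0" for x y
    using M by (auto simp: represents_def)
  have sm: "a \<odot>\<^bsub>M\<^esub> x = act a x" if "a \<in> carrier FG" "x \<in> A" for a x
    using M that by (auto simp: represents_def)
  have F_smult: "a \<odot>\<^bsub>?F\<^esub> x \<in> carrier ?F" if "a \<in> carrier FG" "x \<in> carrier ?F" for a x
    using that by (auto simp: free_module_def)
  have F_zero: "a \<odot>\<^bsub>?F\<^esub> \<zero>\<^bsub>?F\<^esub> = \<zero>\<^bsub>?F\<^esub>" if "a \<in> carrier FG" for a
    using that by (auto simp: free_module_def intro!: restrict_ext)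
  have "submodule (carrier ?F) FG ?F"
    unfolding submodule_def submodule_axioms_def
    using group.subgroup_self[OF F.a_group] F_smult by simp
  moreover have "submodule {\<zero>\<^bsub>?F\<^esub>} FG ?F"
    unfolding submodule_def submodule_axioms_def
    using group.triv_subgroup[OF F.a_group] F_zero by simp
  moreover have "carrier ?F <+>\<^bsub>?F\<^esub> {\<zero>\<^bsub>?F\<^esub>} = carrier ?F"
    by (auto simp: set_add_def')
  ultimately have ds: "internal_direct_sum FG ?F (carrier ?F) {\<zero>\<^bsub>?F\<^esub>}"
    by (auto simp: internal_direct_sum_def)
  define f where "f x = (\<lambda>i\<in>{..<n}. \<lambda>g. if g \<in> carrier G then \<psi> i x g else 0)" for x
  have f_cl: "f x \<in> carrier ?F" for x
    by (auto simp: f_def free_module_def group_algebra_def)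
  have f_add: "f (x + y) = f x \<oplus>\<^bsub>?F\<^esub> f y" for x y
    by (auto simp: f_def free_module_def group_algebra_def add fun_eq_iff)
  have f_inj: "inj_on f A"
  proof (rule inj_onI)
    fix x y assume xy: "x \<in> A" "y \<in> A" "f x = f y"
    have "\<psi> i x g = \<psi> i y g" if "i < n" "g \<in> carrier G" for i g
      using fun_cong[OF fun_cong[OF xy(3), of i], of g] that by (simp add: f_def)
    then show "x = y" using uniq[of "\<lambda>i g. \<psi> i y g"] xy(1,2) by blast
  qed
  have f_surj: "f ` A = carrier ?F"
  proof
    show "f ` A \<subseteq> carrier ?F" using f_cl by blast
    show "carrier ?F \<subseteq> f ` A"
    proof
      fix y assume y: "y \<in> carrier ?F"
      then have y': "y \<in> {..<n} \<rightarrow>\<^sub>E carrier FG" by (simp only: free_module_def partial_object.simps)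
      obtain x where x: "x \<in> A" "\<forall>i<n. \<forall>g\<in>carrier G. \<psi> i x g = y i g" using uniq[of y] by blast
      have "f x i = y i" for i
      proof (cases "i < n")
        case True
        then have "y i \<in> carrier FG" using y' by auto
        then have "y i g = 0" if "g \<notin> carrier G" for g using that by (simp add: group_algebra_def)
        then show ?thesis using True x(2) by (auto simp: f_def fun_eq_iff)
      next
        case False
        then have "y i = undefined" using y' PiE_arb by fastforce
        then show ?thesis using False by (simp add: f_def)
      qed
      then have "f x = y" by (rule ext)
      then show "y \<in> f ` A" using x(1) by blast
    qed
  qed
  have psi_act: "\<psi> i (act a x) g = (\<Sum>h\<in>carrier G. a h * \<psi> i x (g \<otimes> inv h))" if g: "g \<in> carrier G" for i a x g
  proof -
    have z: "\<psi> i 0 g = 0" using scale[of i 0 0 g] by simp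
    have "\<psi> i (act a x) g = (\<Sum>h\<in>carrier G. \<psi> i (fun_scale (a h) (T h x)) g)"
      unfolding act_def
      using sum_comp_morphism[of "\<lambda>x. \<psi> i x g" "\<lambda>h. fun_scale (a h) (T h x)" "carrier G"] z add
      by (simp only: o_def)
    also have "\<dots> = (\<Sum>h\<in>carrier G. a h * \<psi> i x (g \<otimes> inv h))"
      by (intro sum.cong refl) (simp only: scale T[OF g])
    finally show ?thesis .
  qed
  have f_smult: "f (a \<odot>\<^bsub>M\<^esub> x) = a \<odot>\<^bsub>?F\<^esub> f x" if a: "a \<in> carrier FG" and x: "x \<in> A" for a x
  proof -
    have "(f x i \<otimes>\<^bsub>FG\<^esub> a) g = (if g \<in> carrier G then \<psi> i (act a x) g else 0)" if i: "i < n" for i g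
    proof (cases "g \<in> carrier G")
      case g: True
      have "(f x i \<otimes>\<^bsub>FG\<^esub> a) g = (\<Sum>k\<in>carrier G. \<psi> i x k * a (inv k \<otimes> g))"
        using i by (simp add: group_algebra_mult_eq[OF group_axioms g] f_def)
      also have "\<dots> = (\<Sum>h\<in>carrier G. a h * \<psi> i x (g \<otimes> inv h))"
        by (rule sum.reindex_bij_witness[of _ "\<lambda>h. g \<otimes> inv h" "\<lambda>k. inv k \<otimes> g"])
          (use g in \<open>auto simp: inv_mult_group m_assoc[symmetric] mult.commute\<close>,
           auto simp: m_assoc)
      finally show ?thesis using g psi_act[OF g] by simp
    next
      case False
      then show ?thesis by (auto simp: group_algebra_def intro!: sum.neutral)
    qed
    then show ?thesis
      unfolding sm[OF a x] by (auto simp: f_def free_module_def fun_eq_iff)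
  qed
  have "f \<in> iso (add_monoid M) (add_monoid (?F\<lparr>carrier := carrier ?F\<rparr>))"
    using f_cl f_add f_inj f_surj by (auto simp: iso_def hom_def bij_betw_def M_simps)
  then have "module_isomorphic FG M (?F\<lparr>carrier := carrier ?F\<rparr>)"
    unfolding module_isomorphic_def using f_smult by (auto simp: M_simps)
  then show ?thesis
    unfolding projective_module_def using represents_right_module[OF M A] ds by blast
qed

lemma projective_splitting:
  assumes M: "represents M U" and U: "invariant U" "fin_dim U"
  obtains A B where "invariant A" "invariant B" "A \<subseteq> U" "B \<subseteq> U" "U = {a + b |a b. a \<in> A \<and> b \<in> B}" "A \<inter> B = {0}"
    "\<forall>x\<in>B. nrm x = 0" "fs.dim A = order G * fs.dim (nrm ` U)" "projective_module FG (M\<lparr>carrier := A\<rparr>)"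
proof (rule free_splitting[OF U])
  fix A B \<psi>
  assume s: "invariant A" "invariant B" "A \<subseteq> U" "B \<subseteq> U" "U = {a + b |a b. a \<in> A \<and> b \<in> B}" "A \<inter> B = {0}"
    "\<And>x. x \<in> B \<Longrightarrow> nrm x = 0" "fs.dim A = order G * fs.dim (nrm ` U)"
    "\<And>i g x y. \<psi> i (x + y) g = \<psi> i x g + \<psi> i y g"
    "\<And>i g c x. \<psi> i (fun_scale c x) g = c * \<psi> i x g"
    "\<And>i g h x. \<lbrakk>g \<in> carrier G; h \<in> carrier G\<rbrakk> \<Longrightarrow> \<psi> i (T h x) g = \<psi> i x (g \<otimes> inv h)"
    "\<And>y :: nat \<Rightarrow> 'g \<Rightarrow> 'f. \<exists>!x. x \<in> A \<and> (\<forall>i<fs.dim (nrm ` U). \<forall>g\<in>carrier G. \<psi> i x g = y i g)"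
  have "projective_module FG (M\<lparr>carrier := A\<rparr>)"
    by (rule projective_if_coordinates[OF represents_restrict[OF M s(3)] s(1) s(9-12)])
  then show thesis using that[of A B] s(1-8) by blast
qed

text \<open>A nonzero module of a \<open>p\<close>-group has a nonzero fixed vector, and in a projective module this is a norm.\<close>

lemma projective_killed_by_norm:
  assumes "represents M A" "invariant A" "projective_module FG M" "\<And>x. x \<in> A \<Longrightarrow> nrm x = 0"
  shows "A = {0}"
proof (rule ccontr)
  assume ne: "A \<noteq> {0}"
  have sub: "fs.subspace A" using assms(2) by (simp add: invariant_def)
  then obtain v where v: "v \<in> A" "v \<noteq> 0" using ne fs.subspace_0[OF sub] by blast
  have "\<exists>w\<in>A. w \<noteq> 0 \<and> fixed w"
    by (rule exists_fixed_vector[OF char_p prime_p order_G _ _ v])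
      (use assms(2) in \<open>auto simp: invariant_def fs.subspace_add\<close>)
  then obtain w where w: "w \<in> A" "w \<noteq> 0" "fixed w" by blast
  have "w \<in> nrm ` A" by (rule projective_fixed[OF assms(1-3) w(1,3)])
  then show False using assms(4) w(2) by auto
qed

text \<open>If some norm is nonzero, the free submodule of the splitting is a nonzero projective summand.
  Conversely a projective summand of a module killed by the norm is zero.\<close>

lemma projective_free_iff:
  assumes M: "represents M U" and U: "invariant U" "fin_dim U"
  shows "projective_free_module FG M \<longleftrightarrow> (\<forall>x\<in>U. nrm x = 0)"
proof
  assume pf: "projective_free_module FG M"
  from projective_splitting[OF M U]
  obtain A B where s: "invariant A" "invariant B" "A \<subseteq> U" "B \<subseteq> U" "U = {a + b |a b. a \<in> A \<and> b \<in> B}" "A \<inter> B = {0}"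
    "\<forall>x\<in>B. nrm x = 0" "fs.dim A = order G * fs.dim (nrm ` U)" "projective_module FG (M\<lparr>carrier := A\<rparr>)" .
  note s(9)
  moreover have "internal_direct_sum FG M A B"
    unfolding direct_sum_iff[OF M U(1)] using s(1-6) by blast
  ultimately have "A = {0}" using pf M by (auto simp: projective_free_module_def represents_def)
  then show "\<forall>x\<in>U. nrm x = 0" using s(5,7) by auto
next
  assume z: "\<forall>x\<in>U. nrm x = 0"
  show "projective_free_module FG M"
    unfolding projective_free_module_def
  proof (intro conjI allI impI)
    show "right_module FG M" by (rule represents_right_module[OF M U(1)])
    fix A B assume "internal_direct_sum FG M A B \<and> projective_module FG (M\<lparr>carrier := A\<rparr>)"
    then have A: "A \<subseteq> U" "invariant A" "projective_module FG (M\<lparr>carrier := A\<rparr>)"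
      using direct_sum_iff[OF M U(1)] by auto
    have "A = {0}"
      by (rule projective_killed_by_norm[OF represents_restrict[OF M A(1)] A(2,3)]) (use A(1) z in auto)
    then show "A = {\<zero>\<^bsub>M\<^esub>}" using M by (simp add: represents_def)
  qed
qed

theorem pr_pf_decomposition_exists:
  assumes M: "represents M U" and U: "invariant U" "fin_dim U"
  shows "\<exists>A B. pr_pf_decomposition FG M A B"
proof -
  from projective_splitting[OF M U]
  obtain A B where s: "invariant A" "invariant B" "A \<subseteq> U" "B \<subseteq> U" "U = {a + b |a b. a \<in> A \<and> b \<in> B}" "A \<inter> B = {0}"
    "\<forall>x\<in>B. nrm x = 0" "fs.dim A = order G * fs.dim (nrm ` U)" "projective_module FG (M\<lparr>carrier := A\<rparr>)" .
  note s(9)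
  moreover have "internal_direct_sum FG M A B"
    unfolding direct_sum_iff[OF M U(1)] using s(1-6) by blast
  moreover have "projective_free_module FG (M\<lparr>carrier := B\<rparr>)"
    using projective_free_iff[OF represents_restrict[OF M s(4)] s(2) fin_dim_mono[OF U(2) s(4)]] s(7) by blast
  ultimately show ?thesis by (auto simp: pr_pf_decomposition_def)
qed

text \<open>Every decomposition qualifies: the norm kills the projective-free part, so the norm image of the whole
  is that of the projective part. In the splitting of the latter a nonzero fixed vector of the summand
  killed by the norm would be a norm itself, hence lie in the free summand; so there is no such vector
  and the projective part is free.\<close>

theorem dim_projective_free_part:
  assumes M: "represents M U" and U: "invariant U" "fin_dim U"
    and dec: "pr_pf_decomposition FG M A B"
  shows "fs.dim B + order G * fs.dim (nrm ` U) = fs.dim U"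
proof -
  have d: "A \<subseteq> U" "B \<subseteq> U" "invariant A" "invariant B" "U = {a + b |a b. a \<in> A \<and> b \<in> B}" "A \<inter> B = {0}"
    "projective_module FG (M\<lparr>carrier := A\<rparr>)" "projective_free_module FG (M\<lparr>carrier := B\<rparr>)"
    using dec direct_sum_iff[OF M U(1)] by (auto simp: pr_pf_decomposition_def)
  have finA: "fin_dim A" and finB: "fin_dim B" using U(2) d(1,2) fin_dim_mono by blast+
  have B0: "nrm x = 0" if "x \<in> B" for x
    using projective_free_iff[OF represents_restrict[OF M d(2)] d(4) finB] d(8) that by blast
  have nadd: "nrm (a + b) = nrm a + nrm b" for a b
    using nrm_linear by (simp add: Vector_Spaces.linear_iff)
  have "nrm ` U = nrm ` A"
  proof
    show "nrm ` A \<subseteq> nrm ` U" using d(1) by blast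
    show "nrm ` U \<subseteq> nrm ` A"
    proof
      fix y assume "y \<in> nrm ` U"
      then obtain a b where "a \<in> A" "b \<in> B" "y = nrm (a + b)" using d(5) by auto
      then show "y \<in> nrm ` A" using nadd B0 by simp
    qed
  qed
  moreover have "fs.dim A = order G * fs.dim (nrm ` A)"
  proof -
    from projective_splitting[OF represents_restrict[OF M d(1)] d(3) finA]
    obtain A' B' where s: "invariant A'" "invariant B'" "A' \<subseteq> A" "B' \<subseteq> A" "A = {a + b |a b. a \<in> A' \<and> b \<in> B'}" "A' \<inter> B' = {0}"
      "\<forall>x\<in>B'. nrm x = 0" "fs.dim A' = order G * fs.dim (nrm ` A)"
      "projective_module FG (M\<lparr>carrier := A, carrier := A'\<rparr>)" .
    have "B' = {0}"
    proof (rule ccontr)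
      assume ne: "B' \<noteq> {0}"
      have sub: "fs.subspace B'" using s(2) by (simp add: invariant_def)
      then obtain v where v: "v \<in> B'" "v \<noteq> 0" using ne fs.subspace_0[OF sub] by blast
      have "\<exists>w\<in>B'. w \<noteq> 0 \<and> fixed w"
        by (rule exists_fixed_vector[OF char_p prime_p order_G _ _ v])
          (use s(2) in \<open>auto simp: invariant_def fs.subspace_add\<close>)
      then obtain w where w: "w \<in> B'" "w \<noteq> 0" "fixed w" by blast
      have "w \<in> nrm ` A"
        using projective_fixed[OF represents_restrict[OF M d(1)] d(3,7) _ w(3)] w(1) s(4) by blast
      then obtain a' b' where "a' \<in> A'" "b' \<in> B'" "w = nrm (a' + b')" using s(5) by auto
      then have "w \<in> A'" using nadd s(7) nrm_in[OF s(1)] by simp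
      then show False using w s(6) by blast
    qed
    then have "A = A'" using s(5) by auto
    then show ?thesis using s(8) by simp
  qed
  moreover have "fs.dim U = fs.dim A + fs.dim B"
    using dim_direct_sum[OF U(2) d(5) _ _ d(6)] d(3,4) by (simp add: invariant_def)
  ultimately show ?thesis by simp
qed

end

section \<open>Invariants in a permuted basis\<close>

definition independent_family :: "('c \<Rightarrow> 'x \<Rightarrow> 'f::field) \<Rightarrow> 'c set \<Rightarrow> bool" where
  "independent_family E \<Gamma> \<longleftrightarrow> (\<forall>u. (\<Sum>\<gamma>\<in>\<Gamma>. fun_scale (u \<gamma>) (E \<gamma>)) = 0 \<longrightarrow> (\<forall>\<gamma>\<in>\<Gamma>. u \<gamma> = 0))"

lemma independent_familyD:
  "\<lbrakk>independent_family E \<Gamma>; (\<Sum>\<gamma>\<in>\<Gamma>. fun_scale (u \<gamma>) (E \<gamma>)) = 0; \<gamma> \<in> \<Gamma>\<rbrakk> \<Longrightarrow> u \<gamma> = 0"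
  unfolding independent_family_def by blast

lemma family_independent:
  fixes E :: "'c \<Rightarrow> 'x \<Rightarrow> 'f::field"
  assumes fin: "finite \<Gamma>"
    and indE: "independent_family E \<Gamma>"
  shows "inj_on E \<Gamma>" "fs.independent (E ` \<Gamma>)"
proof -
  note ind = independent_familyD[OF indE]
  show inj: "inj_on E \<Gamma>"
  proof (rule inj_onI)
    fix j j' assume j: "j \<in> \<Gamma>" "j' \<in> \<Gamma>" "E j = E j'"
    show "j = j'"
    proof (rule ccontr)
      assume ne: "j \<noteq> j'"
      let ?a = "\<lambda>l. if l = j then 1 else if l = j' then - 1 else (0::'f)"
      have "(\<Sum>l\<in>\<Gamma>. fun_scale (?a l) (E l)) = (\<Sum>l\<in>\<Gamma>. (if l = j then E j else 0) - (if l = j' then E j' else 0))"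
        using ne by (intro sum.cong refl) auto
      also have "\<dots> = 0" using j fin by (simp add: sum_subtractf)
      finally have "?a j = 0" by (rule ind[OF _ j(1)])
      then show False by simp
    qed
  qed
  show "fs.independent (E ` \<Gamma>)"
  proof (rule fs.independent_if_scalars_zero)
    show "finite (E ` \<Gamma>)" using fin by simp
    fix f x assume 0: "(\<Sum>x\<in>E ` \<Gamma>. fun_scale (f x) x) = 0" and x: "x \<in> E ` \<Gamma>"
    have "(\<Sum>j\<in>\<Gamma>. fun_scale (f (E j)) (E j)) = 0"
      using 0 by (simp only: sum.reindex[OF inj] o_def)
    from ind[OF this] show "f x = 0" using x by auto
  qed
qed

text \<open>The orbit sums of the basis are a basis of the invariants, and Burnside's lemma counts the orbits. The
  factor \<open>order G\<close> stays on the left since it is zero in the field.\<close>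

lemma (in group_rep) dim_fixed_span:
  fixes E :: "'c \<Rightarrow> 'x \<Rightarrow> 'f"
  assumes fin: "finite \<Gamma>"
    and indE: "independent_family E \<Gamma>"
    and t: "\<And>g \<gamma>. \<lbrakk>g \<in> carrier G; \<gamma> \<in> \<Gamma>\<rbrakk> \<Longrightarrow> t g \<gamma> \<in> \<Gamma>"
    and Tt: "\<And>g \<gamma>. \<lbrakk>g \<in> carrier G; \<gamma> \<in> \<Gamma>\<rbrakk> \<Longrightarrow> T g (E \<gamma>) = E (t g \<gamma>)"
  shows "fs.dim {v \<in> fs.span (E ` \<Gamma>). fixed v} * order G = (\<Sum>g\<in>carrier G. card {\<gamma> \<in> \<Gamma>. t g \<gamma> = \<gamma>})"
proof -
  note ind = independent_familyD[OF indE]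
  have inj: "inj_on E \<Gamma>" and indep: "fs.independent (E ` \<Gamma>)"
    using family_independent[OF fin indE] by auto
  have t_one: "t \<one> \<gamma> = \<gamma>" if "\<gamma> \<in> \<Gamma>" for \<gamma>
    using Tt[OF one_closed that] inj_onD[OF inj _ t[OF one_closed that] that] by (simp add: T_one)
  have t_mult: "t (g \<otimes> h) \<gamma> = t h (t g \<gamma>)" if "g \<in> carrier G" "h \<in> carrier G" "\<gamma> \<in> \<Gamma>" for g h \<gamma>
  proof (rule inj_onD[OF inj])
    show "E (t (g \<otimes> h) \<gamma>) = E (t h (t g \<gamma>))"
      using that by (simp flip: Tt add: T_mult t)
  qed (use that t in auto)
  define \<phi> where "\<phi> = (\<lambda>g. restrict (t (inv g)) \<Gamma>)"
  have action: "group_action G \<Gamma> \<phi>"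
    unfolding \<phi>_def
    by (rule group_actionI) (auto simp: group_axioms t t_one t_mult inv_mult_group)
  interpret a: group_action G \<Gamma> \<phi> by (rule action)
  let ?O = "orbits G \<Gamma> \<phi>"
  define orb where "orb \<gamma> = orbit G \<phi> \<gamma>" for \<gamma>
  have O_eq: "?O = orb ` \<Gamma>" by (auto simp: orbits_def orb_def)
  have finO: "finite ?O" using fin by (simp add: O_eq)
  have orb_sub: "orb \<gamma> \<subseteq> \<Gamma>" if "\<gamma> \<in> \<Gamma>" for \<gamma>
    using that by (auto simp: orb_def orbit_def \<phi>_def t)
  have orb_self: "\<gamma> \<in> orb \<gamma>" if "\<gamma> \<in> \<Gamma>" for \<gamma>
    using a.orbit_refl[OF that] by (simp add: orb_def)
  have orb_eq: "orb \<gamma>' = orb \<gamma>" if "\<gamma> \<in> \<Gamma>" "\<gamma>' \<in> orb \<gamma>" for \<gamma> \<gamma>'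
  proof -
    have g': "\<gamma>' \<in> \<Gamma>" using that orb_sub by blast
    have "orb \<gamma> \<in> ?O" "orb \<gamma>' \<in> ?O" using that(1) g' by (auto simp: O_eq)
    then show ?thesis using a.disjoint_union[of "orb \<gamma>" "orb \<gamma>'"] that(2) orb_self[OF g'] by blast
  qed
  have t_orb: "t g \<gamma> \<in> orb \<gamma>" if "g \<in> carrier G" "\<gamma> \<in> \<Gamma>" for g \<gamma>
    using that by (auto simp: orb_def orbit_def \<phi>_def intro!: exI[of _ "inv g"])
  define s where "s Q = (\<Sum>\<gamma>\<in>Q. E \<gamma>)" for Q
  have s_sum: "(\<Sum>Q\<in>?O. fun_scale (c Q) (s Q)) = (\<Sum>\<gamma>\<in>\<Gamma>. fun_scale (c (orb \<gamma>)) (E \<gamma>))" for c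
  proof -
    have "(\<Sum>\<gamma>\<in>\<Gamma>. fun_scale (c (orb \<gamma>)) (E \<gamma>)) = (\<Sum>Q\<in>orb ` \<Gamma>. \<Sum>\<gamma>\<in>{\<gamma> \<in> \<Gamma>. orb \<gamma> = Q}. fun_scale (c (orb \<gamma>)) (E \<gamma>))"
      by (rule sum.image_gen[OF fin])
    also have "\<dots> = (\<Sum>Q\<in>?O. fun_scale (c Q) (s Q))"
      unfolding O_eq
    proof (rule sum.cong[OF refl])
      fix Q assume Q: "Q \<in> orb ` \<Gamma>"
      have "{\<gamma> \<in> \<Gamma>. orb \<gamma> = Q} = Q" using Q orb_eq orb_self orb_sub by blast
      then show "(\<Sum>\<gamma>\<in>{\<gamma> \<in> \<Gamma>. orb \<gamma> = Q}. fun_scale (c (orb \<gamma>)) (E \<gamma>)) = fun_scale (c Q) (s Q)"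
        unfolding s_def fs.scale_sum_right by (intro sum.cong) auto
    qed
    finally show ?thesis by simp
  qed
  have s_ind: "independent_family s ?O"
    unfolding independent_family_def
  proof (intro allI impI ballI)
    fix u Q assume u: "(\<Sum>Q\<in>?O. fun_scale (u Q) (s Q)) = 0" and "Q \<in> ?O"
    then obtain \<gamma> where "\<gamma> \<in> \<Gamma>" "Q = orb \<gamma>" using O_eq by blast
    then show "u Q = 0" using ind[of "\<lambda>\<gamma>. u (orb \<gamma>)" \<gamma>] u unfolding s_sum by blast
  qed
  let ?U = "{v \<in> fs.span (E ` \<Gamma>). fixed v}"
  have s_U: "s Q \<in> ?U" if QO: "Q \<in> ?O" for Q
  proof -
    obtain \<gamma> where g: "\<gamma> \<in> \<Gamma>" "Q = orb \<gamma>" using QO O_eq by blast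
    have "s Q \<in> fs.span (E ` \<Gamma>)"
      unfolding s_def using orb_sub g by (intro fs.span_sum fs.span_base) auto
    moreover have "T h (s Q) = s Q" if h: "h \<in> carrier G" for h
    proof -
      have tQ: "t h' \<delta> \<in> Q" if "\<delta> \<in> Q" "h' \<in> carrier G" for \<delta> h'
        using that g orb_sub t_orb orb_eq by (metis subsetD)
      have Qs: "\<delta> \<in> \<Gamma>" if "\<delta> \<in> Q" for \<delta> using that g orb_sub by blast
      have "T h (s Q) = (\<Sum>\<gamma>\<in>Q. E (t h \<gamma>))"
        unfolding s_def T_sum[OF h] by (intro sum.cong refl Tt[OF h] Qs)
      also have "\<dots> = (\<Sum>\<gamma>\<in>Q. E \<gamma>)"
        by (rule sum.reindex_bij_witness[of _ "\<lambda>\<gamma>. t (inv h) \<gamma>" "\<lambda>\<gamma>. t h \<gamma>"])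
          (use h Qs tQ in \<open>auto simp: t_mult[symmetric] t_one\<close>)
      finally show ?thesis by (simp add: s_def)
    qed
    ultimately show ?thesis by (simp add: fixed_def)
  qed
  have U_span: "?U \<subseteq> fs.span (s ` ?O)"
  proof
    fix v assume v: "v \<in> ?U"
    then obtain u' where "v = (\<Sum>x\<in>E ` \<Gamma>. fun_scale (u' x) x)"
      using fin by (auto simp: fs.span_finite)
    then obtain u where u: "v = (\<Sum>\<gamma>\<in>\<Gamma>. fun_scale (u \<gamma>) (E \<gamma>))"
      by (simp only: sum.reindex[OF inj] o_def)
    have u_t: "u (t h \<gamma>) = u \<gamma>" if h: "h \<in> carrier G" and g: "\<gamma> \<in> \<Gamma>" for h \<gamma>
    proof -
      have "v = T (inv h) v" using v h by (auto simp: fixed_def)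
      also have "\<dots> = (\<Sum>\<gamma>\<in>\<Gamma>. fun_scale (u \<gamma>) (E (t (inv h) \<gamma>)))"
        unfolding u using h by (simp add: T_sum T_scale Tt)
      also have "\<dots> = (\<Sum>\<gamma>\<in>\<Gamma>. fun_scale (u (t h \<gamma>)) (E \<gamma>))"
        by (rule sum.reindex_bij_witness[of _ "\<lambda>\<gamma>. t h \<gamma>" "\<lambda>\<gamma>. t (inv h) \<gamma>"])
          (use h t in \<open>auto simp: t_mult[symmetric] t_one\<close>)
      finally have "(\<Sum>\<gamma>\<in>\<Gamma>. fun_scale (u \<gamma>) (E \<gamma>)) - (\<Sum>\<gamma>\<in>\<Gamma>. fun_scale (u (t h \<gamma>)) (E \<gamma>)) = 0"
        using u by simp
      then have "(\<Sum>\<gamma>\<in>\<Gamma>. fun_scale (u \<gamma> - u (t h \<gamma>)) (E \<gamma>)) = 0"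
        by (simp only: fs.scale_left_diff_distrib sum_subtractf)
      from ind[OF this g] show ?thesis by simp
    qed
    define c where "c Q = u (SOME \<gamma>. \<gamma> \<in> Q)" for Q
    have "c (orb \<gamma>) = u \<gamma>" if g: "\<gamma> \<in> \<Gamma>" for \<gamma>
    proof -
      have "(SOME \<delta>. \<delta> \<in> orb \<gamma>) \<in> orb \<gamma>" using orb_self[OF g] by (rule someI)
      then obtain h where h: "h \<in> carrier G" "(SOME \<delta>. \<delta> \<in> orb \<gamma>) = t (inv h) \<gamma>"
        using g by (auto simp: orb_def orbit_def \<phi>_def)
      then show ?thesis using u_t[of "inv h" \<gamma>] g by (simp add: c_def)
    qed
    then have "v = (\<Sum>\<gamma>\<in>\<Gamma>. fun_scale (c (orb \<gamma>)) (E \<gamma>))" unfolding u by (intro sum.cong) auto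
    also have "\<dots> \<in> fs.span (s ` ?O)"
      unfolding s_sum[symmetric] by (intro fs.span_sum fs.span_scale fs.span_base imageI)
    finally show "v \<in> fs.span (s ` ?O)" .
  qed
  have "s ` ?O \<subseteq> ?U" using s_U by (rule image_subsetI)
  then have "fs.dim ?U = card (s ` ?O)"
    using fs.basis_card_eq_dim[OF _ U_span family_independent(2)[OF finO s_ind]] by simp
  also have "\<dots> = card ?O" by (rule card_image[OF family_independent(1)[OF finO s_ind]])
  finally have "fs.dim ?U * order G = (\<Sum>g\<in>carrier G. card (invariants \<Gamma> \<phi> g))"
    using a.burnside[OF fin_carrier fin] by simp
  also have "\<dots> = (\<Sum>g\<in>carrier G. card {\<gamma> \<in> \<Gamma>. t (inv g) \<gamma> = \<gamma>})"
    by (intro sum.cong refl arg_cong[of _ _ card]) (auto simp: invariants_def \<phi>_def)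
  also have "\<dots> = (\<Sum>g\<in>carrier G. card {\<gamma> \<in> \<Gamma>. t g \<gamma> = \<gamma>})"
    by (rule sum.reindex_bij_witness[of _ "\<lambda>g. inv g" "\<lambda>g. inv g"])
      auto
  finally show ?thesis .
qed

section \<open>Left-normed brackets\<close>

text \<open>\<open>bracket v f\<close> is the value of the linear functional with coefficients \<open>f\<close> at an iterated commutator: for
  \<open>v = [b\<^sub>r, \<dots>, b\<^sub>1]\<close> it is the bracket \<open>[[b\<^sub>1, b\<^sub>2], \<dots>, b\<^sub>r]\<close>, expanded from its last letter \<open>b\<^sub>r\<close>
  inwards.\<close>

fun bracket :: "'a list \<Rightarrow> ('a list \<Rightarrow> 'f::field) \<Rightarrow> 'f" where
  "bracket [] f = f []"
| "bracket [x] f = f [x]"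
| "bracket (b # c # v) f = bracket (c # v) (\<lambda>w. f (w @ [b]) - f (b # w))"

lemma bracket_Cons: "v \<noteq> [] \<Longrightarrow> bracket (b # v) f = bracket v (\<lambda>w. f (w @ [b]) - f (b # w))"
  by (cases v) auto

lemma bracket_cong:
  "(\<And>w. mset w = mset v \<Longrightarrow> f w = g w) \<Longrightarrow> bracket v f = bracket v g"
proof (induction v f arbitrary: g rule: bracket.induct)
  case (3 b c v f)
  have "bracket (c # v) (\<lambda>w. f (w @ [b]) - f (b # w)) = bracket (c # v) (\<lambda>w. g (w @ [b]) - g (b # w))"
    by (rule "3.IH") (use "3.prems" in simp)
  then show ?case by simp
qed auto

lemma bracket_add: "bracket v (\<lambda>w. f w + g w) = bracket v f + bracket v g"
proof (induction v f arbitrary: g rule: bracket.induct)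
  case (3 b c v f)
  show ?case using "3.IH"[of "\<lambda>w. g (w @ [b]) - g (b # w)"] by (simp add: algebra_simps)
qed auto

lemma bracket_scale: "bracket v (\<lambda>w. k * f w) = k * bracket v f"
proof (induction v f rule: bracket.induct)
  case (3 b c v f)
  then show ?case by (simp add: right_diff_distrib)
qed auto

lemma bracket_zero: "bracket v (\<lambda>w. 0) = 0"
  using bracket_scale[of v 0 "\<lambda>w. 0"] by simp

lemma bracket_diff: "bracket v (\<lambda>w. f w - g w) = bracket v f - bracket v g"
  using bracket_add[of v f "\<lambda>w. - 1 * g w"] by (simp only: bracket_scale) simp

lemma bracket_sum: "bracket v (\<lambda>w. \<Sum>i\<in>I. k i * f i w) = (\<Sum>i\<in>I. k i * bracket v (f i))"
  by (induction I rule: infinite_finite_induct) (simp_all add: bracket_zero bracket_add bracket_scale)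

text \<open>Lie elements are orthogonal to proper shuffles (Ree). If the outermost letter satisfies \<open>P\<close>, then
  bracketing with it affects the factor \<open>f\<close> alone, so the product form is preserved and induction
  applies; when no further letter satisfies \<open>P\<close>, the two terms of the commutator cancel.\<close>

lemma bracket_shuffle:
  assumes "\<exists>x\<in>set v. P x" "\<exists>x\<in>set v. \<not> P x"
  shows "bracket v (\<lambda>w. f (filter P w) * g (filter (\<lambda>x. \<not> P x) w)) = 0"
  using assms
proof (induction v "\<lambda>w. f (filter P w) * g (filter (\<lambda>x. \<not> P x) w)" arbitrary: f g rule: bracket.induct)
  case (3 b c v)
  let ?v = "c # v"
  have eq: "bracket (b # ?v) (\<lambda>w. f (filter P w) * g (filter (\<lambda>x. \<not> P x) w)) =
     bracket ?v (\<lambda>w. f (filter P (w @ [b])) * g (filter (\<lambda>x. \<not> P x) (w @ [b])) -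
               f (filter P (b # w)) * g (filter (\<lambda>x. \<not> P x) (b # w)))" by simp
  show ?case
  proof (cases "P b")
    case True
    let ?f = "\<lambda>u. f (u @ [b]) - f (b # u)"
    have eq': "bracket (b # ?v) (\<lambda>w. f (filter P w) * g (filter (\<lambda>x. \<not> P x) w)) =
       bracket ?v (\<lambda>w. ?f (filter P w) * g (filter (\<lambda>x. \<not> P x) w))"
      unfolding eq using True by (simp add: left_diff_distrib)
    have mixed: "\<exists>x\<in>set ?v. \<not> P x" using "3.prems" True by auto
    show ?thesis
    proof (cases "\<exists>x\<in>set ?v. P x")
      case ex: True
      show ?thesis unfolding eq'
        by (rule "3.hyps"[of ?f g]) (use True ex mixed in \<open>auto simp: left_diff_distrib\<close>)
    next
      case False
      have "bracket ?v (\<lambda>w. ?f (filter P w) * g (filter (\<lambda>x. \<not> P x) w)) = bracket ?v (\<lambda>w. 0)"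
      proof (rule bracket_cong)
        fix w assume "mset w = mset ?v"
        then have "set w = set ?v" by (rule mset_eq_setD)
        then have "filter P w = []" using False by (auto simp: filter_empty_conv)
        then show "?f (filter P w) * g (filter (\<lambda>x. \<not> P x) w) = 0" by simp
      qed
      then show ?thesis unfolding eq' by (simp add: bracket_zero)
    qed
  next
    case False
    let ?g = "\<lambda>u. g (u @ [b]) - g (b # u)"
    have eq': "bracket (b # ?v) (\<lambda>w. f (filter P w) * g (filter (\<lambda>x. \<not> P x) w)) =
       bracket ?v (\<lambda>w. f (filter P w) * ?g (filter (\<lambda>x. \<not> P x) w))"
      unfolding eq using False by (simp add: right_diff_distrib)
    have mixed: "\<exists>x\<in>set ?v. P x" using "3.prems" False by auto
    show ?thesis
    proof (cases "\<exists>x\<in>set ?v. \<not> P x")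
      case ex: True
      show ?thesis unfolding eq'
        by (rule "3.hyps"[of f ?g]) (use False ex mixed in \<open>auto simp: right_diff_distrib\<close>)
    next
      case all: False
      have "bracket ?v (\<lambda>w. f (filter P w) * ?g (filter (\<lambda>x. \<not> P x) w)) = bracket ?v (\<lambda>w. 0)"
      proof (rule bracket_cong)
        fix w assume "mset w = mset ?v"
        then have "set w = set ?v" by (rule mset_eq_setD)
        then have "filter (\<lambda>x. \<not> P x) w = []" using all by (auto simp: filter_empty_conv)
        then show "f (filter P w) * ?g (filter (\<lambda>x. \<not> P x) w) = 0" by simp
      qed
      then show ?thesis unfolding eq' by (simp add: bracket_zero)
    qed
  qed
qed auto

text \<open>The bracket \<open>[[x, b\<^sub>2], \<dots>, b\<^sub>r]\<close> contains exactly one word that starts with \<open>x\<close>, namely \<open>x b\<^sub>2 \<dots> b\<^sub>r\<close>.\<close>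

lemma bracket_head:
  assumes "distinct (x # v)" "\<And>w. mset w = mset (x # v) \<Longrightarrow> hd w \<noteq> x \<Longrightarrow> f w = 0"
  shows "bracket (rev (x # v)) f = f (x # v)"
  using assms
proof (induction v arbitrary: f rule: rev_induct)
  case (snoc b v)
  have "bracket (rev (x # v @ [b])) f = bracket (rev (x # v)) (\<lambda>w. f (w @ [b]) - f (b # w))"
    by (simp add: bracket_Cons)
  also have "\<dots> = bracket (rev (x # v)) (\<lambda>w. f (w @ [b]))"
    using snoc.prems by (intro bracket_cong) auto
  also have "\<dots> = f ((x # v) @ [b])"
  proof (rule snoc.IH)
    fix w assume w: "mset w = mset (x # v)" "hd w \<noteq> x"
    then have "w \<noteq> []" by auto
    then show "f (w @ [b]) = 0" using snoc.prems(2)[of "w @ [b]"] w by simp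
  qed (use snoc.prems in auto)
  finally show ?case by simp
qed simp

section \<open>Permutations as words\<close>

definition word :: "nat \<Rightarrow> (nat \<Rightarrow> nat) \<Rightarrow> nat list" where
  "word n \<sigma> = map \<sigma> [1..<Suc n]"

definition perm_of :: "nat list \<Rightarrow> nat \<Rightarrow> nat" where
  "perm_of w i = (if 1 \<le> i \<and> i \<le> length w then w ! (i - 1) else i)"

definition words :: "nat \<Rightarrow> nat list set" where
  "words n = {w. distinct w \<and> set w = {1..n}}"

lemma length_word [simp]: "length (word n \<sigma>) = n"
  by (simp add: word_def)

lemma words_length: "w \<in> words n \<Longrightarrow> length w = n"
  using distinct_card[of w] by (simp add: words_def)

lemma nth_word: "i < n \<Longrightarrow> word n \<sigma> ! i = \<sigma> (Suc i)"
  by (simp add: word_def del: upt_Suc)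

lemma word_perm_of: "length w = n \<Longrightarrow> word n (perm_of w) = w"
  by (rule nth_equalityI) (auto simp: nth_word perm_of_def)

lemma perm_of_word: "\<sigma> permutes {1..n} \<Longrightarrow> perm_of (word n \<sigma>) = \<sigma>"
proof
  fix i assume s: "\<sigma> permutes {1..n}"
  show "perm_of (word n \<sigma>) i = \<sigma> i"
    using permutes_not_in[OF s, of i] nth_word[of "i - 1" n \<sigma>] by (auto simp: perm_of_def)
qed

lemma word_in_words: "\<sigma> permutes {1..n} \<Longrightarrow> word n \<sigma> \<in> words n"
proof -
  assume s: "\<sigma> permutes {1..n}"
  have "set [1..<Suc n] = {1..n}" by auto
  then have "set (word n \<sigma>) = {1..n}" by (simp only: word_def set_map permutes_image[OF s])
  moreover have "distinct (word n \<sigma>)"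
    by (simp only: word_def distinct_map permutes_inj_on[OF s]) simp
  ultimately show ?thesis by (simp add: words_def)
qed

lemma perm_of_permutes: "w \<in> words n \<Longrightarrow> perm_of w permutes {1..n}"
proof -
  assume w: "w \<in> words n"
  then have len: "length w = n" by (rule words_length)
  have "bij_betw (perm_of w) {1..n} {1..n}"
  proof (rule bij_betwI')
    fix x y assume "x \<in> {1..n}" "y \<in> {1..n}"
    then show "perm_of w x = perm_of w y \<longleftrightarrow> x = y"
      using w len by (auto simp: perm_of_def words_def nth_eq_iff_index_eq)
  next
    fix x assume "x \<in> {1..n}"
    then show "perm_of w x \<in> {1..n}"
      using w len nth_mem[of "x - 1" w] by (auto simp: perm_of_def words_def)
  next
    fix y assume "y \<in> {1..n}"
    then obtain i where "i < n" "w ! i = y" using w len by (metis (mono_tags, lifting) in_set_conv_nth mem_Collect_eq words_def)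
    then show "\<exists>x\<in>{1..n}. y = perm_of w x"
      using len by (intro bexI[of _ "Suc i"]) (auto simp: perm_of_def)
  qed
  moreover have "perm_of w x = x" if "x \<notin> {1..n}" for x using that len by (auto simp: perm_of_def)
  ultimately show ?thesis by (rule bij_imp_permutes)
qed

section \<open>The Dynkin element acts by brackets\<close>

lemma cyc_permutes: "cyc j permutes {1..j}"
proof -
  have "cyc j permutes set [1..<Suc j]"
    unfolding cyc_def by (rule cycle_permutes)
  moreover have "set [1..<Suc j] = {1..j}" by auto
  ultimately show ?thesis by simp
qed

text \<open>Composition with the inverse of a cycle moves one letter of the word to the front. This is how the
  factors \<open>1 - c\<^sub>j\<close> of the Dynkin element turn into commutators.\<close>

lemma cyc_word:
  assumes "length u = m"
  shows "perm_of (u @ b # r) \<circ> inv_into UNIV (cyc (Suc m)) = perm_of (b # u @ r)"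
proof -
  have "perm_of (u @ b # r) = perm_of (b # u @ r) \<circ> cyc (Suc m)"
  proof
    fix i
    show "perm_of (u @ b # r) i = (perm_of (b # u @ r) \<circ> cyc (Suc m)) i"
    proof (cases "i \<in> {1..Suc m}")
      case True
      then show ?thesis
        using assms cyc_apply[of i "Suc m"] by (auto simp: perm_of_def nth_append nth_Cons')
    next
      case False
      then have "cyc (Suc m) i = i" by (rule permutes_not_in[OF cyc_permutes])
      then show ?thesis using False assms by (auto simp: perm_of_def nth_append nth_Cons')
    qed
  qed
  then show ?thesis
    using permutes_inv_o(1)[OF cyc_permutes[of "Suc m"]] by (simp add: comp_assoc)
qed

abbreviation SA :: "nat \<Rightarrow> ((nat \<Rightarrow> nat) \<Rightarrow> 'f::field) ring" where
  "SA n \<equiv> group_algebra (Sym n)"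

lemma ring_SA: "ring (SA n)"
  by (rule ring_group_algebra[OF group_Sym finite_carrier_Sym])

lemma inv_Sym: "\<sigma> permutes {1..n} \<Longrightarrow> inv\<^bsub>Sym n\<^esub> \<sigma> = inv_into UNIV \<sigma>"
proof -
  assume s: "\<sigma> permutes {1..n}"
  interpret group "Sym n" by (rule group_Sym)
  show ?thesis
    by (rule inv_equality) (use s in \<open>auto simp: Sym_def permutes_inv permutes_inv_o\<close>)
qed

lemma cyc_in_Sym: "j \<le> n \<Longrightarrow> cyc j \<in> carrier (Sym n)"
  using permutes_subset[OF cyc_permutes, of j "{1..n}"] by (auto simp: Sym_def)

definition dynkin_factor :: "nat \<Rightarrow> nat \<Rightarrow> (nat \<Rightarrow> nat) \<Rightarrow> 'f::field" where
  "dynkin_factor n j = \<one>\<^bsub>SA n\<^esub> \<ominus>\<^bsub>SA n\<^esub> basis_elt (cyc j)"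

lemma basis_elt_closed: "h \<in> carrier (Sym n) \<Longrightarrow> basis_elt h \<in> carrier (SA n)"
  by (auto simp: group_algebra_def basis_elt_def)

lemma dynkin_factor_closed:
  assumes "j \<le> n"
  shows "(dynkin_factor n j :: (nat \<Rightarrow> nat) \<Rightarrow> 'f::field) \<in> carrier (SA n)"
proof -
  interpret ring "SA n :: ((nat \<Rightarrow> nat) \<Rightarrow> 'f) ring" by (rule ring_SA)
  show ?thesis
    unfolding dynkin_factor_def by (intro minus_closed one_closed basis_elt_closed cyc_in_Sym assms)
qed

lemma basis_mult_left:
  assumes h: "h \<in> carrier (Sym n)" and g: "g \<in> carrier (Sym n)"
  shows "(basis_elt h \<otimes>\<^bsub>SA n\<^esub> a) g = a (g \<circ> inv_into UNIV h)"
proof -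
  have inv: "inv\<^bsub>Sym n\<^esub> h = inv_into UNIV h"
    by (rule inv_Sym) (use h in \<open>simp add: Sym_def\<close>)
  have mult: "x \<otimes>\<^bsub>Sym n\<^esub> y = y \<circ> x" for x y by (simp add: Sym_def)
  have "(basis_elt h \<otimes>\<^bsub>SA n\<^esub> a) g = (\<Sum>k\<in>carrier (Sym n). basis_elt h k * a (inv\<^bsub>Sym n\<^esub> k \<otimes>\<^bsub>Sym n\<^esub> g))"
    by (rule group_algebra_mult_eq[OF group_Sym g])
  also have "\<dots> = (\<Sum>k\<in>carrier (Sym n). if k = h then a (g \<circ> inv_into UNIV h) else 0)"
    by (intro sum.cong refl) (auto simp: basis_elt_def inv mult)
  finally show ?thesis using h finite_carrier_Sym by simp
qed

lemma dynkin_factor_mult: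
  fixes a :: "(nat \<Rightarrow> nat) \<Rightarrow> 'f::field"
  assumes "j \<le> n" "a \<in> carrier (SA n)" "g \<in> carrier (Sym n)"
  shows "(dynkin_factor n j \<otimes>\<^bsub>SA n\<^esub> a) g = a g - a (g \<circ> inv_into UNIV (cyc j))"
proof -
  interpret ring "SA n :: ((nat \<Rightarrow> nat) \<Rightarrow> 'f) ring" by (rule ring_SA)
  let ?b = "basis_elt (cyc j) :: (nat \<Rightarrow> nat) \<Rightarrow> 'f"
  have b: "?b \<in> carrier (SA n)" using basis_elt_closed[OF cyc_in_Sym] assms(1) by blast
  have ba: "?b \<otimes>\<^bsub>SA n\<^esub> a \<in> carrier (SA n)" using b assms(2) by simp
  have "dynkin_factor n j \<otimes>\<^bsub>SA n\<^esub> a = a \<ominus>\<^bsub>SA n\<^esub> ?b \<otimes>\<^bsub>SA n\<^esub> a"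
    unfolding dynkin_factor_def using b assms(2) by (simp add: minus_eq l_distr l_minus)
  moreover have "(a \<ominus>\<^bsub>SA n\<^esub> ?b \<otimes>\<^bsub>SA n\<^esub> a) \<oplus>\<^bsub>SA n\<^esub> ?b \<otimes>\<^bsub>SA n\<^esub> a = a"
    using ba assms(2) by (simp add: minus_eq a_assoc l_neg)
  ultimately have "(dynkin_factor n j \<otimes>\<^bsub>SA n\<^esub> a) g + (?b \<otimes>\<^bsub>SA n\<^esub> a) g = a g"
    by (metis (no_types, lifting) group_algebra_def ring.simps(2) ring_record_simps(12))
  then show ?thesis
    using basis_mult_left[OF cyc_in_Sym[OF assms(1)] assms(3), of a] by (simp add: eq_diff_eq)
qed

text \<open>Each factor \<open>1 - c\<^sub>j\<close> contributes one commutator.\<close>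

lemma omega_mult:
  fixes a :: "(nat \<Rightarrow> nat) \<Rightarrow> 'f::field"
  assumes n: "n \<ge> 1" and a: "a \<in> carrier (SA n)" and s: "\<sigma> permutes {1..n}"
  shows "(omega n \<otimes>\<^bsub>SA n\<^esub> a) \<sigma> = bracket (rev (word n \<sigma>)) (\<lambda>u. a (perm_of u))"
proof -
  interpret R: ring "SA n :: ((nat \<Rightarrow> nat) \<Rightarrow> 'f) ring" by (rule ring_SA)
  let ?m = "monoid.mult (SA n) :: ((nat \<Rightarrow> nat) \<Rightarrow> 'f) \<Rightarrow> _"
  have fold_closed: "foldr ?m (map (dynkin_factor n) js) a \<in> carrier (SA n)"
    if "a \<in> carrier (SA n)" "\<forall>j\<in>set js. j \<le> n" for js and a :: "(nat \<Rightarrow> nat) \<Rightarrow> 'f"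
    using that by (induction js) (auto intro: dynkin_factor_closed)
  have fold_mult: "foldr ?m (map (dynkin_factor n) js) \<one>\<^bsub>SA n\<^esub> \<otimes>\<^bsub>SA n\<^esub> a = foldr ?m (map (dynkin_factor n) js) a"
    if "\<forall>j\<in>set js. j \<le> n" for js
    using that by (induction js) (auto simp: R.m_assoc a dynkin_factor_closed fold_closed)
  have step: "foldr ?m (map (dynkin_factor n) [2..<Suc m]) a (perm_of (v @ r)) = bracket (rev v) (\<lambda>u. a (perm_of (u @ r)))"
    if "1 \<le> m" "m \<le> n" "length v = m" "v @ r \<in> words n" "a \<in> carrier (SA n)"
    for m v r and a :: "(nat \<Rightarrow> nat) \<Rightarrow> 'f"
    using that
  proof (induction m arbitrary: v r a rule: nat_induct_at_least)
    case base
    then obtain x where "v = [x]" by (cases v) auto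
    then show ?case by simp
  next
    case (Suc m)
    obtain v' b where v: "v = v' @ [b]" using Suc.prems(2) by (cases v rule: rev_cases) auto
    have len: "length v' = m" using Suc.prems(2) v by simp
    then have ne: "v' \<noteq> []" using Suc.hyps by auto
    let ?a = "dynkin_factor n (Suc m) \<otimes>\<^bsub>SA n\<^esub> a"
    have a': "?a \<in> carrier (SA n)" using dynkin_factor_closed[OF Suc.prems(1)] Suc.prems(4) by blast
    have w: "v' @ b # r \<in> words n" using Suc.prems(3) v by simp
    have "foldr ?m (map (dynkin_factor n) [2..<Suc (Suc m)]) a (perm_of (v @ r))
        = foldr ?m (map (dynkin_factor n) [2..<Suc m]) ?a (perm_of (v' @ b # r))"
      using Suc.hyps v by simp
    also have "\<dots> = bracket (rev v') (\<lambda>u. ?a (perm_of (u @ b # r)))"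
      by (rule Suc.IH) (use Suc.prems len w a' in auto)
    also have "\<dots> = bracket (rev v') (\<lambda>u. a (perm_of (u @ b # r)) - a (perm_of (b # u @ r)))"
    proof (rule bracket_cong)
      fix u assume u: "mset u = mset (rev v')"
      then have lu: "length u = m" using len by (metis length_rev size_mset)
      have "mset (u @ b # r) = mset (v' @ b # r)" using u by simp
      then have "u @ b # r \<in> words n" using w unfolding words_def
        by (metis (mono_tags, lifting) mem_Collect_eq mset_eq_imp_distinct_iff mset_eq_setD)
      then have "perm_of (u @ b # r) \<in> carrier (Sym n)" using perm_of_permutes by (simp add: Sym_def)
      from dynkin_factor_mult[OF Suc.prems(1) Suc.prems(4) this]
      show "?a (perm_of (u @ b # r)) = a (perm_of (u @ b # r)) - a (perm_of (b # u @ r))"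
        by (simp add: cyc_word[OF lu])
    qed
    also have "\<dots> = bracket (rev v) (\<lambda>u. a (perm_of (u @ r)))"
      using ne by (simp add: v bracket_Cons)
    finally show ?case .
  qed
  have "omega n \<otimes>\<^bsub>SA n\<^esub> a = foldr ?m (map (dynkin_factor n) [2..<Suc n]) a"
    unfolding omega_def Let_def dynkin_factor_def[symmetric]
    by (rule fold_mult) auto
  moreover have "foldr ?m (map (dynkin_factor n) [2..<Suc n]) a (perm_of (word n \<sigma> @ [])) = bracket (rev (word n \<sigma>)) (\<lambda>u. a (perm_of (u @ [])))"
    by (rule step) (use n a word_in_words[OF s] in auto)
  ultimately show ?thesis by (simp add: perm_of_word[OF s])
qed

section \<open>Words with prescribed subwords\<close>

text \<open>For a word \<open>w\<close> without repeated letters this says that \<open>c\<close> is a subword of \<open>w\<close>, not necessarily a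
  contiguous one.\<close>

definition sub :: "nat list \<Rightarrow> nat list \<Rightarrow> bool" where
  "sub c w \<longleftrightarrow> filter (\<lambda>x. x \<in> set c) w = c"

text \<open>The sum of the words with property \<open>Q\<close>, as an element of the group algebra.\<close>

definition word_ind :: "nat \<Rightarrow> (nat list \<Rightarrow> bool) \<Rightarrow> (nat \<Rightarrow> nat) \<Rightarrow> 'f::field" where
  "word_ind n Q \<sigma> = (if \<sigma> permutes {1..n} \<and> Q (word n \<sigma>) then 1 else 0)"

lemma sum_fun_apply: "(\<Sum>i\<in>I. f i) x = (\<Sum>i\<in>I. f i x)"
  by (induction I rule: infinite_finite_induct) simp_all

lemma sub_shuffles:
  assumes "set u \<inter> set y = {}"
  shows "sub u w \<and> sub y w \<longleftrightarrow> (\<exists>t\<in>shuffles u y. sub t w)"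
proof
  assume uy: "sub u w \<and> sub y w"
  define t where "t = filter (\<lambda>x. x \<in> set u \<union> set y) w"
  have "filter (\<lambda>x. x \<in> set u) t = filter (\<lambda>x. x \<in> set u) w"
    by (simp add: t_def) (metis (mono_tags, lifting) filter_cong)
  then have 1: "filter (\<lambda>x. x \<in> set u) t = u" using uy by (simp add: sub_def)
  have "filter (\<lambda>x. x \<notin> set u) t = filter (\<lambda>x. x \<in> set y) w"
    unfolding t_def filter_filter using assms by (intro filter_cong) auto
  then have 2: "filter (\<lambda>x. x \<notin> set u) t = y" using uy by (simp add: sub_def)
  have "t \<in> shuffles u y" using partition_in_shuffles[of t "\<lambda>x. x \<in> set u"] 1 2 by simp
  moreover from this have "set t = set u \<union> set y" by (rule set_shuffles)
  then have "sub t w" by (simp add: sub_def t_def)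
  ultimately show "\<exists>t\<in>shuffles u y. sub t w" by blast
next
  assume "\<exists>t\<in>shuffles u y. sub t w"
  then obtain t where t: "t \<in> shuffles u y" "filter (\<lambda>x. x \<in> set t) w = t" by (auto simp: sub_def)
  have start: "set t = set u \<union> set y" by (rule set_shuffles[OF t(1)])
  have "filter (\<lambda>x. x \<in> set u) w = filter (\<lambda>x. x \<in> set u) (filter (\<lambda>x. x \<in> set t) w)"
    unfolding filter_filter using start by (intro filter_cong) auto
  then have "sub u w" using filter_shuffles_disjoint1(1)[OF assms t(1)] t(2) by (simp add: sub_def)
  moreover have "filter (\<lambda>x. x \<in> set y) w = filter (\<lambda>x. x \<in> set y) (filter (\<lambda>x. x \<in> set t) w)"
    unfolding filter_filter using start by (intro filter_cong) auto
  then have "sub y w" using filter_shuffles_disjoint2(1)[OF assms t(1)] t(2) by (simp add: sub_def)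
  ultimately show "sub u w \<and> sub y w" by simp
qed

text \<open>Words that contain two disjoint subwords are classified by the way these are interleaved.\<close>

lemma word_ind_shuffles:
  assumes "set u \<inter> set y = {}"
  shows "(word_ind n (\<lambda>w. Q w \<and> sub u w \<and> sub y w) :: _ \<Rightarrow> 'f::field) = (\<Sum>t\<in>shuffles u y. word_ind n (\<lambda>w. Q w \<and> sub t w))"
proof
  fix \<sigma>
  let ?w = "word n \<sigma>"
  have uniq: "t = t'" if "t \<in> shuffles u y" "t' \<in> shuffles u y" "sub t ?w" "sub t' ?w" for t t'
    using that set_shuffles unfolding sub_def by metis
  show "word_ind n (\<lambda>w. Q w \<and> sub u w \<and> sub y w) \<sigma> = (\<Sum>t\<in>shuffles u y. word_ind n (\<lambda>w. Q w \<and> sub t w) :: _ \<Rightarrow> 'f) \<sigma>"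
  proof (cases "\<sigma> permutes {1..n} \<and> Q ?w \<and> sub u ?w \<and> sub y ?w")
    case True
    then obtain t0 where t0: "t0 \<in> shuffles u y" "sub t0 ?w" using sub_shuffles[OF assms] by blast
    have "(\<Sum>t\<in>shuffles u y. word_ind n (\<lambda>w. Q w \<and> sub t w) :: _ \<Rightarrow> 'f) \<sigma> = (\<Sum>t\<in>shuffles u y. if t = t0 then 1 else 0)"
      unfolding sum_fun_apply using True t0 uniq by (intro sum.cong refl) (auto simp: word_ind_def)
    then show ?thesis using True t0 by (simp add: word_ind_def)
  next
    case False
    then have "\<not> (\<sigma> permutes {1..n} \<and> Q ?w \<and> sub t ?w)" if "t \<in> shuffles u y" for t
      using that sub_shuffles[OF assms] by blast
    then have "(\<Sum>t\<in>shuffles u y. word_ind n (\<lambda>w. Q w \<and> sub t w) :: _ \<Rightarrow> 'f) \<sigma> = 0"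
      unfolding sum_fun_apply by (intro sum.neutral) (auto simp: word_ind_def)
    then show ?thesis using False by (simp add: word_ind_def)
  qed
qed

lemma shuffles_index:
  "t \<in> shuffles u (s # v) \<Longrightarrow> s \<notin> set u \<Longrightarrow> t = u @ s # v \<or> length (takeWhile (\<lambda>x. x \<noteq> s) t) < length u"
proof (induction u arbitrary: t)
  case (Cons a u)
  then show ?case by (cases t) (auto simp: Cons_in_shuffles_iff)
qed simp

section \<open>Multichains\<close>

text \<open>\<open>start I\<close> is the element at which a chain with \<open>A\<close>-part \<open>I\<close> has to start.\<close>

locale chains =
  fixes n :: nat and A :: "nat set" and start :: "nat set \<Rightarrow> nat"
  assumes n_pos: "n \<ge> 1" and A_sub: "A \<subseteq> {1..n}" and A_ne: "A \<noteq> {}"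
    and start_in: "\<And>I. \<lbrakk>I \<subseteq> A; I \<noteq> {}\<rbrakk> \<Longrightarrow> start I \<in> I"
begin

definition multichains :: "nat set \<Rightarrow> nat list set set" where
  "multichains S = {\<gamma>. (\<forall>c\<in>\<gamma>. distinct c \<and> A \<inter> set c \<noteq> {} \<and> hd c = start (A \<inter> set c)) \<and>
     (\<forall>c\<in>\<gamma>. \<forall>c'\<in>\<gamma>. c \<noteq> c' \<longrightarrow> set c \<inter> set c' = {}) \<and> \<Union> (set ` \<gamma>) = S}"

definition E :: "nat list set \<Rightarrow> (nat \<Rightarrow> nat) \<Rightarrow> 'f::field" where
  "E \<gamma> = word_ind n (\<lambda>w. \<forall>c\<in>\<gamma>. sub c w)"

lemma multichains_Un:
  assumes "\<gamma> \<in> multichains S" "\<gamma>' \<in> multichains S'" "S \<inter> S' = {}"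
  shows "\<gamma> \<union> \<gamma>' \<in> multichains (S \<union> S')"
proof -
  have *: "set c \<subseteq> S" if "c \<in> \<gamma>" for c using that assms(1) by (auto simp: multichains_def)
  have **: "set c \<subseteq> S'" if "c \<in> \<gamma>'" for c using that assms(2) by (auto simp: multichains_def)
  have d: "set c \<inter> set c' = {}" if "c \<in> \<gamma>" "c' \<in> \<gamma>'" for c c'
    using *[OF that(1)] **[OF that(2)] assms(3) by blast
  have d': "set c' \<inter> set c = {}" if "c \<in> \<gamma>" "c' \<in> \<gamma>'" for c c'
    using d[OF that] by blast
  show ?thesis
    unfolding multichains_def mem_Collect_eq
  proof (intro conjI ballI impI)
    fix c c' assume "c \<in> \<gamma> \<union> \<gamma>'" "c' \<in> \<gamma> \<union> \<gamma>'" "c \<noteq> c'"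
    then show "set c \<inter> set c' = {}"
      using assms(1,2) d d' unfolding multichains_def by blast
  qed (use assms(1,2) in \<open>auto simp: multichains_def\<close>)
qed

text \<open>Induction on the length of \<open>x\<close> and then on the position of its prescribed first letter \<open>s\<close>. If \<open>x = u s v\<close> with \<open>u\<close> nonempty, then
  shuffling \<open>u\<close> with \<open>s v\<close> produces \<open>x\<close> plus words in which \<open>s\<close> occurs earlier but whose first letter still
  lies in \<open>A\<close>, while the shuffle itself prescribes the two shorter words \<open>u\<close> and \<open>s v\<close>.\<close>

lemma chain_in_span:
  fixes Q :: "nat list \<Rightarrow> bool"
  assumes "distinct x" "x \<noteq> []" "hd x \<in> A"
  shows "(word_ind n (\<lambda>w. Q w \<and> sub x w) :: _ \<Rightarrow> 'f::field) \<in>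
    fs.span ((\<lambda>\<gamma>. word_ind n (\<lambda>w. Q w \<and> (\<forall>c\<in>\<gamma>. sub c w))) ` multichains (set x))"
  using assms
proof (induction x arbitrary: Q rule: measure_induct_rule
    [where f = "\<lambda>x. length x * length x + length (takeWhile (\<lambda>y. y \<noteq> start (A \<inter> set x)) x)"])
  case (less x)
  let ?idx = "\<lambda>x. length (takeWhile (\<lambda>y. y \<noteq> start (A \<inter> set x)) x)"
  define s where "s = start (A \<inter> set x)"
  have "hd x \<in> A \<inter> set x" using less.prems by simp
  then have ne: "A \<inter> set x \<noteq> {}" by blast
  then have s: "s \<in> A" "s \<in> set x" using start_in[of "A \<inter> set x"] by (auto simp: s_def)
  then obtain u v where x: "x = u @ s # v" "s \<notin> set u" using split_list_first by fastforce
  have "takeWhile (\<lambda>y. y \<noteq> s) x = u" using x(2) by (subst x(1)) (auto simp: takeWhile_append)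
  then have idx: "?idx x = length u" by (simp only: s_def)
  let ?G = "\<lambda>Q S. (\<lambda>\<gamma>. word_ind n (\<lambda>w. Q w \<and> (\<forall>c\<in>\<gamma>. sub c w)) :: _ \<Rightarrow> 'f) ` multichains S"
  show ?case
  proof (cases "u = []")
    case True
    have hd_s: "hd x = s" using True x(1) by simp
    have "{x} \<in> multichains (set x)"
      using less.prems(1) ne hd_s unfolding multichains_def s_def by simp
    then have "word_ind n (\<lambda>w. Q w \<and> (\<forall>c\<in>{x}. sub c w)) \<in> ?G Q (set x)" by blast
    then show ?thesis by (intro fs.span_base) simp
  next
    case False
    \<comment> \<open>the square of the length outweighs the position\<close>
    have sq: "length y * length y + ?idx y < length x * length x" if "length y < length x" for y
    proof -
      have "?idx y \<le> length y" by (rule length_takeWhile_le)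
      then have "length y * length y + ?idx y < Suc (length y) * Suc (length y)" by simp
      also have "\<dots> \<le> length x * length x" using that by (intro mult_le_mono) auto
      finally show ?thesis .
    qed
    have disj: "set u \<inter> set (s # v) = {}" using less.prems(1) x(1) by auto
    have du: "distinct u" "distinct (s # v)" using less.prems(1) x(1) by auto
    have both: "word_ind n (\<lambda>w. Q w \<and> sub u w \<and> sub (s # v) w) \<in> fs.span (?G Q (set x))"
    proof -
      have "word_ind n (\<lambda>w. (Q w \<and> sub (s # v) w) \<and> sub u w) \<in> fs.span (?G (\<lambda>w. Q w \<and> sub (s # v) w) (set u))"
        by (rule less.IH) (use sq[of u] du less.prems(3) False x(1) in auto)
      moreover have "?G (\<lambda>w. Q w \<and> sub (s # v) w) (set u) \<subseteq> fs.span (?G Q (set x))"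
      proof
        fix z assume "z \<in> ?G (\<lambda>w. Q w \<and> sub (s # v) w) (set u)"
        then obtain \<gamma> where g: "\<gamma> \<in> multichains (set u)"
          and z: "z = word_ind n (\<lambda>w. (Q w \<and> sub (s # v) w) \<and> (\<forall>c\<in>\<gamma>. sub c w))" by blast
        have "z = word_ind n (\<lambda>w. (Q w \<and> (\<forall>c\<in>\<gamma>. sub c w)) \<and> sub (s # v) w)"
          unfolding z by (rule arg_cong[of _ _ "word_ind n"]) blast
        also have "\<dots> \<in> fs.span (?G (\<lambda>w. Q w \<and> (\<forall>c\<in>\<gamma>. sub c w)) (set (s # v)))"
          by (rule less.IH) (use sq[of "s # v"] du s(1) False x(1) in auto)
        also have "\<dots> \<subseteq> fs.span (?G Q (set x))"
        proof (rule fs.span_mono, rule subsetI)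
          fix z' assume "z' \<in> ?G (\<lambda>w. Q w \<and> (\<forall>c\<in>\<gamma>. sub c w)) (set (s # v))"
          then obtain \<gamma>' where g': "\<gamma>' \<in> multichains (set (s # v))"
            and z': "z' = word_ind n (\<lambda>w. (Q w \<and> (\<forall>c\<in>\<gamma>. sub c w)) \<and> (\<forall>c\<in>\<gamma>'. sub c w))" by blast
          have "z' = word_ind n (\<lambda>w. Q w \<and> (\<forall>c\<in>\<gamma> \<union> \<gamma>'. sub c w))"
            unfolding z' by (rule arg_cong[of _ _ "word_ind n"]) blast
          moreover have "\<gamma> \<union> \<gamma>' \<in> multichains (set x)"
            using multichains_Un[OF g g' disj] x(1) by simp
          ultimately show "z' \<in> ?G Q (set x)" by blast
        qed
        finally show "z \<in> fs.span (?G Q (set x))" .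
      qed
      ultimately have "word_ind n (\<lambda>w. (Q w \<and> sub (s # v) w) \<and> sub u w) \<in> fs.span (?G Q (set x))"
        using fs.span_minimal[OF _ fs.subspace_span] by blast
      moreover have "(\<lambda>w. (Q w \<and> sub (s # v) w) \<and> sub u w) = (\<lambda>w. Q w \<and> sub u w \<and> sub (s # v) w)" by blast
      ultimately show ?thesis by simp
    qed
    let ?T = "shuffles u (s # v)"
    have xT: "x \<in> ?T"
    proof -
      have "filter (\<lambda>z. z \<in> set u) x = u" "filter (\<lambda>z. z \<notin> set u) x = s # v"
        using disj by (auto simp: x(1) filter_id_conv filter_empty_conv)
      then show ?thesis using partition_in_shuffles[of x "\<lambda>z. z \<in> set u"] by simp
    qed
    have rest: "word_ind n (\<lambda>w. Q w \<and> sub t w) \<in> fs.span (?G Q (set x))" if t: "t \<in> ?T - {x}" for t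
    proof -
      have tT: "t \<in> ?T" and tx: "t \<noteq> x" using t by auto
      have setx: "set t = set x" using set_shuffles[OF tT] x(1) by simp
      have lenx: "length t = length x" using length_shuffles[OF tT] x(1) by simp
      have "length (takeWhile (\<lambda>y. y \<noteq> s) t) < length u"
        using shuffles_index[OF tT x(2)] tx x(1) by blast
      then have lt: "length t * length t + ?idx t < length x * length x + ?idx x"
        using idx setx lenx by (simp add: s_def)
      have dt: "distinct t" by (rule distinct_disjoint_shuffles[OF du disj tT])
      have tne: "t \<noteq> []" using lenx less.prems(2) by auto
      then have "hd t = hd u \<or> hd t = s"
        using tT Cons_in_shuffles_iff[of "hd t" "tl t" u "s # v"] by auto
      then have "hd t \<in> A" using s(1) less.prems(3) x(1) False by auto
      from less.IH[OF lt dt tne this] show ?thesis by (simp only: setx)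
    qed
    have "word_ind n (\<lambda>w. Q w \<and> sub x w) =
        word_ind n (\<lambda>w. Q w \<and> sub u w \<and> sub (s # v) w) - (\<Sum>t\<in>?T - {x}. word_ind n (\<lambda>w. Q w \<and> sub t w) :: _ \<Rightarrow> 'f)"
      unfolding word_ind_shuffles[OF disj] sum.remove[OF finite_shuffles xT] by (simp only: add_diff_cancel_right')
    also have "\<dots> \<in> fs.span (?G Q (set x))"
      by (intro fs.span_diff both fs.span_sum rest)
    finally show ?thesis .
  qed
qed

end

section \<open>Products of brackets\<close>

text \<open>The functional attached to a concatenation of brackets, one for each word of the list.\<close>

fun brackets :: "'a list list \<Rightarrow> ('a list \<Rightarrow> 'f::field) \<Rightarrow> 'f" where
  "brackets [] f = f []"
| "brackets (c # cs) f = bracket (rev c) (\<lambda>w. brackets cs (\<lambda>w'. f (w @ w')))"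

lemma brackets_cong:
  "(\<And>ws. list_all2 (\<lambda>w c. mset w = mset c) ws cs \<Longrightarrow> f (concat ws) = g (concat ws)) \<Longrightarrow> brackets cs f = brackets cs g"
proof (induction cs arbitrary: f g)
  case Nil
  then show ?case using Nil[of "[]"] by simp
next
  case (Cons c cs)
  have "brackets cs (\<lambda>w'. f (w @ w')) = brackets cs (\<lambda>w'. g (w @ w'))" if w: "mset w = mset (rev c)" for w
  proof (rule Cons.IH)
    fix ws assume "list_all2 (\<lambda>w c. mset w = mset c) ws cs"
    then show "f (w @ concat ws) = g (w @ concat ws)" using Cons.prems[of "w # ws"] w by simp
  qed
  then show ?case by (auto intro: bracket_cong)
qed

lemma brackets_sum: "brackets cs (\<lambda>w. \<Sum>i\<in>I. k i * f i w) = (\<Sum>i\<in>I. k i * brackets cs (f i))"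
  by (induction cs arbitrary: f) (simp_all add: bracket_sum)

lemma brackets_diff: "brackets cs (\<lambda>w. f w - g w) = brackets cs f - brackets cs g"
  by (induction cs arbitrary: f g) (simp_all add: bracket_diff)

lemma brackets_zero: "brackets cs (\<lambda>w. 0) = 0"
  using brackets_sum[of cs "\<lambda>_. 0" "\<lambda>_ _. 0" "{} :: nat set"] by simp

lemma bracket_brackets_swap: "bracket v (\<lambda>w. brackets cs (g w)) = brackets cs (\<lambda>w'. bracket v (\<lambda>w. g w w'))"
proof (induction v "\<lambda>w. brackets cs (g w)" arbitrary: g rule: bracket.induct)
  case (3 b c v)
  show ?case
    using "3.hyps"[of "\<lambda>w w'. g (w @ [b]) w' - g (b # w) w'"] by (simp add: brackets_diff)
qed auto

text \<open>One factor to which Ree's orthogonality applies is enough to annihilate the product.\<close>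

lemma brackets_mixed:
  assumes "c \<in> set cs" "\<exists>x\<in>set c. P x" "\<exists>x\<in>set c. \<not> P x"
    and "\<And>pre post. \<exists>g h. \<forall>w. f (pre @ w @ post) = g (filter P w) * h (filter (\<lambda>x. \<not> P x) w)"
  shows "brackets cs f = 0"
  using assms(1,4)
proof (induction cs arbitrary: f)
  case (Cons c' cs)
  show ?case
  proof (cases "c' = c")
    case True
    have "bracket (rev c) (\<lambda>w. f (w @ w')) = 0" for w'
    proof -
      obtain g h where "\<And>w. f (w @ w') = g (filter P w) * h (filter (\<lambda>x. \<not> P x) w)"
        using Cons.prems(2)[of "[]" w'] by auto
      then show ?thesis using bracket_shuffle[of "rev c" P g h] assms(2,3) by simp
    qed
    then show ?thesis using True by (simp add: bracket_brackets_swap brackets_zero)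
  next
    case False
    have "brackets cs (\<lambda>w'. f (w @ w')) = 0" for w
    proof (rule Cons.IH)
      show "c \<in> set cs" using Cons.prems(1) False by simp
      show "\<exists>g h. \<forall>w'. f (w @ pre @ w' @ post) = g (filter P w') * h (filter (\<lambda>x. \<not> P x) w')" for pre post
        using Cons.prems(2)[of "w @ pre" post] by simp
    qed
    then show ?thesis by (simp add: bracket_zero)
  qed
qed simp

lemma brackets_head:
  assumes "\<And>c. c \<in> set cs \<Longrightarrow> distinct c \<and> c \<noteq> []"
    and "\<And>ws i. \<lbrakk>list_all2 (\<lambda>w c. mset w = mset c) ws cs; i < length cs; hd (ws ! i) \<noteq> hd (cs ! i)\<rbrakk> \<Longrightarrow> f (concat ws) = 0"
  shows "brackets cs f = f (concat cs)"
  using assms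
proof (induction cs arbitrary: f)
  case (Cons c cs)
  obtain x v where c: "c = x # v" using Cons.prems(1)[of c] by (cases c) auto
  have "bracket (rev (x # v)) (\<lambda>w. brackets cs (\<lambda>w'. f (w @ w'))) = brackets cs (\<lambda>w'. f ((x # v) @ w'))"
  proof (rule bracket_head)
    show "distinct (x # v)" using Cons.prems(1)[of c] c by simp
    fix w assume w: "mset w = mset (x # v)" "hd w \<noteq> x"
    have "brackets cs (\<lambda>w'. f (w @ w')) = brackets cs (\<lambda>w'. 0)"
    proof (rule brackets_cong)
      fix ws assume "list_all2 (\<lambda>w c. mset w = mset c) ws cs"
      then show "f (w @ concat ws) = 0" using Cons.prems(2)[of "w # ws" 0] w c by simp
    qed
    then show "brackets cs (\<lambda>w'. f (w @ w')) = 0" by (simp add: brackets_zero)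
  qed
  also have "\<dots> = f ((x # v) @ concat cs)"
  proof (rule Cons.IH)
    fix ws i assume "list_all2 (\<lambda>w c. mset w = mset c) ws cs" "i < length cs" "hd (ws ! i) \<noteq> hd (cs ! i)"
    then show "f ((x # v) @ concat ws) = 0" using Cons.prems(2)[of "c # ws" "Suc i"] c by simp
  qed (use Cons.prems(1) in simp)
  finally show ?case by (simp add: c)
qed simp

lemma filter_concat_nth:
  assumes "distinct (concat ws)" "i < length ws"
  shows "filter (\<lambda>x. x \<in> set (ws ! i)) (concat ws) = ws ! i"
  using assms
proof (induction ws arbitrary: i)
  case (Cons w ws)
  show ?case
  proof (cases i)
    case 0
    have "filter (\<lambda>x. x \<in> set w) (concat ws) = []"
      using Cons.prems(1) by (auto simp: filter_empty_conv)
    then show ?thesis using 0 by simp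
  next
    case (Suc j)
    then have j: "j < length ws" using Cons.prems(2) by simp
    then have "set (ws ! j) \<subseteq> set (concat ws)" using UN_upper[of "ws ! j" "set ws" set] j by simp
    then have "filter (\<lambda>x. x \<in> set (ws ! j)) w = []"
      using Cons.prems(1) by (auto simp: filter_empty_conv)
    then show ?thesis using Suc Cons.IH[OF _ j] Cons.prems(1) by simp
  qed
qed simp

definition subword_ind :: "nat list set \<Rightarrow> nat list \<Rightarrow> 'f::field" where
  "subword_ind \<gamma> w = (if \<forall>c\<in>\<gamma>. sub c w then 1 else 0)"

context chains
begin

lemma multichainD:
  assumes "\<gamma> \<in> multichains S" "c \<in> \<gamma>"
  shows "distinct c" "A \<inter> set c \<noteq> {}" "hd c = start (A \<inter> set c)" "c \<noteq> []" "hd c \<in> A" "set c \<subseteq> S"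
proof -
  show "distinct c" and ne: "A \<inter> set c \<noteq> {}" and hd: "hd c = start (A \<inter> set c)" and "set c \<subseteq> S"
    using assms by (auto simp: multichains_def)
  show "c \<noteq> []" using ne by auto
  show "hd c \<in> A" using hd ne start_in[of "A \<inter> set c"] by auto
qed

lemma multichain_disjoint:
  "\<lbrakk>\<gamma> \<in> multichains S; c \<in> \<gamma>; c' \<in> \<gamma>; x \<in> set c; x \<in> set c'\<rbrakk> \<Longrightarrow> c = c'"
  unfolding multichains_def by blast

lemma multichain_cover: "\<gamma> \<in> multichains S \<Longrightarrow> x \<in> S \<Longrightarrow> \<exists>c\<in>\<gamma>. x \<in> set c"
  unfolding multichains_def by auto

lemma finite_multichains: "finite S \<Longrightarrow> finite (multichains S)"
proof -
  assume S: "finite S"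
  let ?L = "{c. set c \<subseteq> S \<and> length c \<le> card S}"
  have "multichains S \<subseteq> Pow ?L"
  proof
    fix \<gamma> assume g: "\<gamma> \<in> multichains S"
    have "c \<in> ?L" if "c \<in> \<gamma>" for c
      using multichainD(1,6)[OF g that] S by (metis (mono_tags) card_mono distinct_card mem_Collect_eq)
    then show "\<gamma> \<in> Pow ?L" by blast
  qed
  then show ?thesis using finite_lists_length_le[OF S] by (auto intro: finite_subset)
qed

lemma finite_multichain: "finite S \<Longrightarrow> \<gamma> \<in> multichains S \<Longrightarrow> finite \<gamma>"
proof -
  assume S: "finite S" and g: "\<gamma> \<in> multichains S"
  have "\<gamma> \<subseteq> {c. set c \<subseteq> S \<and> length c \<le> card S}"
    using multichainD(1,6)[OF g] S by (metis (mono_tags) card_mono distinct_card mem_Collect_eq subsetI)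
  then show ?thesis using finite_lists_length_le[OF S] by (auto intro: finite_subset)
qed

section \<open>Independence of the multichain vectors\<close>

lemma E_perm_of: "u \<in> words n \<Longrightarrow> E \<gamma> (perm_of u) = subword_ind \<gamma> u"
  by (simp only: E_def word_ind_def subword_ind_def perm_of_permutes word_perm_of words_length simp_thms)

text \<open>Whether the chain \<open>c\<close> is a subword depends on the letters of \<open>c\<close> only, and the other chains of \<open>\<gamma>\<close> depend
  on the remaining letters only.\<close>

lemma subword_ind_factor:
  assumes g: "\<gamma> \<in> multichains S" and c: "c \<in> \<gamma>"
  shows "\<exists>g h. \<forall>w. (subword_ind \<gamma> (pre @ w @ post) :: 'f::field) =
    g (filter (\<lambda>x. x \<in> set c) w) * h (filter (\<lambda>x. x \<notin> set c) w)"
proof (intro exI allI)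
  fix w
  let ?P = "\<lambda>x. x \<in> set c"
  let ?g = "\<lambda>y. if filter ?P pre @ y @ filter ?P post = c then 1 else (0::'f)"
  let ?h = "\<lambda>y. if \<forall>c'\<in>\<gamma> - {c}. filter (\<lambda>x. x \<in> set c') pre @ filter (\<lambda>x. x \<in> set c') y @ filter (\<lambda>x. x \<in> set c') post = c' then 1 else (0::'f)"
  have "filter (\<lambda>x. x \<in> set c') (filter (\<lambda>x. x \<notin> set c) w) = filter (\<lambda>x. x \<in> set c') w" if "c' \<in> \<gamma> - {c}" for c'
    unfolding filter_filter using multichain_disjoint[OF g, of c' c] that c by (intro filter_cong) auto
  then have "?h (filter (\<lambda>x. x \<notin> set c) w) = (if \<forall>c'\<in>\<gamma> - {c}. sub c' (pre @ w @ post) then 1 else 0)"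
    by (auto simp: sub_def)
  moreover have "?g (filter ?P w) = (if sub c (pre @ w @ post) then 1 else 0)"
    by (simp add: sub_def)
  moreover have "(\<forall>c\<in>\<gamma>. sub c (pre @ w @ post)) \<longleftrightarrow> sub c (pre @ w @ post) \<and> (\<forall>c'\<in>\<gamma> - {c}. sub c' (pre @ w @ post))"
    using c by blast
  ultimately show "(subword_ind \<gamma> (pre @ w @ post) :: 'f) = ?g (filter ?P w) * ?h (filter (\<lambda>x. x \<notin> set c) w)"
    unfolding subword_ind_def by simp
qed

text \<open>If some chain of \<open>\<gamma>\<close> meets two chains of \<open>\<gamma>'\<close>, orthogonality gives zero. Otherwise every chain of \<open>\<gamma>\<close> lies
  within one of \<open>\<gamma>'\<close>; by the assumption on cardinalities both have the same underlying partition, hence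
  the same first letters, and then each bracket is evaluated by \<open>bracket_head\<close>.\<close>

lemma brackets_subword_ind:
  assumes g: "\<gamma> \<in> multichains {1..n}" and g': "\<gamma>' \<in> multichains {1..n}" and card: "card \<gamma> \<le> card \<gamma>'"
    and cs: "set cs = \<gamma>" "distinct cs"
  shows "brackets cs (subword_ind \<gamma>') = (if \<gamma> = \<gamma>' then 1 else (0::'f::field))"
proof -
  have fin: "finite \<gamma>" "finite \<gamma>'" using finite_multichain g g' by auto
  have refines: "\<exists>c'\<in>\<gamma>'. set c \<subseteq> set c'" if c: "c \<in> \<gamma>" and nz: "brackets cs (subword_ind \<gamma>') \<noteq> (0::'f)" for c
  proof -
    obtain x where x: "x \<in> set c" using multichainD(4)[OF g c] by (cases c) auto
    then have "x \<in> {1..n}" using multichainD(6)[OF g c] by blast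
    then obtain c' where c': "c' \<in> \<gamma>'" "x \<in> set c'" using multichain_cover[OF g'] by blast
    have "set c \<subseteq> set c'"
    proof (rule ccontr)
      assume "\<not> set c \<subseteq> set c'"
      then have "\<exists>x\<in>set c. x \<notin> set c'" by blast
      then have "brackets cs (subword_ind \<gamma>') = (0::'f)"
        using c x c'(2) cs(1) subword_ind_factor[OF g' c'(1)]
        by (intro brackets_mixed[of c cs "\<lambda>x. x \<in> set c'"]) auto
      then show False using nz by simp
    qed
    then show ?thesis using c'(1) by blast
  qed
  have d_cs: "distinct (concat cs)"
    using cs multichainD(1)[OF g] multichain_disjoint[OF g] by (intro distinct_concat) auto
  have same: "brackets cs (subword_ind \<gamma>') = (subword_ind \<gamma>' (concat cs) :: 'f)"
    if phi: "\<And>c. c \<in> \<gamma> \<Longrightarrow> \<phi> c \<in> \<gamma>' \<and> set (\<phi> c) = set c" for \<phi>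
  proof (rule brackets_head)
    show "distinct c \<and> c \<noteq> []" if "c \<in> set cs" for c using that cs(1) multichainD[OF g] by auto
    fix ws i assume ws: "list_all2 (\<lambda>w c. mset w = mset c) ws cs" and i: "i < length cs" "hd (ws ! i) \<noteq> hd (cs ! i)"
    have "mset (concat ws) = mset (concat cs)"
      using ws by (induction ws cs rule: list_all2_induct) auto
    then have d_ws: "distinct (concat ws)" using d_cs mset_eq_imp_distinct_iff by blast
    have len: "length ws = length cs" using ws by (rule list_all2_lengthD)
    have "mset (ws ! i) = mset (cs ! i)" using ws i(1) list_all2_nthD2 by fastforce
    then have set_i: "set (ws ! i) = set (cs ! i)" by (rule mset_eq_setD)
    have c: "cs ! i \<in> \<gamma>" using i(1) cs(1) by auto
    note p = phi[OF c]
    have "\<not> sub (\<phi> (cs ! i)) (concat ws)"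
    proof
      assume "sub (\<phi> (cs ! i)) (concat ws)"
      then have "ws ! i = \<phi> (cs ! i)"
        using filter_concat_nth[OF d_ws, of i] i(1) len p set_i by (simp add: sub_def)
      then show False using i(2) p multichainD(3)[OF g c] multichainD(3)[OF g', of "\<phi> (cs ! i)"] by simp
    qed
    then show "subword_ind \<gamma>' (concat ws) = (0::'f)" using p by (auto simp: subword_ind_def)
  qed
  have sub_cs: "sub c (concat cs)" if "c \<in> \<gamma>" for c
    using that cs(1) filter_concat_nth[OF d_cs] by (auto simp: sub_def in_set_conv_nth)
  show ?thesis
  proof (cases "\<gamma> = \<gamma>'")
    case True
    then show ?thesis using same[of id] sub_cs by (auto simp: subword_ind_def)
  next
    case False
    have "brackets cs (subword_ind \<gamma>') = (0::'f)"
    proof (rule ccontr)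
      assume nz: "brackets cs (subword_ind \<gamma>') \<noteq> (0::'f)"
      then obtain \<phi> where phi: "\<And>c. c \<in> \<gamma> \<Longrightarrow> \<phi> c \<in> \<gamma>' \<and> set c \<subseteq> set (\<phi> c)"
        using refines by metis
      have meet: "\<phi> c = c'" if "c \<in> \<gamma>" "c' \<in> \<gamma>'" "x \<in> set c" "x \<in> set c'" for c c' x
        using multichain_disjoint[OF g', of "\<phi> c" c' x] phi[OF that(1)] that by blast
      have surj: "\<phi> ` \<gamma> = \<gamma>'"
      proof
        show "\<gamma>' \<subseteq> \<phi> ` \<gamma>"
        proof
          fix c' assume c': "c' \<in> \<gamma>'"
          obtain x where x: "x \<in> set c'" using multichainD(4)[OF g' c'] by (cases c') auto
          then have "x \<in> {1..n}" using multichainD(6)[OF g' c'] by blast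
          then obtain c where "c \<in> \<gamma>" "x \<in> set c" using multichain_cover[OF g] by blast
          then show "c' \<in> \<phi> ` \<gamma>" using meet[OF _ c' _ x] by blast
        qed
      qed (use phi in blast)
      have "card (\<phi> ` \<gamma>) = card \<gamma>"
        using surj card card_image_le[OF fin(1), of \<phi>] by simp
      then have inj: "inj_on \<phi> \<gamma>" using fin(1) by (simp add: eq_card_imp_inj_on)
      have eq: "set (\<phi> c) = set c" if c: "c \<in> \<gamma>" for c
      proof
        show "set c \<subseteq> set (\<phi> c)" using phi[OF c] by blast
        show "set (\<phi> c) \<subseteq> set c"
        proof
          fix x assume x: "x \<in> set (\<phi> c)"
          have pcomp: "\<phi> c \<in> \<gamma>'" using phi[OF c] by blast
          then have "x \<in> {1..n}" using x multichainD(6)[OF g'] by blast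
          then obtain c2 where c2: "c2 \<in> \<gamma>" "x \<in> set c2" using multichain_cover[OF g] by blast
          then have "\<phi> c2 = \<phi> c" using meet[OF c2(1) pcomp c2(2) x] by blast
          then have "c2 = c" using inj_onD[OF inj] c2(1) c by blast
          then show "x \<in> set c" using c2(2) by simp
        qed
      qed
      have "subword_ind \<gamma>' (concat cs) \<noteq> (0::'f)" using same[of \<phi>] phi eq nz by auto
      then have s': "sub c' (concat cs)" if "c' \<in> \<gamma>'" for c' using that by (auto simp: subword_ind_def split: if_splits)
      have "\<phi> c = c" if c: "c \<in> \<gamma>" for c
        using s'[of "\<phi> c"] sub_cs[OF c] phi[OF c] eq[OF c] by (simp add: sub_def)
      then have "\<gamma> = \<gamma>'" using surj by simp
      then show False using False by simp
    qed
    then show ?thesis using False by simp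
  qed
qed

text \<open>The functionals are triangular with respect to the number of chains, so they extract the coefficients
  of a linear combination with fewest chains.\<close>

lemma brackets_coefficient:
  fixes u :: "nat list set \<Rightarrow> 'f::field"
  assumes g: "\<gamma> \<in> multichains {1..n}" and cs: "set cs = \<gamma>" "distinct cs"
    and min: "\<And>\<gamma>'. \<lbrakk>\<gamma>' \<in> multichains {1..n}; u \<gamma>' \<noteq> 0\<rbrakk> \<Longrightarrow> card \<gamma> \<le> card \<gamma>'"
  shows "brackets cs (\<lambda>w. (\<Sum>\<gamma>'\<in>multichains {1..n}. fun_scale (u \<gamma>') (E \<gamma>')) (perm_of w)) = u \<gamma>"
proof -
  have "brackets cs (\<lambda>w. (\<Sum>\<gamma>'\<in>multichains {1..n}. fun_scale (u \<gamma>') (E \<gamma>')) (perm_of w)) =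
    brackets cs (\<lambda>w. \<Sum>\<gamma>'\<in>multichains {1..n}. u \<gamma>' * subword_ind \<gamma>' w)"
  proof (rule brackets_cong)
    fix ws assume "list_all2 (\<lambda>w c. mset w = mset c) ws cs"
    then have m: "mset (concat ws) = mset (concat cs)"
      by (induction ws cs rule: list_all2_induct) auto
    have "distinct (concat cs)"
      using cs multichainD(1)[OF g] multichain_disjoint[OF g] by (intro distinct_concat) auto
    then have "distinct (concat ws)" using m mset_eq_imp_distinct_iff by blast
    moreover have "set (concat ws) = {1..n}"
      using mset_eq_setD[OF m] cs(1) g by (simp add: multichains_def)
    ultimately have "concat ws \<in> words n" by (simp add: words_def)
    then show "(\<Sum>\<gamma>'\<in>multichains {1..n}. fun_scale (u \<gamma>') (E \<gamma>')) (perm_of (concat ws)) =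
        (\<Sum>\<gamma>'\<in>multichains {1..n}. u \<gamma>' * subword_ind \<gamma>' (concat ws))"
      by (simp add: sum_fun_apply fun_scale_def E_perm_of)
  qed
  also have "\<dots> = (\<Sum>\<gamma>'\<in>multichains {1..n}. u \<gamma>' * brackets cs (subword_ind \<gamma>'))"
    by (rule brackets_sum)
  also have "\<dots> = (\<Sum>\<gamma>'\<in>multichains {1..n}. if \<gamma>' = \<gamma> then u \<gamma> else 0)"
  proof (rule sum.cong[OF refl])
    fix \<gamma>' assume g': "\<gamma>' \<in> multichains {1..n}"
    show "u \<gamma>' * brackets cs (subword_ind \<gamma>') = (if \<gamma>' = \<gamma> then u \<gamma> else 0)"
    proof (cases "u \<gamma>' = 0")
      case False
      show ?thesis using brackets_subword_ind[OF g g' min[OF g' False] cs, where 'f = 'f] by auto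
    qed auto
  qed
  also have "\<dots> = u \<gamma>" using g finite_multichains[of "{1..n}"] by simp
  finally show ?thesis .
qed

lemma E_independent: "independent_family (E :: _ \<Rightarrow> _ \<Rightarrow> 'f::field) (multichains {1..n})"
  unfolding independent_family_def
proof (intro allI impI ballI, rule ccontr)
  fix u :: "nat list set \<Rightarrow> 'f" and \<gamma>0
  assume 0: "(\<Sum>\<gamma>\<in>multichains {1..n}. fun_scale (u \<gamma>) (E \<gamma>)) = 0" and "\<gamma>0 \<in> multichains {1..n}" "u \<gamma>0 \<noteq> 0"
  then have "\<exists>\<gamma>. (\<gamma> \<in> multichains {1..n} \<and> u \<gamma> \<noteq> 0) \<and>
      (\<forall>\<gamma>'. \<gamma>' \<in> multichains {1..n} \<and> u \<gamma>' \<noteq> 0 \<longrightarrow> card \<gamma> \<le> card \<gamma>')"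
    by (intro ex_has_least_nat[of _ \<gamma>0]) simp
  then obtain \<gamma> where g: "\<gamma> \<in> multichains {1..n}" "u \<gamma> \<noteq> 0"
    and min: "\<And>\<gamma>'. \<lbrakk>\<gamma>' \<in> multichains {1..n}; u \<gamma>' \<noteq> 0\<rbrakk> \<Longrightarrow> card \<gamma> \<le> card \<gamma>'"
    by (elim exE conjE) simp
  obtain cs where "set cs = \<gamma>" "distinct cs"
    using finite_distinct_list[OF finite_multichain[OF _ g(1)]] by auto
  from brackets_coefficient[OF g(1) this, of u] min 0
  have "u \<gamma> = brackets cs (\<lambda>w. 0)" by simp
  then show False using g(2) by (simp add: brackets_zero)
qed

section \<open>The kernel of the Dynkin element\<close>

definition X_space :: "((nat \<Rightarrow> nat) \<Rightarrow> 'f::field) set" where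
  "X_space = {a. \<forall>\<sigma>. a \<sigma> \<noteq> 0 \<longrightarrow> \<sigma> permutes {1..n} \<and> \<sigma> 1 \<in> A}"

lemma subspace_X: "fs.subspace X_space"
  unfolding fs.subspace_def X_space_def
  by (auto simp: fun_scale_def) (metis add_0)+

lemma word_nonempty: "word n \<sigma> \<noteq> []"
  using n_pos length_word[of n \<sigma>] by (metis list.size(3) not_one_le_zero)

lemma hd_word: "hd (word n \<sigma>) = \<sigma> 1"
proof -
  have "word n \<sigma> \<noteq> []" by (rule word_nonempty)
  then have "hd (word n \<sigma>) = word n \<sigma> ! 0" by (rule hd_conv_nth)
  then show ?thesis using nth_word[of 0 n \<sigma>] n_pos by simp
qed

lemma E_in_X: "\<gamma> \<in> multichains {1..n} \<Longrightarrow> E \<gamma> \<in> X_space"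
proof -
  assume g: "\<gamma> \<in> multichains {1..n}"
  have "\<sigma> 1 \<in> A" if s: "\<sigma> permutes {1..n}" and sub: "\<forall>c\<in>\<gamma>. sub c (word n \<sigma>)" for \<sigma>
  proof -
    have "word n \<sigma> \<noteq> []" by (rule word_nonempty)
    then obtain x w where w: "word n \<sigma> = x # w" by (cases "word n \<sigma>") auto
    have x: "x = \<sigma> 1" using hd_word[of \<sigma>] w by simp
    have "x \<in> {1..n}" using word_in_words[OF s] w by (auto simp: words_def)
    then obtain c where c: "c \<in> \<gamma>" "x \<in> set c" using multichain_cover[OF g] by blast
    then have "c = x # filter (\<lambda>y. y \<in> set c) w" using sub w by (auto simp: sub_def)
    then have "hd c = x" by (metis list.sel(1))
    then show ?thesis using multichainD(5)[OF g c(1)] x by simp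
  qed
  then show ?thesis by (auto simp: X_space_def E_def word_ind_def split: if_splits)
qed

lemma finite_perms: "finite {\<sigma>. \<sigma> permutes {1..n}}"
  by (rule finite_permutations) simp

lemma X_expand:
  assumes "a \<in> X_space"
  shows "a = (\<Sum>\<sigma>\<in>{\<sigma>. \<sigma> permutes {1..n} \<and> \<sigma> 1 \<in> A}. fun_scale (a \<sigma>) (basis_elt \<sigma>))"
proof
  fix \<tau>
  have fin: "finite {\<sigma>. \<sigma> permutes {1..n} \<and> \<sigma> 1 \<in> A}"
    using finite_perms by (rule rev_finite_subset) auto
  have "(\<Sum>\<sigma>\<in>{\<sigma>. \<sigma> permutes {1..n} \<and> \<sigma> 1 \<in> A}. fun_scale (a \<sigma>) (basis_elt \<sigma>)) \<tau> =
    (\<Sum>\<sigma>\<in>{\<sigma>. \<sigma> permutes {1..n} \<and> \<sigma> 1 \<in> A}. if \<sigma> = \<tau> then a \<tau> else 0)"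
    unfolding sum_fun_apply by (intro sum.cong refl) (auto simp: fun_scale_def basis_elt_def)
  also have "\<dots> = a \<tau>" using fin assms by (auto simp: X_space_def)
  finally show "a \<tau> = (\<Sum>\<sigma>\<in>{\<sigma>. \<sigma> permutes {1..n} \<and> \<sigma> 1 \<in> A}. fun_scale (a \<sigma>) (basis_elt \<sigma>)) \<tau>" by simp
qed

text \<open>A single word that starts in \<open>A\<close> is one prescribed subword of full length; \<open>chain_in_span\<close> expands it.\<close>

lemma X_span_E: "X_space = fs.span (E ` multichains {1..n})"
proof
  show "fs.span (E ` multichains {1..n}) \<subseteq> X_space"
    by (rule fs.span_minimal[OF _ subspace_X]) (use E_in_X in blast)
  have "basis_elt \<sigma> \<in> fs.span (E ` multichains {1..n})" if s: "\<sigma> permutes {1..n}" "\<sigma> 1 \<in> A" for \<sigma>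
  proof -
    let ?x = "word n \<sigma>"
    have x: "distinct ?x" "set ?x = {1..n}" using word_in_words[OF s(1)] by (auto simp: words_def)
    have sub_iff: "sub ?x (word n \<tau>) \<longleftrightarrow> \<tau> = \<sigma>" if t: "\<tau> permutes {1..n}" for \<tau>
    proof -
      have "set (word n \<tau>) = set ?x" using word_in_words[OF t] x(2) by (simp add: words_def)
      then have "filter (\<lambda>y. y \<in> set ?x) (word n \<tau>) = word n \<tau>" by (intro filter_True) simp
      then show ?thesis using perm_of_word[OF t] perm_of_word[OF s(1)] by (metis sub_def)
    qed
    have "basis_elt \<sigma> = word_ind n (\<lambda>w. True \<and> sub ?x w)"
    proof
      fix \<tau>
      show "basis_elt \<sigma> \<tau> = word_ind n (\<lambda>w. True \<and> sub ?x w) \<tau>"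
        using s(1) sub_iff[of \<tau>] unfolding basis_elt_def word_ind_def by (cases "\<tau> permutes {1..n}") auto
    qed
    also have "\<dots> \<in> fs.span ((\<lambda>\<gamma>. word_ind n (\<lambda>w. True \<and> (\<forall>c\<in>\<gamma>. sub c w))) ` multichains (set ?x))"
      by (rule chain_in_span[OF x(1) word_nonempty]) (simp only: hd_word s(2))
    finally show ?thesis unfolding x(2) E_def by (simp only: simp_thms)
  qed
  then show "X_space \<subseteq> fs.span (E ` multichains {1..n})"
    using X_expand by (metis (mono_tags, lifting) fs.span_scale fs.span_sum mem_Collect_eq subsetI)
qed

text \<open>Left multiplication by the Dynkin element, which is a bracket functional at every permutation.\<close>

definition dynkin :: "((nat \<Rightarrow> nat) \<Rightarrow> 'f::field) \<Rightarrow> (nat \<Rightarrow> nat) \<Rightarrow> 'f" where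
  "dynkin a \<sigma> = (if \<sigma> permutes {1..n} then bracket (rev (word n \<sigma>)) (\<lambda>u. a (perm_of u)) else 0)"

lemma dynkin_eq: "a \<in> carrier (SA n) \<Longrightarrow> omega n \<otimes>\<^bsub>SA n\<^esub> a = dynkin a"
proof
  fix \<sigma> assume a: "a \<in> carrier (SA n)"
  show "(omega n \<otimes>\<^bsub>SA n\<^esub> a) \<sigma> = dynkin a \<sigma>"
  proof (cases "\<sigma> permutes {1..n}")
    case True
    then show ?thesis using omega_mult[OF n_pos a] by (simp add: dynkin_def)
  next
    case False
    then have "\<sigma> \<notin> carrier (Sym n)" by (simp add: Sym_def)
    then have "(omega n \<otimes>\<^bsub>SA n\<^esub> a) \<sigma> = 0"
      unfolding group_algebra_def using group.is_monoid[OF group_Sym] 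
      by (auto intro!: sum.neutral dest: monoid.m_closed)
    then show ?thesis using False by (simp add: dynkin_def)
  qed
qed

lemma dynkin_linear: "Vector_Spaces.linear fun_scale fun_scale dynkin"
proof -
  have "dynkin (a + b) = dynkin a + dynkin b" for a b :: "(nat \<Rightarrow> nat) \<Rightarrow> 'a"
    by (auto simp: dynkin_def fun_eq_iff bracket_add)
  moreover have "dynkin (fun_scale k a) = fun_scale k (dynkin a)" for a and k :: 'a
    by (auto simp: dynkin_def fun_eq_iff bracket_scale fun_scale_def)
  ultimately show ?thesis by (simp add: Vector_Spaces.linear_iff vector_space_fun_scale)
qed

text \<open>With two chains the vector is a proper shuffle, to which Lie elements are orthogonal.\<close>

lemma dynkin_E_zero:
  assumes g: "\<gamma> \<in> multichains {1..n}" and "card \<gamma> \<ge> 2"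
  shows "dynkin (E \<gamma>) = (0 :: _ \<Rightarrow> 'f::field)"
proof
  fix \<sigma>
  have fin: "finite \<gamma>" using finite_multichain[OF _ g] by simp
  obtain c c' where c: "c \<in> \<gamma>" "c' \<in> \<gamma>" "c \<noteq> c'"
    using assms(2) fin by (metis card_le_Suc0_iff_eq not_less_eq_eq numeral_2_eq_2)
  show "dynkin (E \<gamma>) \<sigma> = (0 :: _ \<Rightarrow> 'f) \<sigma>"
  proof (cases "\<sigma> permutes {1..n}")
    case True
    have w: "word n \<sigma> \<in> words n" by (rule word_in_words[OF True])
    obtain g' h' :: "nat list \<Rightarrow> 'f" where gh: "\<And>w. subword_ind \<gamma> w = g' (filter (\<lambda>x. x \<in> set c) w) * h' (filter (\<lambda>x. x \<notin> set c) w)"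
      using subword_ind_factor[OF g c(1), of "[]" "[]"] by auto
    have "bracket (rev (word n \<sigma>)) (\<lambda>u. E \<gamma> (perm_of u)) = bracket (rev (word n \<sigma>)) (subword_ind \<gamma> :: _ \<Rightarrow> 'f)"
    proof (rule bracket_cong)
      fix u assume "mset u = mset (rev (word n \<sigma>))"
      then have "u \<in> words n" using w unfolding words_def
        by (metis (mono_tags, lifting) mem_Collect_eq mset_eq_imp_distinct_iff mset_eq_setD mset_rev)
      then show "E \<gamma> (perm_of u) = (subword_ind \<gamma> u :: 'f)" by (rule E_perm_of)
    qed
    then have "dynkin (E \<gamma>) \<sigma> = bracket (rev (word n \<sigma>)) (subword_ind \<gamma> :: _ \<Rightarrow> 'f)"
      unfolding dynkin_def using True by simp
    also have "\<dots> = bracket (rev (word n \<sigma>)) (\<lambda>w. g' (filter (\<lambda>x. x \<in> set c) w) * h' (filter (\<lambda>x. x \<notin> set c) w))"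
      by (rule bracket_cong) (rule gh)
    also have "\<dots> = 0"
    proof (rule bracket_shuffle)
      have s: "set (rev (word n \<sigma>)) = {1..n}" using w by (simp add: words_def)
      show "\<exists>x\<in>set (rev (word n \<sigma>)). x \<in> set c"
        unfolding s using multichainD(4,6)[OF g c(1)] by (metis hd_in_set subsetD)
      have "hd c' \<in> set c'" using multichainD(4)[OF g c(2)] by simp
      then have "hd c' \<notin> set c" "hd c' \<in> {1..n}"
        using multichain_disjoint[OF g c(1,2)] c(3) multichainD(6)[OF g c(2)] by blast+
      then show "\<exists>x\<in>set (rev (word n \<sigma>)). x \<notin> set c" unfolding s by blast
    qed
    finally show ?thesis by simp
  qed (simp add: dynkin_def)
qed

lemma card_multichain_pos: "\<gamma> \<in> multichains {1..n} \<Longrightarrow> card \<gamma> \<ge> 1"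
proof -
  assume g: "\<gamma> \<in> multichains {1..n}"
  have "1 \<in> {1..n}" using n_pos by simp
  then obtain c where "c \<in> \<gamma>" using multichain_cover[OF g] by blast
  moreover have "finite \<gamma>" using finite_multichain[OF _ g] by simp
  ultimately have "card \<gamma> > 0" by (auto simp: card_gt_0_iff)
  then show ?thesis by simp
qed

definition \<Gamma>2 :: "nat list set set" where
  "\<Gamma>2 = {\<gamma> \<in> multichains {1..n}. card \<gamma> \<ge> 2}"

text \<open>The functional of a single chain is the value of the bracket functional at the corresponding
  permutation, so it vanishes on the kernel; by \<open>brackets_coefficient\<close> it picks out the coefficient of
  that chain.\<close>

lemma kernel_dynkin: "{a \<in> X_space. dynkin a = 0} = fs.span (E ` \<Gamma>2)"
proof
  have "fs.subspace {a \<in> X_space. dynkin a = (0 :: _ \<Rightarrow> 'a)}"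
    using fs.subspace_inter[OF subspace_X fsp.linear_subspace_kernel[OF dynkin_linear]] by (simp add: Int_def)
  then show "fs.span (E ` \<Gamma>2) \<subseteq> {a \<in> X_space. dynkin a = (0 :: _ \<Rightarrow> 'a)}"
    by (intro fs.span_minimal) (auto simp: \<Gamma>2_def E_in_X dynkin_E_zero)
  show "{a \<in> X_space. dynkin a = (0 :: _ \<Rightarrow> 'a)} \<subseteq> fs.span (E ` \<Gamma>2)"
  proof
    fix a :: "(nat \<Rightarrow> nat) \<Rightarrow> 'a" assume a: "a \<in> {a \<in> X_space. dynkin a = 0}"
    have fin: "finite (multichains {1..n})" by (rule finite_multichains) simp
    have inj: "inj_on (E :: _ \<Rightarrow> _ \<Rightarrow> 'a) (multichains {1..n})"
      by (rule family_independent(1)[OF fin E_independent])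
    obtain u' where "a = (\<Sum>x\<in>E ` multichains {1..n}. fun_scale (u' x) x)"
      using a fin by (auto simp: X_span_E fs.span_finite)
    then obtain u where u: "a = (\<Sum>\<gamma>\<in>multichains {1..n}. fun_scale (u \<gamma>) (E \<gamma>))"
      by (simp only: sum.reindex[OF inj] o_def)
    have z: "u \<gamma> = 0" if g: "\<gamma> \<in> multichains {1..n}" "\<gamma> \<notin> \<Gamma>2" for \<gamma>
    proof -
      have "card \<gamma> = 1" using card_multichain_pos[OF g(1)] g by (simp add: \<Gamma>2_def)
      then obtain c where c: "\<gamma> = {c}" by (rule card_1_singletonE)
      have cw: "c \<in> words n" using g(1) multichainD(1)[OF g(1)] by (auto simp: c multichains_def words_def)
      have "u \<gamma> = brackets [c] (\<lambda>w. a (perm_of w))"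
        unfolding u
        by (rule brackets_coefficient[symmetric]) (use g(1) c card_multichain_pos in auto)
      also have "\<dots> = dynkin a (perm_of c)"
        unfolding dynkin_def word_perm_of[OF words_length[OF cw]] using perm_of_permutes[OF cw] by simp
      finally show ?thesis using a by simp
    qed
    have "a = (\<Sum>\<gamma>\<in>\<Gamma>2. fun_scale (u \<gamma>) (E \<gamma>))"
      unfolding u by (rule sum.mono_neutral_right[OF fin]) (auto simp: \<Gamma>2_def z)
    also have "\<dots> \<in> fs.span (E ` \<Gamma>2)"
      by (intro fs.span_sum fs.span_scale fs.span_base imageI)
    finally show "a \<in> fs.span (E ` \<Gamma>2)" .
  qed
qed

end

section \<open>The dimension of the Lie module\<close>

lemma card_lists_hd:
  assumes "s \<in> {1..n}"
  shows "card {c \<in> words n. hd c = s} = fact (n - 1)"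
proof -
  let ?B = "{1..n} - {s}"
  let ?L = "{xs. length xs = n - 1 \<and> distinct xs \<and> set xs \<subseteq> ?B}"
  have cB: "card ?B = n - 1" using assms by simp
  have "bij_betw ((#) s) ?L {c \<in> words n. hd c = s}"
  proof (rule bij_betw_byWitness[where f' = tl])
    show "(#) s ` ?L \<subseteq> {c \<in> words n. hd c = s}"
    proof
      fix c assume "c \<in> (#) s ` ?L"
      then obtain xs where xs: "c = s # xs" "length xs = n - 1" "distinct xs" "set xs \<subseteq> ?B" by blast
      then have "set xs = ?B" using cB distinct_card[of xs] by (intro card_subset_eq) auto
      moreover have "insert s ?B = {1..n}" using assms by blast
      ultimately have "set c = {1..n}" by (simp only: xs(1) list.set)
      moreover have "distinct c" using xs by auto
      ultimately show "c \<in> {c \<in> words n. hd c = s}" by (simp add: words_def xs(1))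
    qed
    show "tl ` {c \<in> words n. hd c = s} \<subseteq> ?L"
    proof
      fix xs assume "xs \<in> tl ` {c \<in> words n. hd c = s}"
      then obtain c where c: "c \<in> words n" "hd c = s" "xs = tl c" by blast
      have "length c = n" by (rule words_length[OF c(1)])
      then have "c \<noteq> []" using assms by auto
      then have "c = s # xs" using c by (metis list.collapse)
      then show "xs \<in> ?L" using c(1) \<open>length c = n\<close> by (auto simp: words_def)
    qed
    show "\<forall>c\<in>{c \<in> words n. hd c = s}. s # tl c = c"
    proof
      fix c assume c: "c \<in> {c \<in> words n. hd c = s}"
      then have "length c = n" using words_length by blast
      then have "c \<noteq> []" using assms by auto
      then show "s # tl c = c" using c by (metis (mono_tags) list.collapse mem_Collect_eq)
    qed
  qed simp
  then have "card {c \<in> words n. hd c = s} = card ?L" by (simp add: bij_betw_same_card)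
  also have "\<dots> = \<Prod>{card ?B - (n - 1) + 1..card ?B}"
    by (rule card_lists_distinct_length_eq) (simp_all only: cB finite_Diff finite_atLeastAtMost order_refl)
  also have "\<dots> = fact (n - 1)" unfolding cB by (simp add: fact_prod)
  finally show ?thesis .
qed

lemma independent_basis_elt:
  assumes "finite S"
  shows "independent_family (basis_elt :: 'g \<Rightarrow> 'g \<Rightarrow> 'f::field) S"
  unfolding independent_family_def
proof (intro allI impI ballI)
  fix u :: "'g \<Rightarrow> 'f" and \<gamma> assume 0: "(\<Sum>\<gamma>\<in>S. fun_scale (u \<gamma>) (basis_elt \<gamma>)) = 0" and g: "\<gamma> \<in> S"
  have "(\<Sum>\<gamma>\<in>S. fun_scale (u \<gamma>) (basis_elt \<gamma>)) \<gamma> = (\<Sum>\<delta>\<in>S. if \<delta> = \<gamma> then u \<gamma> else 0)"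
    unfolding sum_fun_apply by (intro sum.cong refl) (auto simp: fun_scale_def basis_elt_def)
  then show "u \<gamma> = 0" using 0 g assms by simp
qed

lemma dim_span_family:
  assumes "finite \<Gamma>" "independent_family E \<Gamma>"
  shows "fs.dim (fs.span (E ` \<Gamma>)) = card \<Gamma>"
  by (simp only: fs.dim_span_eq_card_independent[OF family_independent(2)[OF assms]]
      card_image[OF family_independent(1)[OF assms]])

context chains
begin

lemma card_perms_hd: "card {\<sigma>. \<sigma> permutes {1..n} \<and> \<sigma> 1 \<in> S} = card S * fact (n - 1)" if S: "S \<subseteq> {1..n}" for S
proof -
  have finS: "finite S" using S finite_subset by blast
  have "bij_betw (word n) {\<sigma>. \<sigma> permutes {1..n} \<and> \<sigma> 1 \<in> S} {c \<in> words n. hd c \<in> S}"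
  proof (rule bij_betw_byWitness[where f' = perm_of])
    show "\<forall>c\<in>{c \<in> words n. hd c \<in> S}. word n (perm_of c) = c"
      using word_perm_of words_length by blast
    show "\<forall>\<sigma>\<in>{\<sigma>. \<sigma> permutes {1..n} \<and> \<sigma> 1 \<in> S}. perm_of (word n \<sigma>) = \<sigma>"
      using perm_of_word by blast
    show "word n ` {\<sigma>. \<sigma> permutes {1..n} \<and> \<sigma> 1 \<in> S} \<subseteq> {c \<in> words n. hd c \<in> S}"
      using word_in_words hd_word by (intro image_subsetI) simp
    show "perm_of ` {c \<in> words n. hd c \<in> S} \<subseteq> {\<sigma>. \<sigma> permutes {1..n} \<and> \<sigma> 1 \<in> S}"
    proof (rule image_subsetI)
      fix c assume c: "c \<in> {c \<in> words n. hd c \<in> S}"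
      then have "word n (perm_of c) = c" using word_perm_of words_length by blast
      then have "perm_of c 1 = hd c" using hd_word[of "perm_of c"] by simp
      then show "perm_of c \<in> {\<sigma>. \<sigma> permutes {1..n} \<and> \<sigma> 1 \<in> S}" using c perm_of_permutes by auto
    qed
  qed
  then have "card {\<sigma>. \<sigma> permutes {1..n} \<and> \<sigma> 1 \<in> S} = card {c \<in> words n. hd c \<in> S}"
    by (rule bij_betw_same_card)
  also have "{c \<in> words n. hd c \<in> S} = (\<Union>s\<in>S. {c \<in> words n. hd c = s})" by auto
  also have "card \<dots> = (\<Sum>s\<in>S. card {c \<in> words n. hd c = s})"
  proof (rule card_UN_disjoint[OF finS])
    have "finite (words n)"
    proof (rule finite_subset)
      show "words n \<subseteq> {xs. set xs \<subseteq> {1..n} \<and> length xs = n}" using words_length by (auto simp: words_def)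
    qed (rule finite_lists_length_eq, simp)
    then show "\<forall>s\<in>S. finite {c \<in> words n. hd c = s}" by simp
  qed auto
  also have "\<dots> = (\<Sum>s\<in>S. fact (n - 1))" using S by (intro sum.cong refl card_lists_hd) blast
  finally show ?thesis by simp
qed

lemma fin_dim_X: "fin_dim (X_space :: ((nat \<Rightarrow> nat) \<Rightarrow> 'f::field) set)"
  unfolding fin_dim_def X_span_E using finite_multichains[of "{1..n}"] by blast

lemma X_span_basis: "X_space = fs.span (basis_elt ` {\<sigma>. \<sigma> permutes {1..n} \<and> \<sigma> 1 \<in> A})"
proof
  show "fs.span (basis_elt ` {\<sigma>. \<sigma> permutes {1..n} \<and> \<sigma> 1 \<in> A}) \<subseteq> X_space"
    by (rule fs.span_minimal[OF _ subspace_X]) (auto simp: X_space_def basis_elt_def split: if_splits)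
  show "X_space \<subseteq> fs.span (basis_elt ` {\<sigma>. \<sigma> permutes {1..n} \<and> \<sigma> 1 \<in> A})"
  proof
    fix a assume "a \<in> X_space"
    from X_expand[OF this] show "a \<in> fs.span (basis_elt ` {\<sigma>. \<sigma> permutes {1..n} \<and> \<sigma> 1 \<in> A})"
      by (rule ssubst) (intro fs.span_sum fs.span_scale fs.span_base imageI)
  qed
qed

lemma finite_X_perms: "finite {\<sigma>. \<sigma> permutes {1..n} \<and> \<sigma> 1 \<in> A}"
  using finite_perms by (rule rev_finite_subset) auto

lemma card_multichains: "card (multichains {1..n}) = card A * fact (n - 1)"
proof -
  have "fs.dim (X_space :: ((nat \<Rightarrow> nat) \<Rightarrow> rat) set) = card (multichains {1..n})"
    unfolding X_span_E by (rule dim_span_family[OF finite_multichains E_independent]) simp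
  moreover have "fs.dim (X_space :: ((nat \<Rightarrow> nat) \<Rightarrow> rat) set) = card A * fact (n - 1)"
    unfolding X_span_basis card_perms_hd[OF A_sub, symmetric]
    by (rule dim_span_family[OF finite_X_perms independent_basis_elt[OF finite_X_perms]])
  ultimately show ?thesis by simp
qed

lemma multichains_single: "multichains {1..n} - \<Gamma>2 = (\<lambda>c. {c}) ` {c \<in> words n. hd c = start A}"
proof
  show "multichains {1..n} - \<Gamma>2 \<subseteq> (\<lambda>c. {c}) ` {c \<in> words n. hd c = start A}"
  proof
    fix \<gamma> assume g: "\<gamma> \<in> multichains {1..n} - \<Gamma>2"
    then have "card \<gamma> = 1" using card_multichain_pos[of \<gamma>] by (auto simp: \<Gamma>2_def)
    then obtain c where c: "\<gamma> = {c}" by (rule card_1_singletonE)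
    have "set c = {1..n}" using g by (auto simp: c multichains_def)
    moreover from this have "A \<inter> set c = A" using A_sub by blast
    ultimately have "c \<in> words n" "hd c = start A"
      using multichainD(1,3)[of \<gamma> "{1..n}" c] g by (auto simp: c words_def)
    then show "\<gamma> \<in> (\<lambda>c. {c}) ` {c \<in> words n. hd c = start A}" using c by blast
  qed
  show "(\<lambda>c. {c}) ` {c \<in> words n. hd c = start A} \<subseteq> multichains {1..n} - \<Gamma>2"
  proof (rule image_subsetI)
    fix c assume c: "c \<in> {c \<in> words n. hd c = start A}"
    have "A \<inter> {1..n} = A" using A_sub by blast
    then show "{c} \<in> multichains {1..n} - \<Gamma>2"
      using c A_ne by (auto simp: multichains_def \<Gamma>2_def words_def)
  qed
qed

lemma start_A: "start A \<in> A"
  using start_in A_ne by blast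

lemma card_\<Gamma>2: "card \<Gamma>2 + fact (n - 1) = card A * fact (n - 1)"
proof -
  have fin: "finite (multichains {1..n})" by (rule finite_multichains) simp
  have "card (multichains {1..n} - \<Gamma>2) = fact (n - 1)"
    unfolding multichains_single using card_lists_hd[of "start A" n] start_A A_sub
    by (subst card_image) (auto simp: inj_on_def)
  moreover have "\<Gamma>2 \<subseteq> multichains {1..n}" by (auto simp: \<Gamma>2_def)
  ultimately show ?thesis
    using card_multichains card_Diff_subset[of \<Gamma>2 "multichains {1..n}"] fin card_mono[of "multichains {1..n}" \<Gamma>2]
    by (metis finite_subset le_add_diff_inverse)
qed

lemma finite_\<Gamma>2: "finite \<Gamma>2"
  by (rule finite_subset[OF _ finite_multichains[of "{1..n}"]]) (auto simp: \<Gamma>2_def)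

lemma E_independent_\<Gamma>2: "independent_family (E :: _ \<Rightarrow> _ \<Rightarrow> 'f::field) \<Gamma>2"
  unfolding independent_family_def
proof (intro allI impI ballI)
  fix u :: "_ \<Rightarrow> 'f" and \<gamma> assume 0: "(\<Sum>\<gamma>\<in>\<Gamma>2. fun_scale (u \<gamma>) (E \<gamma>)) = 0" and g: "\<gamma> \<in> \<Gamma>2"
  have fin: "finite (multichains {1..n})" by (rule finite_multichains) simp
  let ?u = "\<lambda>\<gamma>. if \<gamma> \<in> \<Gamma>2 then u \<gamma> else 0"
  have "(\<Sum>\<gamma>\<in>multichains {1..n}. fun_scale (?u \<gamma>) (E \<gamma>)) = (\<Sum>\<gamma>\<in>\<Gamma>2. fun_scale (?u \<gamma>) (E \<gamma>))"
    by (rule sum.mono_neutral_right[OF fin]) (auto simp: \<Gamma>2_def)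
  also have "\<dots> = 0" using 0 by (simp cong: sum.cong)
  finally have "?u \<gamma> = 0" by (rule independent_familyD[OF E_independent]) (use g in \<open>auto simp: \<Gamma>2_def\<close>)
  then show "u \<gamma> = 0" using g by simp
qed

lemma dim_dynkin_X: "fs.dim (dynkin ` X_space :: ((nat \<Rightarrow> nat) \<Rightarrow> 'f::field) set) = fact (n - 1)"
proof -
  have fin: "finite (multichains {1..n})" by (rule finite_multichains) simp
  have "fs.dim (dynkin ` X_space :: ((nat \<Rightarrow> nat) \<Rightarrow> 'f) set) + fs.dim {a \<in> X_space :: ((nat \<Rightarrow> nat) \<Rightarrow> 'f) set. dynkin a = 0} = fs.dim (X_space :: ((nat \<Rightarrow> nat) \<Rightarrow> 'f) set)"
    by (rule rank_nullity[OF dynkin_linear fin_dim_X subspace_X])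
  moreover have "fs.dim {a \<in> X_space :: ((nat \<Rightarrow> nat) \<Rightarrow> 'f) set. dynkin a = 0} = card \<Gamma>2"
    unfolding kernel_dynkin by (rule dim_span_family[OF finite_\<Gamma>2 E_independent_\<Gamma>2])
  moreover have "fs.dim (X_space :: ((nat \<Rightarrow> nat) \<Rightarrow> 'f) set) = card A * fact (n - 1)"
    unfolding X_span_E card_multichains[symmetric] by (rule dim_span_family[OF fin E_independent])
  ultimately show ?thesis using card_\<Gamma>2 by linarith
qed

text \<open>Modulo the kernel only the multichains with one chain remain.\<close>

lemma dynkin_X_single: "dynkin ` X_space = dynkin ` fs.span ((\<lambda>c. word_ind n (sub c)) ` {c \<in> words n. hd c = start A})"
proof -
  let ?S = "(\<lambda>c. word_ind n (sub c)) ` {c \<in> words n. hd c = start A} :: ((nat \<Rightarrow> nat) \<Rightarrow> 'a) set"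
  have single: "word_ind n (sub c) = E {c}" for c by (simp add: E_def)
  have im: "?S = E ` (multichains {1..n} - \<Gamma>2)"
    unfolding multichains_single image_image single by (rule refl)
  have "dynkin ` X_space = dynkin ` (fs.span (E ` multichains {1..n}) :: ((nat \<Rightarrow> nat) \<Rightarrow> 'a) set)" by (simp add: X_span_E)
  also have "\<dots> = fs.span (dynkin ` E ` multichains {1..n})" by (simp only: fsp.linear_span_image[OF dynkin_linear])
  also have "\<dots> = fs.span (dynkin ` E ` (multichains {1..n} - \<Gamma>2))"
  proof -
    have "dynkin ` E ` multichains {1..n} \<subseteq> insert (0 :: _ \<Rightarrow> 'a) (dynkin ` E ` (multichains {1..n} - \<Gamma>2))"
    proof
      fix y :: "_ \<Rightarrow> 'a" assume "y \<in> dynkin ` E ` multichains {1..n}"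
      then obtain \<gamma> where g: "\<gamma> \<in> multichains {1..n}" and y: "y = dynkin (E \<gamma>)" by blast
      show "y \<in> insert (0 :: _ \<Rightarrow> 'a) (dynkin ` E ` (multichains {1..n} - \<Gamma>2))"
      proof (cases "\<gamma> \<in> \<Gamma>2")
        case True
        then have "dynkin (E \<gamma>) = (0 :: _ \<Rightarrow> 'a)" by (intro dynkin_E_zero[OF g]) (simp add: \<Gamma>2_def)
        then show ?thesis using y by simp
      next
        case False
        then show ?thesis unfolding y using g by (intro insertI2 imageI) simp
      qed
    qed
    from fs.span_mono[OF this] have "fs.span (dynkin ` E ` multichains {1..n} :: ((nat \<Rightarrow> nat) \<Rightarrow> 'a) set) \<subseteq> fs.span (dynkin ` E ` (multichains {1..n} - \<Gamma>2))"
      by (simp only: fs.span_insert_0)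
    moreover have "fs.span (dynkin ` E ` (multichains {1..n} - \<Gamma>2)) \<subseteq> fs.span (dynkin ` E ` multichains {1..n} :: ((nat \<Rightarrow> nat) \<Rightarrow> 'a) set)"
      by (intro fs.span_mono image_mono) auto
    ultimately show ?thesis by blast
  qed
  also have "\<dots> = dynkin ` fs.span ?S" unfolding im by (simp only: fsp.linear_span_image[OF dynkin_linear])
  finally show ?thesis .
qed

text \<open>The whole group algebra is the space of this kind for \<open>{1..n}\<close> in place of \<open>A\<close>. By \<open>dynkin_X_single\<close> the
  image depends on the first letter prescribed for the full set only, and this letter can be chosen to
  be the same for both.\<close>

lemma Lie_carrier: "carrier (Lie n :: (_, (nat \<Rightarrow> nat) \<Rightarrow> 'f::field) module) = dynkin ` X_space"
proof -
  \<comment> \<open>the image depends on the value at the full set, which is taken from \<open>start A\<close>\<close>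
  define st' where "st' I = (if I = {1..n} then start A else Min I)" for I
  have "start A \<in> {1..n}" using start_A A_sub by blast
  then interpret full: chains n "{1..n}" st'
    using n_pos by unfold_locales (auto simp: st'_def intro!: Min_in dest: finite_subset)
  have "\<sigma> 1 \<in> {1..n}" if "\<sigma> permutes {1..n}" for \<sigma>
    using permutes_in_image[OF that, of 1] n_pos by simp
  then have "carrier (SA n) = (full.X_space :: ((nat \<Rightarrow> nat) \<Rightarrow> 'f) set)"
    unfolding full.X_space_def group_algebra_def Sym_def by auto
  then have "carrier (Lie n :: (_, (nat \<Rightarrow> nat) \<Rightarrow> 'f) module) = dynkin ` full.X_space"
    unfolding Lie_def Let_def using dynkin_eq by (auto simp: image_iff) metis+
  moreover have "full.dynkin = dynkin" by (simp add: fun_eq_iff full.dynkin_def dynkin_def)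
  moreover have "st' {1..n} = start A" by (simp add: st'_def)
  ultimately show ?thesis
    using full.dynkin_X_single[where 'a = 'f] dynkin_X_single[where 'a = 'f] by simp
qed

end

section \<open>Invariants of the Lie module under a group that permutes the multichains\<close>

lemma bracket_map: "bracket (map h v) f = bracket v (\<lambda>u. f (map h u))"
  by (induction v "\<lambda>u. f (map h u)" arbitrary: f rule: bracket.induct) simp_all

lemma word_comp: "word n (g \<circ> \<sigma>) = map g (word n \<sigma>)"
  by (simp add: word_def)

lemma sub_map:
  assumes "bij g"
  shows "sub c (map (inv_into UNIV g) w) \<longleftrightarrow> sub (map g c) w"
proof -
  let ?i = "inv_into UNIV g"
  have gi: "g (?i x) = x" "?i (g x) = x" for x
    using assms by (simp_all add: bij_def surj_f_inv_f inv_f_f)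
  have mem: "?i x \<in> set c \<longleftrightarrow> x \<in> set (map g c)" for x
    using gi by (metis image_eqI image_iff list.set_map)
  have "filter (\<lambda>x. x \<in> set c) (map ?i w) = map ?i (filter (\<lambda>x. x \<in> set (map g c)) w)"
    unfolding filter_map o_def mem by (rule refl)
  moreover have "map ?i y = c \<longleftrightarrow> y = map g c" for y
    by (auto simp: gi o_def)
  ultimately show ?thesis by (simp only: sub_def)
qed

text \<open>Right multiplication by \<open>g\<close> in the group algebra, on coefficient functions.\<close>

definition rtrans :: "(nat \<Rightarrow> nat) \<Rightarrow> ((nat \<Rightarrow> nat) \<Rightarrow> 'f::field) \<Rightarrow> (nat \<Rightarrow> nat) \<Rightarrow> 'f" where
  "rtrans g x = (\<lambda>\<sigma>. x (inv_into UNIV g \<circ> \<sigma>))"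

text \<open>Equivariance of \<open>start\<close> is required for proper subsets of \<open>A\<close> only. For \<open>A\<close> itself it would force a fixed
  point, but multichains with at least two chains involve proper subsets only.\<close>

locale lie_action = chains +
  fixes P :: "(nat \<Rightarrow> nat) set"
  assumes subgroup_P: "subgroup P (Sym n)"
    and A_stable: "g \<in> P \<Longrightarrow> g ` A = A"
    and start_equivariant: "\<lbrakk>g \<in> P; I \<subset> A; I \<noteq> {}\<rbrakk> \<Longrightarrow> start (g ` I) = g (start I)"
begin

abbreviation "GP \<equiv> Sym n\<lparr>carrier := P\<rparr>"

lemma P_permutes: "g \<in> P \<Longrightarrow> g permutes {1..n}"
  using subgroup.subset[OF subgroup_P] by (auto simp: Sym_def)

lemma P_id: "id \<in> P"
  using subgroup.one_closed[OF subgroup_P] by (simp add: Sym_def)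

lemma P_comp: "g \<in> P \<Longrightarrow> h \<in> P \<Longrightarrow> h \<circ> g \<in> P"
  using subgroup.m_closed[OF subgroup_P, of g h] by (simp add: Sym_def)

lemma P_inv: "g \<in> P \<Longrightarrow> inv_into UNIV g \<in> P"
  using subgroup.m_inv_closed[OF subgroup_P, of g] inv_Sym[OF P_permutes] by simp

lemma finite_P: "finite P"
  by (rule finite_subset[OF _ finite_perms]) (use P_permutes in blast)

lemma bij_P: "g \<in> P \<Longrightarrow> bij g"
  using P_permutes permutes_bij by blast

lemma inv_P_permutes: "g \<in> P \<Longrightarrow> inv_into UNIV g permutes {1..n}"
  using P_permutes permutes_inv by blast

lemma GP_simps: "carrier GP = P" "g \<otimes>\<^bsub>GP\<^esub> h = h \<circ> g" "\<one>\<^bsub>GP\<^esub> = id"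
  by (simp_all add: Sym_def)

lemma group_GP: "group GP"
  by (rule subgroup.subgroup_is_group[OF subgroup_P group_Sym])

sublocale R: group_rep GP "rtrans :: _ \<Rightarrow> ((nat \<Rightarrow> nat) \<Rightarrow> 'f::field) \<Rightarrow> _"
proof (intro group_rep.intro group_GP group_rep_axioms.intro)
  fix g h and x y :: "(nat \<Rightarrow> nat) \<Rightarrow> 'f" and c :: 'f
  show "finite (carrier GP)" using finite_P by (simp add: GP_simps)
  show "rtrans g (x + y) = rtrans g x + rtrans g y" by (simp add: rtrans_def fun_eq_iff)
  show "rtrans g (fun_scale c x) = fun_scale c (rtrans g x)" by (simp add: rtrans_def fun_scale_def)
  show "rtrans \<one>\<^bsub>GP\<^esub> x = x" by (simp only: rtrans_def GP_simps inv_id id_comp)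
  show "rtrans (g \<otimes>\<^bsub>GP\<^esub> h) x = rtrans h (rtrans g x)" if "g \<in> carrier GP" "h \<in> carrier GP"
    using that o_inv_distrib[OF bij_P bij_P, of h g] unfolding rtrans_def GP_simps by (simp only: o_assoc)
qed

lemma perm_comp_iff: "g \<in> P \<Longrightarrow> inv_into UNIV g \<circ> \<sigma> permutes {1..n} \<longleftrightarrow> \<sigma> permutes {1..n}"
proof
  assume g: "g \<in> P"
  show "\<sigma> permutes {1..n}" if s: "inv_into UNIV g \<circ> \<sigma> permutes {1..n}"
  proof -
    have "g \<circ> (inv_into UNIV g \<circ> \<sigma>) permutes {1..n}" by (rule permutes_compose[OF s P_permutes[OF g]])
    then show ?thesis using permutes_inv_o(1)[OF P_permutes[OF g]] by (simp only: o_assoc id_comp)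
  qed
  show "inv_into UNIV g \<circ> \<sigma> permutes {1..n}" if "\<sigma> permutes {1..n}"
    by (rule permutes_compose[OF that inv_P_permutes[OF g]])
qed

lemma rtrans_E: "g \<in> P \<Longrightarrow> rtrans g (E \<gamma>) = E (map g ` \<gamma>)"
proof
  fix \<sigma> assume g: "g \<in> P"
  have "(\<forall>c\<in>\<gamma>. sub c (word n (inv_into UNIV g \<circ> \<sigma>))) \<longleftrightarrow> (\<forall>c\<in>map g ` \<gamma>. sub c (word n \<sigma>))"
    unfolding word_comp using sub_map[OF bij_P[OF g]] by simp
  then show "rtrans g (E \<gamma>) \<sigma> = E (map g ` \<gamma>) \<sigma>"
    unfolding rtrans_def E_def word_ind_def perm_comp_iff[OF g] by simp
qed

lemma dynkin_rtrans: "g \<in> P \<Longrightarrow> dynkin (rtrans g a) = rtrans g (dynkin a)"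
proof
  fix \<sigma> assume g: "g \<in> P"
  show "dynkin (rtrans g a) \<sigma> = rtrans g (dynkin a) \<sigma>"
  proof (cases "\<sigma> permutes {1..n}")
    case True
    have "rtrans g (dynkin a) \<sigma> = bracket (rev (word n \<sigma>)) (\<lambda>u. a (perm_of (map (inv_into UNIV g) u)))"
      using True unfolding rtrans_def dynkin_def perm_comp_iff[OF g] word_comp rev_map bracket_map by simp
    also have "\<dots> = bracket (rev (word n \<sigma>)) (\<lambda>u. a (inv_into UNIV g \<circ> perm_of u))"
    proof (rule bracket_cong)
      fix u assume "mset u = mset (rev (word n \<sigma>))"
      then have len: "length u = n" by (metis length_rev length_word size_mset)
      have "perm_of (map (inv_into UNIV g) u) i = (inv_into UNIV g \<circ> perm_of u) i" for i
        using len permutes_not_in[OF inv_P_permutes[OF g], of i] by (cases "i \<in> {1..n}") (auto simp: perm_of_def)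
      then have "perm_of (map (inv_into UNIV g) u) = inv_into UNIV g \<circ> perm_of u" by (rule ext)
      then show "a (perm_of (map (inv_into UNIV g) u)) = a (inv_into UNIV g \<circ> perm_of u)" by simp
    qed
    finally show ?thesis using True unfolding dynkin_def rtrans_def by simp
  next
    case False
    then show ?thesis unfolding dynkin_def rtrans_def perm_comp_iff[OF g] by simp
  qed
qed

text \<open>Since there are two chains, the \<open>A\<close>-part of every chain is a proper subset, so the translated chain
  again starts at the prescribed letter.\<close>

lemma map_multichain:
  assumes g: "g \<in> P" and c: "\<gamma> \<in> \<Gamma>2"
  shows "map g ` \<gamma> \<in> \<Gamma>2"
proof -
  have gm: "\<gamma> \<in> multichains {1..n}" and card: "card \<gamma> \<ge> 2" using c by (simp_all add: \<Gamma>2_def)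
  have inj: "inj g" using bij_P[OF g] by (simp add: bij_def)
  have int: "A \<inter> g ` S = g ` (A \<inter> S)" for S
    using A_stable[OF g] image_Int[OF inj, of A S] by simp
  have proper: "A \<inter> set x \<subset> A" if x: "x \<in> \<gamma>" for x
  proof -
    have "\<gamma> \<noteq> {x}" using card by auto
    then obtain y where y: "y \<in> \<gamma>" "y \<noteq> x" using x by blast
    have "hd y \<in> set y" "hd y \<in> A" using multichainD(4,5)[OF gm y(1)] by auto
    moreover from this have "hd y \<notin> set x" using multichain_disjoint[OF gm y(1) x] y(2) by blast
    ultimately show ?thesis by blast
  qed
  have "map g ` \<gamma> \<in> multichains {1..n}"
    unfolding multichains_def mem_Collect_eq
  proof (intro conjI ballI impI)
    fix y assume "y \<in> map g ` \<gamma>"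
    then obtain x where x: "x \<in> \<gamma>" "y = map g x" by blast
    note m = multichainD[OF gm x(1)]
    show "distinct y" using m(1) x(2) inj_on_subset[OF inj subset_UNIV] by (simp add: distinct_map)
    show "A \<inter> set y \<noteq> {}" using m(2) by (simp add: x(2) int)
    have "hd y = g (hd x)" using m(4) by (simp add: x(2) hd_map)
    also have "\<dots> = start (A \<inter> set y)"
      using start_equivariant[OF g proper[OF x(1)] m(2)] m(3) by (simp add: x(2) int)
    finally show "hd y = start (A \<inter> set y)" .
  next
    fix y y' assume "y \<in> map g ` \<gamma>" "y' \<in> map g ` \<gamma>" and ne: "y \<noteq> y'"
    then obtain x x' where x: "x \<in> \<gamma>" "y = map g x" and x': "x' \<in> \<gamma>" "y' = map g x'" by blast
    then have "x \<noteq> x'" using ne by blast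
    then have "set x \<inter> set x' = {}" using multichain_disjoint[OF gm x(1) x'(1)] by blast
    then show "set y \<inter> set y' = {}" using image_Int[OF inj, of "set x" "set x'"] by (simp add: x(2) x'(2))
  next
    have "\<Union> (set ` map g ` \<gamma>) = g ` \<Union> (set ` \<gamma>)" by (auto simp: image_iff)
    also have "\<dots> = g ` {1..n}" using gm by (simp only: multichains_def mem_Collect_eq)
    also have "\<dots> = {1..n}" by (rule permutes_image[OF P_permutes[OF g]])
    finally show "\<Union> (set ` map g ` \<gamma>) = {1..n}" .
  qed
  moreover have "card (map g ` \<gamma>) = card \<gamma>"
    using inj by (intro card_image) (simp add: inj_on_def inj_map_eq_map)
  ultimately show ?thesis using card by (simp add: \<Gamma>2_def)
qed

lemma rtrans_X: "g \<in> P \<Longrightarrow> x \<in> X_space \<Longrightarrow> rtrans g x \<in> X_space"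
proof -
  assume g: "g \<in> P" and x: "x \<in> X_space"
  have "\<sigma> permutes {1..n} \<and> \<sigma> 1 \<in> A" if nz: "x (inv_into UNIV g \<circ> \<sigma>) \<noteq> 0" for \<sigma>
  proof -
    have "inv_into UNIV g \<circ> \<sigma> permutes {1..n} \<and> (inv_into UNIV g \<circ> \<sigma>) 1 \<in> A"
      using x nz unfolding X_space_def by blast
    then have s: "inv_into UNIV g \<circ> \<sigma> permutes {1..n}" "inv_into UNIV g (\<sigma> 1) \<in> A" by auto
    have "g (inv_into UNIV g (\<sigma> 1)) = \<sigma> 1" using bij_P[OF g] by (simp add: bij_def surj_f_inv_f)
    then show ?thesis using s perm_comp_iff[OF g] A_stable[OF g] by (metis imageI)
  qed
  then show ?thesis by (simp add: X_space_def rtrans_def)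
qed

text \<open>The group acts freely on words, so every invariant is constant on regular orbits and thus a norm.\<close>

lemma nrm_X: "R.nrm ` X_space = {v \<in> X_space :: ((nat \<Rightarrow> nat) \<Rightarrow> 'f::field) set. R.fixed v}"
proof
  show "R.nrm ` X_space \<subseteq> {v \<in> X_space :: ((nat \<Rightarrow> nat) \<Rightarrow> 'f) set. R.fixed v}"
  proof
    fix y :: "(nat \<Rightarrow> nat) \<Rightarrow> 'f" assume "y \<in> R.nrm ` X_space"
    then obtain x where x: "x \<in> X_space" "y = R.nrm x" by blast
    have "R.nrm x \<in> X_space"
      unfolding R.nrm_def GP_simps by (rule fs.subspace_sum[OF subspace_X rtrans_X[OF _ x(1)]])
    then show "y \<in> {v \<in> X_space. R.fixed v}" using R.fixed_nrm x(2) by simp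
  qed
  show "{v \<in> X_space :: ((nat \<Rightarrow> nat) \<Rightarrow> 'f) set. R.fixed v} \<subseteq> R.nrm ` X_space"
  proof
    fix v :: "(nat \<Rightarrow> nat) \<Rightarrow> 'f" assume v: "v \<in> {v \<in> X_space. R.fixed v}"
    define orb where "orb \<sigma> = (\<lambda>g. inv_into UNIV g \<circ> \<sigma>) ` P" for \<sigma> :: "nat \<Rightarrow> nat"
    define rep where "rep \<sigma> = (SOME \<tau>. \<tau> \<in> orb \<sigma>)" for \<sigma>
    define x where "x \<sigma> = (if rep \<sigma> = \<sigma> then v \<sigma> else 0)" for \<sigma>
    have orb_eq: "orb (inv_into UNIV g \<circ> \<sigma>) = orb \<sigma>" if g: "g \<in> P" for g \<sigma>
    proof
      show "orb (inv_into UNIV g \<circ> \<sigma>) \<subseteq> orb \<sigma>"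
      proof
        fix \<tau> assume "\<tau> \<in> orb (inv_into UNIV g \<circ> \<sigma>)"
        then obtain h where h: "h \<in> P" "\<tau> = inv_into UNIV h \<circ> (inv_into UNIV g \<circ> \<sigma>)" unfolding orb_def by blast
        then have "\<tau> = inv_into UNIV (g \<circ> h) \<circ> \<sigma>"
          using o_inv_distrib[OF bij_P[OF g] bij_P[OF h(1)]] by (simp only: o_assoc)
        then show "\<tau> \<in> orb \<sigma>" using P_comp[OF h(1) g] unfolding orb_def by blast
      qed
      show "orb \<sigma> \<subseteq> orb (inv_into UNIV g \<circ> \<sigma>)"
      proof
        fix \<tau> assume "\<tau> \<in> orb \<sigma>"
        then obtain h where h: "h \<in> P" "\<tau> = inv_into UNIV h \<circ> \<sigma>" unfolding orb_def by blast
        let ?k = "inv_into UNIV g \<circ> h"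
        have k: "?k \<in> P" by (rule P_comp[OF h(1) P_inv[OF g]])
        have "inv_into UNIV ?k = inv_into UNIV h \<circ> g"
          using o_inv_distrib[OF bij_P[OF P_inv[OF g]] bij_P[OF h(1)]] inv_inv_eq[OF bij_P[OF g]] by simp
        then have "inv_into UNIV ?k \<circ> (inv_into UNIV g \<circ> \<sigma>) = inv_into UNIV h \<circ> (g \<circ> inv_into UNIV g) \<circ> \<sigma>"
          by (simp only: o_assoc)
        also have "\<dots> = \<tau>" unfolding permutes_inv_o(1)[OF P_permutes[OF g]] h(2) by simp
        finally show "\<tau> \<in> orb (inv_into UNIV g \<circ> \<sigma>)" using k unfolding orb_def by (metis image_eqI)
      qed
    qed
    have x_X: "x \<in> X_space" using v by (auto simp: X_space_def x_def)
    have "R.nrm x \<sigma> = v \<sigma>" for \<sigma>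
    proof (cases "\<sigma> permutes {1..n}")
      case s: True
      have "inv_into UNIV id \<circ> \<sigma> \<in> orb \<sigma>" unfolding orb_def using P_id by (rule imageI)
      then have "rep \<sigma> \<in> orb \<sigma>" unfolding rep_def by (rule someI[of "\<lambda>\<tau>. \<tau> \<in> orb \<sigma>"])
      then obtain g0 where g0: "g0 \<in> P" "rep \<sigma> = inv_into UNIV g0 \<circ> \<sigma>" unfolding orb_def by blast
      have rep_g: "rep (inv_into UNIV g \<circ> \<sigma>) = inv_into UNIV g \<circ> \<sigma> \<longleftrightarrow> g = g0" if g: "g \<in> P" for g
      proof -
        have r: "rep (inv_into UNIV g \<circ> \<sigma>) = inv_into UNIV g0 \<circ> \<sigma>"
          unfolding g0(2)[symmetric] by (simp only: rep_def orb_eq[OF g])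
        moreover have "g = g0" if eq: "inv_into UNIV g0 \<circ> \<sigma> = inv_into UNIV g \<circ> \<sigma>"
        proof -
          have "inv_into UNIV g0 \<circ> (\<sigma> \<circ> inv_into UNIV \<sigma>) = inv_into UNIV g \<circ> (\<sigma> \<circ> inv_into UNIV \<sigma>)"
            unfolding o_assoc eq by (rule refl)
          then have "inv_into UNIV g0 = inv_into UNIV g" unfolding permutes_inv_o(1)[OF s] by simp
          then show ?thesis using inv_inv_eq[OF bij_P[OF g]] inv_inv_eq[OF bij_P[OF g0(1)]] by metis
        qed
        ultimately show ?thesis by metis
      qed
      have "R.nrm x \<sigma> = (\<Sum>g\<in>P. x (inv_into UNIV g \<circ> \<sigma>))"
        unfolding R.nrm_def GP_simps sum_fun_apply rtrans_def by (rule refl)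
      also have "\<dots> = (\<Sum>g\<in>P. if g = g0 then v (inv_into UNIV g0 \<circ> \<sigma>) else 0)"
        unfolding x_def by (intro sum.cong refl) (simp add: rep_g)
      also have "\<dots> = rtrans g0 v \<sigma>" using g0(1) finite_P by (simp add: rtrans_def)
      also have "\<dots> = v \<sigma>" using v g0(1) by (simp add: R.fixed_def GP_simps)
      finally show ?thesis .
    next
      case False
      then have "x (inv_into UNIV g \<circ> \<sigma>) = 0" if "g \<in> P" for g
        using perm_comp_iff[OF that] x_X unfolding X_space_def by blast
      then have "R.nrm x \<sigma> = 0" unfolding R.nrm_def GP_simps sum_fun_apply rtrans_def by simp
      moreover have "v \<sigma> = 0" using v False unfolding X_space_def by blast
      ultimately show ?thesis by simp
    qed
    then have "R.nrm x = v" by (rule ext)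
    then show "v \<in> R.nrm ` X_space" using x_X by blast
  qed
qed

lemma nrm_dynkin: "R.nrm (dynkin a) = dynkin (R.nrm a)"
  unfolding R.nrm_def GP_simps fsp.linear_sum[OF dynkin_linear] by (intro sum.cong refl dynkin_rtrans[symmetric])

text \<open>The image of the norm is the image of the invariants of \<open>X_space\<close>, so its dimension is the difference
  of two dimensions of invariants, on \<open>X_space\<close> and on the kernel. Both are orbit counts, and the terms
  of the unit element contribute \<open>card A * (n - 1)!\<close> and \<open>(card A - 1) * (n - 1)!\<close>.\<close>

theorem dim_nrm_Lie:
  "card P * fs.dim (R.nrm ` dynkin ` X_space :: ((nat \<Rightarrow> nat) \<Rightarrow> 'f::field) set) +
     (\<Sum>g\<in>P - {id}. card {\<gamma> \<in> \<Gamma>2. map g ` \<gamma> = \<gamma>}) = fact (n - 1)"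
proof -
  let ?X = "X_space :: ((nat \<Rightarrow> nat) \<Rightarrow> 'f) set"
  let ?XP = "{v \<in> ?X. R.fixed v}"
  let ?f = "\<Sum>g\<in>P - {id}. card {\<gamma> \<in> \<Gamma>2. map g ` \<gamma> = \<gamma>}"
  have ord: "order GP = card P" by (simp add: order_def GP_simps)
  have "fs.subspace {v :: (nat \<Rightarrow> nat) \<Rightarrow> 'f. R.fixed v}"
    unfolding fs.subspace_def R.fixed_def mem_Collect_eq
    by (intro conjI ballI allI impI) (simp_all only: R.T_zero R.T_add R.T_scale mem_Collect_eq)
  from fs.subspace_inter[OF subspace_X this] have sub_XP: "fs.subspace ?XP" by (simp add: Int_def)
  have nrm_eq: "R.nrm ` dynkin ` ?X = dynkin ` ?XP"
    unfolding nrm_X[symmetric] image_image nrm_dynkin by (rule refl)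
  have rn: "fs.dim (dynkin ` ?XP) + fs.dim {a \<in> ?XP. dynkin a = 0} = fs.dim ?XP"
    by (rule rank_nullity[OF dynkin_linear fin_dim_mono[OF fin_dim_X] sub_XP]) blast
  have dim_XP: "fs.dim ?XP * card P = card A * fact (n - 1)"
  proof -
    let ?S = "{\<sigma>. \<sigma> permutes {1..n} \<and> \<sigma> 1 \<in> A}"
    have "fs.dim {v \<in> fs.span (basis_elt ` ?S :: ((nat \<Rightarrow> nat) \<Rightarrow> 'f) set). R.fixed v} * order GP
        = (\<Sum>g\<in>carrier GP. card {\<sigma> \<in> ?S. g \<circ> \<sigma> = \<sigma>})"
    proof (rule R.dim_fixed_span[OF finite_X_perms independent_basis_elt[OF finite_X_perms]])
      fix g \<sigma> assume "g \<in> carrier GP" and s: "\<sigma> \<in> ?S"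
      then have g: "g \<in> P" by (simp add: GP_simps)
      have "g \<circ> \<sigma> permutes {1..n}" using permutes_compose[OF _ P_permutes[OF g]] s by blast
      moreover have "g (\<sigma> 1) \<in> A" using A_stable[OF g] s by blast
      ultimately show "g \<circ> \<sigma> \<in> ?S" by simp
      have "inv_into UNIV g \<circ> \<tau> = \<sigma> \<longleftrightarrow> \<tau> = g \<circ> \<sigma>" for \<tau>
      proof
        assume "inv_into UNIV g \<circ> \<tau> = \<sigma>"
        then have "g \<circ> \<sigma> = (g \<circ> inv_into UNIV g) \<circ> \<tau>" by (simp only: o_assoc[symmetric])
        then show "\<tau> = g \<circ> \<sigma>" using permutes_inv_o(1)[OF P_permutes[OF g]] by simp
      next
        assume "\<tau> = g \<circ> \<sigma>"
        then show "inv_into UNIV g \<circ> \<tau> = \<sigma>"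
          using permutes_inv_o(2)[OF P_permutes[OF g]] by (simp only: o_assoc id_comp)
      qed
      then show "rtrans g (basis_elt \<sigma> :: _ \<Rightarrow> 'f) = basis_elt (g \<circ> \<sigma>)"
        by (simp add: rtrans_def basis_elt_def)
    qed
    also have "(\<Sum>g\<in>carrier GP. card {\<sigma> \<in> ?S. g \<circ> \<sigma> = \<sigma>}) = (\<Sum>g\<in>P. if g = id then card ?S else 0)"
      unfolding GP_simps
    proof (rule sum.cong[OF refl])
      fix g assume g: "g \<in> P"
      have "g = id" if s: "\<sigma> permutes {1..n}" "g \<circ> \<sigma> = \<sigma>" for \<sigma>
      proof -
        have "g \<circ> (\<sigma> \<circ> inv_into UNIV \<sigma>) = \<sigma> \<circ> inv_into UNIV \<sigma>" unfolding o_assoc s(2) by (rule refl)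
        then show ?thesis unfolding permutes_inv_o(1)[OF s(1)] by simp
      qed
      then have "{\<sigma> \<in> ?S. g \<circ> \<sigma> = \<sigma>} = (if g = id then ?S else {})" by auto
      then show "card {\<sigma> \<in> ?S. g \<circ> \<sigma> = \<sigma>} = (if g = id then card ?S else 0)" by simp
    qed
    also have "\<dots> = card A * fact (n - 1)" using P_id finite_P card_perms_hd[OF A_sub] by simp
    finally show ?thesis by (simp only: X_span_basis ord)
  qed
  have dim_ker: "fs.dim {a \<in> ?XP. dynkin a = 0} * card P = card \<Gamma>2 + ?f"
  proof -
    have ker: "{a \<in> ?XP. dynkin a = 0} = {v \<in> fs.span (E ` \<Gamma>2). R.fixed v}"
      unfolding kernel_dynkin[symmetric] by blast
    have "fs.dim {v \<in> fs.span ((E :: _ \<Rightarrow> _ \<Rightarrow> 'f) ` \<Gamma>2). R.fixed v} * order GP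
        = (\<Sum>g\<in>carrier GP. card {\<gamma> \<in> \<Gamma>2. map g ` \<gamma> = \<gamma>})"
      by (rule R.dim_fixed_span[OF finite_\<Gamma>2 E_independent_\<Gamma>2])
        (simp_all only: GP_simps map_multichain rtrans_E)
    also have "\<dots> = card \<Gamma>2 + ?f"
      unfolding GP_simps sum.remove[OF finite_P P_id] by simp
    finally show ?thesis by (simp only: ker ord)
  qed
  have "card P * fs.dim (dynkin ` ?XP) + (card \<Gamma>2 + ?f) = card A * fact (n - 1)"
    unfolding dim_ker[symmetric] dim_XP[symmetric] rn[symmetric] by (simp add: algebra_simps)
  then have "card P * fs.dim (dynkin ` ?XP) + ?f = fact (n - 1)"
    using card_\<Gamma>2 by linarith
  then show ?thesis by (simp only: nrm_eq)
qed

lemma act_eq_mult: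
  fixes a x :: "(nat \<Rightarrow> nat) \<Rightarrow> 'f::field"
  assumes a: "a \<in> carrier (group_algebra GP)" and x: "x \<in> carrier (SA n)"
  shows "x \<otimes>\<^bsub>SA n\<^esub> a = R.act a x"
proof
  fix \<sigma>
  interpret S: group "Sym n" by (rule group_Sym)
  have a0: "a g = 0" if "g \<notin> P" for g using a that by (auto simp: group_algebra_def)
  have act: "R.act a x \<sigma> = (\<Sum>k\<in>P. a k * x (inv_into UNIV k \<circ> \<sigma>))"
    unfolding R.act_def GP_simps sum_fun_apply rtrans_def fun_scale_def by (rule refl)
  show "(x \<otimes>\<^bsub>SA n\<^esub> a) \<sigma> = R.act a x \<sigma>"
  proof (cases "\<sigma> \<in> carrier (Sym n)")
    case s: True
    have "(x \<otimes>\<^bsub>SA n\<^esub> a) \<sigma> = (\<Sum>h\<in>carrier (Sym n). x h * a (inv\<^bsub>Sym n\<^esub> h \<otimes>\<^bsub>Sym n\<^esub> \<sigma>))"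
      by (rule group_algebra_mult_eq[OF group_Sym s])
    also have "\<dots> = (\<Sum>k\<in>carrier (Sym n). x (\<sigma> \<otimes>\<^bsub>Sym n\<^esub> inv\<^bsub>Sym n\<^esub> k) * a k)"
      by (rule sum.reindex_bij_witness[of _ "\<lambda>k. \<sigma> \<otimes>\<^bsub>Sym n\<^esub> inv\<^bsub>Sym n\<^esub> k" "\<lambda>h. inv\<^bsub>Sym n\<^esub> h \<otimes>\<^bsub>Sym n\<^esub> \<sigma>"])
        (use s in \<open>auto simp: S.inv_mult_group S.m_assoc[symmetric]\<close>, auto simp: S.m_assoc)
    also have "\<dots> = (\<Sum>k\<in>P. x (\<sigma> \<otimes>\<^bsub>Sym n\<^esub> inv\<^bsub>Sym n\<^esub> k) * a k)"
      by (rule sum.mono_neutral_right[OF finite_carrier_Sym subgroup.subset[OF subgroup_P]]) (auto simp: a0)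
    also have "\<dots> = R.act a x \<sigma>"
      unfolding act
    proof (rule sum.cong[OF refl])
      fix k assume k: "k \<in> P"
      have "\<sigma> \<otimes>\<^bsub>Sym n\<^esub> inv\<^bsub>Sym n\<^esub> k = inv_into UNIV k \<circ> \<sigma>"
        unfolding inv_Sym[OF P_permutes[OF k]] by (simp add: Sym_def)
      then show "x (\<sigma> \<otimes>\<^bsub>Sym n\<^esub> inv\<^bsub>Sym n\<^esub> k) * a k = a k * x (inv_into UNIV k \<circ> \<sigma>)" by simp
    qed
    finally show ?thesis .
  next
    case False
    then have "(x \<otimes>\<^bsub>SA n\<^esub> a) \<sigma> = 0"
      by (auto simp: group_algebra_def intro!: sum.neutral)
    moreover have "x (inv_into UNIV k \<circ> \<sigma>) = 0" if "k \<in> P" for k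
      using False perm_comp_iff[OF that, of \<sigma>] x by (simp add: Sym_def group_algebra_def)
    ultimately show ?thesis unfolding act by simp
  qed
qed

end

section \<open>The rotation of the last block\<close>

locale rotation =
  fixes p b :: nat
  assumes prime_p: "prime p"
begin

definition A :: "nat set" where "A = {b + 1..b + p}"

definition \<zeta> :: "nat \<Rightarrow> nat" where
  "\<zeta> x = (if x \<in> A then if x = b + p then b + 1 else x + 1 else x)"

lemma p_pos: "p > 0"
  using prime_p prime_gt_0_nat by blast

lemma A_repr: "x \<in> A \<longleftrightarrow> (\<exists>r<p. x = b + 1 + r)"
  unfolding A_def by (auto intro!: exI[of _ "x - (b + 1)"])

lemma zeta_outside: "x \<notin> A \<Longrightarrow> (\<zeta> ^^ i) x = x"
  by (induction i) (auto simp: \<zeta>_def)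

lemma zeta_step: "r < p \<Longrightarrow> \<zeta> (b + 1 + r) = b + 1 + (r + 1) mod p"
  using A_repr[of "b + 1 + r"] by (auto simp: \<zeta>_def mod_if)

lemma zeta_pow: "r < p \<Longrightarrow> (\<zeta> ^^ i) (b + 1 + r) = b + 1 + (r + i) mod p"
proof (induction i)
  case (Suc i)
  have "(\<zeta> ^^ Suc i) (b + 1 + r) = \<zeta> (b + 1 + (r + i) mod p)" using Suc by simp
  also have "\<dots> = b + 1 + ((r + i) mod p + 1) mod p" using p_pos by (intro zeta_step) simp
  also have "((r + i) mod p + 1) mod p = (r + Suc i) mod p" by (simp add: mod_Suc_eq)
  finally show ?case .
qed simp

lemma zeta_pow_A: "x \<in> A \<Longrightarrow> (\<zeta> ^^ i) x \<in> A"
proof -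
  assume "x \<in> A"
  then obtain r where "r < p" "x = b + 1 + r" using A_repr by blast
  then have "(\<zeta> ^^ i) x = b + 1 + (r + i) mod p" using zeta_pow by simp
  then show ?thesis using A_repr p_pos mod_less_divisor by blast
qed

lemma zeta_pow_cong: "i mod p = j mod p \<Longrightarrow> \<zeta> ^^ i = \<zeta> ^^ j"
proof
  fix x assume ij: "i mod p = j mod p"
  show "(\<zeta> ^^ i) x = (\<zeta> ^^ j) x"
  proof (cases "x \<in> A")
    case True
    then obtain r where "r < p" "x = b + 1 + r" using A_repr by blast
    moreover have "(r + i) mod p = (r + j) mod p" using ij by (metis mod_add_right_eq)
    ultimately show ?thesis using zeta_pow by simp
  qed (simp add: zeta_outside)
qed

lemma zeta_pow_p: "\<zeta> ^^ (p * i) = id"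
  using zeta_pow_cong[of "p * i" 0] by simp

lemma zeta_pow_fix: "x \<in> A \<Longrightarrow> (\<zeta> ^^ i) x = x \<longleftrightarrow> p dvd i"
proof -
  assume "x \<in> A"
  then obtain r where r: "r < p" "x = b + 1 + r" using A_repr by blast
  show ?thesis
  proof
    assume "(\<zeta> ^^ i) x = x"
    then have "(r + i) mod p = (r + 0) mod p" using zeta_pow[OF r(1)] r by simp
    then show "p dvd i" using mod_eq_dvd_iff_nat[of "r + 0" "r + i" p] by simp
  next
    assume "p dvd i"
    then show "(\<zeta> ^^ i) x = x" using zeta_pow_p by auto
  qed
qed

lemma zeta_transitive:
  assumes "\<not> p dvd i" "x \<in> A" "y \<in> A"
  shows "\<exists>s. (\<zeta> ^^ (i * s)) x = y"
proof -
  obtain r r' where r: "r < p" "x = b + 1 + r" "r' < p" "y = b + 1 + r'" using A_repr assms by metis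
  obtain u v where uv: "i * u = Suc (p * v)" using bezout_prime[OF prime_p assms(1)] by blast
  have "(r + i * (u * (r' + (p - r)))) mod p = (r + (r' + (p - r)) + p * (v * (r' + (p - r)))) mod p"
    using uv by (metis add.assoc add_mult_distrib mult.assoc mult_Suc plus_1_eq_Suc mult_1)
  also have "\<dots> = (r' + p) mod p" using r(1) by simp
  also have "\<dots> = r'" using r(3) by simp
  finally show ?thesis using zeta_pow[OF r(1), of "i * (u * (r' + (p - r)))"] r by auto
qed

lemma zeta_pow_inj: "inj (\<zeta> ^^ i)"
proof (rule injI)
  fix x y assume "(\<zeta> ^^ i) x = (\<zeta> ^^ i) y"
  then have "(\<zeta> ^^ ((p - 1) * i)) ((\<zeta> ^^ i) x) = (\<zeta> ^^ ((p - 1) * i)) ((\<zeta> ^^ i) y)" by simp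
  moreover have "(\<zeta> ^^ ((p - 1) * i)) ((\<zeta> ^^ i) z) = z" for z
  proof -
    have "(\<zeta> ^^ ((p - 1) * i)) ((\<zeta> ^^ i) z) = (\<zeta> ^^ ((p - 1) * i + i)) z" by (simp add: funpow_add)
    also have "(p - 1) * i + i = p * i" using p_pos by (cases p) auto
    finally show ?thesis by (simp add: zeta_pow_p)
  qed
  ultimately show "x = y" by simp
qed

lemma zeta_pow_image: "(\<zeta> ^^ i) ` A = A"
proof (rule endo_inj_surj)
  show "finite A" by (simp add: A_def)
  show "(\<zeta> ^^ i) ` A \<subseteq> A" using zeta_pow_A by blast
  show "inj_on (\<zeta> ^^ i) A" using zeta_pow_inj subset_UNIV by (rule inj_on_subset)
qed

text \<open>A nontrivial power of the rotation is transitive on \<open>A\<close>, because \<open>p\<close> is prime.\<close>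

lemma zeta_invariant:
  assumes "\<not> p dvd i" "I \<subseteq> A" "I \<noteq> {}" "(\<zeta> ^^ i) ` I = I"
  shows "I = A"
proof -
  have *: "(\<zeta> ^^ (i * s)) ` I = I" for s
  proof (induction s)
    case (Suc s)
    have "(\<zeta> ^^ (i * Suc s)) ` I = (\<zeta> ^^ i) ` (\<zeta> ^^ (i * s)) ` I"
      by (simp add: funpow_add image_comp)
    then show ?case using Suc assms(4) by simp
  qed simp
  have "y \<in> I" if y: "y \<in> A" for y
  proof -
    obtain x where x: "x \<in> I" using assms(3) by blast
    then obtain s where "(\<zeta> ^^ (i * s)) x = y" using zeta_transitive[OF assms(1)] assms(2) y by blast
    then show ?thesis using *[of s] x by blast
  qed
  then show ?thesis using assms(2) by blast
qed

text \<open>By \<open>zeta_invariant\<close> the rotations act freely on the proper nonempty subsets of \<open>A\<close>. So an element may be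
  chosen in one subset of every orbit and then be carried around.\<close>

lemma equivariant_choice:
  "\<exists>start. (\<forall>I. I \<subseteq> A \<longrightarrow> I \<noteq> {} \<longrightarrow> start I \<in> I) \<and>
     (\<forall>i I. I \<subset> A \<longrightarrow> I \<noteq> {} \<longrightarrow> start ((\<zeta> ^^ i) ` I) = (\<zeta> ^^ i) (start I))"
proof -
  define orb where "orb I = range (\<lambda>i. (\<zeta> ^^ i) ` I)" for I :: "nat set"
  define rep where "rep I = (SOME J. J \<in> orb I)" for I
  define pos where "pos I = (SOME i. (\<zeta> ^^ i) ` rep I = I)" for I
  define start where "start I = (if I = A then b + 1 else (\<zeta> ^^ pos I) (SOME x. x \<in> rep I))" for I
  have self: "I \<in> orb I" for I unfolding orb_def by (rule range_eqI[of _ _ 0]) simp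
  have orb_eq: "orb ((\<zeta> ^^ t) ` I) = orb I" for t I
  proof
    show "orb ((\<zeta> ^^ t) ` I) \<subseteq> orb I"
    proof
      fix J assume "J \<in> orb ((\<zeta> ^^ t) ` I)"
      then obtain i where "J = (\<zeta> ^^ i) ` (\<zeta> ^^ t) ` I" unfolding orb_def by blast
      then have "J = (\<zeta> ^^ (i + t)) ` I" by (simp add: funpow_add image_comp)
      then show "J \<in> orb I" unfolding orb_def by blast
    qed
    show "orb I \<subseteq> orb ((\<zeta> ^^ t) ` I)"
    proof
      fix J assume "J \<in> orb I"
      then obtain i where i: "J = (\<zeta> ^^ i) ` I" unfolding orb_def by blast
      have "i + (p - 1) * t + t = i + p * t" using p_pos by (cases p) auto
      then have "\<zeta> ^^ (i + (p - 1) * t + t) = \<zeta> ^^ i"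
        by (intro zeta_pow_cong) (simp only: mod_mult_self2)
      then have "J = (\<zeta> ^^ (i + (p - 1) * t)) ` (\<zeta> ^^ t) ` I"
        unfolding i image_comp funpow_add[symmetric] by simp
      then show "J \<in> orb ((\<zeta> ^^ t) ` I)" unfolding orb_def by blast
    qed
  qed
  have rep_orb: "rep I \<in> orb I" for I
    unfolding rep_def by (rule someI[of "\<lambda>J. J \<in> orb I", OF self])
  have pos_eq: "(\<zeta> ^^ pos I) ` rep I = I" for I
  proof -
    obtain t where t: "rep I = (\<zeta> ^^ t) ` I" using rep_orb[of I] unfolding orb_def by blast
    have "I \<in> orb (rep I)" unfolding t orb_eq by (rule self)
    then obtain i where "(\<zeta> ^^ i) ` rep I = I" unfolding orb_def by blast
    then show ?thesis unfolding pos_def by (rule someI)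
  qed
  have start_in: "start I \<in> I" if I: "I \<subseteq> A" "I \<noteq> {}" for I
  proof (cases "I = A")
    case True
    then show ?thesis using p_pos by (simp add: start_def A_def)
  next
    case False
    have "rep I \<noteq> {}" using pos_eq[of I] I(2) by auto
    then have "(SOME x. x \<in> rep I) \<in> rep I" by (simp add: some_in_eq)
    then have "(\<zeta> ^^ pos I) (SOME x. x \<in> rep I) \<in> (\<zeta> ^^ pos I) ` rep I" by (rule imageI)
    then show ?thesis using False by (simp add: start_def pos_eq)
  qed
  have equi: "start ((\<zeta> ^^ t) ` I) = (\<zeta> ^^ t) (start I)" if I: "I \<subset> A" "I \<noteq> {}" for t I
  proof -
    let ?I' = "(\<zeta> ^^ t) ` I" and ?J = "rep I"
    have "card ?I' = card I" by (rule card_image[OF inj_on_subset[OF zeta_pow_inj subset_UNIV]])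
    moreover have "card I < card A" using I(1) by (intro psubset_card_mono) (simp add: A_def)
    ultimately have ne: "?I' \<noteq> A" by auto
    have rep_eq: "rep ?I' = ?J" unfolding rep_def orb_eq ..
    have J: "?J \<subseteq> A" "?J \<noteq> A" "?J \<noteq> {}"
    proof -
      obtain s where s: "?J = (\<zeta> ^^ s) ` I" using rep_orb[of I] unfolding orb_def by blast
      have "card ?J = card I" unfolding s by (rule card_image[OF inj_on_subset[OF zeta_pow_inj subset_UNIV]])
      then show "?J \<noteq> A" using \<open>card I < card A\<close> by auto
      show "?J \<subseteq> A" unfolding s using I(1) zeta_pow_image[of s] by blast
      show "?J \<noteq> {}" unfolding s using I(2) by simp
    qed
    have cong: "\<zeta> ^^ i = \<zeta> ^^ j" if eq: "(\<zeta> ^^ i) ` ?J = (\<zeta> ^^ j) ` ?J" for i j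
    proof -
      have le: "\<zeta> ^^ i = \<zeta> ^^ j" if le: "i \<le> j" and eq: "(\<zeta> ^^ i) ` ?J = (\<zeta> ^^ j) ` ?J" for i j
      proof -
        have "(\<zeta> ^^ i) ` ?J = (\<zeta> ^^ i) ` (\<zeta> ^^ (j - i)) ` ?J"
          using eq le by (simp add: image_comp flip: funpow_add)
        then have "(\<zeta> ^^ (j - i)) ` ?J = ?J" using inj_image_eq_iff[OF zeta_pow_inj] by metis
        then have "p dvd j - i" using zeta_invariant[of "j - i" ?J] J by blast
        then have "i mod p = j mod p" using le by (metis mod_eq_dvd_iff_nat)
        then show ?thesis by (rule zeta_pow_cong)
      qed
      show ?thesis using le[of i j] le[of j i] eq by (metis nat_le_linear)
    qed
    have "(\<zeta> ^^ pos ?I') ` ?J = (\<zeta> ^^ (t + pos I)) ` ?J"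
      using pos_eq[of ?I'] pos_eq[of I] unfolding rep_eq funpow_add image_comp[symmetric] by simp
    from cong[OF this] have "(\<zeta> ^^ pos ?I') (SOME x. x \<in> ?J) = (\<zeta> ^^ t) ((\<zeta> ^^ pos I) (SOME x. x \<in> ?J))"
      by (simp add: funpow_add)
    moreover have "I \<noteq> A" using I(1) by blast
    ultimately show ?thesis using ne by (simp add: start_def rep_eq)
  qed
  show ?thesis using start_in equi by blast
qed

end

section \<open>Counting transversals of the orbits\<close>

text \<open>Apart from the case \<open>b = 0\<close> these are the fixed point free elements of order \<open>p\<close> in \<open>Sym b\<close>.\<close>

definition fpf :: "nat \<Rightarrow> nat \<Rightarrow> (nat \<Rightarrow> nat) \<Rightarrow> bool" where
  "fpf p b h \<longleftrightarrow> h ^^ p = id \<and> (\<forall>x\<in>{1..b}. h x \<noteq> x)"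

definition orb_set :: "(nat \<Rightarrow> nat) \<Rightarrow> nat list \<Rightarrow> nat set" where
  "orb_set h u = {(h ^^ s) y | s y. y \<in> set u}"

text \<open>The entries lie in pairwise different orbits of \<open>h\<close>.\<close>

fun orb_distinct :: "(nat \<Rightarrow> nat) \<Rightarrow> nat list \<Rightarrow> bool" where
  "orb_distinct h [] = True"
| "orb_distinct h (x # u) = (x \<notin> orb_set h u \<and> orb_distinct h u)"

context
  fixes p b :: nat and h :: "nat \<Rightarrow> nat"
  assumes prime: "prime p" and perm: "h permutes {1..b}" and fpf: "fpf p b h"
begin

lemma h_pow_mult: "h ^^ (p * i) = id"
  unfolding funpow_mult[symmetric] using fpf by (simp add: fpf_def)

lemma h_pow_in: "x \<in> {1..b} \<Longrightarrow> (h ^^ s) x \<in> {1..b}"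
  using permutes_in_image[OF permutes_funpow[OF perm]] by blast

lemma h_pow_fix: "x \<in> {1..b} \<Longrightarrow> (h ^^ s) x = x \<longleftrightarrow> p dvd s"
proof
  assume x: "x \<in> {1..b}" and s: "(h ^^ s) x = x"
  show "p dvd s"
  proof (rule ccontr)
    assume "\<not> p dvd s"
    then obtain u v where uv: "s * u = Suc (p * v)" using bezout_prime[OF prime] by blast
    have "((h ^^ s) ^^ u) x = x" using s by (induction u) auto
    then have "(h ^^ (s * u)) x = x" by (simp only: funpow_mult)
    then have "h ((h ^^ (p * v)) x) = x" unfolding uv by simp
    then show False using fpf x h_pow_mult by (simp add: fpf_def)
  qed
next
  assume "p dvd s"
  then show "(h ^^ s) x = x" using h_pow_mult by (auto simp: dvd_def)
qed

lemma h_pow_inverse: "(h ^^ s) x = y \<Longrightarrow> x = (h ^^ ((p - 1) * s)) y"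
proof -
  assume "(h ^^ s) x = y"
  then have "(h ^^ ((p - 1) * s)) y = (h ^^ ((p - 1) * s + s)) x" by (auto simp: funpow_add)
  also have "(p - 1) * s + s = p * s" using prime_gt_0_nat[OF prime] by (cases p) auto
  finally show ?thesis by (simp add: h_pow_mult)
qed

lemma h_pow_eq: "x \<in> {1..b} \<Longrightarrow> (h ^^ s) x = (h ^^ t) x \<longleftrightarrow> s mod p = t mod p"
proof -
  assume x: "x \<in> {1..b}"
  have le: "(h ^^ s) x = (h ^^ t) x \<longleftrightarrow> s mod p = t mod p" if "s \<le> t" for s t
  proof -
    have "(h ^^ t) x = (h ^^ s) ((h ^^ (t - s)) x)" using that by (metis add_diff_inverse_nat comp_apply funpow_add not_less)
    moreover have "inj (h ^^ s)" using permutes_inj[OF permutes_funpow[OF perm]] .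
    ultimately have "(h ^^ s) x = (h ^^ t) x \<longleftrightarrow> (h ^^ (t - s)) x = x" by (auto simp: inj_eq)
    also have "\<dots> \<longleftrightarrow> s mod p = t mod p"
      using h_pow_fix[OF x] that by (metis mod_eq_dvd_iff_nat)
    finally show ?thesis .
  qed
  show ?thesis using le[of s t] le[of t s] by (metis nat_le_linear)
qed

lemma card_orb_set: "set u \<subseteq> {1..b} \<Longrightarrow> orb_distinct h u \<Longrightarrow> card (orb_set h u) = p * length u \<and> orb_set h u \<subseteq> {1..b}"
proof (induction u)
  case (Cons x u)
  have x: "x \<in> {1..b}" using Cons.prems by simp
  let ?O = "range (\<lambda>s. (h ^^ s) x)"
  have eq: "orb_set h (x # u) = ?O \<union> orb_set h u" by (auto simp: orb_set_def)
  have O: "?O = (\<lambda>s. (h ^^ s) x) ` {..<p}"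
  proof
    show "?O \<subseteq> (\<lambda>s. (h ^^ s) x) ` {..<p}"
    proof (rule image_subsetI)
      fix s
      have "(h ^^ s) x = (h ^^ (s mod p)) x" using h_pow_eq[OF x] by simp
      then show "(h ^^ s) x \<in> (\<lambda>s. (h ^^ s) x) ` {..<p}" using prime_gt_0_nat[OF prime] by auto
    qed
  qed auto
  have cardO: "card ?O = p"
    unfolding O using h_pow_eq[OF x] by (subst card_image) (auto simp: inj_on_def)
  have disj: "?O \<inter> orb_set h u = {}"
  proof (rule equals0I)
    fix z assume "z \<in> ?O \<inter> orb_set h u"
    then have "z \<in> ?O" "z \<in> orb_set h u" by auto
    then obtain s t y where "z = (h ^^ s) x" "z = (h ^^ t) y" "y \<in> set u" unfolding orb_set_def by blast
    then have "x = (h ^^ ((p - 1) * s + t)) y" using h_pow_inverse[of s x z] by (simp add: funpow_add)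
    then have "x \<in> orb_set h u" using \<open>y \<in> set u\<close> by (auto simp: orb_set_def)
    then show False using Cons.prems by simp
  qed
  have IH: "card (orb_set h u) = p * length u" "orb_set h u \<subseteq> {1..b}" using Cons by auto
  have "finite (orb_set h u)" using IH(2) finite_subset by blast
  moreover have "finite ?O" unfolding O by simp
  ultimately have "card (orb_set h (x # u)) = p * length (x # u)"
    unfolding eq using disj cardO IH by (simp add: card_Un_disjoint)
  moreover have "?O \<subseteq> {1..b}" using h_pow_in[OF x] by blast
  ultimately show ?case using IH(2) eq by simp
qed (simp add: orb_set_def)

text \<open>All orbits have \<open>p\<close> elements, so \<open>b - p * t\<close> choices remain after \<open>t\<close> orbits have been used.\<close>

lemma card_orb_distinct:
  "card {u. length u = j \<and> set u \<subseteq> {1..b} \<and> orb_distinct h u} = (\<Prod>t<j. b - p * t)"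
proof (induction j)
  case 0
  have "{u. length u = 0 \<and> set u \<subseteq> {1..b} \<and> orb_distinct h u} = {[]}" by auto
  then show ?case by simp
next
  case (Suc j)
  let ?T = "\<lambda>j. {u. length u = j \<and> set u \<subseteq> {1..b} \<and> orb_distinct h u}"
  have finT: "finite (?T j)" for j
    by (rule finite_subset[OF _ finite_lists_length_eq[of "{1..b}" j]]) auto
  have "?T (Suc j) = (\<lambda>(u, x). x # u) ` (SIGMA u:?T j. {1..b} - orb_set h u)"
  proof
    show "?T (Suc j) \<subseteq> (\<lambda>(u, x). x # u) ` (SIGMA u:?T j. {1..b} - orb_set h u)"
    proof
      fix v assume v: "v \<in> ?T (Suc j)"
      then obtain x u where "v = x # u" by (cases v) auto
      then show "v \<in> (\<lambda>(u, x). x # u) ` (SIGMA u:?T j. {1..b} - orb_set h u)"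
        using v by (intro image_eqI[of _ _ "(u, x)"]) auto
    qed
  qed auto
  then have "card (?T (Suc j)) = card (SIGMA u:?T j. {1..b} - orb_set h u)"
    by (simp add: card_image inj_on_def split_beta prod_eq_iff)
  also have "\<dots> = (\<Sum>u\<in>?T j. card ({1..b} - orb_set h u))"
    using finT by (intro card_SigmaI) auto
  also have "\<dots> = (\<Sum>u\<in>?T j. b - p * j)"
  proof (rule sum.cong[OF refl])
    fix u assume "u \<in> ?T j"
    then have "card (orb_set h u) = p * j" "orb_set h u \<subseteq> {1..b}" using card_orb_set[of u] by auto
    then show "card ({1..b} - orb_set h u) = b - p * j"
      using card_Diff_subset[of "orb_set h u" "{1..b}"] finite_subset by auto
  qed
  also have "\<dots> = (\<Prod>t<Suc j. b - p * t)" using Suc by simp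
  finally show ?case .
qed

end

section \<open>Multichains fixed by a group element\<close>

locale lie_block = rotation p b for p b :: nat +
  fixes k n :: nat and Q :: "(nat \<Rightarrow> nat) set"
  assumes k_pos: "k \<ge> 1" and b_eq: "b = p * (k - 1)" and n_mult: "n = p * k"
    and subgroup_Q: "subgroup Q (Sym b)"
begin

lemmas prime = prime_p

definition start :: "nat set \<Rightarrow> nat" where
  "start = (SOME start. (\<forall>I. I \<subseteq> A \<longrightarrow> I \<noteq> {} \<longrightarrow> start I \<in> I) \<and>
     (\<forall>i I. I \<subset> A \<longrightarrow> I \<noteq> {} \<longrightarrow> start ((\<zeta> ^^ i) ` I) = (\<zeta> ^^ i) (start I)))"

lemma start_props:
  "I \<subseteq> A \<Longrightarrow> I \<noteq> {} \<Longrightarrow> start I \<in> I"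
  "I \<subset> A \<Longrightarrow> I \<noteq> {} \<Longrightarrow> start ((\<zeta> ^^ i) ` I) = (\<zeta> ^^ i) (start I)"
  using someI_ex[OF equivariant_choice] unfolding start_def by blast+

lemma n_eq: "n = b + p"
  using k_pos by (cases k) (auto simp: b_eq n_mult)

lemma n_split: "{1..n} = {1..b} \<union> A" "{1..b} \<inter> A = {}"
  unfolding n_eq A_def by auto

definition P :: "(nat \<Rightarrow> nat) set" where
  "P = {h \<circ> (\<zeta> ^^ i) | h i. h \<in> Q}"

lemma Q_permutes: "h \<in> Q \<Longrightarrow> h permutes {1..b}"
  using subgroup.subset[OF subgroup_Q] by (auto simp: Sym_def)

lemma Q_fix_A: "h \<in> Q \<Longrightarrow> x \<in> A \<Longrightarrow> h x = x"
  using permutes_not_in[OF Q_permutes] n_split(2) by blast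

lemma Q_in: "h \<in> Q \<Longrightarrow> x \<in> {1..b} \<Longrightarrow> h x \<in> {1..b}"
  using permutes_in_image[OF Q_permutes] by blast

lemma Q_id: "id \<in> Q"
  using subgroup.one_closed[OF subgroup_Q] by (simp add: Sym_def)

lemma Q_comp: "g \<in> Q \<Longrightarrow> h \<in> Q \<Longrightarrow> h \<circ> g \<in> Q"
  using subgroup.m_closed[OF subgroup_Q, of g h] by (simp add: Sym_def)

lemma Q_inv: "g \<in> Q \<Longrightarrow> inv_into UNIV g \<in> Q"
  using subgroup.m_inv_closed[OF subgroup_Q, of g] inv_Sym[OF Q_permutes] by simp

lemma finite_Q: "finite Q"
  using finite_subset[OF subgroup.subset[OF subgroup_Q] finite_carrier_Sym] .

lemma zeta_commute: "h \<in> Q \<Longrightarrow> h \<circ> (\<zeta> ^^ i) = (\<zeta> ^^ i) \<circ> h"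
proof
  fix x assume h: "h \<in> Q"
  consider "x \<in> A" | "x \<in> {1..b}" | "x \<notin> {1..n}" using n_split by blast
  then show "(h \<circ> (\<zeta> ^^ i)) x = ((\<zeta> ^^ i) \<circ> h) x"
  proof cases
    case 1
    then show ?thesis using Q_fix_A[OF h] zeta_pow_A by simp
  next
    case 2
    then have "x \<notin> A" "h x \<notin> A" using n_split(2) Q_in[OF h] by blast+
    then show ?thesis by (simp add: zeta_outside)
  next
    case 3
    then have "x \<notin> A" "h x = x" using n_split permutes_not_in[OF Q_permutes[OF h]] by blast+
    then show ?thesis by (simp add: zeta_outside)
  qed
qed

lemma mult_zeta: "g \<in> Q \<Longrightarrow> h \<in> Q \<Longrightarrow> (h \<circ> (\<zeta> ^^ i)) \<circ> (g \<circ> (\<zeta> ^^ j)) = (h \<circ> g) \<circ> (\<zeta> ^^ (i + j))"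
  using zeta_commute[of g i] by (simp add: funpow_add fun_eq_iff)

lemma zeta_permutes: "(\<zeta> ^^ i) permutes {1..n}"
proof (rule bij_imp_permutes)
  have s: "(\<zeta> ^^ i) ` {1..n} \<subseteq> {1..n}"
  proof (rule image_subsetI)
    fix x assume x: "x \<in> {1..n}"
    show "(\<zeta> ^^ i) x \<in> {1..n}"
    proof (cases "x \<in> A")
      case True
      from zeta_pow_A[OF this, of i] show ?thesis unfolding n_split(1) by blast
    next
      case False
      then show ?thesis using x by (simp add: zeta_outside)
    qed
  qed
  moreover have "inj_on (\<zeta> ^^ i) {1..n}" using zeta_pow_inj subset_UNIV by (rule inj_on_subset)
  ultimately show "bij_betw (\<zeta> ^^ i) {1..n} {1..n}"
    using endo_inj_surj[of "{1..n}" "\<zeta> ^^ i"] by (simp add: bij_betw_def)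
  show "(\<zeta> ^^ i) x = x" if "x \<notin> {1..n}" for x using that n_split zeta_outside by blast
qed

lemma P_mem_permutes: "g \<in> P \<Longrightarrow> g permutes {1..n}"
proof -
  assume "g \<in> P"
  then obtain h i where h: "h \<in> Q" "g = h \<circ> (\<zeta> ^^ i)" unfolding P_def by blast
  have "h permutes {1..n}" using permutes_subset[OF Q_permutes[OF h(1)]] n_split by blast
  then show ?thesis unfolding h by (rule permutes_compose[OF zeta_permutes])
qed

lemma inv_zeta: "h \<in> Q \<Longrightarrow> inv_into UNIV (h \<circ> (\<zeta> ^^ i)) = inv_into UNIV h \<circ> (\<zeta> ^^ ((p - 1) * i))"
proof -
  assume h: "h \<in> Q"
  have e: "(p - 1) * i + i = p * i" "i + (p - 1) * i = p * i" using p_pos by (cases p; simp)+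
  have "(inv_into UNIV h \<circ> (\<zeta> ^^ ((p - 1) * i))) \<circ> (h \<circ> (\<zeta> ^^ i)) = id"
    "(h \<circ> (\<zeta> ^^ i)) \<circ> (inv_into UNIV h \<circ> (\<zeta> ^^ ((p - 1) * i))) = id"
    by (simp_all only: mult_zeta[OF h Q_inv[OF h]] mult_zeta[OF Q_inv[OF h] h] e zeta_pow_p
        permutes_inv_o[OF Q_permutes[OF h]] id_comp)
  then show ?thesis using inv_unique_comp by blast
qed

lemma subgroup_P: "subgroup P (Sym n)"
proof (rule group.subgroupI[OF group_Sym])
  show "P \<subseteq> carrier (Sym n)" using P_mem_permutes by (auto simp: Sym_def)
  show "P \<noteq> {}" using Q_id by (auto simp: P_def)
  show "inv\<^bsub>Sym n\<^esub> g \<in> P" if g: "g \<in> P" for g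
  proof -
    obtain h i where h: "h \<in> Q" "g = h \<circ> (\<zeta> ^^ i)" using g unfolding P_def by blast
    show ?thesis
      unfolding inv_Sym[OF P_mem_permutes[OF g]] unfolding h(2) inv_zeta[OF h(1)] P_def
      using Q_inv[OF h(1)] by blast
  qed
  show "g \<otimes>\<^bsub>Sym n\<^esub> g' \<in> P" if "g \<in> P" "g' \<in> P" for g g'
  proof -
    obtain h i h' i' where h: "h \<in> Q" "g = h \<circ> (\<zeta> ^^ i)" "h' \<in> Q" "g' = h' \<circ> (\<zeta> ^^ i')"
      using \<open>g \<in> P\<close> \<open>g' \<in> P\<close> unfolding P_def by blast
    have "g \<otimes>\<^bsub>Sym n\<^esub> g' = (h' \<circ> h) \<circ> (\<zeta> ^^ (i' + i))"
      using mult_zeta[OF h(1,3)] by (simp add: Sym_def h)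
    then show ?thesis using Q_comp[OF h(1,3)] unfolding P_def by blast
  qed
qed

lemma P_on_A: "h \<in> Q \<Longrightarrow> x \<in> A \<Longrightarrow> (h \<circ> (\<zeta> ^^ i)) x = (\<zeta> ^^ i) x"
  using Q_fix_A zeta_pow_A by simp

lemma P_on_B: "x \<in> {1..b} \<Longrightarrow> (h \<circ> (\<zeta> ^^ i)) x = h x"
proof -
  assume "x \<in> {1..b}"
  then have "x \<notin> A" using n_split(2) by blast
  then show ?thesis by (simp add: zeta_outside)
qed

sublocale lie_action n A start P
proof (intro lie_action.intro chains.intro lie_action_axioms.intro)
  show "n \<ge> 1" using p_pos k_pos by (simp add: n_mult)
  show "A \<subseteq> {1..n}" using n_split by blast
  show "A \<noteq> {}" using p_pos by (simp add: A_def)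
  show "start I \<in> I" if "I \<subseteq> A" "I \<noteq> {}" for I using start_props(1) that by blast
  show "subgroup P (Sym n)" by (rule subgroup_P)
  fix g assume "g \<in> P"
  then obtain h i where h: "h \<in> Q" "g = h \<circ> (\<zeta> ^^ i)" unfolding P_def by blast
  have im: "g ` I = (\<zeta> ^^ i) ` I" if "I \<subseteq> A" for I
    using that P_on_A[OF h(1)] unfolding h(2) by (intro image_cong refl) blast
  show "g ` A = A" using im[of A] zeta_pow_image by simp
  show "start (g ` I) = g (start I)" if "I \<subset> A" "I \<noteq> {}" for I
  proof -
    have "start I \<in> A" using start_props(1)[of I] that by blast
    then have "g (start I) = (\<zeta> ^^ i) (start I)" unfolding h(2) by (rule P_on_A[OF h(1)])
    moreover have "g ` I = (\<zeta> ^^ i) ` I" using im that by blast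
    ultimately show ?thesis using start_props(2)[OF that] by simp
  qed
qed

lemma fixed_chain:
  assumes g: "g \<in> P" and G: "\<gamma> \<in> \<Gamma>2" "map g ` \<gamma> = \<gamma>" and c: "c \<in> \<gamma>"
  shows "map (g ^^ s) c \<in> \<gamma>"
proof (induction s)
  case 0
  then show ?case using c by simp
next
  case (Suc s)
  have "map (g ^^ Suc s) c = map g (map (g ^^ s) c)" by simp
  also have "\<dots> \<in> map g ` \<gamma>" using Suc by (rule imageI)
  also have "map g ` \<gamma> = \<gamma>" by (rule G(2))
  finally show ?case .
qed

text \<open>An element that is trivial on \<open>A\<close> fixes a letter of every chain, hence every chain and every letter.\<close>

lemma fix_trivial:
  assumes h: "h \<in> Q" "h \<noteq> id"
  shows "{\<gamma> \<in> \<Gamma>2. map h ` \<gamma> = \<gamma>} = {}"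
proof (rule ccontr)
  assume "\<not> ?thesis"
  then obtain \<gamma> where G: "\<gamma> \<in> \<Gamma>2" "map h ` \<gamma> = \<gamma>" by blast
  have gm: "\<gamma> \<in> multichains {1..n}" using G(1) by (simp add: \<Gamma>2_def)
  have "h x = x" if x: "x \<in> {1..n}" for x
  proof -
    obtain c where c: "c \<in> \<gamma>" "x \<in> set c" using multichain_cover[OF gm x] by blast
    have "map h c \<in> \<gamma>" using G(2) c(1) by blast
    moreover have "hd c \<in> set c" "hd c \<in> A" using multichainD(4,5)[OF gm c(1)] by auto
    then have "hd c \<in> set (map h c)" using Q_fix_A[OF h(1)] by (metis image_eqI list.set_map)
    ultimately have "map h c = c" using multichain_disjoint[OF gm _ c(1)] \<open>hd c \<in> set c\<close> by blast
    then show ?thesis using c(2) by (metis map_eq_conv map_ident)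
  qed
  moreover have "h x = x" if "x \<notin> {1..n}" for x
    using that permutes_not_in[OF Q_permutes[OF h(1)]] n_split by blast
  ultimately have "h = id" by (auto simp: fun_eq_iff)
  then show False using h(2) by simp
qed

context
  fixes h :: "nat \<Rightarrow> nat" and i :: nat
  assumes h: "h \<in> Q" and i: "\<not> p dvd i"
begin

definition g :: "nat \<Rightarrow> nat" where "g = h \<circ> (\<zeta> ^^ i)"
abbreviation "a0 \<equiv> b + 1"

lemma g_P: "g \<in> P" using h unfolding P_def g_def by blast

lemma g_on_A: "x \<in> A \<Longrightarrow> g x = (\<zeta> ^^ i) x"
  unfolding g_def by (rule P_on_A[OF h])

lemma g_on_B: "x \<in> {1..b} \<Longrightarrow> g x = h x"
  unfolding g_def by (rule P_on_B)

lemma a0_A: "a0 \<in> A" using p_pos by (simp add: A_def)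

lemma g_pow_A: "x \<in> A \<Longrightarrow> (g ^^ s) x = (\<zeta> ^^ (i * s)) x"
proof (induction s)
  case (Suc s)
  have "(g ^^ Suc s) x = g ((\<zeta> ^^ (i * s)) x)" using Suc by simp
  also have "\<dots> = (\<zeta> ^^ i) ((\<zeta> ^^ (i * s)) x)" by (rule g_on_A[OF zeta_pow_A[OF Suc.prems]])
  finally show ?case by (simp add: funpow_add)
qed simp

lemma g_pow_B: "x \<in> {1..b} \<Longrightarrow> (g ^^ s) x = (h ^^ s) x \<and> (h ^^ s) x \<in> {1..b}"
proof (induction s)
  case (Suc s)
  then have IH: "(g ^^ s) x = (h ^^ s) x" "(h ^^ s) x \<in> {1..b}" by auto
  have "(g ^^ Suc s) x = g ((h ^^ s) x)" using IH(1) by simp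
  also have "\<dots> = h ((h ^^ s) x)" by (rule g_on_B[OF IH(2)])
  finally show ?case using Q_in[OF h IH(2)] by simp
qed simp

lemma g_pow_a0: "(g ^^ s) a0 = (g ^^ t) a0 \<longleftrightarrow> s mod p = t mod p"
proof -
  have inj: "inj (g ^^ s)" for s using permutes_inj[OF permutes_funpow[OF P_permutes[OF g_P]]] .
  have le: "(g ^^ s) a0 = (g ^^ t) a0 \<longleftrightarrow> s mod p = t mod p" if "s \<le> t" for s t
  proof -
    have "(g ^^ t) a0 = (g ^^ s) ((g ^^ (t - s)) a0)"
      using that by (metis add_diff_inverse_nat comp_apply funpow_add not_less)
    then have "(g ^^ s) a0 = (g ^^ t) a0 \<longleftrightarrow> (g ^^ (t - s)) a0 = a0" using inj[of s] by (auto simp: inj_eq)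
    also have "\<dots> \<longleftrightarrow> p dvd i * (t - s)" unfolding g_pow_A[OF a0_A] by (rule zeta_pow_fix[OF a0_A])
    also have "\<dots> \<longleftrightarrow> p dvd t - s" using i prime by (simp add: prime_dvd_mult_iff)
    also have "\<dots> \<longleftrightarrow> s mod p = t mod p" using that by (metis mod_eq_dvd_iff_nat)
    finally show ?thesis .
  qed
  show ?thesis using le[of s t] le[of t s] by (metis nat_le_linear)
qed

text \<open>The translates of the chain that starts at the first point of \<open>A\<close> and continues with \<open>u\<close>.\<close>

definition spread :: "nat list \<Rightarrow> nat list set" where
  "spread u = (\<lambda>s. map (g ^^ s) (a0 # u)) ` {..<p}"

definition transversals :: "nat list set" where
  "transversals = {u. length u = k - 1 \<and> set u \<subseteq> {1..b} \<and> orb_distinct h u}"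

text \<open>If a chain contained two letters of \<open>A\<close>, some power of \<open>g\<close> that is transitive on \<open>A\<close> would carry one
  to the other and thus fix the chain, which would then contain \<open>A\<close> and be the only one. So every chain
  meets \<open>A\<close> in its first letter only, and the powers of \<open>g\<close> carry the chain through \<open>a0\<close> to all others.
  A letter fixed by \<open>h\<close> would make \<open>g\<close> fix its chain, with the same contradiction.\<close>

lemma fixed_multichain:
  assumes G: "\<gamma> \<in> \<Gamma>2" "map g ` \<gamma> = \<gamma>"
  shows "fpf p b h \<and> (\<exists>u\<in>transversals. \<gamma> = spread u)"
proof -
  have gm: "\<gamma> \<in> multichains {1..n}" and card: "card \<gamma> \<ge> 2" using G(1) by (simp_all add: \<Gamma>2_def)
  note fc = fixed_chain[OF g_P G]
  have proper: "A \<inter> set c \<noteq> A" if c: "c \<in> \<gamma>" for c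
  proof
    assume "A \<inter> set c = A"
    moreover have "\<gamma> \<noteq> {c}" using card by auto
    then obtain c' where c': "c' \<in> \<gamma>" "c' \<noteq> c" using c by blast
    have "hd c' \<in> A" "hd c' \<in> set c'" using multichainD(4,5)[OF gm c'(1)] by auto
    ultimately show False using multichain_disjoint[OF gm c'(1) c] c'(2) by blast
  qed
  have single: "A \<inter> set c = {hd c}" if c: "c \<in> \<gamma>" for c
  proof -
    have hd: "hd c \<in> A \<inter> set c" using multichainD(4,5)[OF gm c] by auto
    have "y = hd c" if y: "y \<in> A \<inter> set c" for y
    proof (rule ccontr)
      assume ne: "y \<noteq> hd c"
      obtain s where s: "(\<zeta> ^^ (i * s)) (hd c) = y" using zeta_transitive[OF i] hd y by blast
      have nd: "\<not> p dvd i * s" using s ne zeta_pow_fix[of "hd c" "i * s"] hd by auto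
      have "(g ^^ s) (hd c) = y" using s g_pow_A hd by simp
      then have "y \<in> set (map (g ^^ s) c)" using hd by (metis IntD2 image_eqI list.set_map)
      then have "map (g ^^ s) c = c" using multichain_disjoint[OF gm fc[OF c] c] y by blast
      then have "(g ^^ s) ` set c = set c" by (metis list.set_map)
      moreover have "(g ^^ s) x \<in> A \<longleftrightarrow> x \<in> A" if "x \<in> set c" for x
      proof -
        have "x \<in> {1..n}" using that multichainD(6)[OF gm c] by blast
        then consider "x \<in> A" | "x \<in> {1..b}" using n_split(1) by blast
        then show ?thesis
        proof cases
          case 1
          then show ?thesis using g_pow_A zeta_pow_A by simp
        next
          case 2
          then have "(g ^^ s) x \<in> {1..b}" using g_pow_B by simp
          then show ?thesis using 2 n_split(2) by blast
        qed
      qed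
      ultimately have "(g ^^ s) ` (A \<inter> set c) = A \<inter> set c" by (fastforce simp: image_iff)
      moreover have "(g ^^ s) ` (A \<inter> set c) = (\<zeta> ^^ (i * s)) ` (A \<inter> set c)"
        using g_pow_A by (intro image_cong refl) blast
      ultimately have "A \<inter> set c = A" using zeta_invariant[OF nd, of "A \<inter> set c"] hd by blast
      then show False using proper[OF c] by blast
    qed
    then show ?thesis using hd by blast
  qed
  have a0n: "a0 \<in> {1..n}" using a0_A n_split by blast
  obtain c0 where c0: "c0 \<in> \<gamma>" "a0 \<in> set c0" using multichain_cover[OF gm a0n] by blast
  have "a0 \<in> A \<inter> set c0" using c0(2) a0_A by (rule IntI[rotated])
  then have "hd c0 = a0" unfolding single[OF c0(1)] by simp
  then obtain u where u: "c0 = a0 # u" using multichainD(4)[OF gm c0(1)] by (cases c0) auto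
  have d_c0: "distinct c0" by (rule multichainD(1)[OF gm c0(1)])
  have uB: "set u \<subseteq> {1..b}"
  proof
    fix x assume x: "x \<in> set u"
    then have "x \<in> {1..n}" "x \<noteq> a0" "x \<in> set c0" using multichainD(6)[OF gm c0(1)] d_c0 u by auto
    moreover have "x \<notin> A"
    proof
      assume "x \<in> A"
      then have "x \<in> A \<inter> set c0" using \<open>x \<in> set c0\<close> by simp
      then show False unfolding single[OF c0(1)] using \<open>hd c0 = a0\<close> \<open>x \<noteq> a0\<close> by simp
    qed
    ultimately show "x \<in> {1..b}" using n_split by blast
  qed
  have all: "\<gamma> = spread u"
  proof
    show "spread u \<subseteq> \<gamma>" unfolding spread_def using fc[OF c0(1)] u by blast
    show "\<gamma> \<subseteq> spread u"
    proof
      fix c assume c: "c \<in> \<gamma>"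
      have hc: "hd c \<in> A" "hd c \<in> set c" using multichainD(4,5)[OF gm c] by auto
      obtain s where "(\<zeta> ^^ (i * s)) a0 = hd c" using zeta_transitive[OF i a0_A hc(1)] by blast
      then have s: "(g ^^ s) a0 = hd c" using g_pow_A[OF a0_A] by simp
      then have s': "(g ^^ (s mod p)) a0 = hd c" using g_pow_a0[of "s mod p" s] by simp
      then have "hd c \<in> set (map (g ^^ (s mod p)) c0)" using c0(2) by (metis image_eqI list.set_map)
      then have "map (g ^^ (s mod p)) c0 = c" using multichain_disjoint[OF gm fc[OF c0(1)] c] hc(2) by blast
      then show "c \<in> spread u" unfolding spread_def u using p_pos by (metis imageI lessThan_iff mod_less_divisor)
    qed
  qed
  have same: "map (g ^^ s) c0 = c0" if "x \<in> set (map (g ^^ s) c0)" "x \<in> set c0" for s x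
    using multichain_disjoint[OF gm fc[OF c0(1)] c0(1) that] .
  have fix_p: "(g ^^ p) x = x" if x: "x \<in> {1..n}" for x
  proof -
    have "(g ^^ p) a0 = a0" using g_pow_a0[of p 0] by simp
    then have "map (g ^^ p) c0 = c0" using same[of a0 p] c0(2) by (metis image_eqI list.set_map)
    then have fix0: "(g ^^ p) y = y" if "y \<in> set c0" for y using that by (metis map_eq_conv map_ident)
    obtain c where "c \<in> \<gamma>" "x \<in> set c" using multichain_cover[OF gm x] by blast
    then obtain s where "x \<in> set (map (g ^^ s) c0)" unfolding all spread_def u by blast
    then obtain y where y: "y \<in> set c0" "x = (g ^^ s) y" by (metis imageE list.set_map)
    have "(g ^^ p) x = (g ^^ (p + s)) y" using y(2) by (simp add: funpow_add)
    also have "\<dots> = (g ^^ s) ((g ^^ p) y)" by (simp add: add.commute[of p] funpow_add)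
    finally show ?thesis using fix0[OF y(1)] y(2) by simp
  qed
  have fpf: "fpf p b h"
    unfolding fpf_def
  proof (intro conjI ballI)
    have "(h ^^ p) x = x" for x
    proof (cases "x \<in> {1..b}")
      case True
      then have "x \<in> {1..n}" unfolding n_split by blast
      then show ?thesis using g_pow_B[OF True, of p] fix_p[of x] by simp
    next
      case False
      then show ?thesis using permutes_not_in[OF permutes_funpow[OF Q_permutes[OF h]]] by blast
    qed
    then show "h ^^ p = id" by (auto simp: fun_eq_iff)
    fix x assume x: "x \<in> {1..b}"
    show "h x \<noteq> x"
    proof
      assume hx: "h x = x"
      have "x \<in> {1..n}" using x n_split by blast
      then obtain c where c: "c \<in> \<gamma>" "x \<in> set c" using multichain_cover[OF gm] by blast
      have "g x = x" using g_on_B[OF x] hx by simp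
      then have "x \<in> set (map g c)" using c(2) by (metis image_eqI list.set_map)
      then have "map g c = c" using multichain_disjoint[OF gm _ c(1)] c G(2) by blast
      then have "g (hd c) = hd c" using multichainD(4)[OF gm c(1)] by (metis hd_map)
      then have "(\<zeta> ^^ i) (hd c) = hd c" using g_on_A[OF multichainD(5)[OF gm c(1)]] by simp
      then show False using zeta_pow_fix[OF multichainD(5)[OF gm c(1)]] i by blast
    qed
  qed
  have od: "orb_distinct h v" if "v' @ v = u" for v' v
    using that
  proof (induction v arbitrary: v')
    case (Cons x v)
    have "x \<notin> orb_set h v"
    proof
      assume "x \<in> orb_set h v"
      then obtain s y where y: "y \<in> set v" "x = (h ^^ s) y" by (auto simp: orb_set_def)
      have yB: "y \<in> {1..b}" and xy: "y \<in> set c0" "x \<in> set c0" using y(1) Cons.prems uB u by auto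
      have "x = (g ^^ s) y" using y(2) g_pow_B[OF yB] by simp
      then have "map (g ^^ s) c0 = c0" using same[of x s] xy by (metis image_eqI list.set_map)
      then have "(g ^^ s) y = y" using xy(1) by (metis map_eq_conv map_ident)
      then have "x = y" using \<open>x = (g ^^ s) y\<close> by simp
      then show False using d_c0 y(1) Cons.prems u by auto
    qed
    then show ?case using Cons.IH[of "v' @ [x]"] Cons.prems by simp
  qed simp
  have "length u = k - 1"
  proof -
    have "(\<Union>c\<in>\<gamma>. set c) = {1..n}" using gm by (simp add: multichains_def)
    moreover have "card (\<Union>c\<in>\<gamma>. set c) = (\<Sum>c\<in>\<gamma>. card (set c))"
      using finite_multichain[OF _ gm] multichain_disjoint[OF gm] by (intro card_UN_disjoint) auto
    moreover have "(\<Sum>c\<in>\<gamma>. card (set c)) = (\<Sum>c\<in>\<gamma>. Suc (length u))"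
    proof (rule sum.cong[OF refl])
      fix c assume c: "c \<in> \<gamma>"
      then have "length c = Suc (length u)" unfolding all spread_def by auto
      then show "card (set c) = Suc (length u)" using distinct_card[OF multichainD(1)[OF gm c]] by simp
    qed
    moreover have "card \<gamma> = p"
    proof -
      have "inj_on (\<lambda>s. map (g ^^ s) (a0 # u)) {..<p}"
        by (rule inj_onI) (use g_pow_a0 in \<open>auto simp del: funpow.simps\<close>)
      then show ?thesis unfolding all spread_def by (simp only: card_image card_lessThan)
    qed
    ultimately have "p * k = p * Suc (length u)" by (simp add: n_mult)
    then have "k = Suc (length u)" using p_pos mult_left_cancel by blast
    then show ?thesis by simp
  qed
  then have "u \<in> transversals" using uB od[of "[]" u] by (simp add: transversals_def)
  then show ?thesis using fpf all by blast
qed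

lemma spread_fixed:
  assumes fpf: "fpf p b h" and u: "u \<in> transversals"
  shows "spread u \<in> \<Gamma>2 \<and> map g ` spread u = spread u"
proof -
  have uB: "set u \<subseteq> {1..b}" and len: "length u = k - 1" and od: "orb_distinct h u"
    using u by (auto simp: transversals_def)
  let ?c = "\<lambda>s. map (g ^^ s) (a0 # u)"
  have inj: "inj (g ^^ s)" for s using permutes_inj[OF permutes_funpow[OF P_permutes[OF g_P]]] .
  note hperm = Q_permutes[OF h]
  have orbit_sep: "x = y" if xu: "x \<in> set u" and yu: "y \<in> set u" and hxy: "(h ^^ s) x = (h ^^ t) y" for x y s t
  proof -
    have sep: "\<exists>v v'. orb_distinct h v \<and> v = x # v' \<and> y \<in> set v' \<or> orb_distinct h v \<and> v = y # v' \<and> x \<in> set v'"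
      if "orb_distinct h u" "x \<in> set u" "y \<in> set u" "x \<noteq> y" for u
      using that by (induction u) (auto, (metis orb_distinct.simps(2))+)
    show ?thesis
    proof (rule ccontr)
      assume "x \<noteq> y"
      then obtain v v' where "orb_distinct h v \<and> v = x # v' \<and> y \<in> set v' \<or> orb_distinct h v \<and> v = y # v' \<and> x \<in> set v'"
        using sep[OF od xu yu] by blast
      moreover have "x = (h ^^ ((p - 1) * s + t)) y" "y = (h ^^ ((p - 1) * t + s)) x"
        using h_pow_inverse[OF prime hperm fpf hxy] h_pow_inverse[OF prime hperm fpf hxy[symmetric]]
        by (auto simp: funpow_add)
      then have "y \<in> set v' \<Longrightarrow> x \<in> orb_set h v'" "x \<in> set v' \<Longrightarrow> y \<in> orb_set h v'"
        unfolding orb_set_def by blast+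
      ultimately show False by (metis orb_distinct.simps(2))
    qed
  qed
  have d_u: "distinct u"
  proof -
    have "distinct v" if "orb_distinct h v" for v
      using that
    proof (induction v)
      case (Cons x v)
      have "x \<notin> set v"
      proof
        assume "x \<in> set v"
        then have "x \<in> orb_set h v" unfolding orb_set_def by (metis (mono_tags, lifting) funpow_0 mem_Collect_eq)
        then show False using Cons.prems by simp
      qed
      then show ?case using Cons by simp
    qed simp
    then show ?thesis using od by blast
  qed
  have a0u: "a0 \<notin> {1..b}" using n_split(2) a0_A by blast
  have dist: "distinct (?c s)" for s
    using d_u a0u uB inj[of s] inj_on_subset[OF inj[of s] subset_UNIV] unfolding distinct_map by auto
  have gA: "(g ^^ s) a0 \<in> A" for s using g_pow_A[OF a0_A] zeta_pow_A[OF a0_A] by simp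
  have gB: "(g ^^ s) x \<in> {1..b}" if "x \<in> set u" for s x using g_pow_B[of x s] that uB by auto
  have gB_A: "(g ^^ s) x \<notin> A" if "x \<in> set u" for s x using gB[OF that] n_split(2) by blast
  have int: "A \<inter> set (?c s) = {(g ^^ s) a0}" for s
    using gA[of s] gB_A by auto
  have stS: "start {x} = x" if "x \<in> A" for x using start_props(1)[of "{x}"] that by simp
  have meet: "s = t" if st': "s < p" "t < p" and x: "x \<in> set (?c s)" "x \<in> set (?c t)" for s t x
  proof -
    obtain y where y: "y \<in> set (a0 # u)" "x = (g ^^ s) y" using x(1) by (metis imageE list.set_map)
    obtain z where z: "z \<in> set (a0 # u)" "x = (g ^^ t) z" using x(2) by (metis imageE list.set_map)
    show ?thesis
    proof (cases "x \<in> A")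
      case True
      then have "y = a0" "z = a0" using y z gB[of y s] gB[of z t] n_split(2) by auto
      then show ?thesis using g_pow_a0[of s t] y(2) z(2) st' by simp
    next
      case False
      then have "y \<noteq> a0" "z \<noteq> a0" using y(2) z(2) gA by metis+
      then have yu: "y \<in> set u" and zu: "z \<in> set u" using y(1) z(1) by simp_all
      then have yB: "y \<in> {1..b}" and zB: "z \<in> {1..b}" using uB by auto
      have eq: "(h ^^ s) y = (h ^^ t) z" using y(2) z(2) g_pow_B[OF yB, of s] g_pow_B[OF zB, of t] by simp
      then have "y = z" by (rule orbit_sep[OF yu zu])
      then have "s mod p = t mod p" using h_pow_eq[OF prime hperm fpf yB] eq by simp
      then show ?thesis using st' by simp
    qed
  qed
  have inj_c: "inj_on ?c {..<p}"
  proof (rule inj_onI)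
    fix s t assume "s \<in> {..<p}" "t \<in> {..<p}" "?c s = ?c t"
    then show "s = t" using meet[of s t "(g ^^ s) a0"] by (metis image_eqI lessThan_iff list.set_intros(1) list.set_map)
  qed
  have cardS: "card (spread u) = p" unfolding spread_def by (simp only: card_image[OF inj_c] card_lessThan)
  have sub: "set (?c s) \<subseteq> {1..n}" for s
  proof -
    have "a0 \<in> {1..n}" "set u \<subseteq> {1..n}" using a0_A uB n_split by blast+
    then show ?thesis using permutes_image[OF permutes_funpow[OF P_permutes[OF g_P], of s]] by auto
  qed
  have cover: "\<Union> (set ` spread u) = {1..n}"
  proof (rule card_subset_eq)
    show "\<Union> (set ` spread u) \<subseteq> {1..n}" using sub unfolding spread_def by blast
    have "card (\<Union>s\<in>{..<p}. set (?c s)) = (\<Sum>s<p. card (set (?c s)))"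
      using meet by (intro card_UN_disjoint) (auto simp only: finite_lessThan finite_set lessThan_iff disjoint_iff)
    also have "\<dots> = (\<Sum>s<p. k)"
      using len k_pos by (intro sum.cong refl) (simp only: distinct_card[OF dist], simp)
    finally show "card (\<Union> (set ` spread u)) = card {1..n}" unfolding spread_def by (simp add: image_image n_mult)
  qed simp
  have "spread u \<in> multichains {1..n}"
    unfolding multichains_def mem_Collect_eq
  proof (intro conjI ballI impI)
    fix c assume "c \<in> spread u"
    then obtain s where s: "c = ?c s" unfolding spread_def by blast
    show "distinct c" unfolding s by (rule dist)
    show "A \<inter> set c \<noteq> {}" unfolding s int by simp
    show "hd c = start (A \<inter> set c)" unfolding s int stS[OF gA] by simp
  next
    fix c c' assume "c \<in> spread u" "c' \<in> spread u" "c \<noteq> c'"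
    then obtain s t where st': "c = ?c s" "c' = ?c t" "s < p" "t < p" "s \<noteq> t" unfolding spread_def by blast
    then show "set c \<inter> set c' = {}" using meet[OF st'(3,4)] by blast
  qed (rule cover)
  moreover have "p \<ge> 2" by (rule prime_ge_2_nat[OF prime])
  ultimately have "spread u \<in> \<Gamma>2" using cardS by (simp add: \<Gamma>2_def)
  moreover have "map g ` spread u = spread u"
  proof -
    have "map g ` spread u \<subseteq> spread u"
    proof
      fix c assume "c \<in> map g ` spread u"
      then obtain s where s: "s < p" "c = map g (?c s)" unfolding spread_def by blast
      then have c: "c = ?c (Suc s)" by simp
      have "(g ^^ p) x = x" if "x \<in> set (a0 # u)" for x
      proof (cases "x = a0")
        case True
        then show ?thesis using g_pow_a0[of p 0] by simp
      next
        case False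
        then have "x \<in> {1..b}" using that uB by auto
        then show ?thesis using g_pow_B[of x p] fpf by (simp add: fpf_def)
      qed
      then have cp: "?c p = ?c 0" by (intro map_cong refl) simp
      show "c \<in> spread u"
      proof (cases "Suc s < p")
        case True
        then show ?thesis unfolding c spread_def by blast
      next
        case False
        then have "Suc s = p" using s(1) by simp
        then have "c = ?c 0" using c cp by simp
        then show ?thesis unfolding spread_def using p_pos by blast
      qed
    qed
    moreover have "card (map g ` spread u) = card (spread u)"
      using inj[of 1] by (intro card_image) (simp add: inj_on_def inj_map_eq_map)
    moreover have "finite (spread u)" by (simp add: spread_def)
    ultimately show ?thesis by (simp add: card_subset_eq)
  qed
  ultimately show ?thesis by blast
qed

lemma card_fixed: "card {\<gamma> \<in> \<Gamma>2. map g ` \<gamma> = \<gamma>} = (if fpf p b h then fact (k - 1) * p ^ (k - 1) else 0)"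
proof (cases "fpf p b h")
  case True
  have "{\<gamma> \<in> \<Gamma>2. map g ` \<gamma> = \<gamma>} = spread ` transversals"
    using fixed_multichain spread_fixed[OF True] by blast
  moreover have "inj_on spread transversals"
  proof (rule inj_onI)
    fix u v assume u: "u \<in> transversals" "v \<in> transversals" "spread u = spread v"
    have "a0 # u \<in> spread u" unfolding spread_def using p_pos by (intro image_eqI[of _ _ 0]) auto
    then have "a0 # u \<in> spread v" by (simp only: u(3))
    then obtain s where s: "a0 # u = map (g ^^ s) (a0 # v)" "s \<in> {..<p}" unfolding spread_def by (rule imageE)
    then have "(g ^^ s) a0 = (g ^^ 0) a0" by simp
    then have "s = 0" using g_pow_a0[of s 0] s(2) by simp
    then show "u = v" using s(1) by simp
  qed
  ultimately have "card {\<gamma> \<in> \<Gamma>2. map g ` \<gamma> = \<gamma>} = card transversals" by (simp add: card_image)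
  also have "\<dots> = (\<Prod>t<k - 1. b - p * t)"
    unfolding transversals_def by (rule card_orb_distinct[OF prime Q_permutes[OF h] True])
  also have "\<dots> = (\<Prod>t<k - 1. p * (k - 1 - t))"
    by (simp add: b_eq diff_mult_distrib2)
  also have "\<dots> = p ^ (k - 1) * (\<Prod>t<k - 1. k - 1 - t)" by (simp add: prod.distrib)
  also have "(\<Prod>t<k - 1. k - 1 - t) = fact (k - 1)"
    by (simp add: fact_prod_rev atLeast0LessThan)
  finally show ?thesis using True by simp
next
  case False
  then have "{\<gamma> \<in> \<Gamma>2. map g ` \<gamma> = \<gamma>} = {}" using fixed_multichain by blast
  then show ?thesis using False by (simp only: card.empty if_False)
qed

end

lemma P_param: "bij_betw (\<lambda>(h, i). h \<circ> (\<zeta> ^^ i)) (Q \<times> {..<p}) P"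
proof (rule bij_betwI')
  fix x y assume xy: "x \<in> Q \<times> {..<p}" "y \<in> Q \<times> {..<p}"
  obtain h i h' i' where x: "x = (h, i)" "y = (h', i')" by (metis surj_pair)
  have hq: "h \<in> Q" "h' \<in> Q" "i < p" "i' < p" using xy x by auto
  have "h = h' \<and> i = i'" if eq: "h \<circ> (\<zeta> ^^ i) = h' \<circ> (\<zeta> ^^ i')"
  proof
    have a0: "b + 1 \<in> A" using p_pos by (simp add: A_def)
    have "(\<zeta> ^^ i) (b + 1 + 0) = (\<zeta> ^^ i') (b + 1 + 0)"
      using fun_cong[OF eq, of "b + 1"] P_on_A[OF hq(1) a0] P_on_A[OF hq(2) a0] by simp
    then show "i = i'" using zeta_pow[OF p_pos] hq(3,4) by simp
    show "h = h'"
    proof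
      fix z
      show "h z = h' z"
      proof (cases "z \<in> {1..b}")
        case True
        then show ?thesis using fun_cong[OF eq, of z] P_on_B[OF True, of h i] P_on_B[OF True, of h' i'] by metis
      next
        case False
        then show ?thesis using permutes_not_in[OF Q_permutes] hq by metis
      qed
    qed
  qed
  then show "(case x of (h, i) \<Rightarrow> h \<circ> (\<zeta> ^^ i)) = (case y of (h, i) \<Rightarrow> h \<circ> (\<zeta> ^^ i)) \<longleftrightarrow> x = y"
    using x by auto
next
  fix x assume "x \<in> Q \<times> {..<p}"
  then show "(case x of (h, i) \<Rightarrow> h \<circ> (\<zeta> ^^ i)) \<in> P" by (auto simp: P_def)
next
  fix g assume "g \<in> P"
  then obtain h i where h: "h \<in> Q" "g = h \<circ> (\<zeta> ^^ i)" unfolding P_def by blast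
  then have "g = h \<circ> (\<zeta> ^^ (i mod p))" using zeta_pow_cong[of "i mod p" i] by simp
  then show "\<exists>x\<in>Q \<times> {..<p}. g = (case x of (h, i) \<Rightarrow> h \<circ> (\<zeta> ^^ i))"
    using h(1) p_pos by (intro bexI[of _ "(h, i mod p)"]) auto
qed

lemma card_P: "card P = p * card Q"
  using bij_betw_same_card[OF P_param] by (simp add: card_cartesian_product mult.commute)

text \<open>Only the \<open>p - 1\<close> nontrivial powers of the rotation, combined with a fixed point free \<open>h\<close>, contribute.\<close>

lemma sum_fixed:
  "(\<Sum>g\<in>P - {id}. card {\<gamma> \<in> \<Gamma>2. map g ` \<gamma> = \<gamma>}) =
     (p - 1) * (fact (k - 1) * p ^ (k - 1)) * card {h \<in> Q. fpf p b h}"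
proof -
  let ?F = "\<lambda>g. card {\<gamma> \<in> \<Gamma>2. map g ` \<gamma> = \<gamma>}"
  let ?N = "fact (k - 1) * p ^ (k - 1) :: nat"
  have bij: "bij_betw (\<lambda>(h, i). h \<circ> (\<zeta> ^^ i)) (Q \<times> {..<p} - {(id, 0)}) (P - {id})"
  proof -
    let ?f = "\<lambda>(h, i). h \<circ> (\<zeta> ^^ i)"
    have inj: "inj_on ?f (Q \<times> {..<p})" and im: "?f ` (Q \<times> {..<p}) = P"
      using P_param by (simp_all only: bij_betw_def)
    have "?f ` (Q \<times> {..<p} - {(id, 0)}) = ?f ` (Q \<times> {..<p}) - ?f ` {(id, 0)}"
      by (rule inj_on_image_set_diff[OF inj]) (use Q_id p_pos in auto)
    also have "\<dots> = P - {id}" unfolding im by simp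
    finally show ?thesis by (intro bij_betw_imageI inj_on_subset[OF inj]) auto
  qed
  have "(\<Sum>g\<in>P - {id}. ?F g) = (\<Sum>x\<in>Q \<times> {..<p} - {(id, 0)}. ?F ((\<lambda>(h, i). h \<circ> (\<zeta> ^^ i)) x))"
    by (rule sum.reindex_bij_betw[OF bij, symmetric])
  also have "\<dots> = (\<Sum>x\<in>Q \<times> {..<p} - {(id, 0)}. if snd x \<noteq> 0 \<and> fpf p b (fst x) then ?N else 0)"
  proof (rule sum.cong[OF refl])
    fix x assume x: "x \<in> Q \<times> {..<p} - {(id, 0)}"
    obtain h i where hi: "x = (h, i)" by (metis surj_pair)
    have h: "h \<in> Q" "i < p" "i = 0 \<Longrightarrow> h \<noteq> id" using x hi by auto
    show "?F ((\<lambda>(h, i). h \<circ> (\<zeta> ^^ i)) x) = (if snd x \<noteq> 0 \<and> fpf p b (fst x) then ?N else 0)"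
    proof (cases "i = 0")
      case True
      then have e: "(\<lambda>(h, i). h \<circ> (\<zeta> ^^ i)) x = h" using hi by simp
      show ?thesis unfolding e fix_trivial[OF h(1) h(3)[OF True]] using hi True by simp
    next
      case False
      then have nd: "\<not> p dvd i" using h(2) by (simp add: nat_dvd_not_less)
      have e: "(\<lambda>(h, i). h \<circ> (\<zeta> ^^ i)) x = g h i" using hi by (simp add: g_def[OF h(1) nd])
      show ?thesis unfolding e card_fixed[OF h(1) nd] using hi False by simp
    qed
  qed
  also have "\<dots> = (\<Sum>x\<in>{h \<in> Q. fpf p b h} \<times> {1..<p}. ?N)"
    using finite_Q by (intro sum.mono_neutral_cong_right) auto
  also have "\<dots> = (p - 1) * ?N * card {h \<in> Q. fpf p b h}"
    by (simp add: card_cartesian_product)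
  finally show ?thesis .
qed

theorem dim_nrm_Lie_block:
  "card P * fs.dim (R.nrm ` carrier (Lie n) :: ((nat \<Rightarrow> nat) \<Rightarrow> 'f::field) set) +
     (p - 1) * (fact (k - 1) * p ^ (k - 1)) * card {h \<in> Q. fpf p b h} = fs.dim (carrier (Lie n) :: ((nat \<Rightarrow> nat) \<Rightarrow> 'f::field) set)"
  unfolding Lie_carrier dim_dynkin_X using dim_nrm_Lie[where 'f = 'f] by (simp only: sum_fixed)

end

context lie_block
begin

text \<open>The dimension formula for the projective-free part, with the rank of the norm inserted.\<close>

theorem projective_free_part_Lie:
  fixes M :: "((nat \<Rightarrow> nat) \<Rightarrow> 'f::field, (nat \<Rightarrow> nat) \<Rightarrow> 'f) module"
  defines "M \<equiv> Lie n"
  assumes char: "CHAR('f) = p" and card_Q: "card Q = p ^ e"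
  shows "\<exists>U V. pr_pf_decomposition (subgroup_algebra n P) M U V"
    and "pr_pf_decomposition (subgroup_algebra n P) M U V \<Longrightarrow>
      dim_F V = (p - 1) * fact (k - 1) * (p ^ (k - 1) * card {h \<in> Q. fpf p b h})"
proof -
  have ord: "order GP = p ^ Suc e" by (simp add: order_def GP_simps card_P card_Q)
  interpret pr: p_group_rep GP "rtrans :: _ \<Rightarrow> ((nat \<Rightarrow> nat) \<Rightarrow> 'f) \<Rightarrow> _" p "Suc e"
    by unfold_locales (fact char prime_p ord)+
  let ?W = "dynkin ` X_space :: ((nat \<Rightarrow> nat) \<Rightarrow> 'f) set"
  have X_SA: "x \<in> carrier (SA n)" if "x \<in> X_space" for x :: "(nat \<Rightarrow> nat) \<Rightarrow> 'f"
    using that unfolding X_space_def group_algebra_def Sym_def by auto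
  have W_SA: "x \<in> carrier (SA n)" if "x \<in> ?W" for x
    using that unfolding group_algebra_def Sym_def dynkin_def by auto
  have carr: "carrier M = ?W" unfolding M_def by (rule Lie_carrier)
  have rep: "pr.represents M ?W"
    unfolding pr.represents_def
  proof (intro conjI allI ballI)
    show "carrier M = ?W" by (rule carr)
    show "x \<oplus>\<^bsub>M\<^esub> y = x + y" for x y
      by (simp add: M_def Lie_def Let_def right_regular_def group_algebra_def plus_fun_def)
    show "\<zero>\<^bsub>M\<^esub> = 0"
      by (simp add: M_def Lie_def Let_def right_regular_def group_algebra_def zero_fun_def)
    fix a x assume a: "a \<in> carrier pr.FG" and x: "x \<in> ?W"
    have "a \<odot>\<^bsub>M\<^esub> x = x \<otimes>\<^bsub>SA n\<^esub> a"
      by (simp add: M_def Lie_def Let_def right_regular_def)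
    then show "a \<odot>\<^bsub>M\<^esub> x = R.act a x" using act_eq_mult[OF a W_SA[OF x]] by simp
  qed
  have inv: "pr.invariant ?W"
    unfolding pr.invariant_def
  proof (intro conjI ballI)
    show "fs.subspace ?W" by (rule fsp.linear_subspace_image[OF dynkin_linear subspace_X])
    fix g x assume g: "g \<in> carrier GP" and "x \<in> ?W"
    then obtain y where y: "y \<in> X_space" "x = dynkin y" by blast
    have gP: "g \<in> P" using g by (simp add: GP_simps)
    show "rtrans g x \<in> ?W"
      unfolding y(2) dynkin_rtrans[OF gP, symmetric] by (intro imageI rtrans_X[OF gP y(1)])
  qed
  have fin: "fin_dim ?W"
  proof -
    obtain S where "finite S" "(X_space :: ((nat \<Rightarrow> nat) \<Rightarrow> 'f) set) \<subseteq> fs.span S"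
      using fin_dim_X unfolding fin_dim_def by blast
    then have "finite (dynkin ` S)" "?W \<subseteq> fs.span (dynkin ` S)"
      using fsp.linear_span_image[OF dynkin_linear, of S] by auto
    then show ?thesis unfolding fin_dim_def by blast
  qed
  show "\<exists>U V. pr_pf_decomposition (subgroup_algebra n P) M U V"
    by (rule pr.pr_pf_decomposition_exists[OF rep inv fin])
  show "dim_F V = (p - 1) * fact (k - 1) * (p ^ (k - 1) * card {h \<in> Q. fpf p b h})"
    if dec: "pr_pf_decomposition (subgroup_algebra n P) M U V"
  proof -
    have "fs.dim V + order GP * fs.dim (R.nrm ` ?W) = fs.dim ?W"
      by (rule pr.dim_projective_free_part[OF rep inv fin dec])
    moreover have "card P * fs.dim (R.nrm ` ?W) + (p - 1) * (fact (k - 1) * p ^ (k - 1)) * card {h \<in> Q. fpf p b h} = fs.dim ?W"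
      using dim_nrm_Lie_block[where 'f = 'f] unfolding Lie_carrier .
    moreover have "order GP = card P" by (simp add: order_def GP_simps)
    ultimately have "fs.dim V = (p - 1) * (fact (k - 1) * p ^ (k - 1)) * card {h \<in> Q. fpf p b h}" by simp
    then show ?thesis by (simp add: dim_F_def mult.assoc)
  qed
qed

end

section \<open>Permutations side by side\<close>

text \<open>\<open>\<tau>\<close>, a permutation of \<open>c\<close> points, moved to the points \<open>a + 1, \<dots>, a + c\<close>.\<close>

definition place :: "nat \<Rightarrow> nat \<Rightarrow> (nat \<Rightarrow> nat) \<Rightarrow> nat \<Rightarrow> nat" where
  "place a c \<tau> x = (if a < x \<and> x \<le> a + c then a + \<tau> (x - a) else x)"

text \<open>The product of \<open>G\<close>, acting on the first \<open>a\<close> points, and of \<open>K\<close>, acting on the next \<open>c\<close> points.\<close>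

definition juxta :: "nat \<Rightarrow> nat \<Rightarrow> (nat \<Rightarrow> nat) set \<Rightarrow> (nat \<Rightarrow> nat) set \<Rightarrow> (nat \<Rightarrow> nat) set" where
  "juxta a c G K = {place a c \<tau> \<circ> g | g \<tau>. g \<in> G \<and> \<tau> \<in> K}"

definition perms :: "nat \<Rightarrow> (nat \<Rightarrow> nat) set" where
  "perms n = {\<sigma>. \<sigma> permutes {1..n}}"

lemma carrier_Sym: "carrier (Sym n) = perms n"
  by (simp add: Sym_def perms_def)

lemma finite_permutation_set: "finite (perms n)"
  unfolding perms_def by (rule finite_permutations) simp

lemma perms_in: "\<sigma> \<in> perms n \<Longrightarrow> 1 \<le> x \<Longrightarrow> x \<le> n \<Longrightarrow> 1 \<le> \<sigma> x \<and> \<sigma> x \<le> n"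
  using permutes_in_image[of \<sigma> "{1..n}" x] by (simp add: perms_def)

lemma perms_out: "\<sigma> \<in> perms n \<Longrightarrow> x = 0 \<or> n < x \<Longrightarrow> \<sigma> x = x"
  using permutes_not_in[of \<sigma> "{1..n}" x] by (auto simp: perms_def)

lemma perms_comp: "\<sigma> \<in> perms n \<Longrightarrow> \<tau> \<in> perms n \<Longrightarrow> \<tau> \<circ> \<sigma> \<in> perms n"
  unfolding perms_def using permutes_compose by blast

lemma perms_id: "id \<in> perms n"
  by (simp add: perms_def permutes_id)

lemma perms_inv: "\<sigma> \<in> perms n \<Longrightarrow> inv_into UNIV \<sigma> \<in> perms n"
  unfolding perms_def using permutes_inv by blast

lemma perms_inv_o: "\<sigma> \<in> perms n \<Longrightarrow> \<sigma> \<circ> inv_into UNIV \<sigma> = id" "\<sigma> \<in> perms n \<Longrightarrow> inv_into UNIV \<sigma> \<circ> \<sigma> = id"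
  unfolding perms_def using permutes_inv_o by blast+

lemma perms_mono: "m \<le> n \<Longrightarrow> perms m \<subseteq> perms n"
  unfolding perms_def using permutes_subset[of _ "{1..m}" "{1..n}"] by auto

lemma perms_eqI:
  assumes "\<sigma> \<in> perms n" "\<tau> \<in> perms n" "\<And>x. 1 \<le> x \<Longrightarrow> x \<le> n \<Longrightarrow> \<sigma> x = \<tau> x"
  shows "\<sigma> = \<tau>"
proof
  fix x show "\<sigma> x = \<tau> x"
    using assms(3)[of x] perms_out[OF assms(1), of x] perms_out[OF assms(2), of x] by (cases "1 \<le> x \<and> x \<le> n") auto
qed

lemma perms_injI:
  assumes "\<And>x. 1 \<le> x \<Longrightarrow> x \<le> n \<Longrightarrow> 1 \<le> f x \<and> f x \<le> n"
    and "\<And>x y. \<lbrakk>1 \<le> x; x \<le> n; 1 \<le> y; y \<le> n; f x = f y\<rbrakk> \<Longrightarrow> x = y"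
    and "\<And>x. x = 0 \<or> n < x \<Longrightarrow> f x = x"
  shows "f \<in> perms n"
  unfolding perms_def mem_Collect_eq
proof (rule bij_imp_permutes)
  have "f ` {1..n} \<subseteq> {1..n}" using assms(1) by (intro image_subsetI) auto
  moreover have "inj_on f {1..n}" using assms(2) by (intro inj_onI) auto
  ultimately show "bij_betw f {1..n} {1..n}" using endo_inj_surj[of "{1..n}" f] by (simp add: bij_betw_def)
  show "f x = x" if "x \<notin> {1..n}" for x using assms(3)[of x] that by auto
qed

lemma place_in: "\<tau> \<in> perms c \<Longrightarrow> a < x \<Longrightarrow> x \<le> a + c \<Longrightarrow> a < place a c \<tau> x \<and> place a c \<tau> x \<le> a + c"
proof -
  assume "\<tau> \<in> perms c" and x: "a < x" "x \<le> a + c"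
  moreover have "1 \<le> x - a" "x - a \<le> c" using x by linarith+
  ultimately have "1 \<le> \<tau> (x - a) \<and> \<tau> (x - a) \<le> c" using perms_in by blast
  then show ?thesis using x by (simp add: place_def)
qed

lemma place_perms: "\<tau> \<in> perms c \<Longrightarrow> place a c \<tau> \<in> perms (a + c)"
proof (rule perms_injI)
  assume t: "\<tau> \<in> perms c"
  show "1 \<le> place a c \<tau> x \<and> place a c \<tau> x \<le> a + c" if "1 \<le> x" "x \<le> a + c" for x
    using place_in[OF t, of a x] that by (cases "a < x") (auto simp: place_def)
  fix x y assume xy: "1 \<le> x" "x \<le> a + c" "1 \<le> y" "y \<le> a + c" "place a c \<tau> x = place a c \<tau> y"
  have "inj \<tau>" using t permutes_inj by (auto simp: perms_def)
  then show "x = y"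
    using xy place_in[OF t, of a x] place_in[OF t, of a y] by (auto simp: place_def inj_eq split: if_splits)
qed (auto simp: place_def)

lemma juxta_apply:
  assumes "g \<in> perms a" "\<tau> \<in> perms c"
  shows "x \<le> a \<Longrightarrow> (place a c \<tau> \<circ> g) x = g x" "1 \<le> y \<Longrightarrow> y \<le> c \<Longrightarrow> (place a c \<tau> \<circ> g) (a + y) = a + \<tau> y"
proof -
  show "(place a c \<tau> \<circ> g) x = g x" if "x \<le> a"
    using that perms_in[OF assms(1), of x] perms_out[OF assms(1), of x] by (cases "x = 0") (auto simp: place_def)
  show "(place a c \<tau> \<circ> g) (a + y) = a + \<tau> y" if "1 \<le> y" "y \<le> c"
    using that perms_out[OF assms(1), of "a + y"] by (simp add: place_def)
qed

lemma juxta_mem_perms: "g \<in> perms a \<Longrightarrow> \<tau> \<in> perms c \<Longrightarrow> place a c \<tau> \<circ> g \<in> perms (a + c)"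
  by (rule perms_comp[OF _ place_perms]) (use perms_mono[of a "a + c"] in auto)

lemma juxta_perms: "G \<subseteq> perms a \<Longrightarrow> K \<subseteq> perms c \<Longrightarrow> juxta a c G K \<subseteq> perms (a + c)"
  unfolding juxta_def using juxta_mem_perms by blast

lemma juxta_eq_iff:
  assumes "g \<in> perms a" "\<tau> \<in> perms c" "g' \<in> perms a" "\<tau>' \<in> perms c"
  shows "place a c \<tau> \<circ> g = place a c \<tau>' \<circ> g' \<longleftrightarrow> g = g' \<and> \<tau> = \<tau>'"
proof
  assume eq: "place a c \<tau> \<circ> g = place a c \<tau>' \<circ> g'"
  show "g = g' \<and> \<tau> = \<tau>'"
  proof
    show "g = g'"
    proof (rule perms_eqI[OF assms(1,3)])
      fix x assume "x \<le> a"
      then show "g x = g' x"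
        using juxta_apply(1)[OF assms(1,2), of x] juxta_apply(1)[OF assms(3,4), of x] eq by simp
    qed
    show "\<tau> = \<tau>'"
    proof (rule perms_eqI[OF assms(2,4)])
      fix y assume "1 \<le> y" "y \<le> c"
      then show "\<tau> y = \<tau>' y"
        using juxta_apply(2)[OF assms(1,2), of y] juxta_apply(2)[OF assms(3,4), of y] eq by simp
    qed
  qed
qed simp

lemma juxta_bij:
  assumes "G \<subseteq> perms a" "K \<subseteq> perms c"
  shows "bij_betw (\<lambda>(g, \<tau>). place a c \<tau> \<circ> g) (G \<times> K) (juxta a c G K)"
proof (rule bij_betw_imageI)
  show "inj_on (\<lambda>(g, \<tau>). place a c \<tau> \<circ> g) (G \<times> K)"
    using assms juxta_eq_iff by (intro inj_onI) (auto simp: subset_iff)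
  show "(\<lambda>(g, \<tau>). place a c \<tau> \<circ> g) ` (G \<times> K) = juxta a c G K"
    by (force simp: juxta_def)
qed

lemma card_juxta: "G \<subseteq> perms a \<Longrightarrow> K \<subseteq> perms c \<Longrightarrow> card (juxta a c G K) = card G * card K"
  using bij_betw_same_card[OF juxta_bij] by (simp add: card_cartesian_product)

lemma juxta_comp:
  assumes "g \<in> perms a" "\<tau> \<in> perms c" "g' \<in> perms a" "\<tau>' \<in> perms c"
  shows "(place a c \<tau> \<circ> g) \<circ> (place a c \<tau>' \<circ> g') = place a c (\<tau> \<circ> \<tau>') \<circ> (g \<circ> g')"
proof (rule perms_eqI)
  show "(place a c \<tau> \<circ> g) \<circ> (place a c \<tau>' \<circ> g') \<in> perms (a + c)"
    using assms by (intro perms_comp[of "place a c \<tau>' \<circ> g'"] juxta_mem_perms)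
  show "place a c (\<tau> \<circ> \<tau>') \<circ> (g \<circ> g') \<in> perms (a + c)"
    using assms by (intro juxta_mem_perms perms_comp)
  fix x assume x: "1 \<le> x" "x \<le> a + c"
  have gg: "g \<circ> g' \<in> perms a" and tt: "\<tau> \<circ> \<tau>' \<in> perms c" using assms perms_comp by auto
  show "((place a c \<tau> \<circ> g) \<circ> (place a c \<tau>' \<circ> g')) x = (place a c (\<tau> \<circ> \<tau>') \<circ> (g \<circ> g')) x"
  proof (cases "x \<le> a")
    case True
    have "g' x \<le> a" using perms_in[OF assms(3) x(1) True] by simp
    then show ?thesis
      using juxta_apply(1)[OF assms(1,2), of "g' x"] juxta_apply(1)[OF assms(3,4) True] juxta_apply(1)[OF gg tt True] by simp
  next
    case False
    then obtain y where y: "x = a + y" "1 \<le> y" "y \<le> c" using x by (intro that[of "x - a"]) auto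
    have "1 \<le> \<tau>' y" "\<tau>' y \<le> c" using perms_in[OF assms(4) y(2,3)] by auto
    then show ?thesis
      using juxta_apply(2)[OF assms(1,2), of "\<tau>' y"] juxta_apply(2)[OF assms(3,4) y(2,3)] juxta_apply(2)[OF gg tt y(2,3)] y(1) by simp
  qed
qed

lemma juxta_id: "place a c id \<circ> id = id"
  by (auto simp: place_def fun_eq_iff)

lemma subgroup_SymI:
  assumes "G \<subseteq> perms n" "id \<in> G" "\<And>g h. g \<in> G \<Longrightarrow> h \<in> G \<Longrightarrow> g \<circ> h \<in> G" "\<And>g. g \<in> G \<Longrightarrow> inv_into UNIV g \<in> G"
  shows "subgroup G (Sym n)"
proof (rule group.subgroupI[OF group_Sym])
  show "inv\<^bsub>Sym n\<^esub> g \<in> G" if "g \<in> G" for g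
    using assms(4)[OF that] inv_Sym[of g n] assms(1) that by (auto simp: perms_def)
  show "g \<otimes>\<^bsub>Sym n\<^esub> h \<in> G" if "g \<in> G" "h \<in> G" for g h using assms(3)[OF that(2,1)] by (simp add: Sym_def)
qed (use assms in \<open>auto simp: carrier_Sym\<close>)

lemma subgroup_SymD:
  assumes "subgroup G (Sym n)"
  shows "G \<subseteq> perms n" "id \<in> G" "\<And>g h. g \<in> G \<Longrightarrow> h \<in> G \<Longrightarrow> g \<circ> h \<in> G" "\<And>g. g \<in> G \<Longrightarrow> inv_into UNIV g \<in> G"
proof -
  show sub: "G \<subseteq> perms n" using subgroup.subset[OF assms] by (simp add: carrier_Sym)
  show "id \<in> G" using subgroup.one_closed[OF assms] by (simp add: Sym_def)
  show "g \<circ> h \<in> G" if "g \<in> G" "h \<in> G" for g h using subgroup.m_closed[OF assms that(2,1)] by (simp add: Sym_def)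
  show "inv_into UNIV g \<in> G" if "g \<in> G" for g
    using subgroup.m_inv_closed[OF assms that] inv_Sym[of g n] sub that by (auto simp: perms_def)
qed

lemma subgroup_juxta:
  assumes "subgroup G (Sym a)" "subgroup K (Sym c)"
  shows "subgroup (juxta a c G K) (Sym (a + c))"
proof (rule subgroup_SymI)
  note G = subgroup_SymD[OF assms(1)] and K = subgroup_SymD[OF assms(2)]
  show "juxta a c G K \<subseteq> perms (a + c)" by (rule juxta_perms[OF G(1) K(1)])
  show "id \<in> juxta a c G K" unfolding juxta_def using G(2) K(2) juxta_id[of a c, symmetric] by blast
  fix x assume "x \<in> juxta a c G K"
  then obtain g \<tau> where x: "g \<in> G" "\<tau> \<in> K" "x = place a c \<tau> \<circ> g" unfolding juxta_def by blast
  show "x \<circ> y \<in> juxta a c G K" if yj: "y \<in> juxta a c G K" for y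
  proof -
    obtain g' \<tau>' where y: "g' \<in> G" "\<tau>' \<in> K" "y = place a c \<tau>' \<circ> g'" using yj unfolding juxta_def by blast
    have "x \<circ> y = place a c (\<tau> \<circ> \<tau>') \<circ> (g \<circ> g')"
      unfolding x y using x(1,2) y(1,2) G(1) K(1) by (intro juxta_comp) auto
    then show ?thesis unfolding juxta_def using G(3)[OF x(1) y(1)] K(3)[OF x(2) y(2)] by blast
  qed
  let ?y = "place a c (inv_into UNIV \<tau>) \<circ> inv_into UNIV g"
  have gp: "g \<in> perms a" "\<tau> \<in> perms c" using x G(1) K(1) by auto
  note ip = perms_inv[OF gp(1)] perms_inv[OF gp(2)]
  have "x \<circ> ?y = id" "?y \<circ> x = id"
    unfolding x(3) juxta_comp[OF gp ip] juxta_comp[OF ip gp] by (simp_all only: perms_inv_o[OF gp(1)] perms_inv_o[OF gp(2)] juxta_id)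
  then have "inv_into UNIV x = ?y" using inv_unique_comp by blast
  then show "inv_into UNIV x \<in> juxta a c G K" unfolding juxta_def using G(4)[OF x(1)] K(4)[OF x(2)] by blast
qed

lemma juxta_funpow:
  assumes "g \<in> perms a" "\<tau> \<in> perms c"
  shows "(place a c \<tau> \<circ> g) ^^ s = place a c (\<tau> ^^ s) \<circ> (g ^^ s)"
proof (induction s)
  case 0
  show ?case by (simp only: funpow.simps juxta_id)
next
  case (Suc s)
  have "g ^^ s \<in> perms a" "\<tau> ^^ s \<in> perms c" using assms permutes_funpow by (auto simp: perms_def)
  then show ?case by (simp only: funpow.simps Suc.IH juxta_comp[OF assms])
qed

text \<open>Both conditions can be checked on the two parts separately, which makes the count multiplicative.\<close>

lemma fpf_juxta:
  assumes "g \<in> perms a" "\<tau> \<in> perms c"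
  shows "fpf p (a + c) (place a c \<tau> \<circ> g) \<longleftrightarrow> fpf p a g \<and> fpf p c \<tau>"
proof -
  have cocycle: "g ^^ p \<in> perms a" "\<tau> ^^ p \<in> perms c" using assms permutes_funpow by (auto simp: perms_def)
  have "(place a c \<tau> \<circ> g) ^^ p = id \<longleftrightarrow> g ^^ p = id \<and> \<tau> ^^ p = id"
    using juxta_eq_iff[OF cocycle perms_id perms_id] juxta_funpow[OF assms, of p] juxta_id[of a c] by simp
  moreover have "(\<forall>x\<in>{1..a + c}. (place a c \<tau> \<circ> g) x \<noteq> x) \<longleftrightarrow> (\<forall>x\<in>{1..a}. g x \<noteq> x) \<and> (\<forall>y\<in>{1..c}. \<tau> y \<noteq> y)"
  proof -
    have "x \<in> {1..a + c} \<longleftrightarrow> x \<in> {1..a} \<or> (\<exists>y\<in>{1..c}. x = a + y)" for x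
    proof (cases "x \<le> a")
      case False
      then obtain y where "x = a + y" by (metis le_iff_add nat_le_linear)
      then show ?thesis using False by auto
    qed auto
    then have "(\<forall>x\<in>{1..a + c}. Q x) \<longleftrightarrow> (\<forall>x\<in>{1..a}. Q x) \<and> (\<forall>y\<in>{1..c}. Q (a + y))" for Q by blast
    then have "(\<forall>x\<in>{1..a + c}. (place a c \<tau> \<circ> g) x \<noteq> x) \<longleftrightarrow>
        (\<forall>x\<in>{1..a}. (place a c \<tau> \<circ> g) x \<noteq> x) \<and> (\<forall>y\<in>{1..c}. (place a c \<tau> \<circ> g) (a + y) \<noteq> a + y)" .
    also have "(\<forall>x\<in>{1..a}. (place a c \<tau> \<circ> g) x \<noteq> x) \<longleftrightarrow> (\<forall>x\<in>{1..a}. g x \<noteq> x)"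
      using juxta_apply(1)[OF assms] by (intro ball_cong) auto
    also have "(\<forall>y\<in>{1..c}. (place a c \<tau> \<circ> g) (a + y) \<noteq> a + y) \<longleftrightarrow> (\<forall>y\<in>{1..c}. \<tau> y \<noteq> y)"
    proof (rule ball_cong[OF refl])
      fix y assume "y \<in> {1..c}"
      then have "(place a c \<tau> \<circ> g) (a + y) = a + \<tau> y" by (intro juxta_apply(2)[OF assms]) auto
      then show "(place a c \<tau> \<circ> g) (a + y) \<noteq> a + y \<longleftrightarrow> \<tau> y \<noteq> y" by (simp only: add_left_cancel)
    qed
    finally show ?thesis .
  qed
  ultimately show ?thesis by (auto simp: fpf_def)
qed

lemma card_fpf_juxta:
  assumes "G \<subseteq> perms a" "K \<subseteq> perms c"
  shows "card {h \<in> juxta a c G K. fpf p (a + c) h} = card {g \<in> G. fpf p a g} * card {\<tau> \<in> K. fpf p c \<tau>}"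
proof -
  have "{h \<in> juxta a c G K. fpf p (a + c) h} = juxta a c {g \<in> G. fpf p a g} {\<tau> \<in> K. fpf p c \<tau>}"
    unfolding juxta_def using assms fpf_juxta by blast
  moreover have "{g \<in> G. fpf p a g} \<subseteq> perms a" "{\<tau> \<in> K. fpf p c \<tau>} \<subseteq> perms c" using assms by auto
  ultimately show ?thesis using card_juxta by simp
qed

lemma juxta_assoc:
  assumes "G \<subseteq> perms a" "H \<subseteq> perms c" "K \<subseteq> perms d"
  shows "juxta a (c + d) G (juxta c d H K) = juxta (a + c) d (juxta a c G H) K"
proof -
  have eq: "place a (c + d) (place c d \<tau> \<circ> h) \<circ> g = place (a + c) d \<tau> \<circ> (place a c h \<circ> g)"
    if "g \<in> perms a" "h \<in> perms c" "\<tau> \<in> perms d" for g h \<tau>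
  proof -
    have "place a (c + d) (place c d \<tau> \<circ> h) = place (a + c) d \<tau> \<circ> place a c h"
    proof
      fix x
      show "place a (c + d) (place c d \<tau> \<circ> h) x = (place (a + c) d \<tau> \<circ> place a c h) x"
      proof (cases "a < x \<and> x \<le> a + c")
        case True
        then have "1 \<le> x - a" "x - a \<le> c" by linarith+
        then have "1 \<le> h (x - a)" "h (x - a) \<le> c" using perms_in[OF that(2)] by blast+
        then show ?thesis using True by (simp add: place_def)
      next
        case False
        then have "h (x - a) = x - a" by (intro perms_out[OF that(2)]) linarith
        then show ?thesis using False by (auto simp: place_def)
      qed
    qed
    then show ?thesis by (simp add: o_assoc)
  qed
  show ?thesis
  proof (intro equalityI subsetI)
    fix x assume "x \<in> juxta a (c + d) G (juxta c d H K)"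
    then obtain g h \<tau> where "g \<in> G" "h \<in> H" "\<tau> \<in> K" "x = place a (c + d) (place c d \<tau> \<circ> h) \<circ> g"
      unfolding juxta_def by blast
    moreover from this have "x = place (a + c) d \<tau> \<circ> (place a c h \<circ> g)" using eq assms by blast
    ultimately show "x \<in> juxta (a + c) d (juxta a c G H) K" unfolding juxta_def by blast
  next
    fix x assume "x \<in> juxta (a + c) d (juxta a c G H) K"
    then obtain g h \<tau> where "g \<in> G" "h \<in> H" "\<tau> \<in> K" "x = place (a + c) d \<tau> \<circ> (place a c h \<circ> g)"
      unfolding juxta_def by blast
    moreover from this have "x = place a (c + d) (place c d \<tau> \<circ> h) \<circ> g" using eq assms by (simp add: subset_iff)
    ultimately show "x \<in> juxta a (c + d) G (juxta c d H K)" unfolding juxta_def by blast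
  qed
qed

section \<open>Products along compositions\<close>

text \<open>The product in \<open>Sym n\<close> without reference to \<open>n\<close>. It makes products over lists of different total
  degree comparable.\<close>

definition sp :: "(nat \<Rightarrow> nat) set list \<Rightarrow> (nat \<Rightarrow> nat) set" where
  "sp Ks = foldr (\<lambda>A B. {h \<circ> g | g h. g \<in> A \<and> h \<in> B}) Ks {id}"

lemma set_prod_Sym: "set_prod (Sym n) Ks = sp Ks"
proof -
  have "set_mult (Sym n) = (\<lambda>A B. {h \<circ> g | g h. g \<in> A \<and> h \<in> B})"
    by (intro ext) (auto simp: set_mult_def Sym_def)
  then show ?thesis by (simp add: set_prod_def sp_def Sym_def)
qed

lemma sp_Nil: "sp [] = {id}"
  by (simp add: sp_def)

lemma sp_snoc: "sp (Ks @ [K]) = {h \<circ> g | g h. g \<in> sp Ks \<and> h \<in> K}"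
proof (induction Ks)
  case Nil
  show ?case by (auto simp: sp_def)
next
  case (Cons A Ks)
  have "sp ((A # Ks) @ [K]) = {h \<circ> g | g h. g \<in> A \<and> h \<in> sp (Ks @ [K])}" by (simp add: sp_def)
  also have "\<dots> = {(h \<circ> g') \<circ> g | g g' h. g \<in> A \<and> g' \<in> sp Ks \<and> h \<in> K}" unfolding Cons.IH by blast
  also have "\<dots> = {h \<circ> (g' \<circ> g) | g g' h. g \<in> A \<and> g' \<in> sp Ks \<and> h \<in> K}" by (simp only: o_assoc)
  also have "\<dots> = {h \<circ> g | g h. g \<in> sp (A # Ks) \<and> h \<in> K}"
  proof -
    have "sp (A # Ks) = {g' \<circ> g | g g'. g \<in> A \<and> g' \<in> sp Ks}" by (simp add: sp_def)
    then have "{h \<circ> g | g h. g \<in> sp (A # Ks) \<and> h \<in> K} = {h \<circ> g | g h. g \<in> {g' \<circ> g | g g'. g \<in> A \<and> g' \<in> sp Ks} \<and> h \<in> K}"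
      by simp
    then show ?thesis by blast
  qed
  finally show ?case .
qed

definition total :: "nat \<Rightarrow> nat list \<Rightarrow> nat" where
  "total p l = (\<Sum>m\<leftarrow>l. p ^ m)"

lemma total_simps: "total p [] = 0" "total p [m] = p ^ m" "total p (l @ [m]) = total p l + p ^ m" "total p (l1 @ l2) = total p l1 + total p l2"
  by (simp_all add: total_def)

lemma psum_take: "j \<le> length l \<Longrightarrow> psum p l j = total p (take j l)"
proof (induction j)
  case (Suc j)
  then have "take (Suc j) l = take j l @ [l ! j]" by (simp add: take_Suc_conv_app_nth)
  then show ?case using Suc by (simp add: psum_def total_simps)
qed (simp add: psum_def total_def)

text \<open>The divisibility condition of \<^const>\<open>p_composition\<close> without the prescribed total.\<close>

definition pcomp :: "nat \<Rightarrow> nat list \<Rightarrow> bool" where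
  "pcomp p l \<longleftrightarrow> (\<forall>j\<in>{1..length l}. p ^ (l ! (j - 1)) dvd psum p l j)"

lemma p_composition_iff: "p_composition p d l \<longleftrightarrow> total p l = d \<and> pcomp p l"
  by (simp add: p_composition_def pcomp_def psum_take)

lemma pcomp_Nil: "pcomp p []"
  by (simp add: pcomp_def)

lemma psum_snoc: "j \<le> length l \<Longrightarrow> psum p (l @ [m]) j = psum p l j" "psum p (l @ [m]) (Suc (length l)) = total p l + p ^ m"
  by (simp_all add: psum_take total_simps)

lemma pcomp_snoc: "pcomp p (l @ [m]) \<longleftrightarrow> pcomp p l \<and> p ^ m dvd total p l"
proof -
  have "{1..length (l @ [m])} = insert (Suc (length l)) {1..length l}" by auto
  then have "pcomp p (l @ [m]) \<longleftrightarrow> p ^ m dvd total p l + p ^ m \<and>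
      (\<forall>j\<in>{1..length l}. p ^ ((l @ [m]) ! (j - 1)) dvd psum p (l @ [m]) j)"
    unfolding pcomp_def by (simp add: psum_snoc del: One_nat_def)
  also have "(\<forall>j\<in>{1..length l}. p ^ ((l @ [m]) ! (j - 1)) dvd psum p (l @ [m]) j) \<longleftrightarrow> pcomp p l"
    unfolding pcomp_def by (intro ball_cong refl) (auto simp: psum_snoc nth_append)
  finally show ?thesis by auto
qed

lemma shift_eq_place:
  assumes "p ^ m dvd s" "0 < p"
  shows "shift (p ^ (m + 1)) ((s + p ^ m) div p ^ m) \<tau> = place (p * s) (p ^ (m + 1)) \<tau>"
proof -
  obtain q where "s = p ^ m * q" using assms(1) by (elim dvdE)
  then have "(s + p ^ m) div p ^ m = Suc q" "p * s = q * p ^ (m + 1)" using assms(2) by simp_all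
  then show ?thesis by (auto simp: fun_eq_iff shift_def place_def algebra_simps)
qed

lemma block_prod_Nil: "block_prod p [] K = {id}"
  by (simp add: block_prod_def set_prod_Sym sp_Nil)

lemma block_prod_snoc:
  assumes "p ^ m dvd total p l" "0 < p"
  shows "block_prod p (l @ [m]) K = juxta (p * total p l) (p ^ (m + 1)) (block_prod p l K) (K m)"
proof -
  let ?f = "\<lambda>l r. shift (p ^ (l ! (r - 1) + 1)) (psum p l r div p ^ (l ! (r - 1))) ` K (l ! (r - 1))"
  have "map (?f (l @ [m])) [1..<Suc (length (l @ [m]))] =
      map (?f (l @ [m])) [1..<Suc (length l)] @ [?f (l @ [m]) (Suc (length l))]"
    by simp
  also have "map (?f (l @ [m])) [1..<Suc (length l)] = map (?f l) [1..<Suc (length l)]"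
    by (intro map_cong refl) (auto simp: psum_snoc nth_append)
  also have "?f (l @ [m]) (Suc (length l)) = place (p * total p l) (p ^ (m + 1)) ` K m"
    using shift_eq_place[OF assms] by (simp add: psum_snoc)
  finally have "block_prod p (l @ [m]) K = sp (map (?f l) [1..<Suc (length l)] @ [place (p * total p l) (p ^ (m + 1)) ` K m])"
    by (simp only: block_prod_def set_prod_Sym)
  also have "\<dots> = {h \<circ> g | g h. g \<in> block_prod p l K \<and> h \<in> place (p * total p l) (p ^ (m + 1)) ` K m}"
    by (simp only: sp_snoc block_prod_def set_prod_Sym)
  finally show ?thesis unfolding juxta_def by blast
qed

lemma total_snoc_mult: "p * total p l + p ^ (m + 1) = p * total p (l @ [m])"
  by (simp add: total_simps algebra_simps)

lemma block_prod_perms: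
  assumes "0 < p" "\<And>m. K m \<subseteq> perms (p ^ (m + 1))"
  shows "pcomp p l \<Longrightarrow> block_prod p l K \<subseteq> perms (p * total p l)"
proof (induction l rule: rev_induct)
  case Nil
  show ?case by (simp add: block_prod_Nil perms_id)
next
  case (snoc m l)
  then have l: "pcomp p l" "p ^ m dvd total p l" using pcomp_snoc by auto
  show ?case unfolding block_prod_snoc[OF l(2) assms(1)] total_snoc_mult[symmetric]
    by (rule juxta_perms[OF snoc.IH[OF l(1)] assms(2)])
qed

lemma block_prod_append:
  assumes "0 < p" "\<And>m. K m \<subseteq> perms (p ^ (m + 1))" "pcomp p l1"
  shows "\<lbrakk>pcomp p l2; \<forall>m\<in>set l2. p ^ m dvd total p l1\<rbrakk> \<Longrightarrow> pcomp p (l1 @ l2) \<and>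
    block_prod p (l1 @ l2) K = juxta (p * total p l1) (p * total p l2) (block_prod p l1 K) (block_prod p l2 K)"
proof (induction l2 rule: rev_induct)
  case Nil
  have "place a 0 id = id" for a :: nat by (auto simp: place_def fun_eq_iff)
  then have "juxta a 0 G {id} = G" for a G by (simp add: juxta_def)
  then show ?case using assms(3) by (simp add: total_simps block_prod_Nil)
next
  case (snoc m l2)
  then have l: "pcomp p l2" "p ^ m dvd total p l2" "p ^ m dvd total p l1" using pcomp_snoc by auto
  then have IH: "pcomp p (l1 @ l2)" "block_prod p (l1 @ l2) K = juxta (p * total p l1) (p * total p l2) (block_prod p l1 K) (block_prod p l2 K)"
    using snoc by auto
  have d: "p ^ m dvd total p (l1 @ l2)" using l by (simp add: total_simps)
  have "block_prod p ((l1 @ l2) @ [m]) K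
      = juxta (p * total p l1 + p * total p l2) (p ^ (m + 1)) (juxta (p * total p l1) (p * total p l2) (block_prod p l1 K) (block_prod p l2 K)) (K m)"
    unfolding block_prod_snoc[OF d assms(1)] IH(2) by (simp only: total_simps distrib_left)
  also have "\<dots> = juxta (p * total p l1) (p * total p l2 + p ^ (m + 1)) (block_prod p l1 K) (juxta (p * total p l2) (p ^ (m + 1)) (block_prod p l2 K) (K m))"
    by (rule juxta_assoc[symmetric, OF block_prod_perms[OF assms] block_prod_perms[OF assms(1,2) l(1)] assms(2)])
  also have "\<dots> = juxta (p * total p l1) (p * total p (l2 @ [m])) (block_prod p l1 K) (block_prod p (l2 @ [m]) K)"
    by (simp only: block_prod_snoc[OF l(2) assms(1)] total_snoc_mult)
  finally show ?case using IH(1) d pcomp_snoc[of p "l1 @ l2" m] by simp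
qed

text \<open>Remove parts from the end. As long as the sum of the rest exceeds \<open>d\<close>, the power of \<open>p\<close> belonging to its
  last part divides \<open>d\<close> and hence the excess, so it does not exceed the excess. Thus the partial sums
  hit \<open>d\<close>, and the divisibility conditions for the tail are those modulo \<open>d\<close>.\<close>

lemma composition_split:
  assumes "1 < p" "p ^ v dvd d"
  shows "\<lbrakk>pcomp p l; total p l = d + e; 1 \<le> e; e \<le> p ^ v; l \<noteq> []; last l \<le> v\<rbrakk> \<Longrightarrow>
    \<exists>l1 l2. l = l1 @ l2 \<and> pcomp p l1 \<and> total p l1 = d \<and> pcomp p l2 \<and> total p l2 = e"
proof (induction l arbitrary: e rule: rev_induct)
  case (snoc m l)
  then have l: "pcomp p l" "p ^ m dvd total p l" "m \<le> v" using pcomp_snoc by auto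
  have md: "p ^ m dvd d" using l(3) assms(2) by (meson dvd_trans le_imp_power_dvd)
  have sum: "total p l + p ^ m = d + e" using snoc.prems(2) by (simp add: total_simps)
  have me: "p ^ m dvd e" using md l(2) sum by (metis dvd_add_right_iff dvd_add dvd_refl)
  then have le: "p ^ m \<le> e" using snoc.prems(3) by (intro dvd_imp_le) auto
  then obtain e' where e': "e = e' + p ^ m" by (metis add.commute le_Suc_ex)
  have t: "total p l = d + e'" using sum e' by simp
  show ?case
  proof (cases "e' = 0")
    case True
    have "pcomp p [m]" using pcomp_snoc[of p "[]" m] by (simp add: pcomp_Nil total_simps)
    moreover have "total p [m] = e" using e' True by (simp add: total_def)
    ultimately show ?thesis using l(1) t True by (intro exI[of _ l] exI[of _ "[m]"]) auto
  next
    case False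
    have "0 < p ^ m" using assms(1) by simp
    then have lt: "e' < p ^ v" using e' snoc.prems(4) by linarith
    have ne: "l \<noteq> []" using t False by (auto simp: total_simps)
    then obtain l' m' where l': "l = l' @ [m']" using rev_exhaust by blast
    have "m' \<le> v"
    proof (rule ccontr)
      assume "\<not> m' \<le> v"
      then have "p ^ v dvd p ^ m'" by (simp add: le_imp_power_dvd)
      moreover have "p ^ m' dvd total p l" using l(1) unfolding l' pcomp_snoc by (simp add: total_simps)
      ultimately have "p ^ v dvd d + e'" using t by (metis dvd_trans)
      then have "p ^ v dvd e'" using assms(2) by (simp add: dvd_add_right_iff)
      then show False using lt False by (simp add: nat_dvd_not_less)
    qed
    then obtain l1 l2 where s: "l = l1 @ l2" "pcomp p l1" "total p l1 = d" "pcomp p l2" "total p l2 = e'"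
      using snoc.IH[OF l(1) t] False lt ne l' by auto
    have "p ^ m dvd e'" using me e' by (simp add: dvd_add_left_iff)
    then have "pcomp p (l2 @ [m])" using s pcomp_snoc by simp
    moreover have "total p (l2 @ [m]) = e" using s(5) e' by (simp add: total_simps)
    ultimately show ?thesis using s by (intro exI[of _ l1] exI[of _ "l2 @ [m]"]) auto
  qed
qed simp

lemma part_le_total: "m \<in> set l \<Longrightarrow> p ^ m \<le> total p l"
  unfolding total_def by (rule member_le_sum_list) auto

lemma part_le:
  assumes "1 < p" "m \<in> set l" "total p l \<le> p ^ v"
  shows "m \<le> v"
  using part_le_total[OF assms(2), of p] assms(1,3) by (meson le_trans power_le_imp_le_exp)

text \<open>\<open>X\<^sub>d\<close> for an arbitrary family \<open>K\<close> in place of the sets \<open>Y\<close>.\<close>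

definition comps :: "nat \<Rightarrow> nat \<Rightarrow> (nat \<Rightarrow> (nat \<Rightarrow> nat) set) \<Rightarrow> (nat \<Rightarrow> nat) set" where
  "comps p d K = (\<Union>l\<in>{l. p_composition p d l}. block_prod p l K)"

locale block_family =
  fixes p :: nat and K :: "nat \<Rightarrow> (nat \<Rightarrow> nat) set"
  assumes p_gt: "1 < p" and K_perms: "K m \<subseteq> perms (p ^ (m + 1))"
begin

lemma p_pos: "0 < p" using p_gt by simp

lemma comps_perms: "comps p d K \<subseteq> perms (p * d)"
  unfolding comps_def p_composition_iff using block_prod_perms[OF p_pos K_perms] by blast

lemma split_block:
  assumes "p ^ v dvd d" "pcomp p l" "total p l = d + e" "1 \<le> e" "e \<le> p ^ v" "l \<noteq> []" "last l \<le> v"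
  shows "block_prod p l K \<subseteq> juxta (p * d) (p * e) (comps p d K) (comps p e K)"
proof -
  obtain l1 l2 where s: "l = l1 @ l2" "pcomp p l1" "total p l1 = d" "pcomp p l2" "total p l2 = e"
    using composition_split[OF p_gt assms] by blast
  have "\<forall>m\<in>set l2. p ^ m dvd total p l1"
    using part_le[OF p_gt, of _ l2 v] s assms(1,5) by (metis dvd_trans le_imp_power_dvd)
  then have "block_prod p l K = juxta (p * d) (p * e) (block_prod p l1 K) (block_prod p l2 K)"
    using block_prod_append[OF p_pos K_perms s(2,4)] s by simp
  moreover have "block_prod p l1 K \<subseteq> comps p d K" "block_prod p l2 K \<subseteq> comps p e K"
    using s unfolding comps_def p_composition_iff by blast+
  ultimately show ?thesis unfolding juxta_def by blast
qed

lemma join_comps: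
  assumes "p ^ v dvd d" "e \<le> p ^ v"
  shows "juxta (p * d) (p * e) (comps p d K) (comps p e K) \<subseteq> comps p (d + e) K"
proof
  fix x assume "x \<in> juxta (p * d) (p * e) (comps p d K) (comps p e K)"
  then obtain l1 l2 where l: "pcomp p l1" "total p l1 = d" "pcomp p l2" "total p l2 = e"
      and x: "x \<in> juxta (p * d) (p * e) (block_prod p l1 K) (block_prod p l2 K)"
    unfolding juxta_def comps_def p_composition_iff by blast
  have "\<forall>m\<in>set l2. p ^ m dvd total p l1"
    using part_le[OF p_gt, of _ l2 v] l assms by (metis dvd_trans le_imp_power_dvd)
  then have "pcomp p (l1 @ l2)" "x \<in> block_prod p (l1 @ l2) K"
    using block_prod_append[OF p_pos K_perms l(1,3)] l x by auto
  then show "x \<in> comps p (d + e) K" unfolding comps_def p_composition_iff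
    using l total_simps(4)[of p l1 l2] by blast
qed

text \<open>The exponent of the last part is at most \<open>v\<close>, as its power of \<open>p\<close> divides the total; hence the composition
  can be cut at \<open>d\<close>.\<close>

lemma comps_split:
  assumes "p ^ v dvd d" "1 \<le> e" "e \<le> p ^ v" "\<not> p ^ (v + 1) dvd d + e"
  shows "comps p (d + e) K = juxta (p * d) (p * e) (comps p d K) (comps p e K)"
proof
  show "comps p (d + e) K \<subseteq> juxta (p * d) (p * e) (comps p d K) (comps p e K)"
    unfolding comps_def[of p "d + e"]
  proof (rule UN_least)
    fix l assume "l \<in> {l. p_composition p (d + e) l}"
    then have l: "pcomp p l" "total p l = d + e" by (auto simp: p_composition_iff)
    then have ne: "l \<noteq> []" using assms(2) by (auto simp: total_simps)
    then obtain l' m where l': "l = l' @ [m]" using rev_exhaust by blast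
    then have "p ^ m dvd d + e" using l pcomp_snoc by (metis dvd_add dvd_refl total_simps(3))
    then have "\<not> v + 1 \<le> m" using assms(4) by (meson dvd_trans le_imp_power_dvd)
    then have "last l \<le> v" using l' by simp
    then show "block_prod p l K \<subseteq> juxta (p * d) (p * e) (comps p d K) (comps p e K)"
      using split_block[OF assms(1) l assms(2,3) ne] by blast
  qed
qed (rule join_comps[OF assms(1,3)])

lemma card_comps_split:
  assumes "p ^ v dvd d" "1 \<le> e" "e \<le> p ^ v" "\<not> p ^ (v + 1) dvd d + e"
  shows "card (comps p (d + e) K) = card (comps p d K) * card (comps p e K)"
  unfolding comps_split[OF assms] by (rule card_juxta[OF comps_perms comps_perms])

lemma total_0_iff: "total p l = 0 \<longleftrightarrow> l = []"
  using p_pos by (cases l) (auto simp: total_def)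

lemma comps_0: "comps p 0 K = {id}"
proof -
  have "p_composition p 0 l \<longleftrightarrow> l = []" for l
    unfolding p_composition_iff total_0_iff using pcomp_Nil by blast
  then have "{l. p_composition p 0 l} = {[]}" by blast
  then show ?thesis unfolding comps_def by (simp only: UN_insert UN_empty Un_empty_right block_prod_Nil)
qed

lemma block_prod_single: "block_prod p [m] K = K m"
proof -
  have "place 0 (p ^ (m + 1)) \<tau> \<circ> id = \<tau>" if "\<tau> \<in> K m" for \<tau>
  proof
    fix x show "(place 0 (p ^ (m + 1)) \<tau> \<circ> id) x = \<tau> x"
      using K_perms[of m] that perms_out[of \<tau> "p ^ (m + 1)" x] by (auto simp: place_def)
  qed
  moreover have "block_prod p ([] @ [m]) K = juxta (p * total p []) (p ^ (m + 1)) {id} (K m)"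
    using block_prod_snoc[of p m "[]" K] p_pos by (simp add: total_simps block_prod_Nil)
  moreover have "juxta 0 (p ^ (m + 1)) {id} (K m) = (\<lambda>\<tau>. place 0 (p ^ (m + 1)) \<tau> \<circ> id) ` K m" unfolding juxta_def by blast
  ultimately show ?thesis by (simp only: total_simps mult_0_right append_Nil) (simp cong: image_cong)
qed

text \<open>A part that equals the total is the only part.\<close>

lemma composition_power_cases:
  assumes "pcomp p l" "total p l = p ^ m"
  obtains "l = [m]" | "l \<noteq> []" "last l < m"
proof (cases l rule: rev_cases)
  case Nil
  then show ?thesis using assms p_pos by (simp add: total_simps)
next
  case (snoc l' j)
  have "j \<le> m" using part_le[OF p_gt, of j l m] assms snoc by simp
  moreover have "l = [m]" if "j = m"
  proof -
    have "total p l' = 0" using assms(2) that snoc by (simp add: total_simps)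
    then show ?thesis using total_0_iff snoc that by simp
  qed
  ultimately show ?thesis using that snoc by (cases "j = m") auto
qed

lemma comps_single: "K m \<subseteq> comps p (p ^ m) K"
proof -
  have "p_composition p (p ^ m) [m]" using pcomp_snoc[of p "[]" m] by (simp add: p_composition_iff total_def pcomp_Nil)
  then show ?thesis using block_prod_single[of m] unfolding comps_def by blast
qed

lemma comps_1: "comps p (p ^ 0) K = K 0"
proof
  show "comps p (p ^ 0) K \<subseteq> K 0"
    unfolding comps_def p_composition_iff
    by (rule UN_least) (use composition_power_cases[of _ 0] block_prod_single[of 0] in blast)
qed (rule comps_single)

lemma comps_power_Suc:
  "comps p (p ^ Suc m) K = K (Suc m) \<union> juxta (p * ((p - 1) * p ^ m)) (p * p ^ m) (comps p ((p - 1) * p ^ m) K) (comps p (p ^ m) K)"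
    (is "_ = _ \<union> ?J")
proof
  have eq: "(p - 1) * p ^ m + p ^ m = p ^ Suc m" using p_pos by (cases p) auto
  have pm: "1 \<le> p ^ m" using p_pos by (simp add: Suc_le_eq)
  show "comps p (p ^ Suc m) K \<subseteq> K (Suc m) \<union> ?J"
    unfolding comps_def[of p "p ^ Suc m"]
  proof (rule UN_least)
    fix l assume "l \<in> {l. p_composition p (p ^ Suc m) l}"
    then have l: "pcomp p l" "total p l = p ^ Suc m" by (auto simp: p_composition_iff)
    then show "block_prod p l K \<subseteq> K (Suc m) \<union> ?J"
    proof (cases rule: composition_power_cases)
      case 1
      then show ?thesis using block_prod_single by blast
    next
      case 2
      then show ?thesis using split_block[of m "(p - 1) * p ^ m" l "p ^ m"] l eq pm by auto
    qed
  qed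
  show "K (Suc m) \<union> ?J \<subseteq> comps p (p ^ Suc m) K"
    using comps_single[of "Suc m"] join_comps[of m "(p - 1) * p ^ m" "p ^ m"] unfolding eq by auto
qed

lemma card_comps_multiple: "i < p \<Longrightarrow> card (comps p (i * p ^ m) K) = card (comps p (p ^ m) K) ^ i"
proof (induction i)
  case 0
  show ?case by (simp add: comps_0)
next
  case (Suc i)
  have "\<not> p ^ (m + 1) dvd i * p ^ m + p ^ m"
  proof
    assume "p ^ (m + 1) dvd i * p ^ m + p ^ m"
    then have "p * p ^ m dvd Suc i * p ^ m" by (simp add: add.commute)
    then have "p dvd Suc i" using p_pos by (simp only: mult.commute[of _ "p ^ m"] nat_mult_dvd_cancel_disj) auto
    then show False using Suc.prems by (simp add: nat_dvd_not_less)
  qed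
  moreover have "1 \<le> p ^ m" using p_pos by (simp add: Suc_le_eq)
  ultimately have "card (comps p (i * p ^ m + p ^ m) K) = card (comps p (i * p ^ m) K) * card (comps p (p ^ m) K)"
    by (intro card_comps_split[of m]) auto
  then show ?case using Suc by (simp add: add.commute mult.commute)
qed

lemma card_comps_power_Suc:
  assumes "K (Suc m) \<inter> juxta (p * ((p - 1) * p ^ m)) (p * p ^ m) (comps p ((p - 1) * p ^ m) K) (comps p (p ^ m) K) = {}"
  shows "card (comps p (p ^ Suc m) K) = card (K (Suc m)) + card (comps p (p ^ m) K) ^ p"
proof -
  let ?J = "juxta (p * ((p - 1) * p ^ m)) (p * p ^ m) (comps p ((p - 1) * p ^ m) K) (comps p (p ^ m) K)"
  have "?J \<subseteq> perms (p * ((p - 1) * p ^ m) + p * p ^ m)" by (rule juxta_perms[OF comps_perms comps_perms])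
  then have fin: "finite ?J" "finite (K (Suc m))" using K_perms finite_subset[OF _ finite_permutation_set] by blast+
  have "card (comps p (p ^ Suc m) K) = card (K (Suc m)) + card ?J"
    unfolding comps_power_Suc by (rule card_Un_disjoint[OF fin(2,1) assms])
  also have "card ?J = card (comps p (p ^ m) K) ^ (p - 1) * card (comps p (p ^ m) K)"
    unfolding card_juxta[OF comps_perms comps_perms] using p_gt by (subst card_comps_multiple) auto
  also have "\<dots> = card (comps p (p ^ m) K) ^ p" using p_pos by (metis power_minus_mult)
  finally show ?thesis .
qed

end

section \<open>The p-adic composition\<close>

lemma padic_extend:
  assumes "1 < p" "d \<le> N"
  shows "concat (map (\<lambda>i. replicate (d div p ^ i mod p) i) (rev [0..<N])) = padic_composition p d"
  using assms(2)
proof (induction rule: dec_induct)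
  case base
  show ?case by (simp add: padic_composition_def)
next
  case (step N)
  have "d < p ^ N" using step.hyps(1) less_exp[of N] power_mono[of 2 p N] assms(1) by linarith
  then show ?case using step.IH by simp
qed

text \<open>Subtracting \<open>p ^ v\<close> lowers the lowest nonzero digit by one and keeps all others.\<close>

lemma padic_step:
  assumes "1 < p" "\<not> p dvd c"
  shows "padic_composition p (c * p ^ v) = padic_composition p ((c - 1) * p ^ v) @ [v]"
proof -
  let ?r = "\<lambda>d i. replicate (d div p ^ i mod p) i"
  let ?N = "c * p ^ v + Suc v"
  let ?d = "c * p ^ v" and ?e = "(c - 1) * p ^ v"
  have pos: "0 < p ^ i" for i using assms(1) by simp
  \<comment> \<open>the digits below, above and at position \<open>v\<close>\<close>
  have low: "x * p ^ v div p ^ i mod p = 0" if iv: "i < v" for i x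
  proof -
    obtain j where "v = i + Suc j" using less_imp_Suc_add[OF iv] by auto
    then have "x * p ^ v div p ^ i = p * (x * p ^ j)" using pos[of i] by (simp add: power_add)
    then show ?thesis by simp
  qed
  have hi: "?d div p ^ i mod p = ?e div p ^ i mod p" if iv: "v < i" for i
  proof -
    obtain j where j: "i = v + Suc j" using less_imp_Suc_add[OF iv] by auto
    have c: "0 < c" using assms(2) by (cases c) auto
    then have "(c - 1) div p = c div p" using assms
      by (metis Suc_diff_1 div_Suc dvd_eq_mod_eq_0)
    then have "(c - 1) div p ^ Suc j = c div p ^ Suc j" by (simp add: div_mult2_eq)
    moreover have "x * p ^ v div p ^ i = x div p ^ Suc j" for x
      using pos[of v] unfolding j power_add div_mult2_eq by simp
    ultimately show ?thesis by simp
  qed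
  have mid: "?d div p ^ v mod p = Suc (?e div p ^ v mod p)"
  proof -
    have "c mod p \<noteq> 0" "0 < c" using assms(2) by (auto simp: dvd_eq_mod_eq_0 intro: gr0I)
    then have "c mod p = Suc ((c - 1) mod p)" by (metis Suc_diff_1 mod_Suc)
    then show ?thesis using pos[of v] by simp
  qed
  have rng: "rev [0..<?N] = rev [Suc v..<?N] @ [v] @ rev [0..<v]"
  proof -
    have "[0..<?N] = [0..<v] @ [v] @ [Suc v..<?N]"
      by (metis append_Cons append_Nil le_add2 le_add_same_cancel1 le_less_trans lessI upt_add_eq_append upt_conv_Cons less_add_same_cancel2 add_Suc_right le0 le_add1 less_Suc_eq_le le_SucI add.commute)
    then show ?thesis by simp
  qed
  have lowc: "concat (map (?r (x * p ^ v)) (rev [0..<v])) = []" for x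
    using low by (auto simp: concat_eq_Nil_conv)
  have hic: "map (?r ?d) (rev [Suc v..<?N]) = map (?r ?e) (rev [Suc v..<?N])"
  proof (rule map_cong[OF refl])
    fix i assume "i \<in> set (rev [Suc v..<?N])"
    then have "v < i" by (simp del: upt_Suc)
    then show "?r ?d i = ?r ?e i" by (simp only: hi)
  qed
  have "concat (map (?r ?d) (rev [0..<?N])) = concat (map (?r ?e) (rev [0..<?N])) @ [v]"
    unfolding rng map_append concat_append lowc hic
    by (simp only: list.map concat.simps mid append_Nil2 append_assoc replicate_Suc replicate_append_same[symmetric])
  moreover have "?d \<le> ?N" by simp
  moreover have "?e \<le> ?d" by (intro mult_right_mono) auto
  then have "?e \<le> ?N" by (rule trans_le_add1)
  ultimately show ?thesis by (simp only: padic_extend[OF assms(1)])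
qed

lemma power_cofactor:
  assumes "1 < (p :: nat)" "0 < d"
  obtains c v where "d = c * p ^ v" "\<not> p dvd c"
proof -
  obtain c where "d = p ^ multiplicity p d * c" "\<not> p dvd c"
    by (rule multiplicity_decompose'[of d p]) (use assms in auto)
  then show ?thesis using that[of c "multiplicity p d"] by (simp add: mult.commute)
qed

lemma padic_induct [consumes 1, case_names zero step]:
  assumes "1 < p"
    and "P 0 []"
    and "\<And>c v. \<lbrakk>\<not> p dvd c; P ((c - 1) * p ^ v) (padic_composition p ((c - 1) * p ^ v))\<rbrakk> \<Longrightarrow>
        P ((c - 1) * p ^ v + p ^ v) (padic_composition p ((c - 1) * p ^ v) @ [v])"
  shows "P d (padic_composition p d)"
proof (induction d rule: less_induct)
  case (less d)
  show ?case
  proof (cases "d = 0")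
    case True
    then show ?thesis using assms(2) by (simp add: padic_composition_def)
  next
    case False
    then obtain c v where cv: "d = c * p ^ v" "\<not> p dvd c" using power_cofactor[OF assms(1)] by blast
    then have c: "0 < c" by (intro gr0I) auto
    then have eq: "(c - 1) * p ^ v + p ^ v = d" using cv(1) by (cases c) auto
    moreover have "0 < p ^ v" using assms(1) by simp
    ultimately have "P ((c - 1) * p ^ v) (padic_composition p ((c - 1) * p ^ v))" by (intro less) linarith
    from assms(3)[OF cv(2) this] show ?thesis by (simp only: eq padic_step[OF assms(1) cv(2), symmetric] cv(1)[symmetric])
  qed
qed

lemma padic_composition_is_composition:
  assumes "1 < p"
  shows "pcomp p (padic_composition p d) \<and> total p (padic_composition p d) = d"
  using assms
proof (induction d rule: padic_induct)
  case zero
  show ?case by (simp add: pcomp_Nil total_simps)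
next
  case (step c v)
  then show ?case by (simp add: pcomp_snoc total_simps)
qed

lemma (in block_family) card_comps:
  "card (comps p d K) = (\<Prod>m\<leftarrow>padic_composition p d. card (comps p (p ^ m) K))"
  using p_gt
proof (induction d rule: padic_induct)
  case zero
  show ?case by (simp add: comps_0)
next
  case (step c v)
  have "0 < c" using step by (intro gr0I) auto
  then have eq: "(c - 1) * p ^ v + p ^ v = c * p ^ v" by (cases c) auto
  have "\<not> p ^ (v + 1) dvd (c - 1) * p ^ v + p ^ v"
  proof
    assume "p ^ (v + 1) dvd (c - 1) * p ^ v + p ^ v"
    then have "p * p ^ v dvd c * p ^ v" unfolding eq by simp
    then have "p dvd c" using p_pos by (simp only: mult.commute[of _ "p ^ v"] nat_mult_dvd_cancel_disj) auto
    then show False using step by simp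
  qed
  moreover have "1 \<le> p ^ v" using p_pos by (simp add: Suc_le_eq)
  ultimately have "card (comps p ((c - 1) * p ^ v + p ^ v) K) = card (comps p ((c - 1) * p ^ v) K) * card (comps p (p ^ v) K)"
    by (intro card_comps_split[of v]) auto
  then show ?case using step by simp
qed

section \<open>Wreath products with a cyclic group\<close>

text \<open>The points are arranged in \<open>p\<close> blocks of size \<open>q\<close>. Block \<open>j\<close> is moved to block \<open>j + i\<close>, cyclically, and
  \<open>f j\<close> is applied inside.\<close>

definition wr :: "nat \<Rightarrow> nat \<Rightarrow> (nat \<Rightarrow> nat \<Rightarrow> nat) \<Rightarrow> nat \<Rightarrow> nat \<Rightarrow> nat" where
  "wr p q f i x = (if 1 \<le> x \<and> x \<le> p * q
     then ((x - 1) div q + i) mod p * q + f ((x - 1) div q) ((x - 1) mod q + 1) else x)"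

text \<open>The inner part of the \<open>s\<close>-th power of a wreath product element: the product of the inner parts
  met along the way from block \<open>j\<close>.\<close>

fun cocycle :: "nat \<Rightarrow> (nat \<Rightarrow> nat \<Rightarrow> nat) \<Rightarrow> nat \<Rightarrow> nat \<Rightarrow> nat \<Rightarrow> nat \<Rightarrow> nat" where
  "cocycle p f i 0 j = id"
| "cocycle p f i (Suc s) j = f ((j + s * i) mod p) \<circ> cocycle p f i s j"

lemma mod_add_right_inj:
  assumes "j < p" "k < p" "(j + i) mod p = (k + i) mod (p :: nat)"
  shows "j = k"
proof -
  have c: "(x + i + (p - i mod p)) mod p = x" if "x < p" for x
  proof -
    have "i mod p < p" using that by (intro mod_less_divisor) simp
    then have "(i + (p - i mod p)) mod p = (i mod p + (p - i mod p)) mod p" by (simp only: mod_add_left_eq)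
    also have "\<dots> = 0" using \<open>i mod p < p\<close> by simp
    finally have "(x + (i + (p - i mod p))) mod p = (x + 0) mod p" by (metis mod_add_right_eq mod_0)
    then show ?thesis using that by (simp add: add.assoc)
  qed
  show ?thesis using c[OF assms(1)] c[OF assms(2)] assms(3) by (metis mod_add_left_eq)
qed

lemma grid_coordinates:
  fixes x s c :: nat
  assumes "0 < c" "1 \<le> x" "x \<le> s * c"
  obtains j y where "x = j * c + y" "j < s" "1 \<le> y" "y \<le> c"
proof
  show "x = (x - 1) div c * c + ((x - 1) mod c + 1)" using assms(2) by simp
  show "(x - 1) div c < s" using assms by (simp add: div_less_iff_less_mult)
  show "1 \<le> (x - 1) mod c + 1" by simp
  show "(x - 1) mod c + 1 \<le> c" using assms(1) by (simp add: Suc_le_eq)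
qed

lemma grid_range: "j < s \<Longrightarrow> 1 \<le> y \<Longrightarrow> y \<le> c \<Longrightarrow> 1 \<le> j * c + y \<and> j * c + y \<le> s * (c :: nat)"
proof -
  assume "j < s" "1 \<le> y" "y \<le> c"
  moreover have "Suc j * c \<le> s * c" using \<open>j < s\<close> by (intro mult_right_mono) auto
  ultimately show ?thesis by simp
qed

lemma grid_unique:
  fixes y c :: nat
  assumes "1 \<le> y" "y \<le> c" "1 \<le> y'" "y' \<le> c" "j * c + y = j' * c + y'"
  shows "j = j' \<and> y = y'"
proof -
  have "(a * c + b - 1) div c = a" if "1 \<le> b" "b \<le> c" for a b
  proof -
    have "a * c + b - 1 = (b - 1) + a * c" using that by simp
    moreover have "(b - 1) div c = 0" using that by simp
    moreover have "0 < c" using that by linarith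
    ultimately show ?thesis by simp
  qed
  then have "j = j'" using assms by metis
  then show ?thesis using assms(5) by simp
qed

lemma multiples_mod_inj:
  assumes "prime p" "0 < i" "i < p" "s < p" "t < p" "(s * i) mod p = (t * i) mod (p :: nat)"
  shows "s = t"
proof -
  have *: "s = t" if start: "s \<le> t" "t < p" "(s * i) mod p = (t * i) mod p" for s t
  proof -
    have "p dvd t * i - s * i" using start(3) mod_eq_dvd_iff_nat[of "s * i" "t * i" p] start(1) by simp
    then have "p dvd (t - s) * i" by (simp only: diff_mult_distrib)
    moreover have "\<not> p dvd i" using assms(2,3) by (simp add: nat_dvd_not_less)
    ultimately have "p dvd t - s" using assms(1) prime_dvd_mult_nat by blast
    moreover have "t - s < p" using start(2) by simp
    ultimately have "t - s = 0" using nat_dvd_not_less by blast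
    then show "s = t" using start(1) by simp
  qed
  show ?thesis using *[of s t] *[of t s] assms by (cases "s \<le> t") auto
qed

lemma multiples_mod_surj:
  assumes "prime p" "0 < i" "i < p" "j < p"
  shows "\<exists>s<p. (s * i) mod p = (j :: nat)"
proof -
  have "inj_on (\<lambda>s. (s * i) mod p) {..<p}" by (intro inj_onI, rule multiples_mod_inj[OF assms(1-3)]) simp_all
  moreover have "(\<lambda>s. (s * i) mod p) ` {..<p} \<subseteq> {..<p}" using assms(3) by auto
  ultimately have "(\<lambda>s. (s * i) mod p) ` {..<p} = {..<p}" by (intro endo_inj_surj) auto
  moreover have "j \<in> {..<p}" using assms(4) by simp
  ultimately have "j \<in> (\<lambda>s. (s * i) mod p) ` {..<p}" by (simp only:)
  then show ?thesis by (auto elim!: imageE)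
qed

locale wreath =
  fixes p q :: nat and G :: "(nat \<Rightarrow> nat) set"
  assumes prime_p: "prime p" and q_pos: "0 < q" and subgroup_G: "subgroup G (Sym q)"
begin

lemmas G = subgroup_SymD[OF subgroup_G]

lemma p_pos: "0 < p" using prime_p prime_gt_0_nat by simp

definition W :: "(nat \<Rightarrow> nat) set" where
  "W = {wr p q f i | f i. (\<forall>j<p. f j \<in> G) \<and> i < p}"

lemmas block_coordinates = grid_coordinates[OF q_pos]
lemmas block_range = grid_range
lemmas block_unique = grid_unique

lemma wr_apply:
  assumes "j < p" "1 \<le> y" "y \<le> q"
  shows "wr p q f i (j * q + y) = (j + i) mod p * q + f j y"
proof -
  obtain y' where y': "y = Suc y'" using assms(2) by (cases y) auto
  have e: "j * q + y - 1 = y' + j * q" unfolding y' by simp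
  have "y' < q" using assms y' by simp
  then have "(j * q + y - 1) div q = j" "(j * q + y - 1) mod q + 1 = y" unfolding e using y' by simp_all
  then show ?thesis using block_range[OF assms] by (simp only: wr_def simp_thms if_True)
qed

lemma wr_outside: "x = 0 \<or> p * q < x \<Longrightarrow> wr p q f i x = x"
  by (auto simp: wr_def)

lemma eq_wr:
  assumes "\<And>x. x = 0 \<or> p * q < x \<Longrightarrow> h x = x"
    and "\<And>j y. j < p \<Longrightarrow> 1 \<le> y \<Longrightarrow> y \<le> q \<Longrightarrow> h (j * q + y) = (j + i) mod p * q + f j y"
  shows "h = wr p q f i"
proof
  fix x show "h x = wr p q f i x"
  proof (cases "1 \<le> x \<and> x \<le> p * q")
    case True
    then obtain j y where "x = j * q + y" "j < p" "1 \<le> y" "y \<le> q" using block_coordinates by blast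
    then show ?thesis using assms(2) wr_apply by simp
  next
    case False
    then have "x = 0 \<or> p * q < x" by auto
    then show ?thesis using assms(1)[of x] wr_outside[of x f i] by simp
  qed
qed

lemma wr_cong: "(\<And>j. j < p \<Longrightarrow> f j = g j) \<Longrightarrow> i mod p = k mod p \<Longrightarrow> wr p q f i = wr p q g k"
proof (rule eq_wr)
  fix j y assume fg: "\<And>j. j < p \<Longrightarrow> f j = g j" "i mod p = k mod p" and j: "j < p" "1 \<le> y" "y \<le> q"
  have "(j + i) mod p = (j + k) mod p" using fg(2) by (metis mod_add_right_eq)
  then show "wr p q f i (j * q + y) = (j + k) mod p * q + g j y" using wr_apply[OF j] fg(1)[OF j(1)] by simp
qed (rule wr_outside)

lemma wr_id: "wr p q (\<lambda>_. id) 0 = id"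
  by (rule eq_wr[symmetric]) auto

lemma wr_comp:
  assumes "\<And>j. j < p \<Longrightarrow> g j \<in> perms q"
  shows "wr p q f i \<circ> wr p q g k = wr p q (\<lambda>j. f ((j + k) mod p) \<circ> g j) (k + i)"
proof (rule eq_wr)
  fix j y assume j: "j < p" "1 \<le> y" "y \<le> q"
  have g: "1 \<le> g j y" "g j y \<le> q" using perms_in[OF assms[OF j(1)] j(2,3)] by auto
  have "(j + k) mod p < p" using p_pos by simp
  then have "(wr p q f i \<circ> wr p q g k) (j * q + y) = ((j + k) mod p + i) mod p * q + f ((j + k) mod p) (g j y)"
    using wr_apply[OF j] wr_apply[OF _ g] by simp
  then show "(wr p q f i \<circ> wr p q g k) (j * q + y) = (j + (k + i)) mod p * q + (f ((j + k) mod p) \<circ> g j) y"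
    by (simp add: mod_add_left_eq add.assoc)
qed (simp add: wr_outside)

lemma wr_perms:
  assumes "\<And>j. j < p \<Longrightarrow> f j \<in> perms q"
  shows "wr p q f i \<in> perms (p * q)"
proof (rule perms_injI)
  show "1 \<le> wr p q f i x \<and> wr p q f i x \<le> p * q" if x: "1 \<le> x" "x \<le> p * q" for x
  proof -
    obtain j y where j: "x = j * q + y" "j < p" "1 \<le> y" "y \<le> q" using block_coordinates[OF x] by blast
    then show ?thesis using wr_apply[OF j(2-4)] perms_in[OF assms[OF j(2)] j(3,4)] p_pos by (simp add: block_range)
  qed
  fix x x' assume x: "1 \<le> x" "x \<le> p * q" and x': "1 \<le> x'" "x' \<le> p * q" and eq: "wr p q f i x = wr p q f i x'"
  obtain j y where j: "x = j * q + y" "j < p" "1 \<le> y" "y \<le> q" using block_coordinates[OF x] by blast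
  obtain j' y' where j': "x' = j' * q + y'" "j' < p" "1 \<le> y'" "y' \<le> q" using block_coordinates[OF x'] by blast
  have "(j + i) mod p * q + f j y = (j' + i) mod p * q + f j' y'"
    using eq wr_apply[OF j(2-4)] wr_apply[OF j'(2-4)] j(1) j'(1) by simp
  then have e: "(j + i) mod p = (j' + i) mod p" "f j y = f j' y'"
    using block_unique perms_in[OF assms[OF j(2)] j(3,4)] perms_in[OF assms[OF j'(2)] j'(3,4)] by blast+
  have jj: "j = j'" by (rule mod_add_right_inj[OF j(2) j'(2) e(1)])
  have "inj (f j)" using assms[OF j(2)] permutes_inj by (auto simp: perms_def)
  then have "y = y'" using e(2) jj by (simp add: inj_eq)
  then show "x = x'" using jj j(1) j'(1) by simp
qed (rule wr_outside)

lemma wr_eq_iff: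
  assumes "\<And>j. j < p \<Longrightarrow> f j \<in> perms q" "\<And>j. j < p \<Longrightarrow> g j \<in> perms q" "i < p" "k < p"
  shows "wr p q f i = wr p q g k \<longleftrightarrow> (\<forall>j<p. f j = g j) \<and> i = k"
proof
  assume eq: "wr p q f i = wr p q g k"
  have e: "(j + i) mod p = (j + k) mod p \<and> f j y = g j y" if j: "j < p" "1 \<le> y" "y \<le> q" for j y
  proof -
    have "(j + i) mod p * q + f j y = (j + k) mod p * q + g j y"
      using wr_apply[OF j, of f i] wr_apply[OF j, of g k] eq by simp
    then show ?thesis
      using block_unique perms_in[OF assms(1)[OF j(1)] j(2,3)] perms_in[OF assms(2)[OF j(1)] j(2,3)] by blast
  qed
  have "i = k" using e[of 0 1] p_pos q_pos assms(3,4) by simp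
  moreover have "f j = g j" if "j < p" for j
    by (rule perms_eqI[OF assms(1,2)[OF that]]) (use e that in blast)
  ultimately show "(\<forall>j<p. f j = g j) \<and> i = k" by blast
qed (auto intro: wr_cong)

lemma G_perms: "g \<in> G \<Longrightarrow> g \<in> perms q" using G(1) by blast

lemma wr_W: "(\<And>j. j < p \<Longrightarrow> f j \<in> G) \<Longrightarrow> wr p q f i \<in> W"
  unfolding W_def using wr_cong[of f f i "i mod p"] p_pos by fastforce

lemma W_subgroup: "subgroup W (Sym (p * q))"
proof (rule subgroup_SymI)
  show "W \<subseteq> perms (p * q)" unfolding W_def using wr_perms G_perms by blast
  show "id \<in> W" using wr_W[of "\<lambda>_. id" 0] G(2) wr_id by simp
  fix h assume "h \<in> W"
  then obtain f i where h: "h = wr p q f i" "\<forall>j<p. f j \<in> G" "i < p" unfolding W_def by blast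
  show "h \<circ> h' \<in> W" if h'W: "h' \<in> W" for h'
  proof -
    obtain g k where h': "h' = wr p q g k" "\<forall>j<p. g j \<in> G" using h'W unfolding W_def by blast
    have "h \<circ> h' = wr p q (\<lambda>j. f ((j + k) mod p) \<circ> g j) (k + i)"
      unfolding h(1) h'(1) using h'(2) G_perms by (intro wr_comp) blast
    then show ?thesis using h(2) h'(2) p_pos G(3) by (auto intro: wr_W)
  qed
  let ?g = "\<lambda>j. inv_into UNIV (f ((j + (p - i)) mod p))"
  have gG: "?g j \<in> G" for j using h(2) p_pos G(4) by simp
  have "h \<circ> wr p q ?g (p - i) = wr p q (\<lambda>j. f ((j + (p - i)) mod p) \<circ> ?g j) ((p - i) + i)"
    unfolding h(1) using gG G_perms by (intro wr_comp) blast
  also have "\<dots> = wr p q (\<lambda>_. id) 0"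
  proof (rule wr_cong)
    fix j
    show "f ((j + (p - i)) mod p) \<circ> ?g j = id" by (rule perms_inv_o(1)[OF G_perms]) (use h(2) p_pos in simp)
  qed (use h(3) in simp)
  finally have r: "h \<circ> wr p q ?g (p - i) = id" using wr_id by simp
  have "bij h" using wr_perms[of f i] h G_perms permutes_bij by (auto simp: perms_def)
  then have "inv_into UNIV h \<circ> h = id" using bij_is_inj inv_o_cancel by blast
  then have "inv_into UNIV h = wr p q ?g (p - i)" using r by (metis comp_id id_comp o_assoc)
  then show "inv_into UNIV h \<in> W" using gG by (auto intro: wr_W)
qed

lemma bij_W: "bij_betw (\<lambda>(f, i). wr p q f i) (({..<p} \<rightarrow>\<^sub>E G) \<times> {..<p}) W"
proof (rule bij_betw_imageI)
  show "inj_on (\<lambda>(f, i). wr p q f i) (({..<p} \<rightarrow>\<^sub>E G) \<times> {..<p})"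
  proof (rule inj_onI)
    fix u v assume "u \<in> ({..<p} \<rightarrow>\<^sub>E G) \<times> {..<p}" "v \<in> ({..<p} \<rightarrow>\<^sub>E G) \<times> {..<p}"
      and eq: "(\<lambda>(f, i). wr p q f i) u = (\<lambda>(f, i). wr p q f i) v"
    then obtain f i g k where uv: "u = (f, i)" "v = (g, k)" and f: "f \<in> {..<p} \<rightarrow>\<^sub>E G" and g: "g \<in> {..<p} \<rightarrow>\<^sub>E G"
        and "i < p" "k < p" by auto
    moreover have "wr p q f i = wr p q g k" using eq uv by simp
    moreover have "\<And>j. j < p \<Longrightarrow> f j \<in> perms q" "\<And>j. j < p \<Longrightarrow> g j \<in> perms q" using f g G_perms by (auto simp: PiE_mem)
    ultimately have "\<forall>j<p. f j = g j" "i = k" using wr_eq_iff[of f g i k] by auto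
    then show "u = v" using PiE_ext[OF f g] uv by auto
  qed
  show "(\<lambda>(f, i). wr p q f i) ` (({..<p} \<rightarrow>\<^sub>E G) \<times> {..<p}) = W"
  proof
    show "W \<subseteq> (\<lambda>(f, i). wr p q f i) ` (({..<p} \<rightarrow>\<^sub>E G) \<times> {..<p})"
    proof
      fix h assume "h \<in> W"
      then obtain f i where h: "h = wr p q f i" "\<forall>j<p. f j \<in> G" "i < p" unfolding W_def by blast
      have "h = wr p q (restrict f {..<p}) i" unfolding h(1) by (rule wr_cong) auto
      moreover have "restrict f {..<p} \<in> {..<p} \<rightarrow>\<^sub>E G" using h(2) by auto
      ultimately show "h \<in> (\<lambda>(f, i). wr p q f i) ` (({..<p} \<rightarrow>\<^sub>E G) \<times> {..<p})" using h(3) by force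
    qed
  qed (auto intro!: wr_W simp: PiE_mem)
qed

lemma finite_G: "finite G" using G(1) finite_permutation_set finite_subset by blast

lemma card_W: "card W = p * card G ^ p"
  using bij_betw_same_card[OF bij_W] by (simp add: card_cartesian_product card_PiE mult.commute)

lemma cocycle_G: "(\<And>j. j < p \<Longrightarrow> f j \<in> G) \<Longrightarrow> cocycle p f i s j \<in> G"
  using G(2,3) p_pos by (induction s) auto

lemma wr_funpow:
  assumes "\<And>j. j < p \<Longrightarrow> f j \<in> G"
  shows "wr p q f i ^^ s = wr p q (cocycle p f i s) (s * i)"
proof (induction s)
  case 0
  have "wr p q (cocycle p f i 0) 0 = wr p q (\<lambda>_. id) 0" by (rule wr_cong) auto
  then show ?case by (simp only: wr_id funpow.simps mult_0)
next
  case (Suc s)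
  have "wr p q f i ^^ Suc s = wr p q f i \<circ> wr p q (cocycle p f i s) (s * i)" using Suc by simp
  also have "\<dots> = wr p q (\<lambda>j. f ((j + s * i) mod p) \<circ> cocycle p f i s j) (s * i + i)"
    by (rule wr_comp) (rule G_perms[OF cocycle_G[OF assms]])
  also have "\<dots> = wr p q (cocycle p f i (Suc s)) (Suc s * i)" by (rule wr_cong) (simp_all add: add.commute)
  finally show ?case .
qed

lemma wr_pow_p_eq_id:
  assumes f: "\<And>j. j < p \<Longrightarrow> f j \<in> G"
  shows "wr p q f i ^^ p = id \<longleftrightarrow> (\<forall>j<p. cocycle p f i p j = id)"
proof -
  have "wr p q f i ^^ p = wr p q (cocycle p f i p) 0" by (rule trans[OF wr_funpow wr_cong]) (auto simp: f)
  moreover have "wr p q (cocycle p f i p) 0 = wr p q (\<lambda>_. id) 0 \<longleftrightarrow> (\<forall>j<p. cocycle p f i p j = id) \<and> (0::nat) = 0"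
    using cocycle_G[OF f] G_perms perms_id p_pos by (intro wr_eq_iff) auto
  ultimately show ?thesis using wr_id by simp
qed

text \<open>The \<open>p\<close>-th power commutes with the element, so its inner parts in consecutive blocks are conjugate, and
  the steps of size \<open>i\<close> reach every block.\<close>

lemma cocycle_p_all:
  assumes f: "\<And>j. j < p \<Longrightarrow> f j \<in> G" and i: "0 < i" "i < p" and "cocycle p f i p 0 = id"
  shows "\<forall>j<p. cocycle p f i p j = id"
proof -
  have step: "cocycle p f i p ((j + i) mod p) = id" if j: "j < p" "cocycle p f i p j = id" for j
  proof -
    let ?h = "wr p q f i"
    have h: "?h ^^ p = wr p q (cocycle p f i p) 0" by (rule trans[OF wr_funpow wr_cong]) (auto simp: f)
    have "wr p q (\<lambda>j. f ((j + 0) mod p) \<circ> cocycle p f i p j) (0 + i) = ?h \<circ> ?h ^^ p"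
      unfolding h by (rule wr_comp[symmetric]) (rule G_perms[OF cocycle_G[OF f]])
    also have "\<dots> = ?h ^^ p \<circ> ?h" by (simp add: funpow_swap1 fun_eq_iff)
    also have "\<dots> = wr p q (\<lambda>j. cocycle p f i p ((j + i) mod p) \<circ> f j) (i + 0)"
      unfolding h by (rule wr_comp) (rule G_perms[OF f])
    finally have eq: "wr p q (\<lambda>j. f ((j + 0) mod p) \<circ> cocycle p f i p j) (0 + i) = wr p q (\<lambda>j. cocycle p f i p ((j + i) mod p) \<circ> f j) (i + 0)" .
    have "f ((k + 0) mod p) \<circ> cocycle p f i p k \<in> perms q" "cocycle p f i p ((k + i) mod p) \<circ> f k \<in> perms q" if "k < p" for k
      using cocycle_G[OF f] f that G(3) by (auto intro!: G_perms)
    then have "\<forall>j<p. f ((j + 0) mod p) \<circ> cocycle p f i p j = cocycle p f i p ((j + i) mod p) \<circ> f j"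
      using eq wr_eq_iff[of "\<lambda>j. f ((j + 0) mod p) \<circ> cocycle p f i p j" "\<lambda>j. cocycle p f i p ((j + i) mod p) \<circ> f j" "0 + i" "i + 0"] i by auto
    then have "f j = cocycle p f i p ((j + i) mod p) \<circ> f j" using j by (metis add_0_right comp_id mod_less)
    then have "f j \<circ> inv_into UNIV (f j) = cocycle p f i p ((j + i) mod p) \<circ> (f j \<circ> inv_into UNIV (f j))" by (metis o_assoc)
    then show ?thesis using perms_inv_o(1)[OF G_perms[OF f[OF j(1)]]] by simp
  qed
  have "cocycle p f i p ((s * i) mod p) = id" for s
  proof (induction s)
    case 0
    then show ?case using assms(4) by simp
  next
    case (Suc s)
    have "((s * i) mod p + i) mod p = (Suc s * i) mod p" by (simp add: mod_add_left_eq mod_add_right_eq add.commute)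
    then show ?case using step[OF _ Suc] p_pos by simp
  qed
  then show ?thesis using multiples_mod_surj[OF prime_p i] by metis
qed

lemma cocycle_cong: "(\<And>t. t < s \<Longrightarrow> f ((j + t * i) mod p) = g ((j + t * i) mod p)) \<Longrightarrow> cocycle p f i s j = cocycle p g i s j"
  by (induction s) auto

text \<open>The product around the cycle is trivial: the inner parts of all blocks but the last one visited are
  arbitrary, and the last one is determined by them.\<close>

lemma card_cocycle_p:
  assumes i: "0 < i" "i < p"
  shows "card {f \<in> {..<p} \<rightarrow>\<^sub>E G. cocycle p f i p 0 = id} = card G ^ (p - 1)"
proof -
  \<comment> \<open>the block that is visited last\<close>
  define j where "j = ((p - 1) * i) mod p"
  have jp: "j < p" using p_pos by (simp add: j_def)
  have ne: "(0 + t * i) mod p \<noteq> j" if "t < p - 1" for t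
    using multiples_mod_inj[OF prime_p i, of t "p - 1"] that j_def by auto
  let ?e = "\<lambda>f. inv_into UNIV (cocycle p f i (p - 1) 0)"
  have last: "cocycle p f i p 0 = f j \<circ> cocycle p f i (p - 1) 0" for f
  proof -
    have "cocycle p f i (Suc (p - 1)) 0 = f j \<circ> cocycle p f i (p - 1) 0" by (simp add: j_def)
    then show ?thesis using p_pos by simp
  qed
  have upd: "cocycle p (f(j := g)) i (p - 1) 0 = cocycle p f i (p - 1) 0" for f g
    by (rule cocycle_cong) (use ne in auto)
  have res: "cocycle p (restrict f ({..<p} - {j})) i (p - 1) 0 = cocycle p f i (p - 1) 0" for f
    by (rule cocycle_cong) (use ne p_pos in auto)
  have mem: "cocycle p f i (p - 1) 0 \<in> G" if f: "f \<in> {..<p} - {j} \<rightarrow>\<^sub>E G" for f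
  proof -
    have "cocycle p (f(j := id)) i (p - 1) 0 \<in> G" using f G(2) by (intro cocycle_G) auto
    then show ?thesis unfolding upd .
  qed
  have fill: "(restrict f ({..<p} - {j}))(j := f j) = f" if "f \<in> {..<p} \<rightarrow>\<^sub>E G" for f
    using PiE_arb[OF that] by (auto simp: fun_eq_iff)
  have omit: "restrict (f(j := v)) ({..<p} - {j}) = f" if "f \<in> {..<p} - {j} \<rightarrow>\<^sub>E G" for f v
    using PiE_arb[OF that] by (auto simp: fun_eq_iff)
  have "bij_betw (\<lambda>f. restrict f ({..<p} - {j})) {f \<in> {..<p} \<rightarrow>\<^sub>E G. cocycle p f i p 0 = id} ({..<p} - {j} \<rightarrow>\<^sub>E G)"
  proof (rule bij_betw_byWitness[where f' = "\<lambda>f. f(j := ?e f)"])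
    show "\<forall>f\<in>{f \<in> {..<p} \<rightarrow>\<^sub>E G. cocycle p f i p 0 = id}.
        (restrict f ({..<p} - {j}))(j := ?e (restrict f ({..<p} - {j}))) = f"
    proof
      fix f assume "f \<in> {f \<in> {..<p} \<rightarrow>\<^sub>E G. cocycle p f i p 0 = id}"
      then have f: "f \<in> {..<p} \<rightarrow>\<^sub>E G" "f j \<circ> cocycle p f i (p - 1) 0 = id" unfolding last by auto
      then have "cocycle p f i (p - 1) 0 \<in> G" by (intro cocycle_G) auto
      then have fj: "?e f = f j" using f(2) perms_inv_o(1)[OF G_perms] by (metis comp_id id_comp o_assoc)
      show "(restrict f ({..<p} - {j}))(j := ?e (restrict f ({..<p} - {j}))) = f"
        unfolding res fj by (rule fill[OF f(1)])
    qed
    show "\<forall>f\<in>{..<p} - {j} \<rightarrow>\<^sub>E G. restrict (f(j := ?e f)) ({..<p} - {j}) = f"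
      using omit by blast
    show "(\<lambda>f. restrict f ({..<p} - {j})) ` {f \<in> {..<p} \<rightarrow>\<^sub>E G. cocycle p f i p 0 = id} \<subseteq> ({..<p} - {j} \<rightarrow>\<^sub>E G)"
    proof (rule image_subsetI)
      fix f assume "f \<in> {f \<in> {..<p} \<rightarrow>\<^sub>E G. cocycle p f i p 0 = id}"
      then have "f \<in> {..<p} \<rightarrow>\<^sub>E G" by (simp only: mem_Collect_eq)
      then show "restrict f ({..<p} - {j}) \<in> {..<p} - {j} \<rightarrow>\<^sub>E G" by (auto simp: PiE_mem)
    qed
    show "(\<lambda>f. f(j := ?e f)) ` ({..<p} - {j} \<rightarrow>\<^sub>E G) \<subseteq> {f \<in> {..<p} \<rightarrow>\<^sub>E G. cocycle p f i p 0 = id}"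
    proof (rule image_subsetI)
      fix f assume f: "f \<in> {..<p} - {j} \<rightarrow>\<^sub>E G"
      have "?e f \<circ> cocycle p f i (p - 1) 0 = id" using mem[OF f] perms_inv_o(2)[OF G_perms] by blast
      then have "cocycle p (f(j := ?e f)) i p 0 = id" unfolding last upd by simp
      moreover have "f(j := ?e f) \<in> {..<p} \<rightarrow>\<^sub>E G" using f G(4)[OF mem[OF f]] jp by (auto simp: PiE_iff extensional_def)
      ultimately show "f(j := ?e f) \<in> {f \<in> {..<p} \<rightarrow>\<^sub>E G. cocycle p f i p 0 = id}" by blast
    qed
  qed
  then have "card {f \<in> {..<p} \<rightarrow>\<^sub>E G. cocycle p f i p 0 = id} = card ({..<p} - {j} \<rightarrow>\<^sub>E G)" by (rule bij_betw_same_card)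
  also have "\<dots> = card G ^ (p - 1)" using jp by (simp add: card_PiE)
  finally show ?thesis .
qed

text \<open>No point stays in its block, so only the condition on the \<open>p\<close>-th power remains.\<close>

lemma fpf_rotating:
  assumes f: "\<And>j. j < p \<Longrightarrow> f j \<in> G" and i: "0 < i" "i < p"
  shows "fpf p (p * q) (wr p q f i) \<longleftrightarrow> cocycle p f i p 0 = id"
proof -
  have "wr p q f i x \<noteq> x" if x: "x \<in> {1..p * q}" for x
  proof
    assume eq: "wr p q f i x = x"
    obtain j y where j: "x = j * q + y" "j < p" "1 \<le> y" "y \<le> q" using block_coordinates[of x] x by auto
    have "(j + i) mod p * q + f j y = j * q + y" using eq wr_apply[OF j(2-4)] j(1) by simp
    then have "(j + i) mod p = j" using block_unique perms_in[OF G_perms[OF f[OF j(2)]] j(3,4)] j(3,4) by blast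
    then have "i = 0" using mod_add_right_inj[of i p 0 j] i j(2) by (simp add: add.commute)
    then show False using i by simp
  qed
  moreover have "wr p q f i ^^ p = id \<longleftrightarrow> (\<forall>j<p. cocycle p f i p j = id)" by (rule wr_pow_p_eq_id) (rule f)
  moreover have "(\<forall>j<p. cocycle p f i p j = id) \<longleftrightarrow> cocycle p f i p 0 = id" using cocycle_p_all[of f i] f i p_pos by blast
  ultimately show ?thesis unfolding fpf_def by blast
qed

lemma fpf_still:
  assumes f: "\<And>j. j < p \<Longrightarrow> f j \<in> G"
  shows "fpf p (p * q) (wr p q f 0) \<longleftrightarrow> (\<forall>j<p. fpf p q (f j))"
proof -
  have cocycle: "cocycle p f 0 s j = f j ^^ s" if "j < p" for s j using that by (induction s) auto
  have "(\<forall>x\<in>{1..p * q}. wr p q f 0 x \<noteq> x) \<longleftrightarrow> (\<forall>j<p. \<forall>y\<in>{1..q}. f j y \<noteq> y)"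
  proof
    assume L: "\<forall>x\<in>{1..p * q}. wr p q f 0 x \<noteq> x"
    show "\<forall>j<p. \<forall>y\<in>{1..q}. f j y \<noteq> y"
    proof (intro allI impI ballI)
      fix j y assume j: "j < p" "y \<in> {1..q}"
      then have "wr p q f 0 (j * q + y) \<noteq> j * q + y" using L block_range[of j p y q] by auto
      then show "f j y \<noteq> y" using wr_apply[of j y f 0] j by auto
    qed
  next
    assume R: "\<forall>j<p. \<forall>y\<in>{1..q}. f j y \<noteq> y"
    show "\<forall>x\<in>{1..p * q}. wr p q f 0 x \<noteq> x"
    proof
      fix x assume "x \<in> {1..p * q}"
      then obtain j y where j: "x = j * q + y" "j < p" "1 \<le> y" "y \<le> q" using block_coordinates[of x] by auto
      then show "wr p q f 0 x \<noteq> x" using R wr_apply[OF j(2-4), of f 0] by auto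
    qed
  qed
  moreover have "wr p q f 0 ^^ p = id \<longleftrightarrow> (\<forall>j<p. cocycle p f 0 p j = id)" by (rule wr_pow_p_eq_id) (rule f)
  moreover have "(\<forall>j<p. cocycle p f 0 p j = id) \<longleftrightarrow> (\<forall>j<p. f j ^^ p = id)" by (simp add: cocycle cong: imp_cong)
  ultimately show ?thesis unfolding fpf_def by blast
qed

lemma card_fpf_W: "card {h \<in> W. fpf p (p * q) h} = card {g \<in> G. fpf p q g} ^ p + (p - 1) * card G ^ (p - 1)"
proof -
  let ?E = "{..<p} \<rightarrow>\<^sub>E G"
  let ?S = "\<lambda>i. {f \<in> ?E. fpf p (p * q) (wr p q f i)}"
  have fE: "\<And>j. j < p \<Longrightarrow> f j \<in> G" if "f \<in> ?E" for f using that by (auto simp: PiE_mem)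
  have fin: "finite ?E" using finite_G by (intro finite_PiE) auto
  have inj: "inj_on (\<lambda>(f, i). wr p q f i) (SIGMA i:?E. {..<p})" using bij_W by (simp add: bij_betw_def)
  have "{h \<in> W. fpf p (p * q) h} = (\<lambda>(i, f). wr p q f i) ` (SIGMA i:{..<p}. ?S i)"
  proof -
    have "W = (\<lambda>(f, i). wr p q f i) ` (?E \<times> {..<p})" using bij_W by (simp add: bij_betw_def)
    then have "{h \<in> W. fpf p (p * q) h} = {h \<in> (\<lambda>(f, i). wr p q f i) ` (?E \<times> {..<p}). fpf p (p * q) h}" by simp
    also have "\<dots> = (\<lambda>(i, f). wr p q f i) ` (SIGMA i:{..<p}. ?S i)" by force
    finally show ?thesis .
  qed
  moreover have "inj_on (\<lambda>(i, f). wr p q f i) (SIGMA i:{..<p}. ?S i)"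
    using inj by (auto simp: inj_on_def)
  ultimately have "card {h \<in> W. fpf p (p * q) h} = (\<Sum>i<p. card (?S i))"
    using fin by (simp add: card_image)
  also have "\<dots> = card (?S 0) + (\<Sum>i\<in>{1..<p}. card (?S i))"
    using sum.atLeast_Suc_lessThan[OF p_pos, of "\<lambda>i. card (?S i)"] by (simp add: atLeast0LessThan)
  also have "(\<Sum>i\<in>{1..<p}. card (?S i)) = (\<Sum>i\<in>{1..<p}. card G ^ (p - 1))"
  proof (rule sum.cong[OF refl])
    fix i assume "i \<in> {1..<p}"
    then have i: "0 < i" "i < p" by auto
    have "?S i = {f \<in> ?E. cocycle p f i p 0 = id}"
    proof (rule Collect_cong, rule conj_cong[OF refl])
      fix f assume f: "f \<in> ?E"
      show "fpf p (p * q) (wr p q f i) \<longleftrightarrow> cocycle p f i p 0 = id" by (rule fpf_rotating[OF _ i]) (rule fE[OF f])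
    qed
    then show "card (?S i) = card G ^ (p - 1)" using card_cocycle_p[OF i] by simp
  qed
  also have "\<dots> = (p - 1) * card G ^ (p - 1)" by simp
  also have "?S 0 = ({..<p} \<rightarrow>\<^sub>E {g \<in> G. fpf p q g})"
  proof -
    have "?S 0 = {f \<in> ?E. \<forall>j<p. fpf p q (f j)}"
    proof (rule Collect_cong, rule conj_cong[OF refl])
      fix f assume f: "f \<in> ?E"
      show "fpf p (p * q) (wr p q f 0) \<longleftrightarrow> (\<forall>j<p. fpf p q (f j))" by (rule fpf_still) (rule fE[OF f])
    qed
    also have "\<dots> = ({..<p} \<rightarrow>\<^sub>E {g \<in> G. fpf p q g})"
      unfolding PiE_def Pi_def lessThan_iff mem_Collect_eq by blast
    finally show ?thesis .
  qed
  also have "card \<dots> = card {g \<in> G. fpf p q g} ^ p" by (simp add: card_PiE)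
  finally show ?thesis .
qed

end

section \<open>The Sylow groups of prime power degree\<close>

lemma cyc_perms: "cyc p \<in> perms p"
  using cyc_permutes[of p] by (simp add: perms_def)

lemma perms_funpow: "g \<in> perms n \<Longrightarrow> g ^^ i \<in> perms n"
  using permutes_funpow by (auto simp: perms_def)

lemma subgroup_id: "subgroup {id} (Sym n)"
proof (rule subgroup_SymI)
  show "inv_into UNIV g \<in> {id}" if "g \<in> {id}" for g :: "nat \<Rightarrow> nat" using that inv_id by simp
qed (auto simp: perms_id)

lemma generate_subgroup:
  assumes "K \<subseteq> perms n"
  shows "subgroup (generate (Sym n) K) (Sym n)"
  using group.generate_is_subgroup[OF group_Sym] assms by (simp add: carrier_Sym)

lemma blow_up_eq_wr:
  assumes "prime p" "0 < q"
  shows "blow_up q (cyc p) = wr p q (\<lambda>_. id) 1"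
proof -
  interpret wreath p q "{id}" using assms subgroup_id by (simp add: wreath_def)
  show ?thesis
  proof (rule eq_wr)
    fix x assume x: "x = 0 \<or> p * q < x"
    show "blow_up q (cyc p) x = x"
    proof (cases "x = 0")
      case False
      then have "p * q \<le> x - 1" using x by auto
      then have "p \<le> (x - 1) div q" using assms(2) by (simp add: less_eq_div_iff_mult_less_eq)
      then have "cyc p ((x - 1) div q + 1) = (x - 1) div q + 1" by (intro perms_out[OF cyc_perms]) simp
      then show ?thesis using False by (simp add: blow_up_def)
    qed (simp add: blow_up_def)
  next
    fix j y assume j: "j < p" "1 \<le> y" "y \<le> q"
    have "blow_up q (cyc p) ((j + 1 - 1) * q + y) = (cyc p (j + 1) - 1) * q + y"
      using j by (intro blow_up_apply) auto
    moreover have "cyc p (j + 1) - 1 = (j + 1) mod p" using cyc_apply[of "j + 1" p] j(1) by auto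
    ultimately show "blow_up q (cyc p) (j * q + y) = (j + 1) mod p * q + id y" by simp
  qed
qed

lemma blow_up_perms:
  assumes "prime p" "j < m"
  shows "blow_up (p ^ j) (cyc p) \<in> perms (p ^ m)"
proof -
  have pos: "0 < p" using assms(1) prime_gt_0_nat by simp
  interpret wreath p "p ^ j" "{id}" using assms(1) pos subgroup_id by (simp add: wreath_def)
  have "wr p (p ^ j) (\<lambda>_. id) 1 \<in> perms (p * p ^ j)" by (rule wr_perms) (rule perms_id)
  moreover have "p * p ^ j \<le> p ^ m" using power_increasing[of "Suc j" m p] assms(2) pos by simp
  ultimately have "wr p (p ^ j) (\<lambda>_. id) 1 \<in> perms (p ^ m)" using perms_mono by blast
  then show ?thesis using blow_up_eq_wr[OF assms(1), of "p ^ j"] pos by simp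
qed

lemma R_grp_generators: "R_grp p (int m - 1) = generate (Sym (p ^ m)) {blow_up (p ^ j) (cyc p) | j. j < m}"
proof -
  have "int j \<le> int m - 1 \<longleftrightarrow> j < m" for j by linarith
  then show ?thesis by (simp add: R_grp_def)
qed

lemma R_grp_gens_perms: "prime p \<Longrightarrow> {blow_up (p ^ j) (cyc p) | j. j < m} \<subseteq> perms (p ^ m)"
  using blow_up_perms by blast

lemma subgroup_R_grp: "prime p \<Longrightarrow> subgroup (R_grp p (int m - 1)) (Sym (p ^ m))"
  unfolding R_grp_generators by (rule generate_subgroup[OF R_grp_gens_perms])

lemma wreath_R: "prime p \<Longrightarrow> wreath p (p ^ m) (R_grp p (int m - 1))"
  using subgroup_R_grp prime_gt_0_nat by (simp add: wreath_def)

lemma R_grp_0: "R_grp p (int 0 - 1) = {id}"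
proof -
  have e: "{blow_up (p ^ j) (cyc p) | j. j < 0} = {}" by blast
  show ?thesis unfolding R_grp_generators e using group.generate_empty[OF group_Sym, of "p ^ 0"] by (simp add: Sym_def)
qed

text \<open>The generator of highest level rotates the blocks, and conjugation by it carries the group on the first
  block to all others; so the generated group contains all wreath product elements.\<close>

lemma R_grp_Suc:
  assumes "prime p"
  shows "R_grp p (int (Suc m) - 1) = wreath.W p (p ^ m) (R_grp p (int m - 1))"
proof -
  interpret wreath p "p ^ m" "R_grp p (int m - 1)" by (rule wreath_R[OF assms])
  let ?q = "p ^ m" and ?S = "R_grp p (int (Suc m) - 1)"
  let ?b = "\<lambda>j. blow_up (p ^ j) (cyc p)"
  let ?emb = "\<lambda>k \<sigma>. wr p ?q (\<lambda>j. if j = k then \<sigma> else id) 0"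
  let ?\<theta> = "wr p ?q (\<lambda>_. id) 1"
  have \<theta>: "?b m = ?\<theta>" by (rule blow_up_eq_wr[OF assms q_pos])
  have emb0: "?emb 0 \<sigma> = \<sigma>" if s: "\<sigma> \<in> perms ?q" for \<sigma>
  proof (rule eq_wr[symmetric])
    fix x assume "x = 0 \<or> p * ?q < x"
    moreover have "1 * ?q \<le> p * ?q" using p_pos by (intro mult_right_mono) auto
    ultimately show "\<sigma> x = x" by (intro perms_out[OF s]) (elim disjE, simp, linarith)
  next
    fix j y assume j: "j < p" "1 \<le> y" "y \<le> ?q"
    show "\<sigma> (j * ?q + y) = (j + 0) mod p * ?q + (if j = 0 then \<sigma> else id) y"
    proof (cases "j = 0")
      case False
      then have "1 * ?q \<le> j * ?q" by (intro mult_right_mono) auto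
      then have "\<sigma> (j * ?q + y) = j * ?q + y" using j(2) by (intro perms_out[OF s]) linarith
      then show ?thesis using False j(1) by simp
    qed simp
  qed
  have cocycle: "p ^ Suc m = p * ?q" by simp
  have S: "subgroup ?S (Sym (p * ?q))" using subgroup_R_grp[OF assms, of "Suc m"] by (simp only: cocycle)
  note SD = subgroup_SymD[OF S]
  have gen: "?b j \<in> ?S" if "j < Suc m" for j unfolding R_grp_generators using that by (intro generate.incl) blast
  show ?thesis
  proof
    have "{?b j | j. j < Suc m} \<subseteq> W"
    proof (rule subsetI)
      fix g assume "g \<in> {?b j | j. j < Suc m}"
      then obtain j where j: "g = ?b j" "j < Suc m" by blast
      show "g \<in> W"
      proof (cases "j = m")
        case True
        then show ?thesis using j(1) \<theta> wr_W[of "\<lambda>_. id" 1] G(2) by simp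
      next
        case False
        then have jm: "j < m" using j(2) by simp
        then have "g \<in> R_grp p (int m - 1)" unfolding R_grp_generators using j(1) by (intro generate.incl) blast
        moreover from this have "?emb 0 g = g" by (intro emb0 G_perms)
        ultimately show ?thesis using wr_W[of "\<lambda>j. if j = 0 then g else id" 0] G(2) by simp
      qed
    qed
    then show "?S \<subseteq> W"
      unfolding R_grp_generators[of p "Suc m"] cocycle by (rule group.generate_subgroup_incl[OF group_Sym _ W_subgroup])
  next
    have GS: "R_grp p (int m - 1) \<subseteq> ?S"
    proof -
      have "subgroup (?S \<inter> perms ?q) (Sym ?q)"
      proof (rule subgroup_SymI)
        show "inv_into UNIV g \<in> ?S \<inter> perms ?q" if "g \<in> ?S \<inter> perms ?q" for g using that SD(4) perms_inv by blast
        show "g \<circ> h \<in> ?S \<inter> perms ?q" if "g \<in> ?S \<inter> perms ?q" "h \<in> ?S \<inter> perms ?q" for g h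
          using that SD(3) perms_comp by blast
      qed (use SD(2) perms_id in auto)
      moreover have "{?b j | j. j < m} \<subseteq> ?S \<inter> perms ?q" using gen blow_up_perms[OF assms] by auto
      ultimately have "generate (Sym ?q) {?b j | j. j < m} \<subseteq> ?S \<inter> perms ?q"
        by (intro group.generate_subgroup_incl[OF group_Sym])
      then show ?thesis unfolding R_grp_generators[of p m] by blast
    qed
    have \<theta>S: "?\<theta> \<in> ?S" using gen[of m] \<theta> by simp
    \<comment> \<open>conjugation by the rotation of the blocks carries the first block to all others\<close>
    have embS: "?emb k \<sigma> \<in> ?S" if s: "\<sigma> \<in> R_grp p (int m - 1)" "k < p" for k \<sigma>
      using s(2)
    proof (induction k)
      case 0
      show ?case using emb0[OF G_perms[OF s(1)]] s(1) GS by auto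
    next
      case (Suc k)
      have sp: "\<sigma> \<in> perms ?q" by (rule G_perms[OF s(1)])
      have "?\<theta> \<circ> ?emb k \<sigma> = wr p ?q (\<lambda>j. id \<circ> (if j = k then \<sigma> else id)) (0 + 1)"
        by (rule wr_comp) (use sp perms_id in auto)
      also have "\<dots> = wr p ?q (\<lambda>j. (if (j + 1) mod p = Suc k then \<sigma> else id) \<circ> id) (1 + 0)"
      proof (rule wr_cong)
        fix j assume "j < p"
        then have "(j + 1) mod p = Suc k \<longleftrightarrow> j = k" using Suc.prems by (cases "Suc j = p") auto
        then show "id \<circ> (if j = k then \<sigma> else id) = (if (j + 1) mod p = Suc k then \<sigma> else id) \<circ> id" by simp
      qed simp
      also have "\<dots> = ?emb (Suc k) \<sigma> \<circ> ?\<theta>" by (rule wr_comp[symmetric]) (rule perms_id)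
      finally have "?\<theta> \<circ> ?emb k \<sigma> \<circ> inv_into UNIV ?\<theta> = ?emb (Suc k) \<sigma> \<circ> (?\<theta> \<circ> inv_into UNIV ?\<theta>)" by (simp only: o_assoc)
      moreover have "?\<theta> \<circ> inv_into UNIV ?\<theta> = id" using perms_inv_o(1) \<theta>S SD(1) by blast
      ultimately have "?emb (Suc k) \<sigma> = ?\<theta> \<circ> ?emb k \<sigma> \<circ> inv_into UNIV ?\<theta>" by (simp only: comp_id)
      moreover have "?emb k \<sigma> \<in> ?S" using Suc by simp
      ultimately show ?case using SD(3,4) \<theta>S by metis
    qed
    show "W \<subseteq> ?S"
    proof
      fix h assume "h \<in> W"
      then obtain f i where h: "h = wr p ?q f i" "\<forall>j<p. f j \<in> R_grp p (int m - 1)" unfolding W_def by blast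
      have part: "wr p ?q (\<lambda>j. if j < n then f j else id) 0 \<in> ?S" if "n \<le> p" for n
        using that
      proof (induction n)
        case 0
        have "wr p ?q (\<lambda>j. if j < 0 then f j else id) 0 = wr p ?q (\<lambda>_. id) 0" by (rule wr_cong) auto
        then show ?case by (simp only: wr_id SD(2))
      next
        case (Suc n)
        let ?g = "\<lambda>n j. if j < n then f j else id"
        have "?emb n (f n) \<circ> wr p ?q (?g n) 0 = wr p ?q (\<lambda>j. (if (j + 0) mod p = n then f n else id) \<circ> ?g n j) (0 + 0)"
          by (rule wr_comp) (use h(2) G_perms perms_id in auto)
        also have "\<dots> = wr p ?q (?g (Suc n)) 0"
        proof (rule wr_cong)
          fix j assume "j < p"
          then show "(if (j + 0) mod p = n then f n else id) \<circ> ?g n j = ?g (Suc n) j" by (auto simp: less_Suc_eq)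
        qed simp
        finally have eq: "wr p ?q (?g (Suc n)) 0 = ?emb n (f n) \<circ> wr p ?q (?g n) 0" by (rule sym)
        have "?emb n (f n) \<in> ?S" by (rule embS) (use h(2) Suc.prems in auto)
        moreover have "n \<le> p" using Suc.prems by simp
        then have "wr p ?q (?g n) 0 \<in> ?S" by (rule Suc.IH)
        ultimately show ?case unfolding eq by (rule SD(3))
      qed
      have rot: "wr p ?q (\<lambda>_. id) i \<in> ?S" for i
      proof (induction i)
        case 0
        show ?case by (simp only: wr_id SD(2))
      next
        case (Suc i)
        have "?\<theta> \<circ> wr p ?q (\<lambda>_. id) i = wr p ?q (\<lambda>j. id \<circ> id) (i + 1)" by (rule wr_comp) (rule perms_id)
        then have eq: "wr p ?q (\<lambda>_. id) (Suc i) = ?\<theta> \<circ> wr p ?q (\<lambda>_. id) i" by simp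
        show ?case unfolding eq by (rule SD(3)[OF \<theta>S Suc])
      qed
      let ?g = "\<lambda>j. if j < p then f j else id"
      have "wr p ?q (\<lambda>_. id) i \<circ> wr p ?q ?g 0 = wr p ?q (\<lambda>j. id \<circ> ?g j) (0 + i)"
        by (rule wr_comp) (use h(2) G_perms in auto)
      also have "\<dots> = h" unfolding h(1) by (rule wr_cong) auto
      finally have eq: "wr p ?q (\<lambda>_. id) i \<circ> wr p ?q ?g 0 = h" .
      show "h \<in> ?S" unfolding eq[symmetric] by (rule SD(3)[OF rot part[OF order_refl]])
    qed
  qed
qed

lemma card_R_grp_Suc: "prime p \<Longrightarrow> card (R_grp p (int (Suc m) - 1)) = p * card (R_grp p (int m - 1)) ^ p"
  unfolding R_grp_Suc by (rule wreath.card_W[OF wreath_R])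

lemma card_R_grp:
  assumes "prime p"
  shows "card (R_grp p (int m - 1)) ^ (p - 1) = p ^ (p ^ m - 1)"
proof -
  have p: "0 < p" using assms prime_gt_0_nat by simp
  have "card (R_grp p (int m - 1)) ^ (p - 1) * p = p ^ (p ^ m)"
  proof (induction m)
    case 0
    show ?case unfolding R_grp_0 by simp
  next
    case (Suc m)
    let ?r = "card (R_grp p (int m - 1))"
    have "card (R_grp p (int (Suc m) - 1)) ^ (p - 1) * p = (p ^ (p - 1) * p) * (?r ^ p) ^ (p - 1)"
      unfolding card_R_grp_Suc[OF assms] power_mult_distrib by (simp only: mult_ac)
    also have "p ^ (p - 1) * p = p ^ p" using p by (rule power_minus_mult)
    also have "(?r ^ p) ^ (p - 1) = (?r ^ (p - 1)) ^ p" by (simp only: power_mult[symmetric] mult.commute)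
    also have "p ^ p * (?r ^ (p - 1)) ^ p = (?r ^ (p - 1) * p) ^ p" by (simp only: power_mult_distrib mult.commute)
    also have "\<dots> = p ^ (p ^ Suc m)" unfolding Suc.IH by (simp only: power_mult[symmetric] power_Suc mult.commute)
    finally show ?case .
  qed
  moreover have "p ^ (p ^ m) = p ^ (p ^ m - 1) * p" using p by (intro power_minus_mult[symmetric]) simp
  ultimately show ?thesis using p by simp
qed

lemma card_R_grp_power: "prime p \<Longrightarrow> \<exists>e. card (R_grp p (int m - 1)) = p ^ e"
proof (induction m)
  case 0
  then show ?case unfolding R_grp_0 by (intro exI[of _ 0]) simp
next
  case (Suc m)
  then obtain e where "card (R_grp p (int m - 1)) = p ^ e" by blast
  then have "card (R_grp p (int (Suc m) - 1)) = p ^ (Suc (e * p))"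
    unfolding card_R_grp_Suc[OF Suc.prems] by (simp only: power_mult[symmetric] power_Suc)
  then show ?case by blast
qed

text \<open>The number of fixed point free elements of \<open>R\<^bsub>m-1\<^esub>\<close> whose \<open>p\<close>-th power is trivial.\<close>

definition fpf_count :: "nat \<Rightarrow> nat \<Rightarrow> nat" where
  "fpf_count p m = card {h \<in> R_grp p (int m - 1). fpf p (p ^ m) h}"

lemma fpf_count_0: "fpf_count p 0 = 0"
  unfolding fpf_count_def R_grp_0 by (auto simp: fpf_def card_eq_0_iff)

lemma fpf_count_Suc:
  assumes "prime p"
  shows "fpf_count p (Suc m) = fpf_count p m ^ p + (p - 1) * p ^ (p ^ m - 1)"
  using wreath.card_fpf_W[OF wreath_R[OF assms, of m]]
  unfolding fpf_count_def R_grp_Suc[OF assms] card_R_grp[OF assms] by (simp only: power_Suc)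

text \<open>After scaling by \<open>p ^ (p ^ m)\<close> the recursion is that of the cardinalities of the sets \<open>X\<close>.\<close>

lemma fpf_count_recursion:
  assumes "prime p"
  shows "p ^ (p ^ 0) * fpf_count p (Suc 0) = p ^ (2 * p ^ 0 - 1) * (p - 1)"
    and "p ^ (p ^ Suc m) * fpf_count p (Suc (Suc m)) =
      (p ^ (p ^ m) * fpf_count p (Suc m)) ^ p + p ^ (2 * p ^ Suc m - 1) * (p - 1)"
proof -
  have p: "0 < p" using assms prime_gt_0_nat by simp
  show "p ^ (p ^ 0) * fpf_count p (Suc 0) = p ^ (2 * p ^ 0 - 1) * (p - 1)"
    unfolding fpf_count_Suc[OF assms] fpf_count_0 using p by (simp add: zero_power)
  have "1 \<le> p ^ Suc m" using p by (simp add: Suc_le_eq)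
  then have "p ^ Suc m + (p ^ Suc m - 1) = 2 * p ^ Suc m - 1" by linarith
  then have e: "p ^ (p ^ Suc m) * p ^ (p ^ Suc m - 1) = p ^ (2 * p ^ Suc m - 1)" by (simp only: power_add[symmetric])
  have f: "p ^ (p ^ Suc m) = (p ^ (p ^ m)) ^ p" by (simp only: power_mult[symmetric] power_Suc mult.commute)
  have "p ^ (p ^ Suc m) * fpf_count p (Suc (Suc m))
      = p ^ (p ^ Suc m) * fpf_count p (Suc m) ^ p + (p ^ (p ^ Suc m) * p ^ (p ^ Suc m - 1)) * (p - 1)"
    unfolding fpf_count_Suc[OF assms, of "Suc m"] by (simp only: distrib_left mult_ac)
  also have "\<dots> = (p ^ (p ^ m) * fpf_count p (Suc m)) ^ p + p ^ (2 * p ^ Suc m - 1) * (p - 1)"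
    unfolding e unfolding f by (simp only: power_mult_distrib)
  finally show "p ^ (p ^ Suc m) * fpf_count p (Suc (Suc m)) =
      (p ^ (p ^ m) * fpf_count p (Suc m)) ^ p + p ^ (2 * p ^ Suc m - 1) * (p - 1)" .
qed

section \<open>The cardinality of Y\<close>

definition blocks :: "nat \<Rightarrow> (nat \<Rightarrow> nat) set \<Rightarrow> nat \<Rightarrow> (nat \<Rightarrow> nat) set" where
  "blocks c K s = sp (map (\<lambda>a. shift c a ` K) [1..<Suc s])"

lemma shift_sh: "shift c (Suc a) \<tau> = place (a * c) c \<tau>"
  by (auto simp: fun_eq_iff shift_def place_def)

lemma blocks_0: "blocks c K 0 = {id}"
  by (simp add: blocks_def sp_Nil)

lemma blocks_Suc: "blocks c K (Suc s) = juxta (s * c) c (blocks c K s) K"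
proof -
  have "map (\<lambda>a. shift c a ` K) [1..<Suc (Suc s)] = map (\<lambda>a. shift c a ` K) [1..<Suc s] @ [place (s * c) c ` K]"
    by (simp add: shift_sh)
  then have "blocks c K (Suc s) = {h \<circ> g | g h. g \<in> blocks c K s \<and> h \<in> place (s * c) c ` K}"
    unfolding blocks_def by (simp only: sp_snoc)
  then show ?thesis unfolding juxta_def by blast
qed

lemma blocks_perms:
  assumes "K \<subseteq> perms c"
  shows "blocks c K s \<subseteq> perms (s * c)"
proof (induction s)
  case (Suc s)
  show ?case unfolding blocks_Suc using juxta_perms[OF Suc assms] by (simp add: add.commute)
qed (simp add: blocks_0 perms_id)

lemma card_blocks:
  assumes "K \<subseteq> perms c"
  shows "card (blocks c K s) = card K ^ s"
proof (induction s)
  case (Suc s)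
  then show ?case unfolding blocks_Suc card_juxta[OF blocks_perms[OF assms] assms] by simp
qed (simp add: blocks_0)

lemma blocks_apply:
  assumes "K \<subseteq> perms c"
  shows "g \<in> blocks c K s \<Longrightarrow> i < s \<Longrightarrow> \<exists>\<tau>\<in>K. \<forall>y. 1 \<le> y \<and> y \<le> c \<longrightarrow> g (i * c + y) = i * c + \<tau> y"
proof (induction s arbitrary: g)
  case (Suc s)
  then obtain g' \<tau> where g: "g' \<in> blocks c K s" "\<tau> \<in> K" "g = place (s * c) c \<tau> \<circ> g'" unfolding blocks_Suc juxta_def by blast
  have p: "g' \<in> perms (s * c)" "\<tau> \<in> perms c" using g blocks_perms[OF assms] assms by auto
  show ?case
  proof (cases "i = s")
    case True
    then show ?thesis using juxta_apply(2)[OF p] g by auto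
  next
    case False
    then have i: "i < s" using Suc.prems(2) by simp
    obtain \<tau>' where t: "\<tau>' \<in> K" "\<forall>y. 1 \<le> y \<and> y \<le> c \<longrightarrow> g' (i * c + y) = i * c + \<tau>' y" using Suc.IH[OF g(1) i] by blast
    have "g (i * c + y) = g' (i * c + y)" if y: "1 \<le> y \<and> y \<le> c" for y
      unfolding g(3) by (rule juxta_apply(1)[OF p]) (use grid_range[OF i, of y c] y in simp)
    then show ?thesis using t by metis
  qed
qed simp

lemma generate_cyclic:
  assumes "g \<in> perms n" "g ^^ r = id" "0 < r"
  shows "generate (Sym n) {g} = {g ^^ i | i. i < r}"
proof
  have md: "g ^^ i = g ^^ (i mod r)" for i
  proof
    fix x have "(g ^^ (i mod r)) x = (g ^^ i) x" by (rule funpow_mod_eq) (simp add: assms(2))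
    then show "(g ^^ i) x = (g ^^ (i mod r)) x" by simp
  qed
  have memI: "g ^^ i \<in> {g ^^ i | i. i < r}" for i using md[of i] assms(3) mod_less_divisor by blast
  have "subgroup {g ^^ i | i. i < r} (Sym n)"
  proof (rule subgroup_SymI)
    show "{g ^^ i | i. i < r} \<subseteq> perms n" using perms_funpow[OF assms(1)] by blast
    show "id \<in> {g ^^ i | i. i < r}" using memI[of 0] by (simp only: funpow_0 funpow.simps)
    fix h assume "h \<in> {g ^^ i | i. i < r}"
    then obtain i where i: "h = g ^^ i" "i < r" by blast
    show "h \<circ> k \<in> {g ^^ i | i. i < r}" if kk: "k \<in> {g ^^ i | i. i < r}" for k
    proof -
      obtain j where "k = g ^^ j" using kk by blast
      then have "h \<circ> k = g ^^ (i + j)" using i(1) by (simp only: funpow_add)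
      then show ?thesis using memI[of "i + j"] by (simp only:)
    qed
    have "h \<circ> g ^^ (r - i) = id" "g ^^ (r - i) \<circ> h = id"
      unfolding i(1) funpow_add[symmetric] using i(2) assms(2) by simp_all
    then have "inv_into UNIV h = g ^^ (r - i)" using inv_unique_comp by blast
    then show "inv_into UNIV h \<in> {g ^^ i | i. i < r}" using memI[of "r - i"] by (simp only:)
  qed
  moreover have "g \<in> {g ^^ i | i. i < r}" using memI[of 1] by (simp only: One_nat_def funpow.simps comp_id)
  then have "{g} \<subseteq> {g ^^ i | i. i < r}" by blast
  ultimately show "generate (Sym n) {g} \<subseteq> {g ^^ i | i. i < r}" by (intro group.generate_subgroup_incl[OF group_Sym])
  have S: "subgroup (generate (Sym n) {g}) (Sym n)" using assms(1) by (intro generate_subgroup) simp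
  have "g ^^ i \<in> generate (Sym n) {g}" for i
  proof (induction i)
    case 0
    show ?case using subgroup_SymD(2)[OF S] by (simp only: funpow.simps)
  next
    case (Suc i)
    have "g \<in> generate (Sym n) {g}" by (rule generate.incl) simp
    then show ?case using subgroup_SymD(3)[OF S _ Suc] by (simp only: funpow.simps)
  qed
  then show "{g ^^ i | i. i < r} \<subseteq> generate (Sym n) {g}" by blast
qed

definition rots :: "nat \<Rightarrow> (nat \<Rightarrow> nat) set" where
  "rots p = {cyc p ^^ i | i. i < p}"

lemma cyc_funpow_apply: "y < p \<Longrightarrow> (cyc p ^^ i) (1 + y) = 1 + (y + i) mod p"
proof (induction i)
  case (Suc i)
  let ?z = "(y + i) mod p"
  have z: "?z < p" using Suc.prems by simp
  have "(cyc p ^^ Suc i) (1 + y) = cyc p (1 + ?z)" using Suc by simp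
  also have "\<dots> = (if Suc ?z = p then 1 else 1 + Suc ?z)" using z cyc_apply[of "1 + ?z" p] by simp
  also have "\<dots> = 1 + (y + Suc i) mod p" using z by (simp add: mod_Suc)
  finally show ?case .
qed simp

lemma cyc_funpow_p: "0 < p \<Longrightarrow> cyc p ^^ p = id"
proof (rule perms_eqI[OF perms_funpow[OF cyc_perms] perms_id])
  fix x assume "1 \<le> x" "x \<le> p"
  then obtain y where y: "x = 1 + y" "y < p" by (cases x) auto
  show "(cyc p ^^ p) x = id x" unfolding y(1) cyc_funpow_apply[OF y(2)] using y(2) by simp
qed

lemma rots_perms: "rots p \<subseteq> perms p"
  unfolding rots_def using perms_funpow[OF cyc_perms] by blast

lemma card_rots: "card (rots p) = p"
proof -
  have "inj_on (\<lambda>i. cyc p ^^ i) {..<p}"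
  proof (rule inj_onI)
    fix i j assume ij: "i \<in> {..<p}" "j \<in> {..<p}" "cyc p ^^ i = cyc p ^^ j"
    then have "(cyc p ^^ i) (1 + 0) = (cyc p ^^ j) (1 + 0)" by simp
    then show "i = j" using ij cyc_funpow_apply[of 0 p i] cyc_funpow_apply[of 0 p j] by simp
  qed
  moreover have "rots p = (\<lambda>i. cyc p ^^ i) ` {..<p}" unfolding rots_def by blast
  ultimately show ?thesis by (simp add: card_image)
qed

lemma place_funpow:
  assumes "\<tau> \<in> perms c"
  shows "place a c \<tau> ^^ i = place a c (\<tau> ^^ i)"
  using juxta_funpow[OF perms_id assms, where a = a and s = i] by (simp only: comp_id id_funpow)

lemma generate_shift:
  assumes "0 < p" "a < s"
  shows "generate (Sym (p * s)) {shift p (Suc a) (cyc p)} = shift p (Suc a) ` rots p"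
proof -
  let ?g = "place (a * p) p (cyc p)"
  have "a * p + p \<le> p * s" using mult_le_mono1[of "Suc a" s p] assms(2) by (simp add: mult.commute add.commute)
  then have g: "?g \<in> perms (p * s)" using place_perms[OF cyc_perms] perms_mono by blast
  have "?g ^^ p = place (a * p) p id" unfolding place_funpow[OF cyc_perms] cyc_funpow_p[OF assms(1)] ..
  also have "\<dots> = id" by (rule ext) (simp add: place_def)
  finally have "generate (Sym (p * s)) {?g} = {?g ^^ i | i. i < p}" using generate_cyclic[OF g] assms(1) by blast
  also have "\<dots> = place (a * p) p ` rots p" unfolding rots_def place_funpow[OF cyc_perms] by blast
  finally show ?thesis unfolding shift_sh .
qed

lemma H_grp_eq:
  assumes "0 < p"
  shows "H_grp p s = blocks p (rots p) s"
proof -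
  have "generate (Sym (p * s)) {shift p a (cyc p)} = shift p a ` rots p" if as: "a \<in> set [1..<Suc s]" for a
  proof -
    have "1 \<le> a \<and> a \<le> s" using as by (auto simp del: upt_Suc)
    then obtain a' where "a = Suc a'" "a' < s" by (metis Suc_le_eq le_Suc_ex plus_1_eq_Suc)
    then show ?thesis using generate_shift[OF assms] by simp
  qed
  then show ?thesis unfolding H_grp_def set_prod_Sym blocks_def by (metis (no_types, lifting) map_cong)
qed

lemma R0_grp_eq: "0 < p \<Longrightarrow> R0_grp p m = blocks (p ^ m) (R_grp p (int m - 1)) (p - 1)"
  by (simp add: R0_grp_def set_prod_Sym blocks_def)

locale Y_setting =
  fixes p m :: nat
  assumes prime_p: "prime p"
begin

abbreviation "q \<equiv> p ^ m"
abbreviation "H \<equiv> blocks p (rots p) q"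
abbreviation "B \<equiv> blocks q (R_grp p (int m - 1)) (p - 1)"
abbreviation "z \<equiv> z_perm p m"

lemma p_pos: "0 < p" using prime_p prime_gt_0_nat by simp

lemma q_pos: "0 < q" using p_pos by simp

lemma p_gt: "1 < p" using prime_p prime_gt_1_nat by simp

lemma H_perms: "H \<subseteq> perms (p * q)"
  using blocks_perms[OF rots_perms, of p q] by (simp add: mult.commute)

lemma R_perms: "R_grp p (int m - 1) \<subseteq> perms q" by (rule subgroup_SymD(1)[OF subgroup_R_grp[OF prime_p]])

lemma B_perms': "B \<subseteq> perms ((p - 1) * q)" by (rule blocks_perms[OF R_perms])

lemma B_perms: "B \<subseteq> perms (p * q)"
  using B_perms' perms_mono[of "(p - 1) * q" "p * q"] by (meson diff_le_self mult_le_mono1 order_trans)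

lemma H_apply:
  assumes "h \<in> H" "i < q"
  obtains e where "e < p" "\<And>k. k < p \<Longrightarrow> h (i * p + (1 + k)) = i * p + (1 + (k + e) mod p)"
proof -
  obtain \<tau> where t: "\<tau> \<in> rots p" "\<forall>y. 1 \<le> y \<and> y \<le> p \<longrightarrow> h (i * p + y) = i * p + \<tau> y"
    using blocks_apply[OF rots_perms assms] by blast
  then obtain e where e: "e < p" "\<tau> = cyc p ^^ e" unfolding rots_def by blast
  have "h (i * p + (1 + k)) = i * p + (1 + (k + e) mod p)" if "k < p" for k
  proof -
    have "1 \<le> 1 + k \<and> 1 + k \<le> p" using that by simp
    then have "h (i * p + (1 + k)) = i * p + \<tau> (1 + k)" using t(2) by blast
    then show ?thesis unfolding e(2) cyc_funpow_apply[OF that] .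
  qed
  then show ?thesis using that e(1) by blast
qed

lemma z_apply: "i < q \<Longrightarrow> k < p \<Longrightarrow> z t (i * p + (1 + k)) = (t * k) mod p * q + (1 + i)"
  using z_perm_apply[of "1 + i" p m "1 + k" t] by simp

lemma z_perms:
  assumes "t \<in> {1..<p}"
  shows "z t \<in> perms (p * q)"
proof (rule perms_injI)
  have t: "0 < t" "t < p" using assms by auto
  have coord: "\<exists>i k. x = i * p + (1 + k) \<and> i < q \<and> k < p" if x: "1 \<le> x" "x \<le> p * q" for x
  proof -
    have "x \<le> q * p" using x by (simp add: mult.commute)
    then obtain i y where y: "x = i * p + y" "i < q" "1 \<le> y" "y \<le> p" using grid_coordinates[OF p_pos x(1)] by blast
    then have "x = i * p + (1 + (y - 1))" "y - 1 < p" by auto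
    then show ?thesis using y(2) by blast
  qed
  show "1 \<le> z t x \<and> z t x \<le> p * q" if x: "1 \<le> x" "x \<le> p * q" for x
  proof -
    obtain i k where ik: "x = i * p + (1 + k)" "i < q" "k < p" using coord[OF x] by blast
    have "(t * k) mod p < p" using p_pos by simp
    then show ?thesis unfolding ik(1) z_apply[OF ik(2,3)] by (rule grid_range) (use ik(2) in auto)
  qed
  fix x y assume x: "1 \<le> x" "x \<le> p * q" and y: "1 \<le> y" "y \<le> p * q" and eq: "z t x = z t y"
  obtain i k where ik: "x = i * p + (1 + k)" "i < q" "k < p" using coord[OF x] by blast
  obtain i' k' where ik': "y = i' * p + (1 + k')" "i' < q" "k' < p" using coord[OF y] by blast
  have "(t * k) mod p * q + (1 + i) = (t * k') mod p * q + (1 + i')"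
    using eq unfolding ik(1) ik'(1) z_apply[OF ik(2,3)] z_apply[OF ik'(2,3)] .
  then have e: "(t * k) mod p = (t * k') mod p \<and> 1 + i = 1 + i'" by (intro grid_unique[of _ q]) (use ik(2) ik'(2) in auto)
  then have "k = k'" using multiples_mod_inj[OF prime_p t ik(3) ik'(3)] by (simp add: mult.commute)
  then show "x = y" using e ik(1) ik'(1) by simp
qed (auto simp: z_perm_def)

lemma B_block:
  assumes "b \<in> B" "j < p" "1 \<le> y" "y \<le> q"
  obtains y' where "1 \<le> y'" "y' \<le> q" "b (j * q + y) = j * q + y'"
proof (cases "j < p - 1")
  case True
  obtain \<tau> where t: "\<tau> \<in> R_grp p (int m - 1)" "b (j * q + y) = j * q + \<tau> y" using blocks_apply[OF R_perms assms(1) True] assms(3,4) by blast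
  have "\<tau> \<in> perms q" using t(1) R_perms by blast
  from perms_in[OF this assms(3,4)] show ?thesis using that t(2) by blast
next
  case False
  then have j: "j = p - 1" using assms(2) by simp
  have "b \<in> perms ((p - 1) * q)" using B_perms' assms(1) by blast
  then have "b (j * q + y) = j * q + y" unfolding j using assms(3) by (intro perms_out) auto
  then show ?thesis using that assms(3,4) by blast
qed

text \<open>The image of a point reveals its block of size \<open>q\<close>, and this block is \<open>t\<close> times the position that \<open>h\<close>
  gives to the point; the factor \<open>b\<close> acts inside these blocks.\<close>

lemma Y_block:
  assumes "b \<in> B" "i < q" "k < p" "h (i * p + (1 + k)) = i * p + (1 + k')" "k' < p"
  obtains y where "1 \<le> y" "y \<le> q" "(b \<circ> (z t \<circ> h)) (i * p + (1 + k)) = (t * k') mod p * q + y"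
proof -
  have "(t * k') mod p < p" using p_pos by simp
  then obtain y where "1 \<le> y" "y \<le> q" "b ((t * k') mod p * q + (1 + i)) = (t * k') mod p * q + y"
    using B_block[OF assms(1), of "(t * k') mod p" "1 + i"] assms(2) by auto
  then show ?thesis using that assms(4) z_apply[OF assms(2,5), of t] by simp
qed

text \<open>The blocks of the images of two neighbouring points differ by \<open>t\<close>. Knowing \<open>t\<close>, the blocks of all images
  determine \<open>h\<close>, and then \<open>b\<close> is determined.\<close>

lemma Y_inj: "inj_on (\<lambda>(h, t, b). b \<circ> (z t \<circ> h)) (H \<times> {1..<p} \<times> B)"
proof (rule inj_onI)
  fix u v assume "u \<in> H \<times> {1..<p} \<times> B" "v \<in> H \<times> {1..<p} \<times> B"
    and eq: "(\<lambda>(h, t, b). b \<circ> (z t \<circ> h)) u = (\<lambda>(h, t, b). b \<circ> (z t \<circ> h)) v"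
  then obtain h t b h' t' b' where uv: "u = (h, t, b)" "v = (h', t', b')"
    and h: "h \<in> H" "h' \<in> H" and t: "t \<in> {1..<p}" "t' \<in> {1..<p}" and b: "b \<in> B" "b' \<in> B" by auto
  have eq': "b \<circ> (z t \<circ> h) = b' \<circ> (z t' \<circ> h')" using eq uv by simp
  have key: "(t * ((k + e) mod p)) mod p = (t' * ((k + e') mod p)) mod p"
    if i: "i < q" and k: "k < p" and e: "\<And>k. k < p \<Longrightarrow> h (i * p + (1 + k)) = i * p + (1 + (k + e) mod p)"
      and e': "\<And>k. k < p \<Longrightarrow> h' (i * p + (1 + k)) = i * p + (1 + (k + e') mod p)" for i k e e'
  proof -
    have md: "(k + e) mod p < p" "(k + e') mod p < p" using p_pos by simp_all
    obtain y where y: "1 \<le> y" "y \<le> q" "(b \<circ> (z t \<circ> h)) (i * p + (1 + k)) = (t * ((k + e) mod p)) mod p * q + y"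
      using Y_block[where h = h and k' = "(k + e) mod p", OF b(1) i k e[OF k] md(1)] by blast
    obtain y' where y': "1 \<le> y'" "y' \<le> q" "(b' \<circ> (z t' \<circ> h')) (i * p + (1 + k)) = (t' * ((k + e') mod p)) mod p * q + y'"
      using Y_block[where h = h' and k' = "(k + e') mod p", OF b(2) i k e'[OF k] md(2)] by blast
    have "(t * ((k + e) mod p)) mod p * q + y = (t' * ((k + e') mod p)) mod p * q + y'" using y(3) y'(3) eq' by simp
    then show ?thesis using grid_unique[OF y(1,2) y'(1,2)] by blast
  qed
  \<comment> \<open>compare the images of the first two points\<close>
  have tt: "t = t'"
  proof -
    obtain e where e: "\<And>k. k < p \<Longrightarrow> h (0 * p + (1 + k)) = 0 * p + (1 + (k + e) mod p)" using H_apply[OF h(1) q_pos] by blast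
    obtain e' where e': "\<And>k. k < p \<Longrightarrow> h' (0 * p + (1 + k)) = 0 * p + (1 + (k + e') mod p)" using H_apply[OF h(2) q_pos] by blast
    have k0: "(t * e) mod p = (t' * e') mod p" using key[OF q_pos p_pos e e'] by (simp add: mod_mult_right_eq)
    have "(t * (1 + e)) mod p = (t' * (1 + e')) mod p" using key[OF q_pos p_gt e e'] by (simp only: mod_mult_right_eq)
    then have "(t + t * e) mod p = (t' + t' * e') mod p" by (simp add: distrib_left)
    then have "(t + (t * e) mod p) mod p = (t' + (t' * e') mod p) mod p" by (simp only: mod_add_right_eq)
    then have "(t + (t * e) mod p) mod p = (t' + (t * e) mod p) mod p" unfolding k0 .
    then show ?thesis using mod_add_right_inj[of t p t' "(t * e) mod p"] t by simp
  qed
  have hh: "h = h'"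
  proof (rule perms_eqI)
    show "h \<in> perms (p * q)" "h' \<in> perms (p * q)" using h H_perms by auto
    fix x assume x: "1 \<le> x" "x \<le> p * q"
    then have "x \<le> q * p" by (simp add: mult.commute)
    then obtain i y where y: "x = i * p + y" "i < q" "1 \<le> y" "y \<le> p" using grid_coordinates[OF p_pos x(1)] by blast
    then have k: "x = i * p + (1 + (y - 1))" "y - 1 < p" by auto
    obtain e where e: "\<And>k. k < p \<Longrightarrow> h (i * p + (1 + k)) = i * p + (1 + (k + e) mod p)" using H_apply[OF h(1) y(2)] by blast
    obtain e' where e': "\<And>k. k < p \<Longrightarrow> h' (i * p + (1 + k)) = i * p + (1 + (k + e') mod p)" using H_apply[OF h(2) y(2)] by blast
    have "(t * ((y - 1 + e) mod p)) mod p = (t * ((y - 1 + e') mod p)) mod p" using key[OF y(2) k(2) e e'] unfolding tt .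
    then have "(y - 1 + e) mod p = (y - 1 + e') mod p"
      using multiples_mod_inj[OF prime_p, of t "(y - 1 + e) mod p" "(y - 1 + e') mod p"] t p_pos by (simp add: mult.commute)
    then show "h x = h' x" unfolding k(1) e[OF k(2)] e'[OF k(2)] by simp
  qed
  have "z t \<circ> h \<in> perms (p * q)" using perms_comp[of h "p * q" "z t"] h(1) H_perms z_perms[OF t(1)] by blast
  then have "b \<circ> ((z t \<circ> h) \<circ> inv_into UNIV (z t \<circ> h)) = b' \<circ> ((z t \<circ> h) \<circ> inv_into UNIV (z t \<circ> h))" "(z t \<circ> h) \<circ> inv_into UNIV (z t \<circ> h) = id"
    using eq' perms_inv_o(1) unfolding tt hh by (metis o_assoc, blast)
  then have "b = b'" by (simp only: comp_id)
  then show "u = v" using uv tt hh by simp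
qed

lemma Y_set_eq: "Y_set p m = (\<lambda>(h, t, b). b \<circ> (z t \<circ> h)) ` (H \<times> {1..<p} \<times> B)"
  unfolding Y_set_def H_grp_eq[OF p_pos] R0_grp_eq[OF p_pos] by (force simp: Sym_def image_iff)

lemma Y_perms: "Y_set p m \<subseteq> perms (p * q)"
proof
  fix x assume "x \<in> Y_set p m"
  then obtain h t b where x: "h \<in> H" "t \<in> {1..<p}" "b \<in> B" "x = b \<circ> (z t \<circ> h)" unfolding Y_set_eq by auto
  show "x \<in> perms (p * q)" unfolding x(4)
    using x(1,3) H_perms B_perms by (intro perms_comp[of "z t \<circ> h"] perms_comp[of h] z_perms[OF x(2)]) auto
qed

lemma card_Y: "card (Y_set p m) = p ^ (2 * q - 1) * (p - 1)"
proof -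
  have "card (Y_set p m) = card H * (card {1..<p} * card B)"
    unfolding Y_set_eq card_image[OF Y_inj] card_cartesian_product ..
  also have "\<dots> = p ^ q * ((p - 1) * p ^ (q - 1))"
    unfolding card_blocks[OF rots_perms] card_rots card_blocks[OF R_perms] card_R_grp[OF prime_p] by simp
  also have "\<dots> = (p ^ q * p ^ (q - 1)) * (p - 1)" by (simp only: mult_ac)
  also have "p ^ q * p ^ (q - 1) = p ^ (2 * q - 1)"
  proof -
    have "q + (q - 1) = 2 * q - 1" using q_pos by linarith
    then show ?thesis by (simp only: power_add[symmetric])
  qed
  finally show ?thesis .
qed

text \<open>In contrast to the products of smaller permutations, every element of \<open>Y\<close> carries one of the first \<open>p\<close>
  points into the last block of size \<open>q\<close>, which \<open>b\<close> fixes pointwise.\<close>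

lemma Y_moves:
  assumes "x \<in> Y_set p m"
  shows "\<exists>y. 1 \<le> y \<and> y \<le> p \<and> (p - 1) * q < x y"
proof -
  obtain h t b where x: "h \<in> H" "t \<in> {1..<p}" "b \<in> B" "x = b \<circ> (z t \<circ> h)" using assms unfolding Y_set_eq by auto
  obtain e where e: "e < p" "\<And>k. k < p \<Longrightarrow> h (0 * p + (1 + k)) = 0 * p + (1 + (k + e) mod p)" using H_apply[OF x(1) q_pos] by blast
  obtain s where s: "s < p" "(s * t) mod p = p - 1" using multiples_mod_surj[OF prime_p, of t "p - 1"] x(2) by auto
  \<comment> \<open>the position that \<open>h\<close>, which adds \<open>e\<close>, turns into \<open>s\<close>\<close>
  let ?k = "(s + (p - e)) mod p"
  have kp: "?k < p" using p_pos by simp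
  have "(?k + e) mod p = (s + (p - e) + e) mod p" by (simp only: mod_add_left_eq)
  also have "\<dots> = s" using e(1) s(1) by simp
  finally have he: "h (0 * p + (1 + ?k)) = 0 * p + (1 + s)" using e(2)[OF kp] by simp
  obtain y where y: "1 \<le> y" "x (0 * p + (1 + ?k)) = (t * s) mod p * q + y"
    using Y_block[where h = h and k' = s, OF x(3) q_pos kp he s(1), of t] x(4) by blast
  have "(t * s) mod p = p - 1" using s(2) by (simp add: mult.commute)
  then have "(p - 1) * q < x (1 + ?k)" using y by simp
  then show ?thesis using kp by (intro exI[of _ "1 + ?k"]) simp
qed

end

section \<open>The cardinality of X\<close>

lemma X_set_comps: "X_set p d = comps p d (Y_set p)"
  by (simp add: X_set_def comps_def)

lemma block_family_Y: "prime p \<Longrightarrow> block_family p (Y_set p)"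
  using Y_setting.Y_perms prime_gt_1_nat by (auto simp: block_family_def Y_setting_def)

lemma card_X_1: "prime p \<Longrightarrow> card (X_set p (p ^ 0)) = p ^ (2 * p ^ 0 - 1) * (p - 1)"
  unfolding X_set_comps block_family.comps_1[OF block_family_Y] by (rule Y_setting.card_Y) (simp add: Y_setting_def)

text \<open>Permutations that come from compositions with more than one part preserve the first \<open>(p - 1) p\<^bsup>m+1\<^esup>\<close>
  points, so they are not in \<open>Y\<^bsub>m+1\<^esub>\<close> by \<open>Y_moves\<close>.\<close>

lemma card_X_power_Suc:
  assumes "prime p"
  shows "card (X_set p (p ^ Suc m)) = card (X_set p (p ^ m)) ^ p + p ^ (2 * p ^ Suc m - 1) * (p - 1)"
proof -
  interpret Y: Y_setting p "Suc m" using assms by (simp add: Y_setting_def)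
  interpret F: block_family p "Y_set p" by (rule block_family_Y[OF assms])
  let ?a = "p * ((p - 1) * p ^ m)"
  let ?J = "juxta ?a (p * p ^ m) (comps p ((p - 1) * p ^ m) (Y_set p)) (comps p (p ^ m) (Y_set p))"
  have a: "?a = (p - 1) * p ^ Suc m" by simp
  have pa: "p \<le> ?a" using F.p_gt by simp
  have "x \<notin> ?J" if x: "x \<in> Y_set p (Suc m)" for x
  proof
    assume "x \<in> ?J"
    then obtain g \<tau> where g: "g \<in> perms ?a" "\<tau> \<in> perms (p * p ^ m)" "x = place ?a (p * p ^ m) \<tau> \<circ> g"
      unfolding juxta_def using F.comps_perms by blast
    obtain y where y: "1 \<le> y" "y \<le> p" "?a < x y" using Y.Y_moves[OF x] unfolding a by blast
    have "y \<le> ?a" using y(2) pa by linarith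
    then have "x y = g y" unfolding g(3) by (rule juxta_apply(1)[OF g(1,2)])
    then show False using perms_in[OF g(1) y(1) \<open>y \<le> ?a\<close>] y(3) by linarith
  qed
  then have "Y_set p (Suc m) \<inter> ?J = {}" by blast
  from F.card_comps_power_Suc[OF this] show ?thesis unfolding X_set_comps Y.card_Y by (simp only: add.commute)
qed

lemma card_X_power_eq_fpf:
  assumes "prime p"
  shows "card (X_set p (p ^ m)) = p ^ (p ^ m) * fpf_count p (Suc m)"
proof (induction m)
  case 0
  show ?case unfolding card_X_1[OF assms] fpf_count_recursion(1)[OF assms] ..
next
  case (Suc m)
  show ?case unfolding card_X_power_Suc[OF assms] fpf_count_recursion(2)[OF assms] Suc ..
qed

lemma a_num_nat: "a_num p (int m) = card (X_set p (p ^ m))"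
  by (simp add: a_num_def)

lemma a_num_recursion:
  assumes "prime p"
  shows "a_num p (int m) = a_num p (int m - 1) ^ p + p ^ (2 * p ^ m - 1) * (p - 1)"
proof (cases m)
  case 0
  have "a_num p (int 0 - 1) ^ p = 0" using prime_gt_0_nat[OF assms] by (simp add: a_num_def zero_power)
  then show ?thesis unfolding 0 a_num_nat card_X_1[OF assms] by simp
next
  case (Suc m')
  have "int (Suc m') - 1 = int m'" by simp
  then show ?thesis unfolding Suc by (simp only: a_num_nat card_X_power_Suc[OF assms])
qed

section \<open>The Sylow group in degree prime to p\<close>

lemma R_grp_nat: "R_grp p (int m) = R_grp p (int (Suc m) - 1)"
  by simp

lemma R_grp_one: "0 < p \<Longrightarrow> R_grp p (int 0) = rots p"
proof -
  assume p: "0 < p"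
  have b: "blow_up 1 (cyc p) = cyc p"
  proof
    fix x show "blow_up 1 (cyc p) x = cyc p x"
      using perms_in[OF cyc_perms[of p], of x] perms_out[OF cyc_perms[of p], of x] by (cases "x = 0"; cases "x \<le> p") (auto simp: blow_up_def)
  qed
  have "{blow_up (p ^ j) (cyc p) | j. j < Suc 0} = {cyc p}" using b by simp
  then have "R_grp p (int 0) = generate (Sym p) {cyc p}"
    unfolding R_grp_nat R_grp_generators by (simp only: power_Suc power_0 mult_1_right)
  also have "\<dots> = rots p" unfolding rots_def by (rule generate_cyclic[OF cyc_perms cyc_funpow_p[OF p] p])
  finally show ?thesis .
qed

text \<open>Along the parts of a composition degrees add up, while the counts of fixed point free elements and
  the powers of \<open>p\<close> multiply.\<close>

lemma block_prod_R:
  assumes "prime p"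
  shows "pcomp p l \<Longrightarrow> subgroup (block_prod p l (\<lambda>m. R_grp p (int m))) (Sym (p * total p l)) \<and>
    (\<exists>e. card (block_prod p l (\<lambda>m. R_grp p (int m))) = p ^ e) \<and>
    p ^ total p l * card {h \<in> block_prod p l (\<lambda>m. R_grp p (int m)). fpf p (p * total p l) h} = (\<Prod>m\<leftarrow>l. card (X_set p (p ^ m)))"
proof (induction l rule: rev_induct)
  case Nil
  have f: "{h \<in> {id}. fpf p (p * total p []) h} = {id}" by (auto simp: fpf_def total_simps)
  have "subgroup {id} (Sym (p * total p []))" by (rule subgroup_id)
  moreover have "\<exists>e. card {id :: nat \<Rightarrow> nat} = p ^ e" by (intro exI[of _ 0]) simp
  ultimately show ?case unfolding block_prod_Nil f by (simp add: total_simps)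
next
  case (snoc m l)
  let ?K = "\<lambda>m. R_grp p (int m)" and ?c = "p ^ (m + 1)"
  let ?Q = "block_prod p l ?K" and ?a = "p * total p l"
  have p: "0 < p" using prime_gt_0_nat[OF assms] .
  have l: "pcomp p l" "p ^ m dvd total p l" using snoc.prems pcomp_snoc by auto
  have Q: "subgroup ?Q (Sym ?a)" "\<exists>e. card ?Q = p ^ e"
      "p ^ total p l * card {h \<in> ?Q. fpf p ?a h} = (\<Prod>m\<leftarrow>l. card (X_set p (p ^ m)))" using snoc.IH[OF l(1)] by auto
  have K: "subgroup (?K m) (Sym ?c)" using subgroup_R_grp[OF assms, of "Suc m"] by simp
  note perms = subgroup_SymD(1)[OF Q(1)] subgroup_SymD(1)[OF K]
  have eq: "block_prod p (l @ [m]) ?K = juxta ?a ?c ?Q (?K m)" by (rule block_prod_snoc[OF l(2) p])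
  have sub: "subgroup (block_prod p (l @ [m]) ?K) (Sym (p * total p (l @ [m])))"
    unfolding eq total_snoc_mult[symmetric] by (rule subgroup_juxta[OF Q(1) K])
  obtain e where "card ?Q = p ^ e" using Q(2) by blast
  moreover obtain e' where "card (?K m) = p ^ e'" using card_R_grp_power[OF assms, of "Suc m"] by auto
  ultimately have pow: "card (block_prod p (l @ [m]) ?K) = p ^ (e + e')"
    unfolding eq card_juxta[OF perms] by (simp only: power_add)
  have "card {h \<in> block_prod p (l @ [m]) ?K. fpf p (p * total p (l @ [m])) h} = card {h \<in> ?Q. fpf p ?a h} * card {h \<in> ?K m. fpf p ?c h}"
    unfolding eq total_snoc_mult[symmetric] by (rule card_fpf_juxta[OF perms])
  also have "card {h \<in> ?K m. fpf p ?c h} = fpf_count p (Suc m)" unfolding fpf_count_def R_grp_nat by simp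
  finally have "p ^ total p (l @ [m]) * card {h \<in> block_prod p (l @ [m]) ?K. fpf p (p * total p (l @ [m])) h}
      = (p ^ total p l * card {h \<in> ?Q. fpf p ?a h}) * (p ^ (p ^ m) * fpf_count p (Suc m))"
    by (simp only: total_simps power_add mult_ac)
  also have "\<dots> = (\<Prod>m\<leftarrow>l @ [m]. card (X_set p (p ^ m)))" unfolding Q(3) card_X_power_eq_fpf[OF assms, of m, symmetric] by simp
  finally show ?case using sub pow by blast
qed

text \<open>The last factor of the Sylow group is generated by the rotation of the last block.\<close>

lemma P_grp_snoc:
  assumes "prime p" "lie_block p b k n Q" "P_grp p k = juxta b p Q (R_grp p (int 0))"
  shows "P_grp p k = lie_block.P p b Q"
proof -
  interpret lie_block p b k n Q by fact
  have p: "0 < p" using prime_gt_0_nat[OF assms(1)] .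
  have "\<zeta> = place b p (cyc p)"
  proof
    fix x show "\<zeta> x = place b p (cyc p) x"
    proof (cases "b < x \<and> x \<le> b + p")
      case True
      then have x: "1 \<le> x - b" "x - b \<le> p" by linarith+
      then have "cyc p (x - b) = (if x - b = p then 1 else x - b + 1)" by (rule cyc_apply)
      then show ?thesis using True by (auto simp: \<zeta>_def A_def place_def)
    next
      case False
      then show ?thesis by (auto simp: \<zeta>_def A_def place_def)
    qed
  qed
  then have z: "place b p (cyc p ^^ i) = \<zeta> ^^ i" for i by (simp only: place_funpow[OF cyc_perms])
  show ?thesis
  proof
    show "P_grp p k \<subseteq> P"
    proof
      fix x assume "x \<in> P_grp p k"
      then obtain g i where g: "g \<in> Q" "x = \<zeta> ^^ i \<circ> g" unfolding assms(3) R_grp_one[OF p] juxta_def rots_def by (auto simp: z)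
      then have "x = g \<circ> \<zeta> ^^ i" using zeta_commute by simp
      then show "x \<in> P" unfolding P_def using g(1) by blast
    qed
    show "P \<subseteq> P_grp p k"
    proof
      fix x assume "x \<in> P"
      then obtain g i where g: "g \<in> Q" "x = g \<circ> \<zeta> ^^ i" unfolding P_def by blast
      then have "x = \<zeta> ^^ i \<circ> g" using zeta_commute by simp
      moreover have "\<zeta> ^^ i = \<zeta> ^^ (i mod p)" by (rule zeta_pow_cong) simp
      ultimately have "x = place b p (cyc p ^^ (i mod p)) \<circ> g" unfolding z by simp
      moreover have "i mod p < p" using p by simp
      ultimately show "x \<in> P_grp p k" unfolding assms(3) R_grp_one[OF p] juxta_def rots_def using g(1) by blast
    qed
  qed
qed

lemma prod_nth: "(\<Prod>i=1..length xs. f ((xs @ ys) ! (i - 1))) = (\<Prod>x\<leftarrow>xs. f x)" for f :: "'a \<Rightarrow> nat"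
proof -
  have "(\<Prod>x\<leftarrow>xs. f x) = (\<Prod>i<length xs. f (xs ! i))" by (simp add: prod.list_conv_set_nth atLeast0LessThan)
  also have "\<dots> = (\<Prod>i=1..length xs. f (xs ! (i - 1)))"
    by (rule prod.reindex_bij_witness[of _ "\<lambda>i. i - 1" Suc]) auto
  also have "\<dots> = (\<Prod>i=1..length xs. f ((xs @ ys) ! (i - 1)))"
    by (rule prod.cong) (auto simp: nth_append)
  finally show ?thesis by (rule sym)
qed

theorem corollary6p7:
  fixes p :: nat
  assumes "prime p"
    and "CHAR('f::field) = p"
  shows "(\<forall>m::nat. a_num p (int m) = a_num p (int m - 1) ^ p + p ^ (2 * p ^ m - 1) * (p - 1)) \<and>
    (\<forall>k::nat. k \<ge> 1 \<and> \<not> p dvd k \<longrightarrow>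
      (let \<kappa> = padic_composition p k;
           l = length \<kappa>;
           FP = (subgroup_algebra (k * p) (P_grp p k) :: ((nat \<Rightarrow> nat) \<Rightarrow> 'f) ring);
           W = (Lie (k * p) :: ((nat \<Rightarrow> nat) \<Rightarrow> 'f, (nat \<Rightarrow> nat) \<Rightarrow> 'f) module)
       in card (X_set p (k - 1)) = (\<Prod>i=1..l - 1. a_num p (int (\<kappa> ! (i - 1)))) \<and>
          (\<exists>A B. pr_pf_decomposition FP W A B) \<and>
          (\<forall>A B. pr_pf_decomposition FP W A B \<longrightarrow>
             dim_F B = (p - 1) * fact (k - 1) * (\<Prod>i=1..l - 1. a_num p (int (\<kappa> ! (i - 1)))))))"
proof (rule conjI)
  show "\<forall>m::nat. a_num p (int m) = a_num p (int m - 1) ^ p + p ^ (2 * p ^ m - 1) * (p - 1)"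
    using a_num_recursion[OF assms(1)] by blast
  have p: "1 < p" using prime_gt_1_nat[OF assms(1)] .
  show "\<forall>k::nat. k \<ge> 1 \<and> \<not> p dvd k \<longrightarrow>
      (let \<kappa> = padic_composition p k;
           l = length \<kappa>;
           FP = (subgroup_algebra (k * p) (P_grp p k) :: ((nat \<Rightarrow> nat) \<Rightarrow> 'f) ring);
           W = (Lie (k * p) :: ((nat \<Rightarrow> nat) \<Rightarrow> 'f, (nat \<Rightarrow> nat) \<Rightarrow> 'f) module)
       in card (X_set p (k - 1)) = (\<Prod>i=1..l - 1. a_num p (int (\<kappa> ! (i - 1)))) \<and>
          (\<exists>A B. pr_pf_decomposition FP W A B) \<and>
          (\<forall>A B. pr_pf_decomposition FP W A B \<longrightarrow>
             dim_F B = (p - 1) * fact (k - 1) * (\<Prod>i=1..l - 1. a_num p (int (\<kappa> ! (i - 1))))))"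
  proof (intro allI impI)
    fix k :: nat assume k: "k \<ge> 1 \<and> \<not> p dvd k"
    let ?l = "padic_composition p (k - 1)" and ?K = "\<lambda>m. R_grp p (int m)"
    let ?Q = "block_prod p ?l ?K"
    have kl: "padic_composition p k = ?l @ [0]"
      using padic_step[OF p, of k 0] k by (simp only: power_0 mult_1_right simp_thms)
    have comp: "pcomp p ?l" "total p ?l = k - 1" using padic_composition_is_composition[OF p] by blast+
    have cardX: "card (X_set p (k - 1)) = (\<Prod>m\<leftarrow>?l. card (X_set p (p ^ m)))"
      unfolding X_set_comps by (rule block_family.card_comps[OF block_family_Y[OF assms(1)]])
    have prod: "(\<Prod>i=1..length (padic_composition p k) - 1. a_num p (int (padic_composition p k ! (i - 1)))) = (\<Prod>m\<leftarrow>?l. card (X_set p (p ^ m)))"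
      unfolding kl length_append_singleton diff_Suc_1 prod_nth[of "\<lambda>m. a_num p (int m)"] unfolding a_num_nat ..
    obtain e where Q: "subgroup ?Q (Sym (p * (k - 1)))" "card ?Q = p ^ e"
        "p ^ (k - 1) * card {h \<in> ?Q. fpf p (p * (k - 1)) h} = (\<Prod>m\<leftarrow>?l. card (X_set p (p ^ m)))"
      using block_prod_R[OF assms(1) comp(1)] unfolding comp(2) by blast
    have lb: "lie_block p (p * (k - 1)) k (k * p) ?Q"
      using assms(1) k Q(1) by (simp add: lie_block_def lie_block_axioms_def rotation_def mult.commute)
    have "P_grp p k = juxta (p * (k - 1)) p ?Q (?K 0)"
      unfolding P_grp_def kl using block_prod_snoc[of p 0 ?l ?K] p unfolding comp(2) by simp
    then have P: "P_grp p k = lie_block.P p (p * (k - 1)) ?Q" by (rule P_grp_snoc[OF assms(1) lb])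
    note L = lie_block.projective_free_part_Lie[OF lb assms(2) Q(2), folded P, unfolded Q(3)]
    show "let \<kappa> = padic_composition p k;
           l = length \<kappa>;
           FP = (subgroup_algebra (k * p) (P_grp p k) :: ((nat \<Rightarrow> nat) \<Rightarrow> 'f) ring);
           W = (Lie (k * p) :: ((nat \<Rightarrow> nat) \<Rightarrow> 'f, (nat \<Rightarrow> nat) \<Rightarrow> 'f) module)
       in card (X_set p (k - 1)) = (\<Prod>i=1..l - 1. a_num p (int (\<kappa> ! (i - 1)))) \<and>
          (\<exists>A B. pr_pf_decomposition FP W A B) \<and>
          (\<forall>A B. pr_pf_decomposition FP W A B \<longrightarrow>
             dim_F B = (p - 1) * fact (k - 1) * (\<Prod>i=1..l - 1. a_num p (int (\<kappa> ! (i - 1)))))"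
      unfolding Let_def prod cardX using L by blast
  qed
qed

end
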